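(* Let $D$ be a Dedekind domain with quotient field $F\neq D$, let $M_1,\ldots,M_n$ ($n>1$) be distinct maximal ideals of $D$, and assume that each $K_i=D/M_i$ is finite. For $i=1,\ldots,n$ let $f_i$ be a positive integer such that $[K_i:F_i]=f_i$ for some subfield $F_i$ of $K_i$, and let $K_i'\subseteq\overline{K_i}$ be the unique extension field of $K_i$ of degree $\frac{f_1\cdots f_n}{f_i}$ inside $\overline{K_i}$, where $\overline{K_i}$ is a fixed algebraic closure of $K_i$. Let $m=f_1\cdots f_n$ and, for $i=1,\ldots,n$, let $T(M_i)=\{(K_{i,j},\tfrac{f_1\cdots f_n}{f_i},1)\mid j=1,\ldots,f_i\}$ with $K_{i,j}=K_i'$ for $j=1,\ldots,f_i$. Then $T=\{T(M_1),\ldots,T(M_n)\}$ is a realizable $m$-consistent system for $\{D_{M_1},\ldots,D_{M_n}\}$. Therefore there exists a Dedekind domain $E$ that is a finite separable integral extension domain of $D$ such that $[L:F]=m$, where $L$ is the quotient field of $E$, and, for $i=1,\ldots,n$, there exist exactly $f_i$ maximal ideals $N_{i,1},\ldots,N_{i,f_i}$ in $E$ that lie over $M_i$ and, for $j=1,\ldots,f_i$, $M_iE_{N_{i,j}}=N_{i,j}E_{N_{i,j}}$ and $[(E/N_{i,j}):K_i]=\frac{f_1\cdots f_n}{f_i}$, so $[(E/N_{i,j}):F_i]=m$.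
   Context: A DVR is a rank one discrete valuation ring. A finite separable integral extension domain $E$ of a domain $D$ is a domain $E\supseteq D$ that is integral over $D$ and finitely generated as a $D$-module, and whose quotient field is a finite separable algebraic extension of the quotient field of $D$. Let $(V_1,N_1),\ldots,(V_n,N_n)$ be distinct DVRs with quotient field $F$ (here $V_i=D_{M_i}$, and one writes $T(M_i)$ for $T(D_{M_i})$), and put $K_i=V_i/N_i$ ($=D/M_i$). For a positive integer $m$, an $m$-consistent system for $\{V_1,\ldots,V_n\}$ is a collection $S=\{S(V_1),\ldots,S(V_n)\}$ such that: (1) $S(V_i)=\{(K_{i,j},f_{i,j},e_{i,j})\mid j=1,\ldots,s_i\}$ is a finite family indexed by $j$ (repetitions of triples are allowed), where $K_{i,j}$ is a simple algebraic field extension of $K_i$, $f_{i,j}=[K_{i,j}:K_i]$, and $s_i,e_{i,j}$ are positive integers; (2) for each $i$, $\sum_{j=1}^{s_i}e_{i,j}f_{i,j}=m$. Such a system $S$ is realizable for $\{V_1,\ldots,V_n\}$ if there exists a separable algebraic extension field $L$ of $F$ such that: (a) $[L:F]=m$; (b) for $1\le i\le n$, $V_i$ has exactly $s_i$ extensions $(V_{i,1},N_{i,1}),\ldots,(V_{i,s_i},N_{i,s_i})$ to valuation rings of $L$; (c) (for a suitable numbering) the residue field $V_{i,j}/N_{i,j}$ is $K_i$-isomorphic to $K_{i,j}$, and the ramification index of $V_{i,j}$ over $V_i$ is $e_{i,j}$, i.e. $N_iV_{i,j}=N_{i,j}^{e_{i,j}}$. Such an $L$ is called a realization of $S$. *)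

theory Defs
  imports "HOL-Algebra.Algebra"
begin

text \<open>
  A domain \<open>D\<close>, its quotient field \<open>F\<close> and all algebraic extensions of \<open>F\<close> are taken inside one
  ambient field \<open>R\<close>, which the theorem assumes to be an algebraic closure of \<open>F\<close>. Every algebraic
  extension of \<open>F\<close> is \<open>F\<close>-isomorphic to an intermediate field \<open>F \<subseteq> L \<subseteq> R\<close>, so quantifying over
  such \<open>L\<close> loses no generality.
\<close>

context ring
begin

abbreviation sub_ring :: "'a set \<Rightarrow> ('a, 'b) ring_scheme"
  where "sub_ring D \<equiv> R \<lparr> carrier := D \<rparr>"

definition localization :: "'a set \<Rightarrow> 'a set \<Rightarrow> 'a set"
  where "localization D P = {a \<otimes> inv b | a b. a \<in> D \<and> b \<in> D - P}"

definition quotient_field :: "'a set \<Rightarrow> 'a set"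
  where "quotient_field D = {a \<otimes> inv b | a b. a \<in> D \<and> b \<in> D - {\<zero>}}"

definition integral :: "'a set \<Rightarrow> 'a \<Rightarrow> bool"
  where "integral D x \<longleftrightarrow>
    (\<exists>p. p \<noteq> [] \<and> p \<in> carrier (D[X]) \<and> lead_coeff p = \<one> \<and> eval p x = \<zero>)"

text \<open>Fields count as Dedekind domains here; the theorem excludes them by \<open>F \<noteq> D\<close>.\<close>

definition dedekind_domain :: "'a set \<Rightarrow> bool"
  where "dedekind_domain D \<longleftrightarrow>
    subring D R \<and> noetherian_domain (sub_ring D) \<and>
    (\<forall>x \<in> quotient_field D. integral D x \<longrightarrow> x \<in> D) \<and>
    (\<forall>P. primeideal P (sub_ring D) \<and> P \<noteq> {\<zero>} \<longrightarrow> maximalideal P (sub_ring D))"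

text \<open>
  Minimal polynomials have only simple roots. Roots are counted in \<open>R\<close>, so this is separability
  because the ambient field \<open>R\<close> is algebraically closed.
\<close>

definition separable_extension :: "'a set \<Rightarrow> 'a set \<Rightarrow> bool"
  where "separable_extension F L \<longleftrightarrow>
    subfield F R \<and> subfield L R \<and> F \<subseteq> L \<and>
    (\<forall>x \<in> L. (algebraic over F) x \<and> (\<forall>a \<in> carrier R. alg_mult (Irr F x) a \<le> 1))"

text \<open>\<open>Span D Us\<close> is the set of \<open>D\<close>-linear combinations of the list \<open>Us\<close>, also if \<open>D\<close> is not a field.\<close>

definition finite_separable_integral_extension :: "'a set \<Rightarrow> 'a set \<Rightarrow> bool"
  where "finite_separable_integral_extension D E \<longleftrightarrow>
    subdomain E R \<and> D \<subseteq> E \<and>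
    (\<forall>x \<in> E. integral D x) \<and>
    (\<exists>Us. set Us \<subseteq> E \<and> E = Span D Us) \<and>
    separable_extension (quotient_field D) (quotient_field E) \<and>
    finite_dimension (quotient_field D) (quotient_field E)"

definition valuation_ring :: "'a set \<Rightarrow> 'a set \<Rightarrow> bool"
  where "valuation_ring L W \<longleftrightarrow>
    subring W R \<and> W \<subseteq> L \<and> (\<forall>x \<in> L - {\<zero>}. x \<in> W \<or> inv x \<in> W)"

definition dvr :: "'a set \<Rightarrow> 'a set \<Rightarrow> bool"
  where "dvr F V \<longleftrightarrow>
    subfield F R \<and>
    (\<exists>v :: 'a \<Rightarrow> int.
      v ` (F - {\<zero>}) = UNIV \<and>
      (\<forall>x \<in> F - {\<zero>}. \<forall>y \<in> F - {\<zero>}. v (x \<otimes> y) = v x + v y) \<and>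
      (\<forall>x \<in> F - {\<zero>}. \<forall>y \<in> F - {\<zero>}. x \<oplus> y \<noteq> \<zero> \<longrightarrow> min (v x) (v y) \<le> v (x \<oplus> y)) \<and>
      V = {\<zero>} \<union> {x \<in> F - {\<zero>}. 0 \<le> v x})"

text \<open>The maximal ideal and the residue field of a valuation ring.\<close>

definition nonunits :: "'a set \<Rightarrow> 'a set"
  where "nonunits V = V - Units (sub_ring V)"

definition residue_field :: "'a set \<Rightarrow> 'a set ring"
  where "residue_field V = sub_ring V Quot nonunits V"

text \<open>
  For rings \<open>A \<subseteq> B\<close> with ideals \<open>I\<close> and \<open>J\<close>, \<open>I \<subseteq> J\<close>, the canonical map from \<open>A / I\<close> to \<open>B / J\<close>
  sends the coset \<open>C = a + I\<close> to \<open>a + J = C + J\<close>.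
\<close>

definition coset_map :: "'a set \<Rightarrow> 'a set \<Rightarrow> 'a set"
  where "coset_map J C = C <+>\<^bsub>R\<^esub> J"

definition valuation_extensions :: "'a set \<Rightarrow> 'a set \<Rightarrow> 'a set \<Rightarrow> 'a set set"
  where "valuation_extensions F L V = {W. valuation_ring L W \<and> W \<inter> F = V}"

definition ramification_index :: "'a set \<Rightarrow> 'a set \<Rightarrow> nat \<Rightarrow> bool"
  where "ramification_index V W e \<longleftrightarrow>
    Idl\<^bsub>sub_ring W\<^esub> (nonunits V) = nonunits W [^]\<^bsub>ideals_set (sub_ring W)\<^esub> e"

end

text \<open>
  A triple \<open>(K', f, e)\<close>; the extension field \<open>K'\<close> of \<open>K\<close> consists of a field together with the
  embedding of \<open>K\<close> into it.
\<close>

record ('r, 'k) ext_triple =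
  ext_field :: "'k ring"
  ext_emb :: "'r \<Rightarrow> 'k"
  ext_deg :: nat
  ext_ram :: nat

definition simple_algebraic_extension :: "'r ring \<Rightarrow> 'k ring \<Rightarrow> ('r \<Rightarrow> 'k) \<Rightarrow> bool"
  where "simple_algebraic_extension K K' \<kappa> \<longleftrightarrow>
    field K \<and> field K' \<and> \<kappa> \<in> ring_hom K K' \<and>
    (\<exists>\<theta> \<in> carrier K'. (ring.algebraic K' over (\<kappa> ` carrier K)) \<theta> \<and>
      carrier K' = ring.simple_extension K' (\<kappa> ` carrier K) \<theta>)"

text \<open>\<open>K\<close>-isomorphism of extension fields \<open>\<alpha> : K \<rightarrow> A\<close> and \<open>\<beta> : K \<rightarrow> B\<close>.\<close>

definition isomorphic_over ::
    "'r ring \<Rightarrow> 's ring \<Rightarrow> ('r \<Rightarrow> 's) \<Rightarrow> 'k ring \<Rightarrow> ('r \<Rightarrow> 'k) \<Rightarrow> bool"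
  where "isomorphic_over K A \<alpha> B \<beta> \<longleftrightarrow>
    (\<exists>h \<in> ring_iso A B. \<forall>c \<in> carrier K. h (\<alpha> c) = \<beta> c)"

definition extension_of_degree :: "'k ring \<Rightarrow> 'k set \<Rightarrow> nat \<Rightarrow> 'k set"
  where "extension_of_degree \<Omega> K d =
    (THE L. subfield L \<Omega> \<and> K \<subseteq> L \<and> ring.dimension \<Omega> d K L)"

context ring
begin

text \<open>The family \<open>S(V\<^sub>i)\<close> is the list \<open>S i\<close>, so that repeated triples are allowed.\<close>

definition consistent_system ::
    "'a set \<Rightarrow> nat \<Rightarrow> (nat \<Rightarrow> 'a set) \<Rightarrow> nat \<Rightarrow> (nat \<Rightarrow> ('a set, 'k) ext_triple list) \<Rightarrow> bool"
  where "consistent_system F n V m S \<longleftrightarrow>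
    m > 0 \<and> inj_on V {1..n} \<and> (\<forall>i \<in> {1..n}. dvr F (V i)) \<and>
    (\<forall>i \<in> {1..n}.
      S i \<noteq> [] \<and>
      (\<forall>t \<in> set (S i).
        simple_algebraic_extension (residue_field (V i)) (ext_field t) (ext_emb t) \<and>
        ring.dimension (ext_field t) (ext_deg t)
          (ext_emb t ` carrier (residue_field (V i))) (carrier (ext_field t)) \<and>
        ext_ram t > 0) \<and>
      (\<Sum>t \<leftarrow> S i. ext_ram t * ext_deg t) = m)"

definition realization ::
    "'a set \<Rightarrow> nat \<Rightarrow> (nat \<Rightarrow> 'a set) \<Rightarrow> nat \<Rightarrow> (nat \<Rightarrow> ('a set, 'k) ext_triple list) \<Rightarrow> 'a set \<Rightarrow> bool"
  where "realization F n V m S L \<longleftrightarrow>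
    separable_extension F L \<and> dimension m F L \<and>
    (\<forall>i \<in> {1..n}. \<exists>W.
      bij_betw W {..<length (S i)} (valuation_extensions F L (V i)) \<and>
      (\<forall>j < length (S i).
        isomorphic_over (residue_field (V i))
          (residue_field (W j)) (coset_map (nonunits (W j)))
          (ext_field (S i ! j)) (ext_emb (S i ! j)) \<and>
        ramification_index (V i) (W j) (ext_ram (S i ! j))))"

definition realizable ::
    "'a set \<Rightarrow> nat \<Rightarrow> (nat \<Rightarrow> 'a set) \<Rightarrow> nat \<Rightarrow> (nat \<Rightarrow> ('a set, 'k) ext_triple list) \<Rightarrow> bool"
  where "realizable F n V m S \<longleftrightarrow> (\<exists>L. realization F n V m S L)"

end

end

theory Submission
  imports Defs
begin

text \<open>
  The field \<open>L\<close> is the top of a tower \<open>F = F\<^sub>0 \<subseteq> F\<^sub>1 \<subseteq> \<dots> \<subseteq> F\<^sub>n\<close> with \<open>[F\<^sub>k : F\<^sub>k\<^sub>-\<^sub>1] = f\<^sub>k\<close>. In step \<open>k\<close> the only place over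
  \<open>M\<^sub>k\<close> splits completely into \<open>f\<^sub>k\<close> places with unchanged residue field, while each place over another \<open>M\<^sub>i\<close> is inert, so
  that its residue field is extended by degree \<open>f\<^sub>k\<close>. All places are unramified. In the end there are \<open>f\<^sub>i\<close> places over \<open>M\<^sub>i\<close>,
  each of residue degree \<open>m / f\<^sub>i\<close>. Two of the hypotheses make this possible. Complete splitting needs \<open>f\<^sub>k\<close> distinct
  elements in the residue field, and \<open>f\<^sub>k < 2 ^ f\<^sub>k \<le> |K\<^sub>k|\<close> because \<open>K\<^sub>k\<close> has degree \<open>f\<^sub>k\<close> over a subfield. And \<open>n > 1\<close> gives an inert
  place in each step, which makes the adjoined polynomial irreducible.

  A step adjoins a root \<open>t\<close> of a monic polynomial \<open>X\<^sup>l + g\<close> over the current Dedekind domain \<open>D\<close>, obtained by the Chinese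
  remainder theorem from prescribed polynomials with distinct roots over the finite residue fields
  (\<open>exists_extension_with_places\<close>). Irreducibility lifts from an inert place (\<open>powers_independent_lift\<close>). The integral
  closure \<open>E\<close> of \<open>D\<close> is a finite \<open>D\<close>-module by Lagrange interpolation at the conjugates of \<open>t\<close> (\<open>E_fg\<close>), hence a Dedekind
  domain. As the reductions have distinct roots, \<open>E\<close> coincides with \<open>D[t]\<close> locally at each given place (\<open>E_local\<close>), so the
  places of \<open>E\<close> are read off from the roots of the reduction, as in Kummer's theorem.

  Maximal ideals are represented as kernels of homomorphisms, called places, into the fixed algebraic closures of the
  \<open>K\<^sub>i\<close>; residue fields then are finite subfields of a fixed field, and residue degrees are found by counting
  (\<open>card_dimension\<close>, \<open>dimension_eq_card\<close>). Separability of the whole tower follows from MacLane's criterion, which is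
  transitive (\<open>separable_if_pth_power_spanned\<close>). Finally the valuation rings of \<open>L\<close> over \<open>D\<close> localized at \<open>M\<^sub>i\<close> are the
  localizations of \<open>E\<close> at the kernels of its places (\<open>valuation_extensions_places\<close>).
\<close>

text \<open>The symbol is used for multiples \<open>[n] \<cdot> x\<close> only; without this the product of ideals makes it ambiguous.\<close>

no_notation ideal_prod (infixl "\<cdot>\<index>" 80)

section \<open>Multiple roots and characteristic p\<close>

context cring begin

text \<open>The binomial theorem leads to additivity of \<open>x \<mapsto> x\<^sup>p\<close> in characteristic \<open>p\<close>.\<close>

lemma binomial_expansion:
 assumes x: "x \<in> carrier R" and y: "y \<in> carrier R"
 shows "(x \<oplus> y) [^] n = (\<Oplus>k\<in>{..n}. [(n choose k)] \<cdot> (x [^] k \<otimes> y [^] (n - k)))"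
proof (induction n)
 case 0
 then show ?case using x y by simp
next
 case (Suc n)
 let ?S = "\<Oplus>k\<in>{..n}. [(n choose k)] \<cdot> (x [^] k \<otimes> y [^] (n - k))"
 let ?t = "\<lambda>k. x [^] Suc k \<otimes> y [^] (n - k)"
 have Sx: "?S \<otimes> x = (\<Oplus>k\<in>{..n}. [(n choose k)] \<cdot> ?t k)"
 proof -
  have "?S \<otimes> x = (\<Oplus>k\<in>{..n}. [(n choose k)] \<cdot> (x [^] k \<otimes> y [^] (n - k)) \<otimes> x)"
   using x y by (intro finsum_ldistr) auto
  also have "\<dots> = (\<Oplus>k\<in>{..n}. [(n choose k)] \<cdot> ?t k)"
   using x y by (intro finsum_cong') (auto simp: add_pow_ldistr add_pow_rdistr m_ac)
  finally show ?thesis .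
 qed
 have Sy: "?S \<otimes> y = (\<Oplus>k\<in>{..n}. [(n choose Suc k)] \<cdot> ?t k) \<oplus> y [^] Suc n"
 proof -
  have "?S \<otimes> y = (\<Oplus>k\<in>{..n}. [(n choose k)] \<cdot> (x [^] k \<otimes> y [^] (n - k)) \<otimes> y)"
   using x y by (intro finsum_ldistr) auto
  also have "\<dots> = (\<Oplus>k\<in>{..n}. [(n choose k)] \<cdot> (x [^] k \<otimes> y [^] (Suc n - k)))"
   using x y by (intro finsum_cong') (auto simp: add_pow_ldistr m_assoc Suc_diff_le)
  also have "\<dots> = (\<Oplus>k\<in>{..Suc n}. [(n choose k)] \<cdot> (x [^] k \<otimes> y [^] (Suc n - k)))"
   using x y by (subst finsum_Suc) (auto simp: binomial_eq_0)
  also have "\<dots> = (\<Oplus>k\<in>{..n}. [(n choose Suc k)] \<cdot> ?t k) \<oplus> y [^] Suc n"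
   using x y by (subst finsum_Suc2) auto
  finally show ?thesis .
 qed
 have "(x \<oplus> y) [^] Suc n = ?S \<otimes> x \<oplus> ?S \<otimes> y"
  using x y by (simp add: Suc.IH r_distr)
 also have "\<dots> = ((\<Oplus>k\<in>{..n}. [(n choose k)] \<cdot> ?t k) \<oplus> (\<Oplus>k\<in>{..n}. [(n choose Suc k)] \<cdot> ?t k)) \<oplus> y [^] Suc n"
  unfolding Sx Sy using x y by (subst a_assoc) auto
 also have "(\<Oplus>k\<in>{..n}. [(n choose k)] \<cdot> ?t k) \<oplus> (\<Oplus>k\<in>{..n}. [(n choose Suc k)] \<cdot> ?t k)
   = (\<Oplus>k\<in>{..n}. [(Suc n choose Suc k)] \<cdot> ?t k)"
  using x y by (subst finsum_addf[symmetric]) (auto intro!: finsum_cong' simp: add.nat_pow_mult)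
 also have "(\<Oplus>k\<in>{..n}. [(Suc n choose Suc k)] \<cdot> ?t k) \<oplus> y [^] Suc n =
   (\<Oplus>k\<in>{..Suc n}. [(Suc n choose k)] \<cdot> (x [^] k \<otimes> y [^] (Suc n - k)))"
  using x y by (subst finsum_Suc2) auto
 finally show ?case .
qed

lemma frobenius_add:
 assumes p: "Factorial_Ring.prime (p::nat)" "[p] \<cdot> \<one> = \<zero>" and x: "x \<in> carrier R" and y: "y \<in> carrier R"
 shows "(x \<oplus> y) [^] p = x [^] p \<oplus> y [^] p"
proof -
 have char: "[k] \<cdot> z = \<zero>" if d: "p dvd k" and z: "z \<in> carrier R" for k :: nat and z
 proof -
  obtain j where "k = p * j" using d by (elim dvdE)
  then have "[k] \<cdot> z = [j] \<cdot> ([p] \<cdot> (\<one> \<otimes> z))"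
   using that by (simp add: add.nat_pow_pow)
  also have "[p] \<cdot> (\<one> \<otimes> z) = \<zero>"
   using add_pow_ldistr[OF one_closed that(2), of p] p that by simp
  finally show ?thesis by simp
 qed
 obtain q where q: "p = Suc q" using p(1) prime_gt_0_nat gr0_implies_Suc by blast
 let ?f = "\<lambda>k. [(p choose k)] \<cdot> (x [^] k \<otimes> y [^] (p - k))"
 have "(x \<oplus> y) [^] p = (\<Oplus>k\<in>{..p}. ?f k)" by (rule binomial_expansion[OF x y])
 also have "\<dots> = ?f p \<oplus> (\<Oplus>k\<in>{..q}. ?f k)"
  unfolding q using x y by (subst finsum_Suc) auto
 also have "(\<Oplus>k\<in>{..q}. ?f k) = (\<Oplus>k\<in>{..q}. if k = 0 then y [^] p else \<zero>)"
 proof (intro finsum_cong')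
  fix k assume "k \<in> {..q}"
  show "?f k = (if k = 0 then y [^] p else \<zero>)"
  proof (cases "k = 0")
   case False
   have "p dvd (p choose k)"
    using \<open>k \<in> {..q}\<close> False p(1) q by (intro dvd_choose_prime) auto
   then show ?thesis using False x y by (simp add: char)
  qed (use x y in auto)
 qed (use x y in auto)
 also have "\<dots> = y [^] p"
  using add.finprod_singleton_swap[of 0 "{..q}" "\<lambda>_. y [^] p"] y by simp
 finally show ?thesis using x y by simp
qed

lemma frobenius_pow_add:
 assumes p: "Factorial_Ring.prime (p::nat)" "[p] \<cdot> \<one> = \<zero>" and x: "x \<in> carrier R" and y: "y \<in> carrier R"
 shows "(x \<oplus> y) [^] (p ^ r) = x [^] (p ^ r) \<oplus> y [^] (p ^ r)"
proof (induction r)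
 case (Suc r)
 have "(x \<oplus> y) [^] (p ^ Suc r) = ((x \<oplus> y) [^] (p ^ r)) [^] p"
  using x y by (simp add: nat_pow_pow mult.commute)
 also have "\<dots> = (x [^] (p ^ r)) [^] p \<oplus> (y [^] (p ^ r)) [^] p"
  using x y Suc.IH frobenius_add[OF p] by simp
 finally show ?case using x y by (simp add: nat_pow_pow mult.commute)
qed (use x y in simp)

end

subsection \<open>Dual numbers and multiple roots\<close>

text \<open>The ring \<open>R[\<epsilon>]\<close> with \<open>\<epsilon>\<^sup>2 = 0\<close>. Evaluating a polynomial at \<open>a + \<epsilon>\<close> gives its value and its
 derivative at once, so that the product rule is the multiplicativity of evaluation.\<close>

definition dual_numbers :: "('a, 'b) ring_scheme \<Rightarrow> ('a \<times> 'a) ring"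
 where "dual_numbers R = \<lparr> carrier = carrier R \<times> carrier R,
  monoid.mult = (\<lambda>(a, b) (c, d). (a \<otimes>\<^bsub>R\<^esub> c, a \<otimes>\<^bsub>R\<^esub> d \<oplus>\<^bsub>R\<^esub> b \<otimes>\<^bsub>R\<^esub> c)),
  monoid.one = (\<one>\<^bsub>R\<^esub>, \<zero>\<^bsub>R\<^esub>), ring.zero = (\<zero>\<^bsub>R\<^esub>, \<zero>\<^bsub>R\<^esub>),
  ring.add = (\<lambda>(a, b) (c, d). (a \<oplus>\<^bsub>R\<^esub> c, b \<oplus>\<^bsub>R\<^esub> d)) \<rparr>"

fun (in ring) deriv_at :: "'a list \<Rightarrow> 'a \<Rightarrow> 'a"
 where "deriv_at [] a = \<zero>"
 | "deriv_at (c # p) a = [length p] \<cdot> (c \<otimes> a [^] (length p - 1)) \<oplus> deriv_at p a"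

context cring begin

lemma dual_numbers_cring: "cring (dual_numbers R)"
proof (rule cringI)
 show "abelian_group (dual_numbers R)"
 proof (rule abelian_groupI)
  fix x assume "x \<in> carrier (dual_numbers R)"
  then show "\<exists>y\<in>carrier (dual_numbers R). y \<oplus>\<^bsub>dual_numbers R\<^esub> x = \<zero>\<^bsub>dual_numbers R\<^esub>"
   by (intro bexI[of _ "(\<ominus> fst x, \<ominus> snd x)"]) (auto simp: dual_numbers_def l_neg)
 qed (auto simp: dual_numbers_def a_ac)
 show "comm_monoid (dual_numbers R)"
  by (rule comm_monoidI) (auto simp: dual_numbers_def m_ac l_distr r_distr a_ac)
qed (auto simp: dual_numbers_def l_distr r_distr a_ac)

lemma deriv_at_closed: "set p \<subseteq> carrier R ==> a \<in> carrier R ==> deriv_at p a \<in> carrier R"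
 by (induction p) auto

lemma dual_numbers_pow:
 assumes "a \<in> carrier R"
 shows "(a, \<one>) [^]\<^bsub>dual_numbers R\<^esub> (n::nat) = (a [^] n, [n] \<cdot> (a [^] (n - 1)))"
proof -
 interpret U: cring "dual_numbers R" by (rule dual_numbers_cring)
 show ?thesis
 proof (induction n)
  case 0
  then show ?case by (simp add: dual_numbers_def nat_pow_def)
 next
  case (Suc n)
  show ?case
  proof (cases n)
   case 0
   then show ?thesis using assms by (simp add: U.nat_pow_Suc) (simp add: dual_numbers_def nat_pow_def)
  next
   case (Suc k)
   have "(a, \<one>) [^]\<^bsub>dual_numbers R\<^esub> Suc n = (a [^] n, [n] \<cdot> (a [^] (n - 1))) \<otimes>\<^bsub>dual_numbers R\<^esub> (a, \<one>)"
    by (simp only: U.nat_pow_Suc Suc.IH)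
   then show ?thesis using assms \<open>n = Suc k\<close>
    by (simp add: dual_numbers_def add_pow_ldistr l_distr a_ac)
  qed
 qed
qed

lemma eval_dual_numbers:
 assumes "set p \<subseteq> carrier R" "a \<in> carrier R"
 shows "ring.eval (dual_numbers R) (map (\<lambda>c. (c, \<zero>)) p) (a, \<one>) = (eval p a, deriv_at p a)"
proof -
 interpret U: cring "dual_numbers R" by (rule dual_numbers_cring)
 show ?thesis using assms
 proof (induction p)
  case (Cons c p)
  then show ?case
   using eval_in_carrier[of p a] deriv_at_closed[of p a]
   by (simp add: dual_numbers_pow)
     (simp add: dual_numbers_def add_pow_rdistr)
 next
  case Nil
  show ?case unfolding list.map U.eval.simps eval.simps deriv_at.simps by (simp add: dual_numbers_def)
 qed
qed

lemma deriv_at_poly_mult: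
 assumes "set p \<subseteq> carrier R" "set q \<subseteq> carrier R" "a \<in> carrier R"
 shows "deriv_at (poly_mult p q) a = eval p a \<otimes> deriv_at q a \<oplus> deriv_at p a \<otimes> eval q a"
proof -
 interpret U: cring "dual_numbers R" by (rule dual_numbers_cring)
 define h :: "'a \<Rightarrow> 'a \<times> 'a" where "h = (\<lambda>c. (c, \<zero>))"
 have hom: "ring_hom_ring R (dual_numbers R) h"
  by (rule ring_hom_ringI[OF ring_axioms U.ring_axioms]) (auto simp: dual_numbers_def h_def)
 interpret H: ring_hom_ring R "dual_numbers R" h by (rule hom)
 have in_c: "set (map h r) \<subseteq> carrier (dual_numbers R)" if "set r \<subseteq> carrier R" for r
  using that by auto
 note eval_dual = eval_dual_numbers[folded h_def]
 have a: "(a, \<one>) \<in> carrier (dual_numbers R)" using assms by (simp add: dual_numbers_def)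
 have pq: "set (poly_mult p q) \<subseteq> carrier R" using poly_mult_in_carrier assms by blast
 have "(eval (poly_mult p q) a, deriv_at (poly_mult p q) a) = U.eval (map h (poly_mult p q)) (a, \<one>)"
  by (rule eval_dual[OF pq assms(3), symmetric])
 also have "\<dots> = U.eval (U.normalize (map h (poly_mult p q))) (a, \<one>)"
  by (rule U.eval_normalize[OF in_c[OF pq] a, symmetric])
 also have "\<dots> = U.eval (U.poly_mult (map h p) (map h q)) (a, \<one>)"
  by (simp only: H.poly_mult_hom'[OF assms(1,2)])
 also have "\<dots> = U.eval (map h p) (a, \<one>) \<otimes>\<^bsub>dual_numbers R\<^esub> U.eval (map h q) (a, \<one>)"
  by (rule U.eval_poly_mult[OF in_c[OF assms(1)] in_c[OF assms(2)] a])
 also have "\<dots> = (eval p a, deriv_at p a) \<otimes>\<^bsub>dual_numbers R\<^esub> (eval q a, deriv_at q a)"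
  by (simp only: eval_dual[OF assms(1,3)] eval_dual[OF assms(2,3)])
 also have "\<dots> = (eval p a \<otimes> eval q a, eval p a \<otimes> deriv_at q a \<oplus> deriv_at p a \<otimes> eval q a)"
  by (simp add: dual_numbers_def)
 finally show ?thesis by (rule Pair_inject)
qed

end

text \<open>Write the polynomial as \<open>(X - a)\<^sup>k q\<close> with \<open>q(a) \<noteq> 0\<close> and differentiate.\<close>

lemma (in domain) alg_mult_ge_2_iff:
 assumes p: "p \<in> carrier (poly_ring R)" "p \<noteq> []" and a: "a \<in> carrier R"
 shows "alg_mult p a \<ge> 2 \<longleftrightarrow> eval p a = \<zero> \<and> deriv_at p a = \<zero>"
proof -
 interpret UP: domain "poly_ring R" using univ_poly_is_domain[OF carrier_is_subring] .
 let ?b = "[\<one>, \<ominus> a]"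
 have b: "?b \<in> carrier (poly_ring R)" using a unfolding sym[OF univ_poly_carrier] polynomial_def by auto
 have car: "set q \<subseteq> carrier R" if "q \<in> carrier (poly_ring R)" for q
  using that unfolding sym[OF univ_poly_carrier] polynomial_def by auto
 have evb: "eval ?b a = \<zero>" "deriv_at ?b a = \<one>" using a by (auto simp: r_neg)
 have mult: "q \<otimes>\<^bsub>poly_ring R\<^esub> r = poly_mult q r" for q r by (simp add: univ_poly_mult)
 have b2: "?b [^]\<^bsub>poly_ring R\<^esub> (2::nat) = ?b \<otimes>\<^bsub>poly_ring R\<^esub> ?b"
  using b UP.nat_pow_Suc[of ?b 1] by (simp add: numeral_2_eq_2)
 show ?thesis
 proof
  assume "alg_mult p a \<ge> 2"
  then have "?b [^]\<^bsub>poly_ring R\<^esub> (2::nat) pdivides p"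
   using le_alg_mult_imp_pdivides[OF a p(1)] by blast
  then obtain q where q: "q \<in> carrier (poly_ring R)" "p = (?b \<otimes>\<^bsub>poly_ring R\<^esub> ?b) \<otimes>\<^bsub>poly_ring R\<^esub> q"
   unfolding pdivides_def factor_def b2 by auto
  then have p_eq: "p = poly_mult ?b (poly_mult ?b q)"
   unfolding UP.m_assoc[OF b b q(1)] by (simp only: mult)
  have r: "set (poly_mult ?b q) \<subseteq> carrier R" using poly_mult_in_carrier car b q by blast
  have "eval p a = \<zero>"
   unfolding p_eq eval_poly_mult[OF car[OF b] r a] evb using eval_in_carrier[OF r a] by simp
  moreover have "eval (poly_mult ?b q) a = \<zero>"
   unfolding eval_poly_mult[OF car[OF b] car[OF q(1)] a] evb
   using eval_in_carrier[OF car[OF q(1)] a] by simp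
  then have "deriv_at p a = \<zero>"
   unfolding p_eq deriv_at_poly_mult[OF car[OF b] r a] evb using deriv_at_closed[OF r a] by simp
  ultimately show "eval p a = \<zero> \<and> deriv_at p a = \<zero>" by simp
 next
  assume z: "eval p a = \<zero> \<and> deriv_at p a = \<zero>"
  then have "?b pdivides p" using is_root_imp_pdivides[OF p(1)] p(2) a by (simp add: is_root_def)
  then obtain q where q: "q \<in> carrier (poly_ring R)" "p = poly_mult ?b q"
   unfolding pdivides_def factor_def mult by auto
  have "eval q a = \<zero>"
   using z unfolding q(2) deriv_at_poly_mult[OF car[OF b] car[OF q(1)] a] evb
   using eval_in_carrier[OF car[OF q(1)] a] deriv_at_closed[OF car[OF q(1)] a] by simp
  moreover have "q \<noteq> []" using p(2) q(2) poly_mult_zero(2)[OF car[OF b]] by auto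
  ultimately have "?b pdivides q" using is_root_imp_pdivides[OF q(1)] a by (simp add: is_root_def)
  then obtain s where s: "s \<in> carrier (poly_ring R)" "q = poly_mult ?b s"
   unfolding pdivides_def factor_def mult by auto
  have "p = (?b [^]\<^bsub>poly_ring R\<^esub> (2::nat)) \<otimes>\<^bsub>poly_ring R\<^esub> s"
   unfolding q(2) s(2) b2 UP.m_assoc[OF b b s(1)] by (simp only: mult)
  then have "?b [^]\<^bsub>poly_ring R\<^esub> (2::nat) pdivides p"
   using s(1) unfolding pdivides_def factor_def by auto
  then show "alg_mult p a \<ge> 2" using alg_multE(2)[OF a p] by blast
 qed
qed

section \<open>Finite fields\<close>

lemma (in field) finite_subring_is_subfield:
 assumes K: "subring K R" and fin: "finite K"
 shows "subfield K R"
proof (rule subfieldI'[OF K])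
 fix k assume k: "k \<in> K - {\<zero>}"
 note Kp = subringE[OF K]
 have kc: "k \<in> carrier R" "k \<noteq> \<zero>" using k Kp(1) by auto
 have "inj_on ((\<otimes>) k) K"
 proof (rule inj_onI)
  fix a b assume "a \<in> K" "b \<in> K" "k \<otimes> a = k \<otimes> b"
  then show "a = b" using m_lcancel[OF kc(2,1), of a b] Kp(1) by auto
 qed
 moreover have "(\<otimes>) k ` K \<subseteq> K" using k Kp(6) by auto
 ultimately have "(\<otimes>) k ` K = K" using fin by (metis endo_inj_surj)
 then obtain j where j: "j \<in> K" "k \<otimes> j = \<one>" using Kp(3) by (metis imageE)
 then have "inv k = j" using kc Kp(1) by (metis comm_inv_char subsetD m_comm)
 then show "inv k \<in> K" using j by simp
qed

context ring begin

text \<open>In both directions the cardinality of a finite field determines its degree over a subfield.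
 This is how all residue degrees are computed: it is enough to count residue fields.\<close>

lemma card_dimension:
 assumes K: "subfield K R" and fin: "finite K" and dim: "dimension n K E"
 shows "finite E \<and> card E = card K ^ n"
 using dim K fin
proof (induction rule: dimension.induct)
 case (Suc_dim v E n K)
 note K = Suc_dim.prems(1) and fin = Suc_dim.prems(2)
 note Kp = subringE[OF subfieldE(1)[OF K]]
 note Ep = space_subgroup_props[OF K Suc_dim.hyps(3)]
 let ?f = "\<lambda>(k, e). k \<otimes> v \<oplus> e"
 have img: "line_extension K v E = ?f ` (K \<times> E)"
  unfolding set_eq_iff by (auto simp: line_extension_mem_iff image_iff)
 have "inj_on ?f (K \<times> E)"
 proof (rule inj_onI, clarify)
  fix k e k' e'
  assume k: "k \<in> K" "k' \<in> K" and e: "e \<in> E" "e' \<in> E" and eq: "k \<otimes> v \<oplus> e = k' \<otimes> v \<oplus> e'"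
  have c: "k \<in> carrier R" "k' \<in> carrier R" "e \<in> carrier R" "e' \<in> carrier R"
   using k e Kp(1) Ep(1) by auto
  note v = Suc_dim.hyps(1)
  have "(k \<ominus> k') \<otimes> v = (k \<otimes> v \<oplus> e) \<ominus> e \<ominus> k' \<otimes> v" using c v by algebra
  also have "\<dots> = e' \<ominus> e" unfolding eq using c v by algebra
  finally have *: "(k \<ominus> k') \<otimes> v = e' \<ominus> e" .
  have "k = k'"
  proof (rule ccontr)
   assume "k \<noteq> k'"
   then have "k \<ominus> k' \<in> K - {\<zero>}" using k c Kp by (auto simp: a_minus_def) (metis c(1) c(2) a_minus_def r_right_minus_eq)
   moreover have "e' \<ominus> e \<in> E" using e Ep unfolding a_minus_def by blast
   ultimately have "v \<in> E" using Ep(6)[of "k \<ominus> k'" v] v * by simp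
   then show False using Suc_dim.hyps(2) by simp
  qed
  moreover have "e = e'" using eq \<open>k = k'\<close> c v add.l_cancel[of "k \<otimes> v" e e'] by simp
  ultimately show "k = k' \<and> e = e'" by simp
 qed
 then show ?case using Suc_dim.IH[OF K fin] fin by (simp add: img card_image card_cartesian_product)
qed simp

lemma dimension_eq_card:
 assumes K: "subfield K R" and fin: "finite E" and ne: "\<one> \<noteq> \<zero>" and E: "E \<subseteq> carrier R" "subring E R" "K \<subseteq> E"
  and card: "card E = card K ^ n"
 shows "dimension n K E"
proof -
 note Kp = subringE[OF subfieldE(1)[OF K]]
 note Ep = subringE[OF E(2)]
 obtain Us where Us: "set Us = E" using fin finite_list by auto
 have "Span K Us = E"
 proof
  show "E \<subseteq> Span K Us" using Span_base_incl[OF K] Us E by auto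
  have "subgroup E (add_monoid R)" using E(2) unfolding subring_def by simp
  moreover have "K <#> set Us \<subseteq> E" using Us E Ep(6) by (auto simp: set_mult_def)
  ultimately show "Span K Us \<subseteq> E" using Span_min[OF K] Us E by auto
 qed
 moreover obtain Vs where "independent K Vs" "Span K Vs = Span K Us"
  using filter_base[OF K] Us E by metis
 ultimately have dim: "dimension (length Vs) K E" by (metis dimension_independent)
 have finK: "finite K" using E(3) fin finite_subset by blast
 have "card {\<zero>, \<one>} \<le> card K" using finK Kp by (intro card_mono) auto
 then have "card K \<ge> 2" using ne by simp
 moreover have "card K ^ n = card K ^ length Vs"
  using card_dimension[OF K finK dim] card by simp
 ultimately have "n = length Vs" by (simp add: power_inject_exp)
 then show ?thesis using dim by simp
qed

end

lemma (in field) finite_subfield_pow_card: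
 assumes K: "subfield K R" and fin: "finite K" and x: "x \<in> K"
 shows "x [^] card K = x"
proof -
 note Kp = subringE[OF subfieldE(1)[OF K]]
 interpret F: field "R \<lparr> carrier := K \<rparr>" using subfield_iff(2)[OF K] .
 have pw: "x [^]\<^bsub>R \<lparr> carrier := K \<rparr>\<^esub> (n::nat) = x [^] n" for n by (simp add: nat_pow_def)
 have card: "card K = Suc (card (K - {\<zero>}))" using Kp(2) fin card.remove by fastforce
 show ?thesis
 proof (cases "x = \<zero>")
  case False
  have "x [^]\<^bsub>R \<lparr> carrier := K \<rparr>\<^esub> card (Units (R \<lparr> carrier := K \<rparr>)) = \<one>"
   using F.units_power_order_eq_one[of x] fin x False F.field_Units by simp
  then have "x [^] card (K - {\<zero>}) = \<one>" using F.field_Units pw by simp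
  then show ?thesis using x Kp(1) card by auto
 qed (simp add: card nat_pow_zero)
qed

lemma (in domain) prime_characteristic:
 assumes ex: "\<exists>n::nat. n > 0 \<and> [n] \<cdot> \<one> = \<zero>"
 obtains p where "Factorial_Ring.prime (p::nat)" "[p] \<cdot> \<one> = \<zero>"
  "\<And>n::nat. 0 < n ==> n < p ==> [n] \<cdot> \<one> \<noteq> \<zero>"
proof -
 define p :: nat where "p = (LEAST n. n > 0 \<and> [n] \<cdot> \<one> = \<zero>)"
 have p: "p > 0" "[p] \<cdot> \<one> = \<zero>" using LeastI_ex[OF ex] unfolding p_def by auto
 have least: "[n] \<cdot> \<one> \<noteq> \<zero>" if "0 < n" "n < p" for n :: nat
  using that not_less_Least unfolding p_def by blast
 have mult: "[a] \<cdot> \<one> \<otimes> [b] \<cdot> \<one> = [(a * b)] \<cdot> \<one>" for a b :: nat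
  by (simp add: add_pow_ldistr add_pow_rdistr add.nat_pow_pow mult.commute)
 have prime: "Factorial_Ring.prime p"
  unfolding prime_nat_iff
 proof (intro conjI allI impI)
  show "p > 1" using p by (cases "p = 1") auto
  fix a assume "a dvd p"
  then obtain b where ab: "p = a * b" by (elim dvdE)
  then have "[a] \<cdot> \<one> = \<zero> \<or> [b] \<cdot> \<one> = \<zero>"
   using p mult[of a b] integral[of "[a] \<cdot> \<one>" "[b] \<cdot> \<one>"] by simp
  moreover have "a > 0" "b > 0" using ab p(1) by auto
  ultimately have "a \<ge> p \<or> b \<ge> p" using least by (meson not_le)
  then show "a = 1 \<or> a = p" using ab \<open>a > 0\<close> \<open>b > 0\<close> by auto
 qed
 show thesis using that[OF prime p(2) least] .
qed

text \<open>The multiples of \<open>1\<close> form the prime field, and a finite field is a vector space over it.\<close>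

lemma (in field) finite_subfield_char:
 assumes K: "subfield K R" and fin: "finite K"
 obtains p r where "Factorial_Ring.prime (p::nat)" "[p] \<cdot> \<one> = \<zero>" "card K = p ^ r"
proof -
 note Kp = subringE[OF subfieldE(1)[OF K]]
 have nat_in: "[n] \<cdot> \<one> \<in> K" for n :: nat by (induction n) (use Kp in auto)
 have ex: "\<exists>n::nat. n > 0 \<and> [n] \<cdot> \<one> = \<zero>"
 proof -
  have "\<not> inj (\<lambda>n::nat. [n] \<cdot> \<one>)"
   using nat_in fin finite_subset[of "range (\<lambda>n::nat. [n] \<cdot> \<one>)" K] finite_imageD
    infinite_UNIV_nat by blast
  then obtain i j :: nat where ij: "i < j" "[i] \<cdot> \<one> = [j] \<cdot> \<one>"
   unfolding inj_def by (metis linorder_neqE_nat)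
  have "[j] \<cdot> \<one> = [i] \<cdot> \<one> \<oplus> [(j - i)] \<cdot> \<one>" using ij add.nat_pow_mult[of \<one> i "j - i"] by simp
  then have "[(j - i)] \<cdot> \<one> = \<zero>" using ij(2) by (metis add.l_cancel_one' add.nat_pow_closed one_closed)
  then show ?thesis using ij(1) by (intro exI[of _ "j - i"]) simp
 qed
 obtain p where prime: "Factorial_Ring.prime (p::nat)" and p: "[p] \<cdot> \<one> = \<zero>"
  and least: "\<And>n::nat. 0 < n ==> n < p ==> [n] \<cdot> \<one> \<noteq> \<zero>"
  using prime_characteristic[OF ex] by metis
 have p: "p > 0" "[p] \<cdot> \<one> = \<zero>" using prime p prime_gt_0_nat by auto
 have mult: "[a] \<cdot> \<one> \<otimes> [b] \<cdot> \<one> = [(a * b)] \<cdot> \<one>" for a b :: nat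
  by (simp add: add_pow_ldistr add_pow_rdistr add.nat_pow_pow mult.commute)
 define P where "P = range (\<lambda>n::nat. [n] \<cdot> \<one>)"
 have PK: "P \<subseteq> K" using nat_in unfolding P_def by auto
 have Psub: "subring P R"
 proof (rule subringI)
  show "P \<subseteq> carrier R" "\<one> \<in> P" unfolding P_def by (auto intro: image_eqI[of _ _ 1])
  fix x assume "x \<in> P"
  then obtain n :: nat where n: "x = [n] \<cdot> \<one>" unfolding P_def by auto
  have "[n] \<cdot> \<one> \<oplus> [(n * (p - 1))] \<cdot> \<one> = [(n * p)] \<cdot> \<one>"
   using p(1) by (simp add: add.nat_pow_mult algebra_simps)
  also have "\<dots> = \<zero>" using mult[of n p] p(2) by simp
  finally have "\<ominus> x = [(n * (p - 1))] \<cdot> \<one>" unfolding n by (simp add: add.inv_unique' a_comm minus_equality)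
  then show "\<ominus> x \<in> P" unfolding P_def by auto
  fix y assume "y \<in> P"
  then obtain m :: nat where m: "y = [m] \<cdot> \<one>" unfolding P_def by auto
  show "x \<otimes> y \<in> P" unfolding n m mult P_def by auto
  show "x \<oplus> y \<in> P" unfolding n m P_def by (simp add: add.nat_pow_mult)
 qed
 have finP: "finite P" using finite_subset[OF PK fin] .
 have Pfield: "subfield P R" by (rule finite_subring_is_subfield[OF Psub finP])
 have Pimg: "P = (\<lambda>n::nat. [n] \<cdot> \<one>) ` {..<p}"
 proof -
  have "[n] \<cdot> \<one> = [(n mod p)] \<cdot> \<one>" for n :: nat
  proof -
   have "[n] \<cdot> \<one> = [(p * (n div p))] \<cdot> \<one> \<oplus> [(n mod p)] \<cdot> \<one>" by (simp add: add.nat_pow_mult)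
   then show ?thesis using mult[of p "n div p"] p(2) by simp
  qed
  then show ?thesis using p(1) unfolding P_def by (auto simp: image_iff) (metis lessThan_iff mod_less_divisor)
 qed
 have "inj_on (\<lambda>n::nat. [n] \<cdot> \<one>) {..<p}"
 proof (rule linorder_inj_onI)
  fix i j :: nat assume ij: "i < j" "i \<in> {..<p}" "j \<in> {..<p}"
  have "[j] \<cdot> \<one> = [i] \<cdot> \<one> \<oplus> [(j - i)] \<cdot> \<one>" using ij add.nat_pow_mult[of \<one> i "j - i"] by simp
  moreover have "[(j - i)] \<cdot> \<one> \<noteq> \<zero>" using ij by (intro least) auto
  ultimately show "[i] \<cdot> \<one> \<noteq> [j] \<cdot> \<one>" by (metis add.l_cancel_one' add.nat_pow_closed one_closed)
 qed auto
 then have cardP: "card P = p" unfolding Pimg by (simp add: card_image)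
 obtain Us where Us: "set Us = K" using fin finite_list by auto
 have "Span P Us = K"
 proof
  show "K \<subseteq> Span P Us" using Span_base_incl[OF Pfield] Us Kp by auto
  have "subgroup K (add_monoid R)" using subfieldE(1)[OF K] unfolding subring_def by simp
  moreover have "P <#> set Us \<subseteq> K" using Us PK Kp(6) by (auto simp: set_mult_def)
  ultimately show "Span P Us \<subseteq> K" using Span_min[OF Pfield] Us Kp by auto
 qed
 moreover obtain Vs where "independent P Vs" "Span P Vs = Span P Us"
  using filter_base[OF Pfield] Us Kp by metis
 ultimately have "dimension (length Vs) P K" by (metis dimension_independent)
 then have "card K = p ^ length Vs" using card_dimension[OF Pfield finP] cardP by simp
 then show thesis using that prime p(2) by blast
qed

subsection \<open>Polynomials as coefficient lists\<close>

context domain begin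

text \<open>Independence of \<open>1, x, \<dots>, x\<^sup>n\<^sup>-\<^sup>1\<close> over a subring, for coefficient lists that are not necessarily
 normalized.\<close>

definition powers_independent :: "'a set \<Rightarrow> nat \<Rightarrow> 'a \<Rightarrow> bool"
 where "powers_independent K n x \<longleftrightarrow>
  (\<forall>h. set h \<subseteq> K \<and> length h \<le> n \<and> eval h x = \<zero> \<longrightarrow> set h \<subseteq> {\<zero>})"

lemma powers_independent_Irr:
 assumes K: "subfield K R" and x: "x \<in> carrier R" "(algebraic over K) x"
 shows "powers_independent K (degree (Irr K x)) x"
 unfolding powers_independent_def
proof clarify
 fix h y assume h: "set h \<subseteq> K" "length h \<le> degree (Irr K x)" "eval h x = \<zero>" and y: "y \<in> set h"
 have "independent K (exp_base x (degree (Irr K x)))" by (rule exp_base_independent[OF K x])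
 moreover have "exp_base x (degree (Irr K x)) =
   map (\<lambda>i. x [^] i) (rev [length h..<degree (Irr K x)]) @ exp_base x (length h)"
  using exp_base_append[of x "length h" "degree (Irr K x) - length h"]
  by (metis h(2) le_add_diff_inverse)
 ultimately have "independent K (exp_base x (length h))" using independent_split(1)[OF K] by metis
 then have "set (take (length (exp_base x (length h))) h) \<subseteq> {\<zero>}"
  using independent_imp_trivial_combine[OF K _ h(1)] combine_eq_eval h(3) by metis
 then show "y = \<zero>" using y by (auto simp: exp_base_def)
qed

lemma eval_eq_zero_iff_Irr:
 assumes K: "subfield K R" and x: "x \<in> carrier R" "(algebraic over K) x" and h: "set h \<subseteq> K"
 shows "eval h x = \<zero> \<longleftrightarrow> Irr K x pdivides normalize h"
proof -
 have hc: "set h \<subseteq> carrier R" using h subfieldE(3)[OF K] by auto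
 have hn: "normalize h \<in> carrier (K[X])"
  using normalize_gives_polynomial[OF h] by (simp add: univ_poly_carrier)
 have ev: "eval (normalize h) x = eval h x" by (rule eval_normalize[OF hc x(1)])
 have Ic: "Irr K x \<in> carrier (poly_ring R)" "normalize h \<in> carrier (poly_ring R)"
  using IrrE(1)[OF K x] hn carrier_polynomial_shell[OF subfieldE(1)[OF K]] by auto
 show ?thesis
 proof
  assume "eval h x = \<zero>"
  then show "Irr K x pdivides normalize h" using Irr_minimal[OF K x hn] ev by simp
 next
  assume "Irr K x pdivides normalize h"
  then have "eval (normalize h) x = \<zero>"
   using pdivides_imp_root_sharing[OF Ic(1) _ x(1)] IrrE(4)[OF K x] by blast
  then show "eval h x = \<zero>" using ev by simp
 qed
qed

lemma Irr_eq_of_root: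
 assumes K: "subfield K R" and x: "x \<in> carrier R" "(algebraic over K) x"
  and y: "y \<in> carrier R" "eval (Irr K x) y = \<zero>"
 shows "(algebraic over K) y" "Irr K y = Irr K x"
proof -
 have "Irr K x \<noteq> []" using IrrE[OF K x] pirreducible_degree[OF K] by fastforce
 then show alg: "(algebraic over K) y"
  using algebraicI[OF IrrE(1)[OF K x] _ y(2)] by (simp add: over_def)
 show "Irr K y = Irr K x"
  using minimal_polynomial_is_unique[OF K y(1) alg] IrrE[OF K y(1) alg] IrrE[OF K x] y(2) by blast
qed

text \<open>The minimal polynomial divides \<open>X\<^sup>n + g\<close>, and independence of the powers of \<open>x\<close> forces equal degrees.\<close>

lemma monic_list_eq_Irr:
 assumes K: "subfield K R" and x: "x \<in> carrier R" and g: "set g \<subseteq> K"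
  and root: "eval (\<one> # g) x = \<zero>" and ind: "powers_independent K (length g) x"
 shows "(algebraic over K) x" "Irr K x = \<one> # g"
proof -
 have gp: "\<one> # g \<in> carrier (K[X])"
  unfolding sym[OF univ_poly_carrier] polynomial_def using g subringE(3)[OF subfieldE(1)[OF K]] by simp
 show alg: "(algebraic over K) x" using algebraicI[OF gp _ root] by (simp add: over_def)
 note I = IrrE[OF K x alg]
 have "degree (Irr K x) \<le> length g"
  using pdivides_imp_degree_le[OF subfieldE(1)[OF K] I(1) gp _ Irr_minimal[OF K x alg gp root]] by simp
 obtain c where c: "Irr K x = \<one> # c"
  using I pirreducible_degree[OF K I(1,2)] by (cases "Irr K x") auto
 have cK: "set c \<subseteq> K" using I(1) c unfolding sym[OF univ_poly_carrier] polynomial_def by auto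
 have len: "length c = length g"
 proof (rule ccontr)
  assume "length c \<noteq> length g"
  then have "length (\<one> # c) \<le> length g" using \<open>degree (Irr K x) \<le> length g\<close> c by simp
  then have "set (\<one> # c) \<subseteq> {\<zero>}"
   using ind I(4) c cK subringE(3)[OF subfieldE(1)[OF K]] unfolding powers_independent_def
   by (metis insert_subset list.set(2))
  then show False by simp
 qed
 have "\<one> # g \<in> (\<lambda>q. poly_mult (Irr K x) q) ` carrier (poly_ring R)"
  using Irr_minimal[OF K x alg gp root] unfolding pdivides_def factor_def univ_poly_mult by auto
 then obtain q where q: "polynomial (carrier R) q" "\<one> # g = poly_mult (Irr K x) q" unfolding univ_poly_carrier by auto
 have Ip: "polynomial (carrier R) (Irr K x)" "Irr K x \<noteq> []"
  using carrier_polynomial_shell[OF subfieldE(1)[OF K] I(1)] c unfolding univ_poly_carrier by auto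
 have q0: "q \<noteq> []" using q(2) poly_mult_zero(2)[OF polynomial_in_carrier[OF carrier_is_subring Ip(1)]] by auto
 note pm = poly_mult_degree_eq[OF carrier_is_subring Ip(1) q(1), folded q(2)]
  poly_mult_lead_coeff[OF carrier_is_subring Ip(1) q(1) Ip(2) q0, folded q(2)]
 have "degree q = 0" using pm(1) Ip(2) q0 len c by simp
 then obtain b where b: "q = [b]" using q0 by (cases q) auto
 have "b \<in> carrier R" using q(1) unfolding polynomial_def b by auto
 moreover have "\<one> = \<one> \<otimes> b" using pm(2) b c by simp
 ultimately have "q = [\<one>]" unfolding b by simp
 then show "Irr K x = \<one> # g" using q(2) poly_mult_one(2)[OF carrier_is_subring Ip(1)] by simp
qed

end

subsection \<open>Finite subfields of an algebraically closed field\<close>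

lemma (in ring) deriv_at_replicate_zero:
 "a \<in> carrier R ==> set q \<subseteq> carrier R ==> deriv_at q a \<in> carrier R ==>
  deriv_at (replicate n \<zero> @ q) a = deriv_at q a"
 by (induction n) auto

context algebraically_closed begin

lemma card_roots_eq_degree:
 assumes p: "p \<in> carrier (poly_ring L)" "p \<noteq> []" and simple: "\<And>a. a \<in> carrier L ==> alg_mult p a \<le> 1"
 shows "card {x \<in> carrier L. eval p x = \<zero>} = degree p" "finite {x \<in> carrier L. eval p x = \<zero>}"
proof -
 have set: "set_mset (roots p) = {x \<in> carrier L. eval p x = \<zero>}"
  using roots_mem_iff_is_root[OF p(1)] p(2) by (auto simp: is_root_def)
 then show fin: "finite {x \<in> carrier L. eval p x = \<zero>}" by (metis finite_set_mset)
 have "count (roots p) a = 1" if "a \<in># roots p" for a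
 proof -
  have "a \<in> carrier L" using that set by auto
  then have "count (roots p) a \<le> 1" using simple alg_mult_eq_count_roots[OF p(1)] by metis
  then show ?thesis using that by (metis One_nat_def count_greater_zero_iff le_antisym Suc_leI)
 qed
 then have "size (roots p) = card (set_mset (roots p))"
  by (simp add: size_multiset_overloaded_eq)
 then show "card {x \<in> carrier L. eval p x = \<zero>} = degree p"
  using roots_over_carrier[OF p(1)] set by (simp add: splitted_def)
qed

definition frobenius_fixed :: "nat \<Rightarrow> 'a set"
 where "frobenius_fixed q = {x \<in> carrier L. x [^] q = x}"

context
 fixes k :: "'a set"
 assumes k: "subfield k L" and fin: "finite k"
begin

text \<open>For \<open>Q = |k|\<^sup>d\<close> the derivative of \<open>X\<^sup>Q - X\<close> is \<open>-1\<close>, so this polynomial has \<open>Q\<close> distinct roots.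
 They form the unique extension of \<open>k\<close> of degree \<open>d\<close>.\<close>

lemma frobenius_polynomial:
 assumes d: "d > 0"
 obtains P where "P \<in> carrier (k[X]\<^bsub>L\<^esub>)" "degree P = card k ^ d"
  "\<And>x. x \<in> carrier L ==> eval P x = x [^] (card k ^ d) \<ominus> x"
  "\<And>a. a \<in> carrier L ==> alg_mult P a \<le> 1"
proof -
 note kp = subringE[OF subfieldE(1)[OF k]]
 obtain p r where pr: "Factorial_Ring.prime (p::nat)" "[p] \<cdot> \<one> = \<zero>" "card k = p ^ r"
  by (rule finite_subfield_char[OF k fin])
 have "card {\<zero>, \<one>} \<le> card k" using fin kp by (intro card_mono) auto
 then have k2: "card k \<ge> 2" by simp
 define Q where "Q = card k ^ d"
 have Q2: "Q \<ge> 2" using k2 d unfolding Q_def by (metis One_nat_def Suc_leI le_trans power_increasing power_one_right Suc_1 one_le_numeral)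
 have rpos: "r > 0" using pr(3) k2 by (cases r) auto
 have "p dvd Q" using pr(3) rpos d unfolding Q_def by (simp add: dvd_power_same dvd_power power_mult[symmetric])
 then obtain s where "Q = p * s" by (elim dvdE)
 then have Q0: "[Q] \<cdot> y = \<zero>" if "y \<in> carrier L" for y
 proof -
  have "[p] \<cdot> y = \<zero>" using add_pow_ldistr[OF one_closed that, of p] pr(2) that by simp
  then show ?thesis using \<open>Q = p * s\<close> add.nat_pow_pow[OF that, of s p] by simp
 qed
 define P where "P = \<one> # (replicate (Q - 2) \<zero> @ [\<ominus> \<one>, \<zero>])"
 have Pc: "P \<in> carrier (k[X]\<^bsub>L\<^esub>)" "set P \<subseteq> carrier L"
  unfolding sym[OF univ_poly_carrier] polynomial_def P_def using kp by auto
 have PL: "P \<in> carrier (poly_ring L)" "P \<noteq> []"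
  using carrier_polynomial_shell[OF subfieldE(1)[OF k] Pc(1)] by (auto simp: P_def)
 have deg: "degree P = Q" using Q2 unfolding P_def by simp
 have ev: "eval P x = x [^] Q \<ominus> x" if x: "x \<in> carrier L" for x
 proof -
  have "x [^] Q = x [^] (Suc (Suc (Q - 2)))" using Q2 by (intro arg_cong[of _ _ "\<lambda>n. x [^] n"]) simp
  then show ?thesis
   using x eval_replicate[of "[\<ominus> \<one>, \<zero>]" x "Q - 2"] unfolding P_def
   by (simp add: a_minus_def l_minus)
 qed
 have "deriv_at P a = \<ominus> \<one>" if a: "a \<in> carrier L" for a
 proof -
  have "length (replicate (Q - 2) \<zero> @ [\<ominus> \<one>, \<zero>]) = Q" using Q2 by simp
  then have "deriv_at P a = [Q] \<cdot> (\<one> \<otimes> a [^] (Q - 1)) \<oplus> deriv_at (replicate (Q - 2) \<zero> @ [\<ominus> \<one>, \<zero>]) a"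
   unfolding P_def deriv_at.simps by (simp only:)
  then show ?thesis
   using a Q0[of "\<one> \<otimes> a [^] (Q - 1)"] deriv_at_replicate_zero[of a "[\<ominus> \<one>, \<zero>]" "Q - 2"] by simp
 qed
 moreover have "\<ominus> \<one> \<noteq> \<zero>" by simp
 ultimately have "alg_mult P a \<le> 1" if "a \<in> carrier L" for a
  using alg_mult_ge_2_iff[OF PL that] that by force
 then show thesis using that Pc(1) deg ev unfolding Q_def by blast
qed

lemma finite_frobenius_fixed:
 assumes d: "d > 0"
 shows "subfield (frobenius_fixed (card k ^ d)) L" "k \<subseteq> frobenius_fixed (card k ^ d)"
  "card (frobenius_fixed (card k ^ d)) = card k ^ d" "finite (frobenius_fixed (card k ^ d))"
proof -
 note kp = subringE[OF subfieldE(1)[OF k]]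
 obtain P where P: "P \<in> carrier (k[X]\<^bsub>L\<^esub>)" "degree P = card k ^ d"
  "\<And>x. x \<in> carrier L ==> eval P x = x [^] (card k ^ d) \<ominus> x"
  "\<And>a. a \<in> carrier L ==> alg_mult P a \<le> 1"
  by (rule frobenius_polynomial[OF d], rule that)
 have "card k > 0" using fin kp(4) by (simp add: card_gt_0_iff)
 then have PL: "P \<in> carrier (poly_ring L)" "P \<noteq> []"
  using carrier_polynomial_shell[OF subfieldE(1)[OF k] P(1)] P(2) by auto
 have X: "frobenius_fixed (card k ^ d) = {x \<in> carrier L. eval P x = \<zero>}"
  using P(3) unfolding frobenius_fixed_def by auto
 show card: "card (frobenius_fixed (card k ^ d)) = card k ^ d"
  and finX: "finite (frobenius_fixed (card k ^ d))"
  unfolding X using card_roots_eq_degree[OF PL P(4)] P(2) by auto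
 obtain p r where pr: "Factorial_Ring.prime (p::nat)" "[p] \<cdot> \<one> = \<zero>" "card k = p ^ r"
  by (rule finite_subfield_char[OF k fin])
 have Q: "card k ^ d = p ^ (r * d)" using pr(3) by (simp add: power_mult)
 have "subring (frobenius_fixed (card k ^ d)) L"
 proof (rule subringI)
  fix x y assume xy: "x \<in> frobenius_fixed (card k ^ d)" "y \<in> frobenius_fixed (card k ^ d)"
  then show "x \<otimes> y \<in> frobenius_fixed (card k ^ d)"
   unfolding frobenius_fixed_def by (simp add: nat_pow_distrib)
  show "x \<oplus> y \<in> frobenius_fixed (card k ^ d)"
   using xy frobenius_pow_add[OF pr(1,2), of x y "r * d"] unfolding frobenius_fixed_def Q by simp
  have x: "x \<in> carrier L" "x [^] (p ^ (r * d)) = x" using xy(1) unfolding frobenius_fixed_def Q by auto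
  have "(x \<oplus> \<ominus> x) [^] (p ^ (r * d)) = x \<oplus> (\<ominus> x) [^] (p ^ (r * d))"
   using frobenius_pow_add[OF pr(1,2), of x "\<ominus> x" "r * d"] x by simp
  moreover have "p ^ (r * d) > 0" using pr(1) prime_gt_0_nat by simp
  ultimately have "x \<oplus> (\<ominus> x) [^] (p ^ (r * d)) = \<zero>" using x by (simp add: r_neg nat_pow_zero)
  then have "(\<ominus> x) [^] (p ^ (r * d)) = \<ominus> x" using x by (metis a_inv_closed minus_equality nat_pow_closed a_comm)
  then show "\<ominus> x \<in> frobenius_fixed (card k ^ d)" using x unfolding frobenius_fixed_def Q by simp
 qed (auto simp: frobenius_fixed_def)
 then show "subfield (frobenius_fixed (card k ^ d)) L"
  using finX by (rule finite_subring_is_subfield)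
 show "k \<subseteq> frobenius_fixed (card k ^ d)"
 proof
  fix x assume x: "x \<in> k"
  then have xc: "x \<in> carrier L" using kp(1) by auto
  have "x [^] (card k ^ j) = x" for j
  proof (induction j)
   case (Suc j)
   have "x [^] (card k ^ Suc j) = (x [^] (card k ^ j)) [^] card k"
    using xc by (simp add: nat_pow_pow mult.commute)
   then show ?case using Suc finite_subfield_pow_card[OF k fin x] by simp
  qed (use xc in simp)
  then show "x \<in> frobenius_fixed (card k ^ d)" using xc unfolding frobenius_fixed_def by simp
 qed
qed

lemma finite_subfield_eq_frobenius_fixed:
 assumes d: "d > 0" and E: "subfield E L" and card: "card E = card k ^ d"
 shows "E = frobenius_fixed (card k ^ d)"
proof -
 have "card k > 0" using fin subringE(3)[OF subfieldE(1)[OF k]] card_gt_0_iff by blast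
 then have finE: "finite E" using card by (metis card_gt_0_iff zero_less_power)
 have "E \<subseteq> frobenius_fixed (card k ^ d)"
  using finite_subfield_pow_card[OF E finE] subfieldE(3)[OF E] card unfolding frobenius_fixed_def by auto
 then show ?thesis using finite_frobenius_fixed[OF d] card card_subset_eq by metis
qed

lemma finite_field_generator:
 assumes E: "subfield E L" "finite E" "k \<subseteq> E"
 obtains a where "a \<in> E" "simple_extension k a = E" "(algebraic over k) a"
proof -
 note Ep = subringE[OF subfieldE(1)[OF E(1)]]
 interpret F: field "L \<lparr> carrier := E \<rparr>" using subfield_iff(2)[OF E(1)] .
 have pw: "x [^]\<^bsub>L \<lparr> carrier := E \<rparr>\<^esub> (n::nat) = x [^] n" for x n by (simp add: nat_pow_def)
 obtain a where a: "a \<in> E - {\<zero>}" "E - {\<zero>} = {a [^] i | i::nat. i \<in> UNIV}"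
  using F.finite_field_mult_group_has_gen E(2) pw by auto
 have ac: "a \<in> carrier L" "a \<in> E" using a Ep(1) by auto
 have sub: "subring (simple_extension k a) L" by (rule simple_extension_is_subring[OF subfieldE(1)[OF k] ac(1)])
 have amem: "a \<in> simple_extension k a" by (rule simple_extension_mem[OF subfieldE(1)[OF k] ac(1)])
 have pows: "a [^] i \<in> simple_extension k a" for i :: nat
  by (induction i) (use subringE[OF sub] amem in auto)
 have "E \<subseteq> simple_extension k a"
 proof
  fix x assume "x \<in> E"
  then have "x = \<zero> \<or> x \<in> {a [^] i | i::nat. i \<in> UNIV}" using a(2) by blast
  then show "x \<in> simple_extension k a" using pows subringE(2)[OF sub] by auto
 qed
 moreover have "simple_extension k a \<subseteq> E"
  using simple_extension_subring_incl[OF subfieldE(1)[OF E(1)] E(3) ac(2)] .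
 ultimately have eq: "simple_extension k a = E" by simp
 then have "(algebraic over k) a" using simple_extension_is_subfield[OF k ac(1)] E(1) by (simp add: over_def)
 then show thesis using that ac(2) eq by blast
qed

text \<open>A generator of the multiplicative group generates the extension of degree \<open>d\<close>. Its minimal
 polynomial is irreducible and divides \<open>X\<^sup>Q - X\<close>, hence has \<open>d\<close> distinct roots.\<close>

lemma exists_irreducible_over_finite_subfield:
 assumes d: "d > 0"
 obtains b g where "b \<in> carrier L" "set g \<subseteq> k" "length g = d" "eval (\<one> # g) b = \<zero>"
  "powers_independent k d b" "card {x \<in> carrier L. eval (\<one> # g) x = \<zero>} = d"
  "\<And>x h. x \<in> carrier L ==> eval (\<one> # g) x = \<zero> ==> set h \<subseteq> k ==> eval h x = \<zero> \<longleftrightarrow> eval h b = \<zero>"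
  "card (simple_extension k b) = card k ^ d"
proof -
 define E where "E = frobenius_fixed (card k ^ d)"
 note E = finite_frobenius_fixed[OF d, folded E_def]
 note kp = subringE[OF subfieldE(1)[OF k]]
 obtain b where b: "b \<in> E" "simple_extension k b = E" "(algebraic over k) b"
  using finite_field_generator[OF E(1,4,2)] by blast
 have bc: "b \<in> carrier L" using b(1) subfieldE(3)[OF E(1)] by auto
 note I = IrrE[OF k bc b(3)]
 have dimd: "dimension d k E"
  by (rule dimension_eq_card[OF k E(4) _ _ _ E(2,3)]) (use subfieldE[OF E(1)] in auto)
 have "dimension (degree (Irr k b)) k E" using dimension_simple_extension[OF k bc b(3)] b(2) by simp
 then have deg: "degree (Irr k b) = d" using dimension_is_inj[OF k] dimd by blast
 obtain g where g: "Irr k b = \<one> # g"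
  using I pirreducible_degree[OF k I(1,2)] by (cases "Irr k b") auto
 have gk: "set g \<subseteq> k" using I(1) g unfolding sym[OF univ_poly_carrier] polynomial_def by auto
 have len: "length g = d" using deg g by simp
 obtain P where P: "P \<in> carrier (k[X]\<^bsub>L\<^esub>)" "degree P = card k ^ d"
  "\<And>x. x \<in> carrier L ==> eval P x = x [^] (card k ^ d) \<ominus> x"
  "\<And>a. a \<in> carrier L ==> alg_mult P a \<le> 1"
  by (rule frobenius_polynomial[OF d], rule that)
 have "card k > 0" using fin kp(4) by (simp add: card_gt_0_iff)
 then have PL: "P \<in> carrier (poly_ring L)" "P \<noteq> []"
  using carrier_polynomial_shell[OF subfieldE(1)[OF k] P(1)] P(2) by auto
 have IL: "Irr k b \<in> carrier (poly_ring L)" "Irr k b \<noteq> []"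
  using carrier_polynomial_shell[OF subfieldE(1)[OF k] I(1)] g by auto
 have "eval P b = \<zero>" using P(3)[OF bc] b(1) unfolding E_def frobenius_fixed_def by simp
 then have "Irr k b pdivides P" by (rule Irr_minimal[OF k bc b(3) P(1)])
 then have sub: "roots (Irr k b) \<subseteq># roots P" using pdivides_imp_roots_incl[OF IL(1) PL] by blast
 have "alg_mult (Irr k b) a \<le> 1" if "a \<in> carrier L" for a
  using P(4)[OF that] sub mset_subset_eq_count alg_mult_eq_count_roots[OF IL(1)]
   alg_mult_eq_count_roots[OF PL(1)] le_trans by metis
 then have card: "card {x \<in> carrier L. eval (\<one> # g) x = \<zero>} = d"
  using card_roots_eq_degree(1)[OF IL] deg g by simp
 have same: "eval h x = \<zero> \<longleftrightarrow> eval h b = \<zero>"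
  if "x \<in> carrier L" "eval (\<one> # g) x = \<zero>" "set h \<subseteq> k" for x h
 proof -
  have x: "(algebraic over k) x" "Irr k x = Irr k b"
   using Irr_eq_of_root[OF k bc b(3) that(1)] that(2) g by auto
  show ?thesis
   using eval_eq_zero_iff_Irr[OF k that(1) x(1) that(3)] eval_eq_zero_iff_Irr[OF k bc b(3) that(3)] x(2) by simp
 qed
 have "powers_independent k d b" using powers_independent_Irr[OF k bc b(3)] deg by simp
 then show thesis using that[OF bc gk len] I(4) g card same b(2) E(3) by simp
qed

end

end

section \<open>Finitely generated modules over a subring and integral elements\<close>

context ring begin

text \<open>Modules over the subring \<open>D\<close> occur only inside the ambient field: ideals of \<open>D\<close>, overrings of \<open>D\<close>
 and fractional ideals are instances.\<close>

definition module_over :: "'a set \<Rightarrow> 'a set \<Rightarrow> bool"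
 where "module_over D A \<longleftrightarrow> A \<subseteq> carrier R \<and> \<zero> \<in> A \<and>
  (\<forall>x \<in> A. \<forall>y \<in> A. x \<oplus> y \<in> A) \<and> (\<forall>d \<in> D. \<forall>x \<in> A. d \<otimes> x \<in> A)"

definition fg_module :: "'a set \<Rightarrow> 'a set \<Rightarrow> bool"
 where "fg_module D A \<longleftrightarrow> (\<exists>Us. set Us \<subseteq> carrier R \<and> A = Span D Us)"

definition noetherian_subring :: "'a set \<Rightarrow> bool"
 where "noetherian_subring D \<longleftrightarrow> subring D R \<and> (\<forall>I. module_over D I \<and> I \<subseteq> D \<longrightarrow> fg_module D I)"

lemma module_overD:
 assumes "module_over D A"
 shows "A \<subseteq> carrier R" "\<zero> \<in> A" "\<And>x y. x \<in> A ==> y \<in> A ==> x \<oplus> y \<in> A"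
  "\<And>d x. d \<in> D ==> x \<in> A ==> d \<otimes> x \<in> A"
 using assms unfolding module_over_def by auto

lemma module_over_minus:
 assumes "subring D R" "module_over D A" "x \<in> A"
 shows "\<ominus> x \<in> A"
proof -
 note Dp = subringE[OF assms(1)]
 have "\<ominus> \<one> \<in> D" using Dp by auto
 then have "\<ominus> \<one> \<otimes> x \<in> A" using module_overD(4)[OF assms(2)] assms(3) by blast
 then show ?thesis using module_overD(1)[OF assms(2)] assms(3) by (metis l_minus l_one one_closed subsetD)
qed

lemma Span_Nil [simp]: "Span D [] = {\<zero>}" by simp

lemma Span_Cons: "Span D (u # Us) = {k \<otimes> u \<oplus> v | k v. k \<in> D \<and> v \<in> Span D Us}"
proof -
 have "Span D (u # Us) = line_extension D u (Span D Us)" by simp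
 then show ?thesis unfolding line_extension_mem_iff[abs_def] set_eq_iff by (auto simp: line_extension_mem_iff)
qed

declare Span.simps [simp del]

lemma module_over_Span:
 assumes D: "subring D R" and Us: "set Us \<subseteq> carrier R"
 shows "module_over D (Span D Us)" "set Us \<subseteq> Span D Us"
proof -
 note Dp = subringE[OF D]
 have "module_over D (Span D Us) \<and> set Us \<subseteq> Span D Us" using Us
 proof (induction Us)
  case Nil
  then show ?case using Dp by (auto simp: module_over_def)
 next
  case (Cons u Us)
  then have IH: "module_over D (Span D Us)" "set Us \<subseteq> Span D Us" and u: "u \<in> carrier R" by auto
  note Sp = module_overD[OF IH(1)]
  have sub: "v \<in> Span D (u # Us)" if "v \<in> Span D Us" for v
  proof -
   have "v = \<zero> \<otimes> u \<oplus> v" using that Sp(1) u by auto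
   then show ?thesis unfolding Span_Cons using that Dp(2) by blast
  qed
  have "u \<in> Span D (u # Us)"
  proof -
   have "u = \<one> \<otimes> u \<oplus> \<zero>" using u by simp
   then show ?thesis unfolding Span_Cons using Dp(3) Sp(2) by blast
  qed
  moreover have "module_over D (Span D (u # Us))"
   unfolding module_over_def
  proof (intro conjI ballI)
   show "Span D (u # Us) \<subseteq> carrier R"
    unfolding Span_Cons using Dp(1) Sp(1) u by auto
   show "\<zero> \<in> Span D (u # Us)" using sub Sp(2) by blast
   fix x assume "x \<in> Span D (u # Us)"
   then obtain k v where x: "k \<in> D" "v \<in> Span D Us" "x = k \<otimes> u \<oplus> v" unfolding Span_Cons by auto
   have xc: "k \<in> carrier R" "v \<in> carrier R" using x Dp(1) Sp(1) by auto
   {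
    fix y assume "y \<in> Span D (u # Us)"
    then obtain l w where y: "l \<in> D" "w \<in> Span D Us" "y = l \<otimes> u \<oplus> w" unfolding Span_Cons by auto
    have yc: "l \<in> carrier R" "w \<in> carrier R" using y Dp(1) Sp(1) by auto
    have "x \<oplus> y = (k \<oplus> l) \<otimes> u \<oplus> (v \<oplus> w)" unfolding x y using xc yc u by algebra
    then show "x \<oplus> y \<in> Span D (u # Us)"
     unfolding Span_Cons using Dp(7)[OF x(1) y(1)] Sp(3)[OF x(2) y(2)] by blast
   }
   fix d assume d: "d \<in> D"
   have "d \<otimes> x = (d \<otimes> k) \<otimes> u \<oplus> d \<otimes> v" unfolding x using xc d Dp(1) u by (simp add: r_distr m_assoc subset_iff)
   then show "d \<otimes> x \<in> Span D (u # Us)"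
    unfolding Span_Cons using Dp(6)[OF d x(1)] Sp(4)[OF d x(2)] by blast
  qed
  ultimately show ?case using IH(2) sub by auto
 qed
 then show "module_over D (Span D Us)" "set Us \<subseteq> Span D Us" by auto
qed

lemma Span_least:
 assumes "module_over D A" "set Us \<subseteq> A"
 shows "Span D Us \<subseteq> A"
 using assms(2)
proof (induction Us)
 case (Cons u Us)
 then show ?case unfolding Span_Cons using module_overD[OF assms(1)] by auto
qed (use module_overD(2)[OF assms(1)] in simp)

lemma fg_module_module:
 assumes "subring D R" "fg_module D A"
 shows "module_over D A"
 using assms module_over_Span unfolding fg_module_def by auto

lemma Span_append_sum:
 assumes D: "subring D R" and "set Us \<subseteq> carrier R" "set Ws \<subseteq> carrier R"
 shows "Span D (Us @ Ws) = {u \<oplus> w | u w. u \<in> Span D Us \<and> w \<in> Span D Ws}"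
 using assms(2)
proof (induction Us)
 case Nil
 have "Span D Ws \<subseteq> carrier R" using module_overD(1)[OF module_over_Span(1)[OF D assms(3)]] .
 then show ?case by force
next
 case (Cons u Us)
 have c: "D \<subseteq> carrier R" "Span D Us \<subseteq> carrier R" "Span D Ws \<subseteq> carrier R" "u \<in> carrier R"
  using module_overD(1)[OF module_over_Span(1)[OF D]] assms(3) Cons.prems subringE(1)[OF D] by auto
 have IH: "Span D (Us @ Ws) = {u \<oplus> w | u w. u \<in> Span D Us \<and> w \<in> Span D Ws}" using Cons by simp
 show ?case
 proof (intro Set.set_eqI iffI)
  fix x assume "x \<in> Span D ((u # Us) @ Ws)"
  then obtain k v w where x: "k \<in> D" "v \<in> Span D Us" "w \<in> Span D Ws" "x = k \<otimes> u \<oplus> (v \<oplus> w)"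
   unfolding append_Cons Span_Cons IH by blast
  then have xx: "x = (k \<otimes> u \<oplus> v) \<oplus> w" using c by (simp add: a_assoc subset_iff)
  show "x \<in> {u' \<oplus> w | u' w. u' \<in> Span D (u # Us) \<and> w \<in> Span D Ws}"
   unfolding Span_Cons using x(1-3) xx by blast
 next
  fix x assume "x \<in> {u' \<oplus> w | u' w. u' \<in> Span D (u # Us) \<and> w \<in> Span D Ws}"
  then obtain k v w where x: "k \<in> D" "v \<in> Span D Us" "w \<in> Span D Ws" "x = (k \<otimes> u \<oplus> v) \<oplus> w"
   unfolding Span_Cons by blast
  then have "x = k \<otimes> u \<oplus> (v \<oplus> w)" using c by (simp add: a_assoc subset_iff)
  then show "x \<in> Span D ((u # Us) @ Ws)"
   unfolding append_Cons Span_Cons IH using x(1-3) by blast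
 qed
qed

lemma fg_module_sum:
 assumes D: "subring D R" and "fg_module D A" "fg_module D B"
 shows "fg_module D {a \<oplus> b | a b. a \<in> A \<and> b \<in> B}"
proof -
 obtain Us Ws where "set Us \<subseteq> carrier R" "A = Span D Us" "set Ws \<subseteq> carrier R" "B = Span D Ws"
  using assms(2,3) unfolding fg_module_def by auto
 then show ?thesis unfolding fg_module_def
  by (intro exI[of _ "Us @ Ws"]) (use Span_append_sum[OF D] in auto)
qed

end

context cring begin

lemma Span_map_mult:
 assumes D: "subring D R" and "set Us \<subseteq> carrier R" and c: "c \<in> carrier R"
 shows "Span D (map ((\<otimes>) c) Us) = (\<otimes>) c ` Span D Us"
 using assms(2)
proof (induction Us)
 case (Cons u Us)
 have cc: "D \<subseteq> carrier R" "Span D Us \<subseteq> carrier R" "u \<in> carrier R"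
  using module_overD(1)[OF module_over_Span(1)[OF D]] Cons.prems subringE(1)[OF D] by auto
 have IH: "Span D (map ((\<otimes>) c) Us) = (\<otimes>) c ` Span D Us" using Cons by simp
 have eq: "c \<otimes> (k \<otimes> u \<oplus> v) = k \<otimes> (c \<otimes> u) \<oplus> c \<otimes> v" if "k \<in> D" "v \<in> Span D Us" for k v
  using that cc c by (simp add: r_distr m_lcomm subset_iff)
 show ?case unfolding list.map Span_Cons IH using eq
  by (auto simp: image_iff) (metis+)
qed (use c in simp)

lemma fg_module_mult:
 assumes D: "subring D R" and A: "fg_module D A" and c: "c \<in> carrier R"
 shows "fg_module D ((\<otimes>) c ` A)"
proof -
 obtain Us where "set Us \<subseteq> carrier R" "A = Span D Us" using A unfolding fg_module_def by auto
 then show ?thesis unfolding fg_module_def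
  by (intro exI[of _ "map ((\<otimes>) c) Us"]) (use Span_map_mult[OF D _ c] c in auto)
qed

lemma fg_module_self: "subring D R ==> fg_module D D"
 unfolding fg_module_def
 by (intro exI[of _ "[\<one>]"]) (use subringE(1)[of D R] in \<open>force simp: Span_Cons\<close>)

lemma fg_module_trans:
 assumes D: "subring D R" and E: "subring E R" and DE: "fg_module D E" and A: "fg_module E A"
 shows "fg_module D A"
proof -
 obtain Ws where Ws: "set Ws \<subseteq> carrier R" "A = Span E Ws" using A unfolding fg_module_def by auto
 have "fg_module D (Span E Ws)" using Ws(1)
 proof (induction Ws)
  case Nil
  show ?case unfolding fg_module_def by (intro exI[of _ "[]"]) simp
 next
  case (Cons w Ws)
  have "Span E (w # Ws) = {a \<oplus> b | a b. a \<in> (\<otimes>) w ` E \<and> b \<in> Span E Ws}"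
   unfolding Span_Cons using Cons.prems subringE(1)[OF E] by (auto simp: image_iff subset_iff) (metis m_comm)+
  then show ?case using fg_module_sum[OF D fg_module_mult[OF D DE]] Cons by simp
 qed
 then show ?thesis using Ws by simp
qed

text \<open>Induction on the number of generators: split off the ideal of the coefficients that elements of the
 submodule have at the first generator.\<close>

lemma fg_submodule:
 assumes noeth: "noetherian_subring D" and A: "module_over D A" and B: "fg_module D B" "A \<subseteq> B"
 shows "fg_module D A"
proof -
 have D: "subring D R" using noeth unfolding noetherian_subring_def by simp
 note Dp = subringE[OF D]
 obtain Us where Us: "set Us \<subseteq> carrier R" "B = Span D Us" using B(1) unfolding fg_module_def by auto
 have "module_over D A ==> A \<subseteq> Span D Us ==> fg_module D A" for A using Us(1)
 proof (induction Us arbitrary: A)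
  case Nil
  then have "A = {\<zero>}" using module_overD(2)[OF Nil.prems(1)] by auto
  then show ?case unfolding fg_module_def by (intro exI[of _ "[]"]) simp
 next
  case (Cons u Us)
  note Ap = module_overD[OF Cons.prems(1)]
  have u: "u \<in> carrier R" and Us: "set Us \<subseteq> carrier R" using Cons.prems by auto
  note Sm = module_over_Span[OF D Us]
  note Sp = module_overD[OF Sm(1)]
  define I where "I = {k \<in> D. \<exists>v \<in> Span D Us. k \<otimes> u \<oplus> v \<in> A}"
  have I: "module_over D I"
   unfolding module_over_def
  proof (intro conjI ballI)
   show "I \<subseteq> carrier R" using Dp(1) unfolding I_def by auto
   show "\<zero> \<in> I" unfolding I_def using Dp(2) Sp(2) Ap(2) u by (auto intro!: bexI[of _ \<zero>])
   fix k assume k: "k \<in> I"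
   then obtain v where v: "k \<in> D" "v \<in> Span D Us" "k \<otimes> u \<oplus> v \<in> A" unfolding I_def by auto
   have c: "k \<in> carrier R" "v \<in> carrier R" using v Dp(1) Sp(1) by auto
   {
    fix l assume l: "l \<in> I"
    then obtain w where w: "l \<in> D" "w \<in> Span D Us" "l \<otimes> u \<oplus> w \<in> A" unfolding I_def by auto
    have "l \<in> carrier R" "w \<in> carrier R" using w Dp(1) Sp(1) by auto
    then have "(k \<otimes> u \<oplus> v) \<oplus> (l \<otimes> u \<oplus> w) = (k \<oplus> l) \<otimes> u \<oplus> (v \<oplus> w)" using c u by algebra
    then show "k \<oplus> l \<in> I" unfolding I_def
     using Ap(3)[OF v(3) w(3)] Dp(7)[OF v(1) w(1)] Sp(3)[OF v(2) w(2)] by auto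
   }
   fix d assume d: "d \<in> D"
   then have "d \<otimes> (k \<otimes> u \<oplus> v) = (d \<otimes> k) \<otimes> u \<oplus> d \<otimes> v"
    using c u Dp(1) by (simp add: r_distr m_assoc subset_iff)
   then show "d \<otimes> k \<in> I" unfolding I_def
    using Ap(4)[OF d v(3)] Dp(6)[OF d v(1)] Sp(4)[OF d v(2)] by auto
  qed
  moreover have "I \<subseteq> D" unfolding I_def by auto
  ultimately have "fg_module D I" using noeth unfolding noetherian_subring_def by blast
  then obtain Ks where Ks: "set Ks \<subseteq> carrier R" "I = Span D Ks" unfolding fg_module_def by auto
  have "\<exists>as. set as \<subseteq> A \<and> (\<forall>k \<in> Span D Ks. \<exists>a \<in> Span D as. \<exists>v \<in> Span D Us. a = k \<otimes> u \<oplus> v)"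
   if "set Ks \<subseteq> I" for Ks using that
  proof (induction Ks)
   case Nil
   then show ?case using u Sp(2) by (intro exI[of _ "[]"]) (auto intro!: bexI[of _ \<zero>])
  next
   case (Cons k Ks)
   then obtain as where as: "set as \<subseteq> A"
    "\<forall>k \<in> Span D Ks. \<exists>a \<in> Span D as. \<exists>v \<in> Span D Us. a = k \<otimes> u \<oplus> v" by auto
   obtain v where v: "k \<in> D" "v \<in> Span D Us" "k \<otimes> u \<oplus> v \<in> A" using Cons.prems unfolding I_def by auto
   have c: "k \<in> carrier R" "v \<in> carrier R" using v Dp(1) Sp(1) by auto
   have Ksc: "set Ks \<subseteq> carrier R" using Cons.prems Dp(1) unfolding I_def by auto
   have "\<exists>a \<in> Span D ((k \<otimes> u \<oplus> v) # as). \<exists>v \<in> Span D Us. a = x \<otimes> u \<oplus> v" if "x \<in> Span D (k # Ks)" for x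
   proof -
    obtain d l where dl: "d \<in> D" "l \<in> Span D Ks" "x = d \<otimes> k \<oplus> l" using \<open>x \<in> _\<close> unfolding Span_Cons by auto
    obtain a w where aw: "a \<in> Span D as" "w \<in> Span D Us" "a = l \<otimes> u \<oplus> w" using as(2) dl(2) by blast
    have cc: "d \<in> carrier R" "l \<in> carrier R" "w \<in> carrier R"
     using dl aw Dp(1) Sp(1) module_overD(1)[OF module_over_Span(1)[OF D Ksc]] by auto
    have "d \<otimes> (k \<otimes> u \<oplus> v) \<oplus> a = x \<otimes> u \<oplus> (d \<otimes> v \<oplus> w)"
     unfolding dl aw using c cc u by algebra
    moreover have "d \<otimes> (k \<otimes> u \<oplus> v) \<oplus> a \<in> Span D ((k \<otimes> u \<oplus> v) # as)"
     unfolding Span_Cons using dl aw by blast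
    moreover have "d \<otimes> v \<oplus> w \<in> Span D Us" using Sp(3) Sp(4) dl(1) v(2) aw(2) by blast
    ultimately show ?thesis by blast
   qed
   then show ?case using v(3) as(1) by (intro exI[of _ "(k \<otimes> u \<oplus> v) # as"]) simp
  qed
  moreover have "set Ks \<subseteq> I" using module_over_Span(2)[OF D Ks(1)] Ks(2) by simp
  ultimately obtain as where as: "set as \<subseteq> A"
   "\<And>k. k \<in> I ==> \<exists>a \<in> Span D as. \<exists>v \<in> Span D Us. a = k \<otimes> u \<oplus> v" using Ks(2) by metis
  have "module_over D (A \<inter> Span D Us)" using Ap Sp unfolding module_over_def by auto
  then have "fg_module D (A \<inter> Span D Us)" by (rule Cons.IH) (use Us in auto)
  then obtain Ws where Ws: "set Ws \<subseteq> carrier R" "A \<inter> Span D Us = Span D Ws" unfolding fg_module_def by auto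
  have WsA: "set Ws \<subseteq> A" using module_over_Span(2)[OF D Ws(1)] Ws(2) by auto
  have asc: "set as \<subseteq> carrier R" using as(1) Ap(1) by auto
  have "A = Span D (as @ Ws)"
  proof
   show "Span D (as @ Ws) \<subseteq> A" using Span_least[OF Cons.prems(1)] as(1) WsA by simp
   show "A \<subseteq> Span D (as @ Ws)"
   proof
    fix x assume x: "x \<in> A"
    then obtain k v where kv: "k \<in> D" "v \<in> Span D Us" "x = k \<otimes> u \<oplus> v"
     using Cons.prems(2) unfolding Span_Cons by auto
    then have "k \<in> I" using x unfolding I_def by auto
    then obtain a w where aw: "a \<in> Span D as" "w \<in> Span D Us" "a = k \<otimes> u \<oplus> w" using as(2) by blast
    have c: "k \<in> carrier R" "v \<in> carrier R" "w \<in> carrier R" using kv aw Dp(1) Sp(1) by auto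
    have aA: "a \<in> A" using Span_least[OF Cons.prems(1) as(1)] aw(1) by auto
    have eq: "x = a \<oplus> (x \<oplus> \<ominus> a)" "x \<oplus> \<ominus> a = v \<oplus> \<ominus> w"
     unfolding kv aw using c u by algebra+
    have "x \<oplus> \<ominus> a \<in> A" using Ap(3) x module_over_minus[OF D Cons.prems(1) aA] by blast
    moreover have "v \<oplus> \<ominus> w \<in> Span D Us" using Sp(3) kv(2) module_over_minus[OF D Sm(1) aw(2)] by blast
    ultimately have "x \<oplus> \<ominus> a \<in> Span D Ws" using eq(2) Ws(2) by auto
    then show "x \<in> Span D (as @ Ws)"
     unfolding Span_append_sum[OF D asc Ws(1)] using eq(1) aw(1) by blast
   qed
  qed
  then show ?case unfolding fg_module_def using asc Ws(1) by (intro exI[of _ "as @ Ws"]) simp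
 qed
 then show ?thesis using A B(2) Us(2) by simp
qed

lemma eval_closed_module:
 assumes "module_over D B" "subring P R" "set bs \<subseteq> B" "x \<in> P" "\<And>p b. p \<in> P ==> b \<in> B ==> b \<otimes> p \<in> B"
 shows "eval bs x \<in> B"
 using assms(3)
proof (induction bs)
 case (Cons b bs)
 have "x [^] n \<in> P" for n :: nat using assms(4) subringE[OF assms(2)] by (induction n) auto
 then show ?case using Cons module_overD(3)[OF assms(1)] assms(5) by simp
qed (use module_overD(2)[OF assms(1)] in simp)

lemma eval_map_mult:
 assumes "c \<in> carrier R" "set p \<subseteq> carrier R" "x \<in> carrier R"
 shows "eval (map ((\<otimes>) c) p) x = c \<otimes> eval p x"
 using assms(2)
proof (induction p)
 case (Cons a p)
 then show ?case using assms eval_in_carrier[of p x] by (simp add: r_distr m_assoc)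
qed (use assms in simp)

lemma eval_map2_minus_mult:
 assumes "length p = length q" "c \<in> carrier R" "set p \<subseteq> carrier R" "set q \<subseteq> carrier R" "x \<in> carrier R"
 shows "eval (map2 (\<lambda>s t. s \<ominus> c \<otimes> t) p q) x = eval p x \<ominus> c \<otimes> eval q x"
 using assms(1,3,4)
proof (induction p q rule: list_induct2)
 case (Cons a p b q)
 have "(a \<ominus> c \<otimes> b) \<otimes> y \<oplus> (r \<ominus> c \<otimes> s) = (a \<otimes> y \<oplus> r) \<ominus> c \<otimes> (b \<otimes> y \<oplus> s)"
  if "y \<in> carrier R" "r \<in> carrier R" "s \<in> carrier R" for y r s
  using Cons.prems that assms(2) by (simp, algebra)
 then show ?case using Cons eval_in_carrier[of p x] eval_in_carrier[of q x] assms(5) by simp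
qed (simp add: a_minus_def assms)

end

context domain begin

lemma integral_iff_list:
 assumes "subring D R"
 shows "integral D x \<longleftrightarrow> (\<exists>q. set q \<subseteq> D \<and> eval (\<one> # q) x = \<zero>)"
proof
 assume "integral D x"
 then obtain p where p: "p \<noteq> []" "p \<in> carrier (D[X])" "lead_coeff p = \<one>" "eval p x = \<zero>"
  unfolding integral_def by auto
 then obtain q where "p = \<one> # q" by (cases p) auto
 then show "\<exists>q. set q \<subseteq> D \<and> eval (\<one> # q) x = \<zero>"
  using p unfolding sym[OF univ_poly_carrier] polynomial_def by auto
next
 assume "\<exists>q. set q \<subseteq> D \<and> eval (\<one> # q) x = \<zero>"
 then obtain q where "set q \<subseteq> D" "eval (\<one> # q) x = \<zero>" by auto
 then show "integral D x" unfolding integral_def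
  by (intro exI[of _ "\<one> # q"])
    (use subringE(3)[OF assms] in \<open>auto simp: univ_poly_carrier[symmetric] polynomial_def\<close>)
qed

lemma monic_root_nonconst:
 assumes "x \<in> carrier R" "eval (\<one> # q) x = \<zero>"
 shows "length q > 0"
 using assms by (cases q) auto

text \<open>\<open>B + B x + \<dots> + B x\<^sup>n\<^sup>-\<^sup>1\<close>.\<close>

definition adjoin_module :: "'a set \<Rightarrow> 'a \<Rightarrow> nat \<Rightarrow> 'a set"
 where "adjoin_module B x n = {eval bs x | bs. set bs \<subseteq> B \<and> length bs = n}"

lemma adjoin_moduleI: "set bs \<subseteq> B ==> length bs = n ==> eval bs x \<in> adjoin_module B x n"
 unfolding adjoin_module_def by blast

context
 fixes D B x
 assumes D: "subring D R" and B: "fg_module D B" and x: "x \<in> carrier R"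
begin

lemma adjoin_module_fg: "fg_module D (adjoin_module B x n)"
proof (induction n)
 case 0
 have "adjoin_module B x 0 = Span D []" unfolding adjoin_module_def by auto
 then show ?case unfolding fg_module_def by (intro exI[of _ "[]"]) simp
next
 case (Suc n)
 have Bc: "B \<subseteq> carrier R" using module_overD(1)[OF fg_module_module[OF D B]] .
 have "adjoin_module B x (Suc n) =
   {a \<oplus> b | a b. a \<in> (\<otimes>) (x [^] n) ` B \<and> b \<in> adjoin_module B x n}" (is "_ = ?S")
 proof (intro Set.set_eqI iffI)
  fix z assume "z \<in> adjoin_module B x (Suc n)"
  then obtain bs where bs: "set bs \<subseteq> B" "length bs = Suc n" "z = eval bs x" unfolding adjoin_module_def by auto
  then obtain b cs where c: "bs = b # cs" by (cases bs) auto
  then have "z = x [^] n \<otimes> b \<oplus> eval cs x" using bs Bc x by (simp add: m_comm subset_iff)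
  moreover have "eval cs x \<in> adjoin_module B x n" using bs c unfolding adjoin_module_def by auto
  ultimately show "z \<in> ?S" using bs c by auto
 next
  fix z assume "z \<in> ?S"
  then obtain b cs where c: "b \<in> B" "set cs \<subseteq> B" "length cs = n" "z = x [^] n \<otimes> b \<oplus> eval cs x"
   unfolding adjoin_module_def by auto
  then have "z = eval (b # cs) x" using Bc x by (simp add: m_comm subset_iff)
  then show "z \<in> adjoin_module B x (Suc n)" unfolding adjoin_module_def
   using c by (intro CollectI exI[of _ "b # cs"]) simp
 qed
 then show ?case using fg_module_sum[OF D fg_module_mult[OF D B] Suc] x by simp
qed

lemma adjoin_module_closed_gen:
 assumes q: "eval (\<one> # q) x = \<zero>" "length q = n" "set q \<subseteq> carrier R"
  and cl: "\<And>p b. p \<in> set q ==> b \<in> B ==> b \<otimes> p \<in> B" and z: "z \<in> adjoin_module B x n"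
 shows "x \<otimes> z \<in> adjoin_module B x n"
proof -
 note Bm = fg_module_module[OF D B]
 note Bp = module_overD[OF Bm]
 obtain bs where bs: "set bs \<subseteq> B" "length bs = n" "z = eval bs x" using z unfolding adjoin_module_def by auto
 obtain b cs where c: "bs = b # cs" using monic_root_nonconst[OF x q(1)] q(2) bs(2) by (cases bs) auto
 have cc: "b \<in> carrier R" "set cs \<subseteq> carrier R" "set bs \<subseteq> carrier R" using bs c Bp(1) by auto
 have len: "length (cs @ [\<zero>]) = length q" using bs c q(2) by simp
 have "x [^] length q \<oplus> eval q x = \<zero>" using q(1) x by simp
 then have xn: "x [^] length q = \<ominus> eval q x"
  using x eval_in_carrier[OF q(3) x] by (metis minus_equality nat_pow_closed a_comm minus_minus a_inv_closed)
 have "x \<otimes> z = eval bs x \<otimes> x \<oplus> \<zero>" using bs cc x eval_in_carrier[OF cc(3) x] by (simp add: m_comm)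
 also have "\<dots> = eval (b # (cs @ [\<zero>])) x" using eval_append_aux[OF cc(3) zero_closed x] c by simp
 also have "\<dots> = b \<otimes> x [^] length q \<oplus> eval (cs @ [\<zero>]) x" using len by simp
 also have "\<dots> = eval (cs @ [\<zero>]) x \<ominus> b \<otimes> eval q x"
 proof -
  have "eval (cs @ [\<zero>]) x \<in> carrier R" "eval q x \<in> carrier R"
   using cc q(3) x by (auto intro!: eval_in_carrier)
  then show ?thesis unfolding xn using cc(1) by algebra
 qed
 also have "\<dots> = eval (map2 (\<lambda>s t. s \<ominus> b \<otimes> t) (cs @ [\<zero>]) q) x"
  using eval_map2_minus_mult[OF len cc(1) _ q(3) x] cc(2) by simp
 finally have eq: "x \<otimes> z = eval (map2 (\<lambda>s t. s \<ominus> b \<otimes> t) (cs @ [\<zero>]) q) x" .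
 have "set (map2 (\<lambda>s t. s \<ominus> b \<otimes> t) (cs @ [\<zero>]) q) \<subseteq> B"
 proof
  fix y assume "y \<in> set (map2 (\<lambda>s t. s \<ominus> b \<otimes> t) (cs @ [\<zero>]) q)"
  then obtain s t where st: "(s, t) \<in> set (zip (cs @ [\<zero>]) q)" "y = s \<ominus> b \<otimes> t" by auto
  then have "s \<in> B" "t \<in> set q" using set_zip_leftD[OF st(1)] set_zip_rightD[OF st(1)] bs c Bp(2) by auto
  moreover have "\<ominus> (b \<otimes> t) \<in> B"
   using module_over_minus[OF D Bm] cl[OF \<open>t \<in> set q\<close>] bs c by auto
  ultimately show "y \<in> B" unfolding st a_minus_def using Bp(3) by blast
 qed
 then show ?thesis unfolding eq by (rule adjoin_moduleI) (use len q(2) in simp)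
qed

lemma adjoin_module_closed_mult:
 assumes y: "y \<in> carrier R" "\<And>b. b \<in> B ==> y \<otimes> b \<in> B" and z: "z \<in> adjoin_module B x n"
 shows "y \<otimes> z \<in> adjoin_module B x n"
proof -
 obtain bs where bs: "set bs \<subseteq> B" "length bs = n" "z = eval bs x" using z unfolding adjoin_module_def by auto
 have "set bs \<subseteq> carrier R" using bs(1) module_overD(1)[OF fg_module_module[OF D B]] by auto
 then have "y \<otimes> z = eval (map ((\<otimes>) y) bs) x" using eval_map_mult[OF y(1) _ x] bs(3) by simp
 moreover have "set (map ((\<otimes>) y) bs) \<subseteq> B" using bs(1) y(2) by auto
 ultimately show ?thesis using adjoin_moduleI[of "map ((\<otimes>) y) bs" B n x] bs(2) by simp
qed

lemma adjoin_module_incl: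
 assumes "n > 0" "b \<in> B"
 shows "b \<in> adjoin_module B x n"
proof -
 have Bp: "B \<subseteq> carrier R" "\<zero> \<in> B" using module_overD[OF fg_module_module[OF D B]] by auto
 have "eval (replicate (n - 1) \<zero> @ [b]) x = b"
  using eval_replicate[of "[b]" x "n - 1"] assms Bp x by auto
 moreover have "set (replicate (n - 1) \<zero> @ [b]) \<subseteq> B" using Bp(2) assms(2) by auto
 ultimately show ?thesis unfolding adjoin_module_def using assms(1)
  by (intro CollectI exI[of _ "replicate (n - 1) \<zero> @ [b]"]) auto
qed

end

end

context field begin

text \<open>The determinant trick is replaced by the ascending chain condition: all powers \<open>x\<^sup>n b\<close> lie in the
 Noetherian module \<open>B\<close>, so one of them is a combination of the preceding ones; cancel \<open>b\<close>.\<close>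

lemma integral_if_stable_module:
 assumes noeth: "noetherian_subring D" and B: "fg_module D B" and b: "b \<in> B" "b \<noteq> \<zero>"
  and x: "x \<in> carrier R" "\<And>b. b \<in> B ==> x \<otimes> b \<in> B"
 shows "integral D x"
proof -
 have D: "subring D R" using noeth unfolding noetherian_subring_def by simp
 note Dp = subringE[OF D]
 note Bp = module_overD[OF fg_module_module[OF D B]]
 have bc: "b \<in> carrier R" using b(1) Bp(1) by auto
 define A where "A = {eval p x | p. set p \<subseteq> D}"
 have setc: "set p \<subseteq> carrier R" if "set p \<subseteq> D" for p using that Dp(1) by auto
 have A: "A = (\<lambda>p. eval p x) ` carrier (D[X])"
 proof (intro Set.set_eqI iffI)
  fix z assume "z \<in> A"
  then obtain p where p: "set p \<subseteq> D" "z = eval p x" unfolding A_def by auto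
  then have "z = eval (normalize p) x" using eval_normalize[OF setc x(1)] by simp
  then show "z \<in> (\<lambda>p. eval p x) ` carrier (D[X])"
   using normalize_gives_polynomial[OF p(1)] by (auto simp: univ_poly_carrier)
 next
  fix z assume "z \<in> (\<lambda>p. eval p x) ` carrier (D[X])"
  then obtain p where "polynomial D p" "z = eval p x" using univ_poly_carrier by blast
  then show "z \<in> A" unfolding A_def using polynomial_incl by blast
 qed
 have Asub: "subring A R"
  using simple_extension_is_subring[OF D x(1)] simple_extension_as_eval_img[OF Dp(1) x(1)] A by simp
 note Ap = subringE[OF Asub]
 have DA: "D \<subseteq> A" unfolding A_def
 proof
  fix d assume "d \<in> D"
  then show "d \<in> {eval p x | p. set p \<subseteq> D}" using Dp(1) x(1) by (intro CollectI exI[of _ "[d]"]) auto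
 qed
 have Amod: "module_over D A" unfolding module_over_def using Ap DA by auto
 have pw: "x [^] n \<otimes> b \<in> B" for n :: nat
 proof (induction n)
  case (Suc n)
  have "x [^] Suc n \<otimes> b = x \<otimes> (x [^] n \<otimes> b)" using x bc by (metis nat_pow_Suc2 m_assoc nat_pow_closed)
  then show ?case using x(2) Suc by simp
 qed (use b bc in simp)
 have "eval p x \<otimes> b \<in> B" if "set p \<subseteq> D" for p
  using that
 proof (induction p)
  case (Cons d p)
  have c: "d \<in> carrier R" "eval p x \<in> carrier R" using Cons.prems Dp(1) eval_in_carrier[OF _ x(1)] by auto
  have "eval (d # p) x \<otimes> b = d \<otimes> (x [^] length p \<otimes> b) \<oplus> eval p x \<otimes> b"
   using c x bc by (simp add: l_distr m_assoc)
  then show ?case using Cons Bp(3,4) pw by simp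
 qed (use Bp(2) bc in simp)
 then have "A \<subseteq> (\<otimes>) (inv b) ` B"
 proof (intro subsetI)
  fix z assume "z \<in> A"
  then obtain p where p: "set p \<subseteq> D" "z = eval p x" unfolding A_def by auto
  have zc: "z \<in> carrier R" using \<open>z \<in> A\<close> Ap(1) by auto
  have "inv b \<otimes> (z \<otimes> b) = z" using b bc zc field_Units by (simp add: m_lcomm[of _ z])
  moreover have "z \<otimes> b \<in> B" using \<open>\<And>p. set p \<subseteq> D ==> eval p x \<otimes> b \<in> B\<close> p by simp
  ultimately show "z \<in> (\<otimes>) (inv b) ` B" by (metis imageI)
 qed
 moreover have "inv b \<in> carrier R" using b(2) bc field_Units by auto
 ultimately have "fg_module D A"
  using fg_submodule[OF noeth Amod fg_module_mult[OF D B]] by blast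
 then obtain Ws where Ws: "set Ws \<subseteq> carrier R" "A = Span D Ws" unfolding fg_module_def by auto
 have "\<forall>w \<in> set Ws. \<exists>p. set p \<subseteq> D \<and> w = eval p x"
  using module_over_Span(2)[OF D Ws(1)] Ws(2) unfolding A_def by blast
 then obtain P where P: "\<And>w. w \<in> set Ws ==> set (P w) \<subseteq> D \<and> w = eval (P w) x" by metis
 define N where "N = Max (insert 0 ((\<lambda>w. length (P w)) ` set Ws))"
 have len: "length (P w) \<le> N" if "w \<in> set Ws" for w unfolding N_def using that by simp
 define C where "C = adjoin_module D x N"
 have Cm: "module_over D C"
  unfolding C_def using fg_module_module[OF D adjoin_module_fg[OF D fg_module_self[OF D] x(1)]] .
 have "set Ws \<subseteq> C"
 proof
  fix w assume w: "w \<in> set Ws"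
  have "eval (replicate (N - length (P w)) \<zero> @ P w) x = w"
   using eval_replicate[of "P w" x "N - length (P w)"] P[OF w] setc x(1) by auto
  then show "w \<in> C" unfolding C_def adjoin_module_def
   using P[OF w] len[OF w] Dp(2) by (intro CollectI exI[of _ "replicate (N - length (P w)) \<zero> @ P w"]) auto
 qed
 then have "A \<subseteq> C" using Span_least[OF Cm] Ws(2) by simp
 moreover have "x [^] N \<in> A"
 proof -
  have "x \<in> A" unfolding A_def using Dp(2,3) x(1) by (intro CollectI exI[of _ "[\<one>, \<zero>]"]) simp
  then show ?thesis by (induction N) (use Ap in auto)
 qed
 ultimately obtain p where p: "set p \<subseteq> D" "length p = N" "x [^] N = eval p x"
  unfolding C_def adjoin_module_def by auto
 have "eval (\<one> # map ((\<otimes>) (\<ominus> \<one>)) p) x = \<zero>"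
  using p(2,3) eval_map_mult[OF _ setc[OF p(1)] x(1), of "\<ominus> \<one>"] eval_in_carrier[OF setc[OF p(1)] x(1)] x(1)
  by (simp add: l_minus r_neg)
 moreover have "set (map ((\<otimes>) (\<ominus> \<one>)) p) \<subseteq> D" using p(1) Dp by auto
 ultimately show ?thesis using integral_iff_list[OF D] by blast
qed

lemma integral_trans:
 assumes noeth: "noetherian_subring D" and E: "subring E R" "fg_module D E"
  and x: "x \<in> carrier R" "integral E x"
 shows "integral D x"
proof -
 have D: "subring D R" using noeth unfolding noetherian_subring_def by simp
 obtain q where q: "set q \<subseteq> E" "eval (\<one> # q) x = \<zero>" using x integral_iff_list[OF E(1)] by auto
 note Ep = subringE[OF E(1)]
 show ?thesis
 proof (rule integral_if_stable_module[OF noeth adjoin_module_fg[OF D E(2) x(1)]])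
  show "\<one> \<in> adjoin_module E x (length q)"
   using adjoin_module_incl[OF D E(2) x(1) monic_root_nonconst[OF x(1) q(2)]] Ep(3) by blast
  show "x \<otimes> b \<in> adjoin_module E x (length q)" if "b \<in> adjoin_module E x (length q)" for b
   using adjoin_module_closed_gen[OF D E(2) x(1) q(2) refl _ _ that] q(1) Ep(1,6) by blast
 qed (use x in auto)
qed

lemma integral_sum_prod:
 assumes noeth: "noetherian_subring D"
  and x: "x \<in> carrier R" "integral D x" and y: "y \<in> carrier R" "integral D y"
 shows "integral D (x \<oplus> y)" "integral D (x \<otimes> y)"
proof -
 have D: "subring D R" using noeth unfolding noetherian_subring_def by simp
 note Dp = subringE[OF D]
 obtain q where q: "set q \<subseteq> D" "eval (\<one> # q) x = \<zero>" using x integral_iff_list[OF D] by auto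
 obtain r where r: "set r \<subseteq> D" "eval (\<one> # r) y = \<zero>" using y integral_iff_list[OF D] by auto
 have qc: "set q \<subseteq> carrier R" "set r \<subseteq> carrier R" using q r Dp(1) by auto
 define B where "B = adjoin_module D x (length q)"
 define C where "C = adjoin_module B y (length r)"
 have B: "fg_module D B" unfolding B_def by (rule adjoin_module_fg[OF D fg_module_self[OF D] x(1)])
 have C: "fg_module D C" unfolding C_def by (rule adjoin_module_fg[OF D B y(1)])
 note Bp = module_overD[OF fg_module_module[OF D B]]
 note Cp = module_overD[OF fg_module_module[OF D C]]
 have "\<one> \<in> B" unfolding B_def
  using adjoin_module_incl[OF D fg_module_self[OF D] x(1) monic_root_nonconst[OF x(1) q(2)]] Dp(3) by blast
 then have one: "\<one> \<in> C" unfolding C_def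
  using adjoin_module_incl[OF D B y(1) monic_root_nonconst[OF y(1) r(2)]] by blast
 have xB: "x \<otimes> b \<in> B" if "b \<in> B" for b
  using adjoin_module_closed_gen[OF D fg_module_self[OF D] x(1) q(2) refl qc(1)] that q(1) Dp(6) unfolding B_def by blast
 have xC: "x \<otimes> b \<in> C" if "b \<in> C" for b
  using adjoin_module_closed_mult[OF D B y(1) x(1) xB] that unfolding C_def by blast
 have yC: "y \<otimes> b \<in> C" if "b \<in> C" for b
  unfolding C_def
 proof (rule adjoin_module_closed_gen[OF D B y(1) r(2) refl qc(2)])
  fix p b assume "p \<in> set r" "b \<in> B"
  then show "b \<otimes> p \<in> B" using r(1) Bp(1) Bp(4)[of p b] Dp(1) m_comm[of b p]
   by (metis subsetD)
 qed (use that in \<open>simp add: C_def\<close>)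
 show "integral D (x \<oplus> y)"
 proof (rule integral_if_stable_module[OF noeth C one])
  fix b assume b: "b \<in> C"
  then have "(x \<oplus> y) \<otimes> b = x \<otimes> b \<oplus> y \<otimes> b" using x y Cp(1) by (simp add: l_distr subset_iff)
  then show "(x \<oplus> y) \<otimes> b \<in> C" using xC[OF b] yC[OF b] Cp(3) by simp
 qed (use x y in auto)
 show "integral D (x \<otimes> y)"
 proof (rule integral_if_stable_module[OF noeth C one])
  fix b assume b: "b \<in> C"
  then have "(x \<otimes> y) \<otimes> b = x \<otimes> (y \<otimes> b)" using x y Cp(1) by (simp add: m_assoc subset_iff)
  then show "(x \<otimes> y) \<otimes> b \<in> C" using xC[OF yC[OF b]] by simp
 qed (use x y in auto)
qed

lemma integral_mem:
 assumes "subring D R" "d \<in> D"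
 shows "integral D d"
proof -
 note Dp = subringE[OF assms(1)]
 have "eval (\<one> # [\<ominus> d]) d = \<zero>" using assms Dp(1) by (auto simp: r_neg subset_iff)
 then show ?thesis using integral_iff_list[OF assms(1)] Dp(5)[OF assms(2)] by (metis empty_set empty_subsetI insert_subset list.set(2))
qed

lemma integral_closure_subring:
 assumes noeth: "noetherian_subring D" and L: "subring L R"
 shows "subring {x \<in> L. integral D x} R"
proof -
 have D: "subring D R" using noeth unfolding noetherian_subring_def by simp
 note Dp = subringE[OF D] and Lp = subringE[OF L]
 have neg: "integral D (\<ominus> \<one>)" by (rule integral_mem[OF D]) (use Dp in auto)
 show ?thesis
 proof (rule subringI)
  show "\<one> \<in> {x \<in> L. integral D x}" using integral_mem[OF D] Dp(3) Lp(3) by simp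
  fix x assume x: "x \<in> {x \<in> L. integral D x}"
  then have "integral D (\<ominus> \<one> \<otimes> x)" using integral_sum_prod(2)[OF noeth _ neg] Lp(1) by auto
  then show "\<ominus> x \<in> {x \<in> L. integral D x}" using x Lp(1,5) by (auto simp: l_minus subset_iff)
  fix y assume y: "y \<in> {x \<in> L. integral D x}"
  have c: "x \<in> carrier R" "y \<in> carrier R" using x y Lp(1) by auto
  show "x \<otimes> y \<in> {x \<in> L. integral D x}" "x \<oplus> y \<in> {x \<in> L. integral D x}"
   using x y integral_sum_prod[OF noeth c(1) _ c(2)] Lp(6,7) by auto
 qed (use Lp in auto)
qed

lemma integral_if_mem_fg:
 assumes noeth: "noetherian_subring D" and E: "subring E R" "fg_module D E" and x: "x \<in> E"
 shows "integral D x"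
proof (rule integral_if_stable_module[OF noeth E(2) subringE(3)[OF E(1)]])
qed (use subringE[OF E(1)] x in auto)

end

section \<open>Dedekind domains and their localizations\<close>

context cring begin

lemma ideal_sub_ring_iff:
 assumes D: "subring D R"
 shows "ideal I (sub_ring D) \<longleftrightarrow> module_over D I \<and> I \<subseteq> D"
proof
 assume "ideal I (sub_ring D)"
 then interpret I: ideal I "sub_ring D" .
 have "I \<subseteq> D" using I.a_subset by simp
 moreover have "module_over D I"
  unfolding module_over_def using calculation subringE(1)[OF D] I.I_l_closed
   additive_subgroup.zero_closed[OF I.additive_subgroup_axioms]
   additive_subgroup.a_closed[OF I.additive_subgroup_axioms] by auto
 ultimately show "module_over D I \<and> I \<subseteq> D" by simp
next
 assume I: "module_over D I \<and> I \<subseteq> D"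
 note Ip = module_overD[OF conjunct1[OF I]]
 interpret S: ring "sub_ring D" by (rule subring_is_ring[OF D])
 have neg: "a_inv (sub_ring D) x = \<ominus> x" if "x \<in> D" for x
  using S.minus_equality[of "\<ominus> x" x] subringE(1,5)[OF D] that by (auto simp: l_neg subset_iff)
 show "ideal I (sub_ring D)"
 proof (rule idealI[OF S.ring_axioms])
  show "subgroup I (add_monoid (sub_ring D))"
  proof (rule S.add.subgroupI)
   fix x assume "x \<in> I"
   then show "\<ominus>\<^bsub>sub_ring D\<^esub> x \<in> I"
    using neg[of x] module_over_minus[OF D] I by auto
  qed (use I Ip in auto)
  fix a x assume "a \<in> I" "x \<in> carrier (sub_ring D)"
  then show "x \<otimes>\<^bsub>sub_ring D\<^esub> a \<in> I" "a \<otimes>\<^bsub>sub_ring D\<^esub> x \<in> I"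
   using Ip(1) Ip(4)[of x a] subringE(1)[OF D] m_comm[of a x] by (simp_all, metis subsetD)
 qed
qed

text \<open>Prime ideals of the subring \<open>D\<close>, in terms of the operations of the ambient field.\<close>

definition prime_in :: "'a set \<Rightarrow> 'a set \<Rightarrow> bool"
 where "prime_in D P \<longleftrightarrow> module_over D P \<and> P \<subseteq> D \<and> \<one> \<notin> P \<and>
  (\<forall>a \<in> D. \<forall>b \<in> D. a \<otimes> b \<in> P \<longrightarrow> a \<in> P \<or> b \<in> P)"

lemma sub_ring_cring: "subring D R ==> cring (sub_ring D)"
 using subcringI' subcring_iff subringE(1) by metis

lemma ideal_one_mem:
 assumes "subring D R" "module_over D I" "I \<subseteq> D" "\<one> \<in> I"
 shows "I = D"
proof -
 have "d \<in> I" if "d \<in> D" for d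
  using module_overD(4)[OF assms(2) that assms(4)] that subringE(1)[OF assms(1)] by (auto simp: subset_iff)
 then show ?thesis using assms(3) by auto
qed

lemma primeideal_sub_ring_iff:
 assumes D: "subring D R"
 shows "primeideal P (sub_ring D) \<longleftrightarrow> prime_in D P"
proof
 assume "primeideal P (sub_ring D)"
 then interpret P: primeideal P "sub_ring D" .
 have "module_over D P" "P \<subseteq> D" using P.ideal_axioms ideal_sub_ring_iff[OF D] by auto
 moreover have "\<one> \<notin> P" using ideal_one_mem[OF D calculation] P.I_notcarr by auto
 ultimately show "prime_in D P" unfolding prime_in_def using P.I_prime by auto
next
 assume P: "prime_in D P"
 show "primeideal P (sub_ring D)"
  by (rule primeidealI)
    (use P ideal_sub_ring_iff[OF D] sub_ring_cring[OF D] subringE(3)[OF D] in \<open>auto simp: prime_in_def\<close>)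
qed

lemma maximalideal_sub_ring_iff:
 assumes D: "subring D R"
 shows "maximalideal P (sub_ring D) \<longleftrightarrow> module_over D P \<and> P \<subseteq> D \<and> \<one> \<notin> P \<and>
  (\<forall>J. module_over D J \<and> J \<subseteq> D \<and> P \<subseteq> J \<longrightarrow> J = P \<or> \<one> \<in> J)"
proof
 assume "maximalideal P (sub_ring D)"
 then interpret P: maximalideal P "sub_ring D" .
 have "module_over D P" "P \<subseteq> D" using P.ideal_axioms ideal_sub_ring_iff[OF D] by auto
 moreover have "\<one> \<notin> P" using ideal_one_mem[OF D calculation] P.I_notcarr by auto
 moreover have "J = P \<or> \<one> \<in> J" if "module_over D J" "J \<subseteq> D" "P \<subseteq> J" for J
  using P.I_maximal[of J] that ideal_sub_ring_iff[OF D] subringE(3)[OF D] by auto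
 ultimately show "module_over D P \<and> P \<subseteq> D \<and> \<one> \<notin> P \<and>
  (\<forall>J. module_over D J \<and> J \<subseteq> D \<and> P \<subseteq> J \<longrightarrow> J = P \<or> \<one> \<in> J)" by blast
next
 assume P: "module_over D P \<and> P \<subseteq> D \<and> \<one> \<notin> P \<and>
  (\<forall>J. module_over D J \<and> J \<subseteq> D \<and> P \<subseteq> J \<longrightarrow> J = P \<or> \<one> \<in> J)"
 show "maximalideal P (sub_ring D)"
 proof (rule maximalidealI)
  show "ideal P (sub_ring D)" using P ideal_sub_ring_iff[OF D] by auto
  show "carrier (sub_ring D) \<noteq> P" using P subringE(3)[OF D] by auto
  fix J assume J: "ideal J (sub_ring D)" "P \<subseteq> J" "J \<subseteq> carrier (sub_ring D)"
  then have "module_over D J" "J \<subseteq> D" using ideal_sub_ring_iff[OF D] by auto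
  then have "J = P \<or> \<one> \<in> J" using P J(2) by blast
  then show "J = P \<or> J = carrier (sub_ring D)"
   using ideal_one_mem[OF D \<open>module_over D J\<close> \<open>J \<subseteq> D\<close>] by auto
 qed
qed

lemma maximalideal_prime_in:
 assumes D: "subring D R" and "maximalideal P (sub_ring D)"
 shows "prime_in D P"
 using cring.maximalideal_prime[OF sub_ring_cring[OF D] assms(2)] primeideal_sub_ring_iff[OF D] by simp

lemma prime_in_maximal_eq:
 assumes D: "subring D R" and "maximalideal P (sub_ring D)" "module_over D J" "J \<subseteq> D" "P \<subseteq> J" "\<one> \<notin> J"
 shows "J = P"
 using assms maximalideal_sub_ring_iff[OF D] by blast

end

context domain begin

lemma noetherian_subring_iff:
 assumes D: "subring D R"
 shows "noetherian_domain (sub_ring D) \<longleftrightarrow> noetherian_subring D"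
proof
 assume "noetherian_domain (sub_ring D)"
 then interpret S: noetherian_domain "sub_ring D" .
 show "noetherian_subring D" unfolding noetherian_subring_def
 proof (intro conjI allI impI D)
  fix I assume I: "module_over D I \<and> I \<subseteq> D"
  then have idl: "ideal I (sub_ring D)" using ideal_sub_ring_iff[OF D] by simp
  then obtain A where A: "A \<subseteq> D" "finite A" "I = genideal (sub_ring D) A"
   using S.finetely_gen by auto
  obtain Us where Us: "set Us = A" using A(2) finite_list by auto
  have Usc: "set Us \<subseteq> carrier R" using Us A(1) subringE(1)[OF D] by auto
  note Sp = module_over_Span[OF D Usc]
  have AI: "A \<subseteq> I" using S.genideal_self[of A] A by simp
  have "Span D Us \<subseteq> I" using Span_least Us AI I by simp
  moreover have "ideal (Span D Us) (sub_ring D)"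
   using ideal_sub_ring_iff[OF D] Sp(1) calculation I by auto
  then have "I \<subseteq> Span D Us" using S.genideal_minimal[of "Span D Us" A] Sp(2) Us A(3) by simp
  ultimately show "fg_module D I" unfolding fg_module_def using Usc by (intro exI[of _ Us]) auto
 qed
next
 assume noeth: "noetherian_subring D"
 interpret S: domain "sub_ring D" by (rule subring_is_domain[OF D])
 show "noetherian_domain (sub_ring D)"
 proof (unfold noetherian_domain_def, intro conjI S.noetherian_ringI S.domain_axioms)
  fix I assume idl: "ideal I (sub_ring D)"
  then have I: "module_over D I" "I \<subseteq> D" using ideal_sub_ring_iff[OF D] by auto
  then obtain Us where Us: "set Us \<subseteq> carrier R" "I = Span D Us"
   using noeth unfolding noetherian_subring_def fg_module_def by blast
  note Sp = module_over_Span[OF D Us(1)]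
  have sub: "set Us \<subseteq> D" using Sp(2) Us(2) I(2) by simp
  have "I = genideal (sub_ring D) (set Us)"
  proof
   show "genideal (sub_ring D) (set Us) \<subseteq> I" using S.genideal_minimal[OF idl] Sp(2) Us(2) by simp
   have "ideal (genideal (sub_ring D) (set Us)) (sub_ring D)" using S.genideal_ideal sub by simp
   then have "module_over D (genideal (sub_ring D) (set Us))" using ideal_sub_ring_iff[OF D] by simp
   then show "I \<subseteq> genideal (sub_ring D) (set Us)"
    using Span_least S.genideal_self[of "set Us"] sub Us(2) by simp
  qed
  then show "\<exists>A \<subseteq> carrier (sub_ring D). finite A \<and> I = genideal (sub_ring D) A"
   using sub by (intro exI[of _ "set Us"]) simp
 qed
qed

lemma noetherian_maximal_ideal:
 assumes noeth: "noetherian_subring D" and ne: "S \<noteq> {}"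
  and S: "\<And>I. I \<in> S ==> module_over D I \<and> I \<subseteq> D"
 obtains I where "I \<in> S" "\<And>J. J \<in> S ==> I \<subseteq> J ==> J = I"
proof -
 have D: "subring D R" using noeth unfolding noetherian_subring_def by simp
 interpret N: noetherian_domain "sub_ring D" using noetherian_subring_iff[OF D] noeth by simp
 have "\<exists>I \<in> S. \<forall>J \<in> S. I \<subseteq> J \<longrightarrow> J = I"
 proof (rule subset_Zorn_nonempty[OF ne])
  fix C assume C: "C \<noteq> {}" "subset.chain S C"
  have "subset.chain {I. ideal I (sub_ring D)} C"
   using C(2) S ideal_sub_ring_iff[OF D] unfolding subset.chain_def by auto
  then have "\<Union>C \<in> C" using N.ideal_chain_is_trivial[OF C(1)] by simp
  then show "\<Union>C \<in> S" using C(2) unfolding subset.chain_def by auto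
 qed
 then show thesis using that by blast
qed

end

context field begin

lemma localization_mem_iff:
 assumes D: "subring D R" and P: "prime_in D P"
 shows "x \<in> localization D P \<longleftrightarrow> x \<in> carrier R \<and> (\<exists>s \<in> D - P. s \<otimes> x \<in> D)"
proof -
 note Dp = subringE[OF D]
 have ne: "s \<noteq> \<zero>" if "s \<in> D - P" for s
  using that P module_overD(2) unfolding prime_in_def by auto
 show ?thesis
 proof
  assume "x \<in> localization D P"
  then obtain a b where ab: "a \<in> D" "b \<in> D - P" "x = a \<otimes> inv b" unfolding localization_def by auto
  have c: "a \<in> carrier R" "b \<in> carrier R" "inv b \<in> carrier R" "b \<otimes> inv b = \<one>"
   using ab Dp(1) ne[OF ab(2)] field_Units by auto
  have "b \<otimes> x = a" unfolding ab using c by (metis m_lcomm r_one)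
  then have "b \<otimes> x \<in> D" using ab by simp
  moreover have "x \<in> carrier R" unfolding ab using c by simp
  ultimately show "x \<in> carrier R \<and> (\<exists>s \<in> D - P. s \<otimes> x \<in> D)" using ab(2) by blast
 next
  assume "x \<in> carrier R \<and> (\<exists>s \<in> D - P. s \<otimes> x \<in> D)"
  then obtain s where s: "x \<in> carrier R" "s \<in> D - P" "s \<otimes> x \<in> D" by auto
  have c: "s \<in> carrier R" "inv s \<in> carrier R" "s \<otimes> inv s = \<one>"
   using s Dp(1) ne[OF s(2)] field_Units by auto
  have "x = (s \<otimes> x) \<otimes> inv s" using c s(1) by (metis m_assoc m_comm r_one)
  then show "x \<in> localization D P" unfolding localization_def using s by blast
 qed
qed

lemma localization_memI:
 assumes "subring D R" "prime_in D P" "x \<in> carrier R" "s \<in> D - P" "s \<otimes> x \<in> D"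
 shows "x \<in> localization D P"
 using localization_mem_iff[OF assms(1,2)] assms(3-5) by blast

lemma prime_in_zero: "subring D R ==> prime_in D {\<zero>}"
 using subringE[of D R] by (auto simp: prime_in_def module_over_def subset_iff integral_iff)

lemma quotient_field_eq: "quotient_field D = localization D {\<zero>}"
 unfolding quotient_field_def localization_def by simp

lemma localization_subring:
 assumes D: "subring D R" and P: "prime_in D P"
 shows "subring (localization D P) R" "D \<subseteq> localization D P" "localization D P \<subseteq> quotient_field D"
proof -
 note Dp = subringE[OF D]
 note mem = localization_mem_iff[OF D P]
 have one: "\<one> \<in> D - P" using P Dp(3) unfolding prime_in_def by auto
 have mult: "s \<otimes> t \<in> D - P" if "s \<in> D - P" "t \<in> D - P" for s t
  using that P Dp(6) unfolding prime_in_def by auto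
 show DL: "D \<subseteq> localization D P"
 proof
  fix d assume "d \<in> D"
  then show "d \<in> localization D P" using mem one Dp(1) by (auto intro!: bexI[of _ \<one>])
 qed
 show "localization D P \<subseteq> quotient_field D"
  unfolding quotient_field_eq subset_iff mem localization_mem_iff[OF D prime_in_zero[OF D]]
  using P module_overD(2) unfolding prime_in_def by blast
 show "subring (localization D P) R"
 proof (rule subringI)
  show "localization D P \<subseteq> carrier R" using mem by auto
  show "\<one> \<in> localization D P" using DL Dp(3) by auto
  fix x assume x: "x \<in> localization D P"
  then obtain s where s: "x \<in> carrier R" "s \<in> D - P" "s \<otimes> x \<in> D" using mem by auto
  have sc: "s \<in> carrier R" using s Dp(1) by auto
  have "s \<otimes> (\<ominus> x) = \<ominus> (s \<otimes> x)" using s sc by (simp add: r_minus)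
  then show "\<ominus> x \<in> localization D P" using mem[of "\<ominus> x"] s Dp(5) by (metis a_inv_closed)
  fix y assume "y \<in> localization D P"
  then obtain t where t: "y \<in> carrier R" "t \<in> D - P" "t \<otimes> y \<in> D" using mem by auto
  have tc: "t \<in> carrier R" using t Dp(1) by auto
  have "(s \<otimes> t) \<otimes> (x \<otimes> y) = (s \<otimes> x) \<otimes> (t \<otimes> y)" using s t sc tc by algebra
  then have "(s \<otimes> t) \<otimes> (x \<otimes> y) \<in> D" using s t Dp(6) by simp
  then show "x \<otimes> y \<in> localization D P" using localization_memI[OF D P _ mult[OF s(2) t(2)]] s t by simp
  have "(s \<otimes> t) \<otimes> (x \<oplus> y) = t \<otimes> (s \<otimes> x) \<oplus> s \<otimes> (t \<otimes> y)" using s t sc tc by algebra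
  moreover have "\<dots> \<in> D" using s t Dp(6,7) by auto
  ultimately show "x \<oplus> y \<in> localization D P" using localization_memI[OF D P _ mult[OF s(2) t(2)]] s t by simp
 qed
qed

lemma quotient_field_subfield:
 assumes D: "subring D R"
 shows "subfield (quotient_field D) R" "D \<subseteq> quotient_field D"
proof -
 note Dp = subringE[OF D]
 note mem = localization_mem_iff[OF D prime_in_zero[OF D], folded quotient_field_eq]
 note sub = localization_subring[OF D prime_in_zero[OF D], folded quotient_field_eq]
 show "D \<subseteq> quotient_field D" by (rule sub(2))
 show "subfield (quotient_field D) R"
 proof (rule subfieldI'[OF sub(1)])
  fix x assume x: "x \<in> quotient_field D - {\<zero>}"
  then obtain s where s: "x \<in> carrier R" "s \<in> D - {\<zero>}" "s \<otimes> x \<in> D" using mem by auto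
  have c: "s \<in> carrier R" "inv x \<in> carrier R" "x \<otimes> inv x = \<one>" using s x Dp(1) field_Units by auto
  have "(s \<otimes> x) \<otimes> inv x = s" using c s by (simp add: m_assoc)
  moreover have "s \<otimes> x \<noteq> \<zero>" using s x c integral_iff by auto
  ultimately show "inv x \<in> quotient_field D" 
   using localization_memI[OF D prime_in_zero[OF D], of "inv x" "s \<otimes> x"] c s
   unfolding quotient_field_eq by auto
 qed
qed

lemma localization_units:
 assumes D: "subring D R" and P: "prime_in D P" and x: "x \<in> localization D P"
 shows "x \<noteq> \<zero> \<and> inv x \<in> localization D P \<longleftrightarrow> (\<exists>s \<in> D - P. s \<otimes> x \<in> D - P)"
proof -
 note Dp = subringE[OF D]
 note mem = localization_mem_iff[OF D P]
 have mult: "s \<otimes> t \<in> D - P" if "s \<in> D - P" "t \<in> D - P" for s t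
  using that P Dp(6) unfolding prime_in_def by auto
 have abs: "s \<otimes> t \<in> P" if "s \<in> D" "t \<in> P" for s t
  using that P module_overD(4) unfolding prime_in_def by blast
 have Pzero: "\<zero> \<in> P" using P module_overD(2) unfolding prime_in_def by auto
 have xc: "x \<in> carrier R" using x mem by auto
 show ?thesis
 proof
  assume a: "x \<noteq> \<zero> \<and> inv x \<in> localization D P"
  obtain s where s: "s \<in> D - P" "s \<otimes> x \<in> D" using x mem by auto
  obtain t where t: "t \<in> D - P" "t \<otimes> inv x \<in> D" using a mem by auto
  have c: "s \<in> carrier R" "t \<in> carrier R" "inv x \<in> carrier R" "x \<otimes> inv x = \<one>"
   using s t a xc Dp(1) field_Units by auto
  have "(t \<otimes> inv x) \<otimes> (s \<otimes> x) = (s \<otimes> t) \<otimes> (x \<otimes> inv x)" using c(1-3) xc by algebra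
  also have "\<dots> = s \<otimes> t" using c by simp
  finally have "(t \<otimes> inv x) \<otimes> (s \<otimes> x) = s \<otimes> t" .
  then have "s \<otimes> x \<notin> P" using abs[OF t(2), of "s \<otimes> x"] mult[OF s(1) t(1)] by auto
  then show "\<exists>s \<in> D - P. s \<otimes> x \<in> D - P" using s by blast
 next
  assume "\<exists>s \<in> D - P. s \<otimes> x \<in> D - P"
  then obtain s where s: "s \<in> D - P" "s \<otimes> x \<in> D - P" by blast
  have sc: "s \<in> carrier R" using s Dp(1) by auto
  then have ne: "x \<noteq> \<zero>" using s(2) Pzero by auto
  then have c: "inv x \<in> carrier R" "x \<otimes> inv x = \<one>" using xc field_Units by auto
  then have "(s \<otimes> x) \<otimes> inv x = s" using xc sc by (simp add: m_assoc)
  then show "x \<noteq> \<zero> \<and> inv x \<in> localization D P"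
   using localization_memI[OF D P c(1) s(2)] ne s(1) by simp
 qed
qed

text \<open>Every nonzero element of \<open>V\<close> is a power of \<open>t\<close> times a unit. The exponent is unique because \<open>t\<close> is not a
 unit, and it extends to differences of exponents on \<open>F\<close>.\<close>

lemma dvr_if_uniformizer:
 assumes F: "subfield F R" and V: "subring V R" "V \<subseteq> F"
  and frac: "\<And>x. x \<in> F ==> \<exists>s \<in> V - {\<zero>}. s \<otimes> x \<in> V"
  and t: "t \<in> V" "t \<noteq> \<zero>" "inv t \<notin> V"
  and fact: "\<And>x. x \<in> V ==> x \<noteq> \<zero> ==> \<exists>k::nat. \<exists>u \<in> V. inv u \<in> V \<and> u \<noteq> \<zero> \<and> x = t [^] k \<otimes> u"
 shows "dvr F V"
proof -
 note Vp = subringE[OF V(1)]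
 note Fp = subringE[OF subfieldE(1)[OF F]]
 define U where "U = {u \<in> V. u \<noteq> \<zero> \<and> inv u \<in> V}"
 have Uc: "u \<in> carrier R" "inv u \<in> carrier R" "u \<otimes> inv u = \<one>" "u \<noteq> \<zero>" "u \<in> V" "inv u \<in> V" if "u \<in> U" for u
  using that Vp(1) field_Units unfolding U_def by auto
 have Umult: "u \<otimes> w \<in> U" if "u \<in> U" "w \<in> U" for u w
 proof -
  have "inv (u \<otimes> w) = inv u \<otimes> inv w"
   using Uc[OF that(1)] Uc[OF that(2)] by (intro comm_inv_char) (auto simp: m_ac)
  then show ?thesis using that Vp(6) Uc[OF that(1)] Uc[OF that(2)] integral_iff unfolding U_def by auto
 qed
 have Uinv: "inv u \<in> U" if "u \<in> U" for u
 proof -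
  have "inv (inv u) = u" using Uc[OF that] by (intro comm_inv_char) (auto simp: m_comm)
  moreover have "inv u \<noteq> \<zero>" using Uc[OF that] by auto
  ultimately show ?thesis using that unfolding U_def by auto
 qed
 have Uone: "\<one> \<in> U" unfolding U_def using Vp(3) by auto
 have tc: "t \<in> carrier R" using t Vp(1) by auto
 have tp: "t [^] (n::nat) \<in> carrier R" "t [^] n \<noteq> \<zero>" "t [^] n \<in> V" for n
 proof -
  show "t [^] (n::nat) \<in> carrier R" using tc by simp
  show "t [^] n \<noteq> \<zero>" using tc t(2) by (induction n) (auto simp: integral_iff)
  show "t [^] n \<in> V" using t(1) Vp by (induction n) auto
 qed
 have no_unit: "k = 0" if "t [^] (k::nat) \<otimes> u \<in> U" "u \<in> V" for k u
 proof (rule ccontr)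
  assume "k \<noteq> 0"
  then obtain j where j: "k = Suc j" using not0_implies_Suc by blast
  define w where "w = t [^] k \<otimes> u"
  have uc: "u \<in> carrier R" using that(2) Vp(1) by auto
  have w: "w \<in> U" using that unfolding w_def by simp
  have wV: "inv w \<in> V" "inv w \<in> carrier R" "w \<otimes> inv w = \<one>" using Uc[OF w] by auto
  have "t \<otimes> (t [^] j \<otimes> u \<otimes> i) = (t [^] k \<otimes> u) \<otimes> i" if "i \<in> carrier R" for i
   unfolding j using tc uc that tp(1)[of j] by (simp add: m_ac)
  then have "t \<otimes> (t [^] j \<otimes> u \<otimes> inv w) = w \<otimes> inv w"
   using wV(2) unfolding w_def[symmetric] by blast
  then have "t \<otimes> (t [^] j \<otimes> u \<otimes> inv w) = \<one>" using wV by simp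
  then have "inv t = t [^] j \<otimes> u \<otimes> inv w" using tc tp(1) uc wV(2) by (intro comm_inv_char) auto
  then show False using t(3) Vp(6) tp(3) that(2) wV(1) by auto
 qed
 have uniq: "k = l" if "t [^] (k::nat) \<otimes> u = t [^] (l::nat) \<otimes> w" "u \<in> U" "w \<in> U" for k l u w
 proof -
  have *: "k = l" if "k \<le> l" "t [^] (k::nat) \<otimes> u = t [^] (l::nat) \<otimes> w" "u \<in> U" "w \<in> U" for k l u w
  proof -
   have c: "u \<in> carrier R" "w \<in> carrier R" using that Uc by auto
   have "t [^] l = t [^] k \<otimes> t [^] (l - k)" using nat_pow_mult[OF tc, of k "l - k"] that(1) by simp
   then have "t [^] k \<otimes> u = t [^] k \<otimes> (t [^] (l - k) \<otimes> w)" using that(2) c tp(1) by (simp add: m_assoc)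
   then have "u = t [^] (l - k) \<otimes> w" using m_lcancel[OF tp(2)[of k] tp(1)[of k]] c tp(1) by auto
   then have "l - k = 0" using no_unit[of "l - k" w] that Uc(5) by simp
   then show ?thesis using that(1) by simp
  qed
  show ?thesis using *[of k l u w] *[of l k w u] that by (cases "k \<le> l") auto
 qed
 define rep where "rep x n \<longleftrightarrow> (\<exists>k l u. n = int k - int l \<and> u \<in> U \<and> x \<otimes> t [^] l = t [^] k \<otimes> u)" for x n
 have rep_uniq: "n = n'" if r1: "rep x n" and r2: "rep x n'" and xc: "x \<in> carrier R" for x n n'
 proof -
  obtain k l u where 1: "n = int k - int l" "u \<in> U" "x \<otimes> t [^] l = t [^] k \<otimes> u" using r1 unfolding rep_def by auto
  obtain k' l' u' where 2: "n' = int k' - int l'" "u' \<in> U" "x \<otimes> t [^] l' = t [^] k' \<otimes> u'" using r2 unfolding rep_def by auto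
  note c = Uc(1)[OF 1(2)] Uc(1)[OF 2(2)] xc
  have "t [^] (k + l') \<otimes> u = (x \<otimes> t [^] l) \<otimes> t [^] l'"
   unfolding 1(3) using c tp(1) by (simp add: nat_pow_mult[OF tc, symmetric] m_ac)
  also have "\<dots> = (x \<otimes> t [^] l') \<otimes> t [^] l" using c tp(1) by (simp add: m_ac)
  also have "\<dots> = t [^] (k' + l) \<otimes> u'"
   unfolding 2(3) using c tp(1) by (simp add: nat_pow_mult[OF tc, symmetric] m_ac)
  finally have "k + l' = k' + l" using uniq 1(2) 2(2) by blast
  then show ?thesis using 1 2 by simp
 qed
 have rep_V: "rep x (int k)" if "u \<in> U" "x = t [^] k \<otimes> u" for x k u
  unfolding rep_def using that tp(1) Uc[OF that(1)] by (intro exI[of _ k] exI[of _ 0] exI[of _ u]) simp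
 have rep_V_ex: "\<exists>k. rep x (int k)" if "x \<in> V" "x \<noteq> \<zero>" for x
  using fact[OF that] rep_V unfolding U_def by blast
 have rep_mult: "rep (x \<otimes> y) (n + n')" if r1: "rep x n" and r2: "rep y n'" and xy: "x \<in> carrier R" "y \<in> carrier R" for x y n n'
 proof -
  obtain k l u where 1: "n = int k - int l" "u \<in> U" "x \<otimes> t [^] l = t [^] k \<otimes> u" using r1 unfolding rep_def by auto
  obtain k' l' u' where 2: "n' = int k' - int l'" "u' \<in> U" "y \<otimes> t [^] l' = t [^] k' \<otimes> u'" using r2 unfolding rep_def by auto
  note c = Uc(1)[OF 1(2)] Uc(1)[OF 2(2)] xy
  have "(x \<otimes> y) \<otimes> t [^] (l + l') = (x \<otimes> t [^] l) \<otimes> (y \<otimes> t [^] l')"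
   using c tp(1) by (simp add: nat_pow_mult[OF tc, symmetric] m_ac)
  also have "\<dots> = t [^] (k + k') \<otimes> (u \<otimes> u')"
   unfolding 1(3) 2(3) using c tp(1) by (simp add: nat_pow_mult[OF tc, symmetric] m_ac)
  finally show ?thesis unfolding rep_def using Umult[OF 1(2) 2(2)] 1(1) 2(1)
   by (intro exI[of _ "k + k'"] exI[of _ "l + l'"] exI[of _ "u \<otimes> u'"]) simp
 qed
 have rep_inv: "rep (inv x) (- n)" if r1: "rep x n" and that: "x \<in> carrier R" "x \<noteq> \<zero>" for x n
 proof -
  obtain k l u where 1: "n = int k - int l" "u \<in> U" "x \<otimes> t [^] l = t [^] k \<otimes> u" using r1 unfolding rep_def by auto
  note u = Uc[OF 1(2)]
  have xi: "inv x \<in> carrier R" "x \<otimes> inv x = \<one>" using that field_Units by auto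
  have "inv x \<otimes> t [^] k = (inv x \<otimes> inv u) \<otimes> (t [^] k \<otimes> u)"
  proof -
   have "(inv x \<otimes> inv u) \<otimes> (a \<otimes> u) = inv x \<otimes> a \<otimes> (u \<otimes> inv u)" if "a \<in> carrier R" for a
    using xi(1) u(1,2) that by algebra
   from this[OF tp(1)] have "(inv x \<otimes> inv u) \<otimes> (t [^] k \<otimes> u) = inv x \<otimes> t [^] k \<otimes> (u \<otimes> inv u)" .
   then show ?thesis using u xi tp(1) by simp
  qed
  also have "\<dots> = (x \<otimes> inv x) \<otimes> (t [^] l \<otimes> inv u)"
   unfolding 1(3)[symmetric] using xi(1) u that(1) tp(1) by (simp add: m_ac)
  also have "\<dots> = t [^] l \<otimes> inv u" using xi u tp(1) by simp
  finally show ?thesis unfolding rep_def using Uinv[OF 1(2)] 1(1)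
   by (intro exI[of _ l] exI[of _ k] exI[of _ "inv u"]) simp
 qed
 have rep_ex: "\<exists>n. rep x n" if x: "x \<in> F - {\<zero>}" for x
 proof -
  obtain s where s: "s \<in> V" "s \<noteq> \<zero>" "s \<otimes> x \<in> V" using frac[of x] x by auto
  have c: "s \<in> carrier R" "x \<in> carrier R" "inv s \<in> carrier R" "s \<otimes> inv s = \<one>"
   using s x Vp(1) Fp(1) field_Units by auto
  obtain k l where k: "rep s (int k)" "rep (s \<otimes> x) (int l)"
   using rep_V_ex[OF s(1,2)] rep_V_ex[OF s(3)] s x c integral_iff by auto
  have "rep (inv s \<otimes> (s \<otimes> x)) (- int k + int l)"
   using rep_mult[OF rep_inv[OF k(1) c(1) s(2)] k(2)] c by simp
  moreover have "inv s \<otimes> (s \<otimes> x) = x" using c by (metis m_assoc m_comm l_one)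
  ultimately show ?thesis by auto
 qed
 define v where "v x = (THE n. rep x n)" for x
 have v: "rep x (v x)" if "x \<in> F - {\<zero>}" for x
 proof -
  have "\<exists>!n. rep x n" using rep_ex[OF that] rep_uniq that Fp(1) by blast
  then show ?thesis unfolding v_def by (rule theI')
 qed
 have v_eq: "v x = n" if "rep x n" "x \<in> F - {\<zero>}" for x n
  using rep_uniq[OF v[OF that(2)] that(1)] that(2) Fp(1) by auto
 have Finv: "inv x \<in> F - {\<zero>}" if "x \<in> F - {\<zero>}" for x
  using subfield_m_inv(1)[OF F] that by simp
 have Fmult: "x \<otimes> y \<in> F - {\<zero>}" if "x \<in> F - {\<zero>}" "y \<in> F - {\<zero>}" for x y
  using that Fp(6) integral_iff[of x y] subsetD[OF Fp(1)] by auto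
 have v_mult: "v (x \<otimes> y) = v x + v y" if "x \<in> F - {\<zero>}" "y \<in> F - {\<zero>}" for x y
  using v_eq[OF rep_mult[OF v[OF that(1)] v[OF that(2)]]] Fmult[OF that] that Fp(1) by auto
 have v_inv: "v (inv x) = - v x" if "x \<in> F - {\<zero>}" for x
  using v_eq[OF rep_inv[OF v[OF that]]] Finv[OF that] that Fp(1) by auto
 have v_V: "x \<in> V \<longleftrightarrow> v x \<ge> 0" if x: "x \<in> F - {\<zero>}" for x
 proof
  assume "x \<in> V"
  then obtain k where "rep x (int k)" using rep_V_ex x by auto
  then show "v x \<ge> 0" using v_eq x by simp
 next
  assume "v x \<ge> 0"
  obtain k l u where 1: "v x = int k - int l" "u \<in> U" "x \<otimes> t [^] l = t [^] k \<otimes> u"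
   using v[OF x] unfolding rep_def by auto
  then have kl: "l \<le> k" using \<open>v x \<ge> 0\<close> by simp
  have xc: "x \<in> carrier R" using x Fp(1) by auto
  note u = Uc[OF 1(2)]
  have "t [^] k = t [^] (k - l) \<otimes> t [^] l" using nat_pow_mult[OF tc, of "k - l" l] kl by simp
  then have "x \<otimes> t [^] l = (t [^] (k - l) \<otimes> u) \<otimes> t [^] l" using 1(3) u tp(1) by (simp add: m_ac)
  then have "t [^] l \<otimes> x = t [^] l \<otimes> (t [^] (k - l) \<otimes> u)" using xc u tp(1) by (simp add: m_comm)
  then have "x = t [^] (k - l) \<otimes> u" using m_lcancel[OF tp(2)[of l] tp(1)[of l]] xc u tp(1) by auto
  then show "x \<in> V" using Vp(6) tp(3) u(5) by simp
 qed
 have tpF: "t [^] (n::nat) \<in> F - {\<zero>}" for n using tp(2,3) V(2) by auto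
 have vt: "v (t [^] (n::nat)) = int n" for n
  using v_eq[OF rep_V[OF Uone, of "t [^] n" n] tpF] tp(1) by simp
 have surj: "v ` (F - {\<zero>}) = UNIV"
 proof -
  have "n \<in> v ` (F - {\<zero>})" for n
  proof (cases "n \<ge> 0")
   case True
   then have "v (t [^] nat n) = n" by (subst vt) simp
   then show ?thesis using tpF by (metis imageI)
  next
   case False
   then have "v (inv (t [^] nat (- n))) = n" by (subst v_inv[OF tpF], subst vt) simp
   then show ?thesis using Finv[OF tpF] by (metis imageI)
  qed
  then show ?thesis by auto
 qed
 have ultra: "min (v x) (v y) \<le> v (x \<oplus> y)"
  if xy: "x \<in> F - {\<zero>}" "y \<in> F - {\<zero>}" "x \<oplus> y \<noteq> \<zero>" for x y
 proof -
  have *: "v x \<le> v (x \<oplus> y)" if le: "v x \<le> v y" and xy: "x \<in> F - {\<zero>}" "y \<in> F - {\<zero>}" "x \<oplus> y \<noteq> \<zero>" for x y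
  proof -
   have c: "x \<in> carrier R" "y \<in> carrier R" "inv x \<in> carrier R" "x \<otimes> inv x = \<one>"
    using xy Fp(1) field_Units by auto
   have "v (inv x \<otimes> y) \<ge> 0" using v_mult[OF Finv[OF xy(1)] xy(2)] v_inv[OF xy(1)] le by simp
   then have "inv x \<otimes> y \<in> V" using v_V[OF Fmult[OF Finv[OF xy(1)] xy(2)]] by simp
   then have z: "\<one> \<oplus> inv x \<otimes> y \<in> V" using Vp(3,7) by simp
   have "x \<otimes> (\<one> \<oplus> inv x \<otimes> y) = x \<oplus> (x \<otimes> inv x) \<otimes> y" using c(1-3) by (simp add: r_distr m_assoc)
   then have eq: "x \<otimes> (\<one> \<oplus> inv x \<otimes> y) = x \<oplus> y" using c by simp
   have ne: "\<one> \<oplus> inv x \<otimes> y \<noteq> \<zero>" using eq xy(3) c(1) by auto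
   then have F': "\<one> \<oplus> inv x \<otimes> y \<in> F - {\<zero>}" using z V(2) by auto
   then show ?thesis using v_mult[OF xy(1) F'] v_V[OF F'] z eq by simp
  qed
  have c: "x \<oplus> y = y \<oplus> x" using xy Fp(1) a_comm by auto
  show ?thesis using *[of x y] *[of y x] xy c by (cases "v x \<le> v y") auto
 qed
 have "V = {\<zero>} \<union> {x \<in> F - {\<zero>}. 0 \<le> v x}" using v_V V(2) Vp(2) by blast
 then show ?thesis unfolding dvr_def using F surj v_mult ultra by (intro conjI exI[of _ v]) auto
qed

lemma dvr_valuation:
 assumes "dvr F V" "x \<in> F"
 shows "x \<in> V \<or> (x \<noteq> \<zero> \<and> inv x \<in> V)"
proof (cases "x = \<zero>")
 case True
 then show ?thesis using assms unfolding dvr_def by auto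
next
 case False
 obtain v :: "'a \<Rightarrow> int" where v: "subfield F R"
   "\<And>x y. x \<in> F - {\<zero>} ==> y \<in> F - {\<zero>} ==> v (x \<otimes> y) = v x + v y"
   "V = {\<zero>} \<union> {x \<in> F - {\<zero>}. 0 \<le> v x}"
  using assms(1) unfolding dvr_def by auto
 have x: "x \<in> F - {\<zero>}" "inv x \<in> F - {\<zero>}" "x \<otimes> inv x = \<one>"
  using subfield_m_inv[OF v(1), of x] assms(2) False by auto
 have one: "\<one> \<in> F - {\<zero>}" using subringE(3)[OF subfieldE(1)[OF v(1)]] by simp
 have "v \<one> = 0" using v(2)[OF one one] by simp
 then have "v (inv x) = - v x" using v(2)[OF x(1,2)] x(3) by simp
 then show ?thesis using v(3) x by auto
qed

text \<open>Among the fractions \<open>x \<notin> V\<close> choose one with maximal denominator ideal \<open>J = {y. y x \<in> V}\<close>. Then \<open>J\<close> is prime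
 and nonzero, so \<open>J = M\<close> and \<open>M x \<subseteq> V\<close>. If \<open>M x\<close> contained no unit of \<open>V\<close>, a multiple \<open>s x\<close>
 with \<open>s \<notin> M\<close> would stabilize \<open>M\<close>, hence be integral over \<open>D\<close>, hence lie in \<open>D\<close>. So some \<open>t x\<close> with
 \<open>t \<in> M\<close> is a unit, and \<open>t\<close> is a uniformizer.\<close>

lemma dedekind_localization_dvr:
 assumes D: "dedekind_domain D" and M: "maximalideal M (sub_ring D)" and M0: "M \<noteq> {\<zero>}"
 shows "dvr (quotient_field D) (localization D M)"
proof -
 have Dr: "subring D R" and noeth: "noetherian_subring D"
  and ic: "\<And>x. x \<in> quotient_field D ==> integral D x ==> x \<in> D"
  using D noetherian_subring_iff unfolding dedekind_domain_def by auto
 note Dp = subringE[OF Dr]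
 have P: "prime_in D M" by (rule maximalideal_prime_in[OF Dr M])
 have Mm: "module_over D M" "M \<subseteq> D" and onenM: "\<one> \<notin> M" using P unfolding prime_in_def by auto
 note Mp = module_overD[OF Mm(1)]
 define V where "V = localization D M"
 define F where "F = quotient_field D"
 note mem = localization_mem_iff[OF Dr P, folded V_def]
 note memF = localization_mem_iff[OF Dr prime_in_zero[OF Dr], folded quotient_field_eq F_def]
 note Vs = localization_subring[OF Dr P, folded V_def F_def]
 note Vp = subringE[OF Vs(1)]
 note Fs = quotient_field_subfield[OF Dr, folded F_def]
 note Fp = subringE[OF subfieldE(1)[OF Fs(1)]]
 have mult: "s \<otimes> r \<in> D - M" if "s \<in> D - M" "r \<in> D - M" for s r
  using that P Dp(6) unfolding prime_in_def by auto
 have sV: "x \<in> V" if s: "s \<in> D - M" and sx: "s \<otimes> x \<in> V" and x: "x \<in> carrier R" for s x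
 proof -
  obtain r where r: "r \<in> D - M" "r \<otimes> (s \<otimes> x) \<in> D" using sx mem by auto
  then have "(r \<otimes> s) \<otimes> x \<in> D" using s x Dp(1) by (simp add: m_assoc subset_iff)
  then show ?thesis using mem mult[OF r(1) s] x by blast
 qed
 obtain a where a: "a \<in> M" "a \<noteq> \<zero>" using M0 Mp(2) by auto
 define I where "I x = {y \<in> D. y \<otimes> x \<in> V}" for x
 have I: "module_over D (I x) \<and> I x \<subseteq> D" if "x \<in> F" for x
 proof -
  have xc: "x \<in> carrier R" using that Fp(1) by auto
  show ?thesis unfolding module_over_def I_def
   using Dp Vp Vs(2) xc by (auto simp: l_distr m_assoc subset_iff)
 qed
 have inv_notV: "inv a \<notin> V" if "a \<in> M" "a \<noteq> \<zero>" for a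
 proof
  assume "inv a \<in> V"
  then obtain s where s: "s \<in> D - M" "s \<otimes> inv a \<in> D" using mem by auto
  have "(s \<otimes> inv a) \<otimes> a = s" using that s Mp(1) Dp(1) field_Units by (simp add: m_assoc subset_iff)
  then show False using Mp(4)[OF s(2) that(1)] s by simp
 qed
 have invF: "inv a \<in> F" using subfield_m_inv(1)[OF Fs(1)] a Mm(2) Fs(2) by auto
 have "I ` (F - V) \<noteq> {}" using inv_notV[OF a] invF by auto
 then obtain J where J: "J \<in> I ` (F - V)" "\<And>J'. J' \<in> I ` (F - V) ==> J \<subseteq> J' ==> J' = J"
  using noetherian_maximal_ideal[OF noeth, of "I ` (F - V)"] I by blast
 then obtain x where x: "x \<in> F" "x \<notin> V" "J = I x" by auto
 have xc: "x \<in> carrier R" using x Fp(1) by auto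
 have JM: "J \<subseteq> M"
 proof
  fix y assume "y \<in> J"
  then have "y \<in> D" "y \<otimes> x \<in> V" unfolding x I_def by auto
  then show "y \<in> M" using sV[of y x] x(2) xc by auto
 qed
 have "prime_in D J" unfolding prime_in_def
 proof (intro conjI ballI impI)
  show "module_over D J" "J \<subseteq> D" using I x by auto
  show "\<one> \<notin> J" using x xc unfolding I_def by auto
  fix y z assume yz: "y \<in> D" "z \<in> D" "y \<otimes> z \<in> J"
  then have c: "y \<in> carrier R" "z \<in> carrier R" using Dp(1) by auto
  show "y \<in> J \<or> z \<in> J"
  proof (rule disjCI)
   assume "z \<notin> J"
   then have zx: "z \<otimes> x \<notin> V" "z \<otimes> x \<in> F" using yz x Fs(2) Fp(6) unfolding x(3) I_def by auto
   have "J \<subseteq> I (z \<otimes> x)"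
   proof
    fix w assume "w \<in> J"
    then have w: "w \<in> D" "w \<otimes> x \<in> V" unfolding x(3) I_def by auto
    then have "w \<otimes> (z \<otimes> x) = z \<otimes> (w \<otimes> x)" using c xc Dp(1) by (simp add: m_lcomm subset_iff)
    then show "w \<in> I (z \<otimes> x)" unfolding I_def using w Vp(6) Vs(2) yz(2) by auto
   qed
   then have "I (z \<otimes> x) = J" using J(2) zx by blast
   moreover have "y \<otimes> (z \<otimes> x) \<in> V" using yz(3) c xc unfolding x(3) I_def by (simp add: m_assoc)
   ultimately show "y \<in> J" using yz(1) unfolding I_def by auto
  qed
 qed
 moreover have "J \<noteq> {\<zero>}"
 proof -
  obtain s where "s \<in> D - {\<zero>}" "s \<otimes> x \<in> D" using x(1) memF by auto
  then show ?thesis using Vs(2) unfolding x(3) I_def by auto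
 qed
 ultimately have "maximalideal J (sub_ring D)"
  using D primeideal_sub_ring_iff[OF Dr] unfolding dedekind_domain_def by blast
 then have JeqM: "M = J" by (rule prime_in_maximal_eq[OF Dr _ Mm JM onenM])
 \<comment> \<open>so \<open>x\<close> behaves like the inverse of a uniformizer\<close>
 have Mx: "y \<otimes> x \<in> V" if "y \<in> M" for y using that unfolding JeqM x(3) I_def by auto
 have "\<exists>u \<in> M. \<exists>s \<in> D - M. s \<otimes> (u \<otimes> x) \<in> D - M"
 proof (rule ccontr)
  assume neg: "\<not> ?thesis"
  have fgM: "fg_module D M" using noeth Mm unfolding noetherian_subring_def by blast
  then obtain Us where Us: "set Us \<subseteq> carrier R" "M = Span D Us" unfolding fg_module_def by auto
  have UsM: "set Us \<subseteq> M" using module_over_Span(2)[OF Dr Us(1)] Us(2) by simp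
  have "\<exists>s \<in> D - M. \<forall>u \<in> set Us. (s \<otimes> x) \<otimes> u \<in> M" using UsM
  proof (induction Us)
   case Nil
   then show ?case using onenM Dp(3) by auto
  next
   case (Cons u Us)
   then obtain s where s: "s \<in> D - M" "\<forall>u \<in> set Us. (s \<otimes> x) \<otimes> u \<in> M" by auto
   obtain r where r: "r \<in> D - M" "r \<otimes> (u \<otimes> x) \<in> D" using Mx[of u] Cons.prems mem by auto
   then have "r \<otimes> (u \<otimes> x) \<in> M" using neg Cons.prems by auto
   then have rM: "s \<otimes> (r \<otimes> (u \<otimes> x)) \<in> M" using Mp(4) s(1) by blast
   have c: "r \<in> carrier R" "s \<in> carrier R" "u \<in> carrier R" using r s Cons.prems Mp(1) Dp(1) by auto
   have "((r \<otimes> s) \<otimes> x) \<otimes> u = s \<otimes> (r \<otimes> (u \<otimes> x))" using c xc by algebra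
   moreover have "((r \<otimes> s) \<otimes> x) \<otimes> w \<in> M" if "w \<in> set Us" for w
   proof -
    have "w \<in> carrier R" using that Cons.prems Mp(1) by auto
    then have "((r \<otimes> s) \<otimes> x) \<otimes> w = r \<otimes> ((s \<otimes> x) \<otimes> w)" using c xc by algebra
    then show ?thesis using Mp(4) r(1) s(2) that by auto
   qed
   ultimately show ?case using rM mult[OF r(1) s(1)] by (intro bexI[of _ "r \<otimes> s"]) auto
  qed
  then obtain s where s: "s \<in> D - M" "\<And>u. u \<in> set Us ==> (s \<otimes> x) \<otimes> u \<in> M" by auto
  have sc: "s \<in> carrier R" using s Dp(1) by auto
  have "(s \<otimes> x) \<otimes> u \<in> M" if "u \<in> M" for u
  proof -
   have "module_over D {w \<in> carrier R. (s \<otimes> x) \<otimes> w \<in> M}"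
    unfolding module_over_def
   proof (intro conjI ballI)
    fix d w assume "d \<in> D" "w \<in> {w \<in> carrier R. (s \<otimes> x) \<otimes> w \<in> M}"
    moreover have "(s \<otimes> x) \<otimes> (d \<otimes> w) = d \<otimes> ((s \<otimes> x) \<otimes> w)" if "d \<in> carrier R" "w \<in> carrier R"
     using that sc xc by algebra
    ultimately show "d \<otimes> w \<in> {w \<in> carrier R. (s \<otimes> x) \<otimes> w \<in> M}"
     using Dp(1) Mp(4) by auto
   qed (use Mp sc xc in \<open>auto simp: r_distr\<close>)
   moreover have "set Us \<subseteq> {w \<in> carrier R. (s \<otimes> x) \<otimes> w \<in> M}" using s(2) Us(1) by auto
   ultimately have "M \<subseteq> {w \<in> carrier R. (s \<otimes> x) \<otimes> w \<in> M}" unfolding Us(2) by (rule Span_least)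
   then show ?thesis using that by auto
  qed
  then have "integral D (s \<otimes> x)"
   using integral_if_stable_module[OF noeth fgM a] sc xc by auto
  moreover have "s \<otimes> x \<in> quotient_field D" using x(1) s(1) Fs(2) Fp(6) unfolding F_def by auto
  ultimately have "s \<otimes> x \<in> D" using ic by blast
  then show False using x(2) mem s(1) xc by auto
 qed
 then obtain t where t: "t \<in> M" "\<exists>s \<in> D - M. s \<otimes> (t \<otimes> x) \<in> D - M" by auto
 have tc: "t \<in> carrier R" using t Mp(1) by auto
 have unit: "t \<otimes> x \<noteq> \<zero>" "inv (t \<otimes> x) \<in> V"
  using localization_units[OF Dr P] Mx[OF t(1)] t(2) unfolding V_def by auto
 then have t0: "t \<noteq> \<zero>" using xc by auto
 have ti: "inv t \<in> carrier R" "t \<otimes> inv t = \<one>" using t0 tc field_Units by auto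
 have tM: "inv t \<otimes> y \<in> V" if y: "y \<in> M" for y
 proof -
  have yc: "y \<in> carrier R" using y Mp(1) by auto
  have w: "inv (t \<otimes> x) \<in> carrier R" "(t \<otimes> x) \<otimes> inv (t \<otimes> x) = \<one>" using unit tc xc field_Units by auto
  have "inv t \<otimes> y = (inv t \<otimes> y) \<otimes> ((t \<otimes> x) \<otimes> inv (t \<otimes> x))" using w ti yc by simp
  also have "\<dots> = (t \<otimes> inv t) \<otimes> ((y \<otimes> x) \<otimes> inv (t \<otimes> x))" using w(1) ti(1) yc tc xc by algebra
  also have "\<dots> = (y \<otimes> x) \<otimes> inv (t \<otimes> x)" using ti w yc xc by simp
  finally show ?thesis using Vp(6)[OF Mx[OF y] unit(2)] by simp
 qed
 have tV: "t \<in> V" using t(1) Mm(2) Vs(2) by auto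
 have tp: "t [^] (n::nat) \<in> carrier R" "t [^] n \<noteq> \<zero>" for n
  using tc t0 by (auto, induction n) (auto simp: integral_iff)
 \<comment> \<open>If all \<open>y / t\<^sup>n\<close> were in \<open>V\<close>, the denominator ideals of the elements \<open>t\<^sup>n / y\<close>
   would form a strictly increasing chain.\<close>
 have fin_div: "\<exists>n::nat. inv (t [^] n) \<otimes> y \<notin> V" if y: "y \<in> V" "y \<noteq> \<zero>" for y
 proof (rule ccontr)
  assume neg: "\<not> ?thesis"
  define z where "z n = inv (t [^] n) \<otimes> y" for n :: nat
  have yc: "y \<in> carrier R" using y Vp(1) by auto
  have tpi: "inv (t [^] n) \<in> carrier R" "t [^] n \<otimes> inv (t [^] n) = \<one>" "inv (t [^] n) \<noteq> \<zero>" for n :: nat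
   using tp[of n] field_Units by auto
  have z: "z n \<in> V" "z n \<in> carrier R" "z n \<noteq> \<zero>" for n
   using neg Vp(1) y yc tpi[of n] unfolding z_def by (auto simp: integral_iff)
  have zi: "inv (z n) \<in> carrier R" "z n \<otimes> inv (z n) = \<one>" for n using z[of n] field_Units by auto
  have zS: "z n = t \<otimes> z (Suc n)" for n
  proof -
   have "t \<otimes> z (Suc n) = (t [^] n \<otimes> inv (t [^] n)) \<otimes> (t \<otimes> z (Suc n))" using tpi tc z by simp
   also have "\<dots> = inv (t [^] n) \<otimes> y \<otimes> (t [^] Suc n \<otimes> inv (t [^] Suc n))"
    unfolding z_def using tpi(1)[of n] tpi(1)[of "Suc n"] tp(1)[of n] tc yc by (simp add: m_ac)
   also have "\<dots> = z n" unfolding z_def using tpi yc by (metis m_closed r_one)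
   finally show ?thesis by simp
  qed
  have ziS: "inv (z (Suc n)) = t \<otimes> inv (z n)" for n
  proof (rule comm_inv_char)
   have "z (Suc n) \<otimes> (t \<otimes> inv (z n)) = (t \<otimes> z (Suc n)) \<otimes> inv (z n)" using z tc zi by (simp add: m_ac)
   also have "\<dots> = z n \<otimes> inv (z n)" by (simp only: zS[of n, symmetric])
   finally show "z (Suc n) \<otimes> (t \<otimes> inv (z n)) = \<one>" using zi(2) by simp
  qed (use z tc zi in auto)
  define J where "J n = {w \<in> D. w \<otimes> inv (z n) \<in> V}" for n
  have J: "module_over D (J n) \<and> J n \<subseteq> D" for n
   unfolding module_over_def J_def using Dp Vp Vs(2) zi(1)[of n] by (auto simp: l_distr m_assoc subset_iff)
  have "range J \<noteq> {}" by auto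
  then obtain I where I: "I \<in> range J" "\<And>J'. J' \<in> range J ==> I \<subseteq> J' ==> J' = I"
   using noetherian_maximal_ideal[OF noeth, of "range J"] J by blast
  then obtain n where "I = J n" by auto
  then have n: "J k = J n" if "J n \<subseteq> J k" for k using I(2) that by blast
  have "J n \<subseteq> J (Suc n)"
  proof
   fix w assume "w \<in> J n"
   then have w: "w \<in> D" "w \<otimes> inv (z n) \<in> V" unfolding J_def by auto
   then have "w \<otimes> inv (z (Suc n)) = t \<otimes> (w \<otimes> inv (z n))"
    unfolding ziS using tc zi Dp(1) by (simp add: m_lcomm subset_iff)
   then show "w \<in> J (Suc n)" unfolding J_def using w Vp(6) tV by simp
  qed
  then have eq: "J (Suc n) = J n" by (rule n)
  obtain s where s: "s \<in> D - M" "s \<otimes> z (Suc n) \<in> D" using z(1) mem by blast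
  have sc: "s \<in> carrier R" using s Dp(1) by auto
  have "(s \<otimes> z (Suc n)) \<otimes> inv (z (Suc n)) = s" using sc z zi by (simp add: m_assoc)
  then have "s \<otimes> z (Suc n) \<in> J (Suc n)" using s Vs(2) unfolding J_def by auto
  then have "(s \<otimes> z (Suc n)) \<otimes> inv (z n) \<in> V" using eq unfolding J_def by auto
  moreover have "(s \<otimes> z (Suc n)) \<otimes> inv (z n) = s \<otimes> inv t"
  proof -
   have "z (Suc n) = inv t \<otimes> z n" using zS[of n] ti tc z by (metis m_assoc m_comm l_one)
   then have "(s \<otimes> z (Suc n)) \<otimes> inv (z n) = (s \<otimes> inv t) \<otimes> (z n \<otimes> inv (z n))" using sc ti z zi by (simp add: m_assoc)
   then show ?thesis using zi sc ti by simp
  qed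
  ultimately have "s \<otimes> inv t \<in> V" by simp
  then have "inv t \<in> V" by (rule sV[OF s(1) _ ti(1)])
  then show False using inv_notV[OF t(1) t0] by simp
 qed
 have "dvr F V"
 proof (rule dvr_if_uniformizer[OF Fs(1) Vs(1,3) _ tV t0 inv_notV[OF t(1) t0]])
  fix y assume "y \<in> F"
  then show "\<exists>s \<in> V - {\<zero>}. s \<otimes> y \<in> V" using memF Vs(2) by blast
 next
  fix y assume y: "y \<in> V" "y \<noteq> \<zero>"
  define n where "n = (LEAST n::nat. inv (t [^] n) \<otimes> y \<notin> V)"
  have n: "inv (t [^] n) \<otimes> y \<notin> V" unfolding n_def using fin_div[OF y] by (rule LeastI_ex)
  have yc: "y \<in> carrier R" using y Vp(1) by auto
  have "n \<noteq> 0"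
  proof
   assume "n = 0"
   then show False using n y yc by simp
  qed
  then obtain k where k: "n = Suc k" using not0_implies_Suc by blast
  define u where "u = inv (t [^] k) \<otimes> y"
  have tpi: "inv (t [^] k) \<in> carrier R" "t [^] k \<otimes> inv (t [^] k) = \<one>" using tp[of k] field_Units by auto
  have uV: "u \<in> V" unfolding u_def using not_less_Least[of k "\<lambda>n. inv (t [^] n) \<otimes> y \<notin> V"] k unfolding n_def by auto
  have uc: "u \<in> carrier R" using uV Vp(1) by auto
  have "inv (t [^] n) = inv t \<otimes> inv (t [^] k)"
  proof (rule comm_inv_char)
   have "t [^] n \<otimes> (inv t \<otimes> inv (t [^] k)) = (t \<otimes> inv t) \<otimes> (t [^] k \<otimes> inv (t [^] k))"
    unfolding k using tp(1)[of k] tc ti(1) tpi(1) by (simp add: m_ac)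
   then show "t [^] n \<otimes> (inv t \<otimes> inv (t [^] k)) = \<one>" using ti tpi by simp
  qed (use tc ti tpi in auto)
  then have nu: "inv t \<otimes> u \<notin> V" using n ti tpi yc unfolding u_def by (simp add: m_assoc)
  obtain s where s: "s \<in> D - M" "s \<otimes> u \<in> D" using uV mem by auto
  have "s \<otimes> u \<notin> M"
  proof
   assume "s \<otimes> u \<in> M"
   then have "inv t \<otimes> (s \<otimes> u) \<in> V" by (rule tM)
   then have "s \<otimes> (inv t \<otimes> u) \<in> V" using ti s Dp(1) uc by (simp add: m_lcomm subset_iff)
   then show False using sV[OF s(1)] nu ti uc by simp
  qed
  then have "u \<noteq> \<zero> \<and> inv u \<in> V" using localization_units[OF Dr P] uV s unfolding V_def by blast
  moreover have "y = t [^] k \<otimes> u" unfolding u_def using tpi tp yc by (metis m_assoc l_one)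
  ultimately show "\<exists>k::nat. \<exists>u \<in> V. inv u \<in> V \<and> u \<noteq> \<zero> \<and> y = t [^] k \<otimes> u" using uV by blast
 qed
 then show ?thesis unfolding V_def F_def .
qed

end

section \<open>Homomorphisms on monogenic extensions\<close>

declare (in ring) poly_add.simps [simp del] poly_mult.simps [simp del]

text \<open>Division with remainder by a monic polynomial works over any subring.\<close>

lemma (in domain) exists_reduced_list:
 assumes A: "subring A R" and g: "set g \<subseteq> A" and t: "t \<in> carrier R" and p: "set p \<subseteq> A"
 obtains q h where "set q \<subseteq> A" "set h \<subseteq> A" "length h = length g"
  "\<And>x. x \<in> carrier R ==> eval p x = eval (\<one> # g) x \<otimes> eval q x \<oplus> eval h x"
  "normalize p = poly_add (poly_mult (\<one> # g) q) (normalize h)"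
proof -
 note Ap = subringE[OF A]
 interpret S: ring "sub_ring A" by (rule subring_is_ring[OF A])
 have pp: "polynomial A (normalize p)" by (rule normalize_gives_polynomial[OF p])
 have gp: "polynomial A (\<one> # g)" unfolding polynomial_def using g Ap(3) by simp
 have "lead_coeff (\<one> # g) \<in> Units (sub_ring A)" using S.Units_one_closed by simp
 then obtain q r where qr: "polynomial A q" "polynomial A r"
  "normalize p = poly_add (poly_mult (\<one> # g) q) r" "r = [] \<or> degree r < degree (\<one> # g)"
  using long_division_theorem[OF A pp gp] by (auto simp: univ_poly_mult univ_poly_add)
 have sets: "set q \<subseteq> A" "set r \<subseteq> A" using qr polynomial_incl by auto
 have len: "length r \<le> length g" using qr(4) by auto
 define h where "h = replicate (length g - length r) \<zero> @ r"
 have c: "set q \<subseteq> carrier R" "set r \<subseteq> carrier R" "set (\<one> # g) \<subseteq> carrier R" "set p \<subseteq> carrier R"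
  using sets g p Ap(1) by auto
 have pm: "set (poly_mult (\<one> # g) q) \<subseteq> carrier R" by (rule poly_mult_in_carrier[OF c(3,1)])
 have "eval p x = eval (\<one> # g) x \<otimes> eval q x \<oplus> eval h x" if x: "x \<in> carrier R" for x
 proof -
  have "eval p x = eval (poly_add (poly_mult (\<one> # g) q) r) x"
   using eval_normalize[OF c(4) x] qr(3) by simp
  also have "\<dots> = eval (poly_mult (\<one> # g) q) x \<oplus> eval r x" by (rule eval_poly_add[OF pm c(2) x])
  also have "eval (poly_mult (\<one> # g) q) x = eval (\<one> # g) x \<otimes> eval q x" by (rule eval_poly_mult[OF c(3,1) x])
  also have "eval r x = eval h x" unfolding h_def using eval_replicate[OF c(2) x] by simp
  finally show ?thesis .
 qed
 moreover have "normalize h = r"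
  unfolding h_def normalize_replicate_zero using normalize_polynomial[OF qr(2)] by simp
 moreover have "set h \<subseteq> A" unfolding h_def using sets(2) Ap(2) by auto
 moreover have "length h = length g" unfolding h_def using len by simp
 ultimately show thesis using that[OF sets(1)] qr(3) by simp
qed

lemma (in domain) mem_simple_extension_iff_eval:
 assumes K: "K \<subseteq> carrier R" and x: "x \<in> carrier R"
 shows "y \<in> simple_extension K x \<longleftrightarrow> (\<exists>h. set h \<subseteq> K \<and> y = eval h x)"
 unfolding simple_extension_as_eval_img[OF assms]
proof
 assume "y \<in> (\<lambda>p. eval p x) ` carrier (K[X])"
 then show "\<exists>h. set h \<subseteq> K \<and> y = eval h x" using polynomial_incl univ_poly_carrier by blast
next
 assume "\<exists>h. set h \<subseteq> K \<and> y = eval h x"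
 then obtain h where h: "set h \<subseteq> K" "y = eval h x" by auto
 have "y = eval (normalize h) x" using eval_normalize[of h x] h K x by auto
 moreover have "normalize h \<in> carrier (K[X])" using normalize_gives_polynomial[OF h(1)] univ_poly_carrier by blast
 ultimately show "y \<in> (\<lambda>p. eval p x) ` carrier (K[X])" by blast
qed

locale hom_eval = domain R + C: domain C
 for R (structure) and C (structure) and A \<phi> b +
 assumes A: "subring A R" and hom: "\<phi> \<in> ring_hom (sub_ring A) C" and b: "b \<in> carrier C"
begin

abbreviation img_eval :: "'a list \<Rightarrow> 'c"
 where "img_eval p \<equiv> C.eval (map \<phi> p) b"

lemma hom_ring: "ring_hom_ring (sub_ring A) C \<phi>"
 by (rule ring_hom_ringI2[OF subring_is_ring[OF A] C.ring_axioms hom])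

lemma map_in_carrier: "set p \<subseteq> A ==> set (map \<phi> p) \<subseteq> carrier C"
 using ring_hom_closed[OF hom] by auto

lemma hom_zero_one: "\<phi> \<zero> = \<zero>\<^bsub>C\<^esub>" "\<phi> \<one> = \<one>\<^bsub>C\<^esub>"
proof -
 interpret H: ring_hom_ring "sub_ring A" C \<phi> by (rule hom_ring)
 show "\<phi> \<zero> = \<zero>\<^bsub>C\<^esub>" "\<phi> \<one> = \<one>\<^bsub>C\<^esub>" using H.hom_zero H.hom_one by auto
qed

lemma img_eval_mult:
 assumes "set p \<subseteq> A" "set q \<subseteq> A"
 shows "img_eval (poly_mult p q) = img_eval p \<otimes>\<^bsub>C\<^esub> img_eval q"
proof -
 interpret H: ring_hom_ring "sub_ring A" C \<phi> by (rule hom_ring)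
 have pm: "set (poly_mult p q) \<subseteq> A"
  using H.R.poly_mult_in_carrier[of p q] assms poly_mult_consistent[OF A] by simp
 have "img_eval (poly_mult p q) = C.eval (C.normalize (map \<phi> (poly_mult p q))) b"
  by (rule C.eval_normalize[OF map_in_carrier[OF pm] b, symmetric])
 also have "\<dots> = C.eval (C.poly_mult (map \<phi> p) (map \<phi> q)) b"
  using H.poly_mult_hom'[of p q] assms poly_mult_consistent[OF A] by simp
 also have "\<dots> = img_eval p \<otimes>\<^bsub>C\<^esub> img_eval q"
  by (rule C.eval_poly_mult[OF map_in_carrier[OF assms(1)] map_in_carrier[OF assms(2)] b])
 finally show ?thesis .
qed

lemma img_eval_add:
 assumes "set p \<subseteq> A" "set q \<subseteq> A"
 shows "img_eval (poly_add p q) = img_eval p \<oplus>\<^bsub>C\<^esub> img_eval q"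
proof -
 interpret H: ring_hom_ring "sub_ring A" C \<phi> by (rule hom_ring)
 have pm: "set (poly_add p q) \<subseteq> A"
  using H.R.poly_add_in_carrier[of p q] assms poly_add_consistent[OF A] by simp
 have "img_eval (poly_add p q) = C.eval (C.normalize (map \<phi> (poly_add p q))) b"
  by (rule C.eval_normalize[OF map_in_carrier[OF pm] b, symmetric])
 also have "\<dots> = C.eval (C.poly_add (map \<phi> p) (map \<phi> q)) b"
  using H.poly_add_hom'[of p q] assms poly_add_consistent[OF A] by simp
 also have "\<dots> = img_eval p \<oplus>\<^bsub>C\<^esub> img_eval q"
  by (rule C.eval_poly_add[OF map_in_carrier[OF assms(1)] map_in_carrier[OF assms(2)] b])
 finally show ?thesis .
qed

lemma img_eval_normalize:
 assumes "set p \<subseteq> A"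
 shows "img_eval (normalize p) = img_eval p"
 using assms
proof (induction p)
 case (Cons a p)
 have "img_eval p \<in> carrier C" using C.eval_in_carrier[OF map_in_carrier b] Cons.prems by simp
 then show ?case using Cons hom_zero_one b by auto
qed simp

lemma in_carrier: "set p \<subseteq> A ==> set p \<subseteq> carrier R"
 using subringE(1)[OF A] by auto

lemma img_eval_in_carrier: "set p \<subseteq> A ==> img_eval p \<in> carrier C"
 using C.eval_in_carrier[OF map_in_carrier b] .

lemma poly_closed:
 assumes "set p \<subseteq> A" "set q \<subseteq> A"
 shows "set (poly_mult p q) \<subseteq> A" "set (poly_add p q) \<subseteq> A"
proof -
 interpret S: ring "sub_ring A" by (rule subring_is_ring[OF A])
 show "set (poly_mult p q) \<subseteq> A" "set (poly_add p q) \<subseteq> A"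
  using S.poly_mult_in_carrier[of p q] S.poly_add_in_carrier[of p q] assms
   poly_mult_consistent[OF A] poly_add_consistent[OF A] by auto
qed

end

text \<open>If the powers of \<open>t\<close> below the degree are independent over \<open>A\<close>, then \<open>A[t] = A[X]/(X\<^sup>n + g)\<close>. Hence a
 homomorphism \<open>\<phi> : A \<rightarrow> C\<close> and a root \<open>b\<close> of the image of \<open>X\<^sup>n + g\<close> determine \<open>A[t] \<rightarrow> C\<close>, \<open>t \<mapsto> b\<close>.\<close>

locale hom_lift = hom_eval R C A \<phi> b for R (structure) and C (structure) and A g t \<phi> b +
 assumes g: "set g \<subseteq> A" and t: "t \<in> carrier R" "eval (\<one> # g) t = \<zero>"
  and ind: "powers_independent A (length g) t"
  and root: "C.eval (map \<phi> (\<one> # g)) b = \<zero>\<^bsub>C\<^esub>"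
begin

lemma img_eval_zero:
 assumes p: "set p \<subseteq> A" "eval p t = \<zero>"
 shows "img_eval p = \<zero>\<^bsub>C\<^esub>"
proof -
 obtain q h where qh: "set q \<subseteq> A" "set h \<subseteq> A" "length h = length g"
  "\<And>x. x \<in> carrier R ==> eval p x = eval (\<one> # g) x \<otimes> eval q x \<oplus> eval h x"
  "normalize p = poly_add (poly_mult (\<one> # g) q) (normalize h)"
  by (rule exists_reduced_list[OF A g t(1) p(1)], rule that)
 have "eval p t = eval h t"
  unfolding qh(4)[OF t(1)] t(2) using eval_in_carrier[OF in_carrier[OF qh(1)] t(1)]
   eval_in_carrier[OF in_carrier[OF qh(2)] t(1)] by simp
 then have "eval h t = \<zero>" using p(2) by simp
 then have "set h \<subseteq> {\<zero>}" using ind qh(2,3) unfolding powers_independent_def by auto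
 then have "normalize h = []" by (induction h) auto
 moreover have g1: "set (\<one> # g) \<subseteq> A" using g subringE(3)[OF A] by simp
 ultimately have "img_eval (normalize p) = img_eval (\<one> # g) \<otimes>\<^bsub>C\<^esub> img_eval q \<oplus>\<^bsub>C\<^esub> \<zero>\<^bsub>C\<^esub>"
  using qh(5) img_eval_add[OF poly_closed(1)[OF g1 qh(1)], of "[]"] img_eval_mult[OF g1 qh(1)] by simp
 also have "\<dots> = \<zero>\<^bsub>C\<^esub>" using root img_eval_in_carrier[OF qh(1)] by simp
 finally show ?thesis using img_eval_normalize[OF p(1)] by simp
qed

lemma img_eval_cong:
 assumes p: "set p \<subseteq> A" and q: "set q \<subseteq> A" and eq: "eval p t = eval q t"
 shows "img_eval p = img_eval q"
proof -
 define n where "n = map ((\<otimes>) (\<ominus> \<one>)) q"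
 have neg: "\<ominus> \<one> \<in> A" "\<ominus> \<one> \<in> carrier R" using subringE[OF A] by auto
 have n: "set n \<subseteq> A" using neg(1) q subringE(6)[OF A] unfolding n_def by auto
 have qc: "eval q t \<in> carrier R" using eval_in_carrier[OF in_carrier[OF q] t(1)] .
 have "eval (poly_add p n) t = eval p t \<oplus> eval n t"
  using eval_poly_add[OF in_carrier[OF p] in_carrier[OF n] t(1)] .
 also have "eval n t = \<ominus> \<one> \<otimes> eval q t" unfolding n_def by (rule eval_map_mult[OF neg(2) in_carrier[OF q] t(1)])
 finally have "eval (poly_add p n) t = \<zero>" using eq qc by (simp add: l_minus r_neg)
 then have z: "img_eval p \<oplus>\<^bsub>C\<^esub> img_eval n = \<zero>\<^bsub>C\<^esub>"
  using img_eval_zero[OF poly_closed(2)[OF p n]] img_eval_add[OF p n] by simp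
 interpret H: ring_hom_ring "sub_ring A" C \<phi> by (rule hom_ring)
 have nm: "\<phi> (\<ominus> \<one> \<otimes> x) = \<ominus>\<^bsub>C\<^esub> \<one>\<^bsub>C\<^esub> \<otimes>\<^bsub>C\<^esub> \<phi> x" if "x \<in> A" for x
 proof -
  have "\<phi> (\<ominus> \<one>) \<oplus>\<^bsub>C\<^esub> \<phi> \<one> = \<phi> (\<ominus> \<one> \<oplus> \<one>)" using H.hom_add[of "\<ominus> \<one>" \<one>] neg subringE(3)[OF A] by simp
  then have "\<phi> (\<ominus> \<one>) = \<ominus>\<^bsub>C\<^esub> \<one>\<^bsub>C\<^esub>"
   using hom_zero_one ring_hom_closed[OF hom, of "\<ominus> \<one>"] neg C.minus_equality[of "\<phi> (\<ominus> \<one>)" "\<one>\<^bsub>C\<^esub>"]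
   by (simp add: l_neg)
  then show ?thesis using H.hom_mult[of "\<ominus> \<one>" x] neg that by simp
 qed
 have "map \<phi> n = map ((\<otimes>\<^bsub>C\<^esub>) (\<ominus>\<^bsub>C\<^esub> \<one>\<^bsub>C\<^esub>)) (map \<phi> q)" unfolding n_def using nm q by auto
 then have "img_eval n = \<ominus>\<^bsub>C\<^esub> \<one>\<^bsub>C\<^esub> \<otimes>\<^bsub>C\<^esub> img_eval q"
  using C.eval_map_mult[OF _ map_in_carrier[OF q] b, of "\<ominus>\<^bsub>C\<^esub> \<one>\<^bsub>C\<^esub>"] by simp
 then have "img_eval p \<ominus>\<^bsub>C\<^esub> img_eval q = \<zero>\<^bsub>C\<^esub>"
  using z img_eval_in_carrier[OF q] by (simp add: C.l_minus C.minus_eq)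
 then show ?thesis using img_eval_in_carrier[OF p] img_eval_in_carrier[OF q] by simp
qed

definition lift :: "'a \<Rightarrow> 'c"
 where "lift x = img_eval (SOME p. set p \<subseteq> A \<and> eval p t = x)"

lemma lift_eval: "set p \<subseteq> A ==> lift (eval p t) = img_eval p"
 unfolding lift_def
 using someI[of "\<lambda>q. set q \<subseteq> A \<and> eval q t = eval p t" p] img_eval_cong by blast

lemma mem_simple_extension:
 "x \<in> simple_extension A t \<longleftrightarrow> (\<exists>h. set h \<subseteq> A \<and> length h = length g \<and> x = eval h t)"
proof
 assume "x \<in> simple_extension A t"
 then obtain p where p: "set p \<subseteq> A" "x = eval p t"
  using mem_simple_extension_iff_eval[OF subringE(1)[OF A] t(1)] by auto
 obtain q h where qh: "set q \<subseteq> A" "set h \<subseteq> A" "length h = length g"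
  "\<And>x. x \<in> carrier R ==> eval p x = eval (\<one> # g) x \<otimes> eval q x \<oplus> eval h x"
  "normalize p = poly_add (poly_mult (\<one> # g) q) (normalize h)"
  by (rule exists_reduced_list[OF A g t(1) p(1)], rule that)
 have "x = eval h t"
  unfolding p(2) qh(4)[OF t(1)] t(2) using eval_in_carrier[OF in_carrier[OF qh(1)] t(1)]
   eval_in_carrier[OF in_carrier[OF qh(2)] t(1)] by simp
 then show "\<exists>h. set h \<subseteq> A \<and> length h = length g \<and> x = eval h t" using qh by blast
qed (use mem_simple_extension_iff_eval[OF subringE(1)[OF A] t(1)] in blast)

lemma lift_hom: "lift \<in> ring_hom (sub_ring (simple_extension A t)) C"
proof (rule ring_hom_memI)
 fix x assume "x \<in> carrier (sub_ring (simple_extension A t))"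
 then obtain p where p: "set p \<subseteq> A" "x = eval p t" using mem_simple_extension by auto
 then show "lift x \<in> carrier C" using lift_eval img_eval_in_carrier by simp
 fix y assume "y \<in> carrier (sub_ring (simple_extension A t))"
 then obtain q where q: "set q \<subseteq> A" "y = eval q t" using mem_simple_extension by auto
 have "x \<otimes> y = eval (poly_mult p q) t"
  using eval_poly_mult[OF in_carrier[OF p(1)] in_carrier[OF q(1)] t(1)] p q by simp
 then show "lift (x \<otimes>\<^bsub>sub_ring (simple_extension A t)\<^esub> y) = lift x \<otimes>\<^bsub>C\<^esub> lift y"
  using lift_eval[OF poly_closed(1)[OF p(1) q(1)]] img_eval_mult[OF p(1) q(1)] lift_eval p q by simp
 have "x \<oplus> y = eval (poly_add p q) t"
  using eval_poly_add[OF in_carrier[OF p(1)] in_carrier[OF q(1)] t(1)] p q by simp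
 then show "lift (x \<oplus>\<^bsub>sub_ring (simple_extension A t)\<^esub> y) = lift x \<oplus>\<^bsub>C\<^esub> lift y"
  using lift_eval[OF poly_closed(2)[OF p(1) q(1)]] img_eval_add[OF p(1) q(1)] lift_eval p q by simp
next
 have "lift (eval [\<one>] t) = \<one>\<^bsub>C\<^esub>"
  using lift_eval[of "[\<one>]"] subringE(3)[OF A] hom_zero_one b by simp
 then show "lift \<one>\<^bsub>sub_ring (simple_extension A t)\<^esub> = \<one>\<^bsub>C\<^esub>" using t(1) by simp
qed

lemma lift_extends: "a \<in> A ==> lift a = \<phi> a"
proof -
 assume a: "a \<in> A"
 then have "a = eval [a] t" using subringE(1)[OF A] t(1) by auto
 then show "lift a = \<phi> a" using lift_eval[of "[a]"] a b ring_hom_closed[OF hom, of a] by simp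
qed

lemma lift_eval_in_extension:
 assumes "set p \<subseteq> simple_extension A t" "z \<in> simple_extension A t"
 shows "lift (eval p z) = C.eval (map lift p) (lift z)" "lift z \<in> carrier C"
proof -
 have S: "subring (simple_extension A t) R" by (rule simple_extension_is_subring[OF A t(1)])
 interpret G: ring_hom_ring "sub_ring (simple_extension A t)" C lift
  by (rule ring_hom_ringI2[OF subring_is_ring[OF S] C.ring_axioms lift_hom])
 show "lift (eval p z) = C.eval (map lift p) (lift z)"
  using G.eval_hom'[of z p] assms eval_consistent[OF S] by simp
 show "lift z \<in> carrier C" using G.hom_closed assms(2) by simp
qed

lemma lift_zero_one: "lift \<zero> = \<zero>\<^bsub>C\<^esub>" "lift \<one> = \<one>\<^bsub>C\<^esub>"
 using lift_extends subringE(2,3)[OF A] hom_zero_one by auto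

end

section \<open>Integral closure in a separable monogenic extension\<close>

context field begin

text \<open>The monic equation of \<open>d x\<close> that belongs to a monic equation of \<open>x\<close>.\<close>

primrec scale_coeffs :: "'a \<Rightarrow> nat \<Rightarrow> 'a list \<Rightarrow> 'a list"
 where "scale_coeffs d k [] = []"
 | "scale_coeffs d k (c # p) = (d [^] k \<otimes> c) # scale_coeffs d (Suc k) p"

lemma length_scale_coeffs [simp]: "length (scale_coeffs d k p) = length p"
 by (induction p arbitrary: k) auto

lemma eval_scale_coeffs:
 assumes "d \<in> carrier R" "x \<in> carrier R" "set (c # p) \<subseteq> carrier R"
 shows "eval (scale_coeffs d k (c # p)) (d \<otimes> x) = d [^] (k + length p) \<otimes> eval (c # p) x"
 using assms(3)
proof (induction p arbitrary: c k)
 case (Cons b p)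
 have IH: "eval (scale_coeffs d (Suc k) (b # p)) (d \<otimes> x) = d [^] (Suc k + length p) \<otimes> eval (b # p) x"
  by (rule Cons.IH) (use Cons.prems in simp)
 have e: "eval (b # p) x \<in> carrier R" using eval_in_carrier assms Cons.prems by simp
 have "eval (scale_coeffs d k (c # b # p)) (d \<otimes> x)
   = (d [^] k \<otimes> c) \<otimes> (d \<otimes> x) [^] Suc (length p) \<oplus> eval (scale_coeffs d (Suc k) (b # p)) (d \<otimes> x)"
  by simp
 also have "\<dots> = (d [^] k \<otimes> c) \<otimes> (d [^] Suc (length p) \<otimes> x [^] Suc (length p)) \<oplus> d [^] (Suc k + length p) \<otimes> eval (b # p) x"
  unfolding IH using assms(1,2) nat_pow_distrib[of d x] by (simp only:)
 also have "(d [^] k \<otimes> c) \<otimes> (d [^] Suc (length p) \<otimes> x [^] Suc (length p)) = d [^] (Suc k + length p) \<otimes> (c \<otimes> x [^] Suc (length p))"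
 proof -
  have pw: "d [^] k \<otimes> d [^] Suc (length p) = d [^] (Suc k + length p)" using nat_pow_mult[OF assms(1), of k "Suc (length p)"] by simp
  have "(a \<otimes> c) \<otimes> (a' \<otimes> y) = (a \<otimes> a') \<otimes> (c \<otimes> y)" if "a \<in> carrier R" "a' \<in> carrier R" "y \<in> carrier R" for a a' y
   using that Cons.prems by (simp add: m_ac)
  from this[of "d [^] k" "d [^] Suc (length p)" "x [^] Suc (length p)"] show ?thesis using pw assms by simp
 qed
 also have "\<dots> \<oplus> d [^] (Suc k + length p) \<otimes> eval (b # p) x = d [^] (Suc k + length p) \<otimes> (c \<otimes> x [^] Suc (length p) \<oplus> eval (b # p) x)"
  using r_distr[of "c \<otimes> x [^] Suc (length p)" "eval (b # p) x" "d [^] (Suc k + length p)"] e assms(1,2) Cons.prems by simp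
 finally show ?case by simp
qed (use assms in \<open>simp add: m_ac\<close>)

lemma common_denominator:
 assumes D: "subring D R" and P: "prime_in D P" and h: "set h \<subseteq> localization D P"
 shows "\<exists>d \<in> D - P. \<forall>c \<in> set h. d \<otimes> c \<in> D"
 using h
proof (induction h)
 case Nil
 then show ?case using P subringE(3)[OF D] unfolding prime_in_def by auto
next
 case (Cons c h)
 then obtain d where d: "d \<in> D - P" "\<forall>c \<in> set h. d \<otimes> c \<in> D" by auto
 obtain s where s: "s \<in> D - P" "s \<otimes> c \<in> D" "c \<in> carrier R" using Cons.prems localization_mem_iff[OF D P] by auto
 have hc: "set h \<subseteq> carrier R" using Cons.prems localization_mem_iff[OF D P] by auto
 note Dp = subringE[OF D]
 have sd: "s \<otimes> d \<in> D - P" using s d P Dp(6) unfolding prime_in_def by auto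
 have sdc: "s \<in> carrier R" "d \<in> carrier R" using s d Dp(1) by auto
 have "(s \<otimes> d) \<otimes> x \<in> D" if "x \<in> set (c # h)" for x
 proof (cases "x = c")
  case True
  then have "(s \<otimes> d) \<otimes> x = d \<otimes> (s \<otimes> c)" using sdc s(3) by (simp add: m_ac)
  then show ?thesis using Dp(6) d(1) s(2) by auto
 next
  case False
  then have x: "x \<in> set h" using that by simp
  then have "(s \<otimes> d) \<otimes> x = s \<otimes> (d \<otimes> x)" using sdc hc by (auto simp: m_assoc)
  then show ?thesis using Dp(6) d(2) s(1) x by auto
 qed
 then have "\<forall>x \<in> set (c # h). (s \<otimes> d) \<otimes> x \<in> D" by blast
 then show ?case using sd by blast
qed

lemma algebraic_denominator:
 assumes D: "subring D R" and x: "x \<in> carrier R" "(algebraic over (quotient_field D)) x"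
 shows "\<exists>d \<in> D - {\<zero>}. integral D (d \<otimes> x)"
proof -
 note Dp = subringE[OF D]
 note F = quotient_field_subfield[OF D]
 note Fp = subringE[OF subfieldE(1)[OF F(1)]]
 note I = IrrE[OF F(1) x]
 obtain q where q: "Irr (quotient_field D) x = \<one> # q"
  using I pirreducible_degree[OF F(1) I(1,2)] by (cases "Irr (quotient_field D) x") auto
 have qF: "set q \<subseteq> quotient_field D" using I(1) q unfolding sym[OF univ_poly_carrier] polynomial_def by auto
 obtain d where d: "d \<in> D - {\<zero>}" "\<forall>c \<in> set q. d \<otimes> c \<in> D"
  using common_denominator[OF D prime_in_zero[OF D]] qF quotient_field_eq by metis
 have dc: "d \<in> carrier R" using d Dp(1) by auto
 have qc: "set q \<subseteq> carrier R" using qF Fp(1) by auto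
 have "eval (scale_coeffs d 0 (\<one> # q)) (d \<otimes> x) = \<zero>"
  using eval_scale_coeffs[OF dc x(1), of \<one> q 0] qc I(4) q dc by simp
 moreover have "scale_coeffs d 0 (\<one> # q) = \<one> # scale_coeffs d 1 q" by simp
 moreover have "set (scale_coeffs d (Suc k) q) \<subseteq> D" for k using d(2) qc
 proof (induction q arbitrary: k)
  case (Cons c q)
  have "d [^] k \<in> D" using d(1) Dp(3,6) by (induction k) auto
  moreover have "d [^] Suc k \<otimes> c = d [^] k \<otimes> (d \<otimes> c)" using dc Cons.prems by (simp add: m_assoc)
  ultimately show ?case using Cons Dp(6) by auto
 qed simp
 ultimately show ?thesis using integral_iff_list[OF D] d(1) by (metis One_nat_def)
qed

text \<open>The quotient of \<open>c # p\<close> by \<open>X - a\<close>, by synthetic division.\<close>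

fun horner_quotient :: "'a \<Rightarrow> 'a \<Rightarrow> 'a list \<Rightarrow> 'a list"
 where "horner_quotient a c [] = []"
 | "horner_quotient a c (d # p) = c # horner_quotient a (c \<otimes> a \<oplus> d) p"

lemma length_horner_quotient [simp]: "length (horner_quotient a c p) = length p"
 by (induction p arbitrary: c) auto

lemma eval_horner_quotient:
 assumes "a \<in> carrier R" "x \<in> carrier R" "set (c # p) \<subseteq> carrier R"
 shows "eval (c # p) x \<ominus> eval (c # p) a = (x \<ominus> a) \<otimes> eval (horner_quotient a c p) x"
  "set (horner_quotient a c p) \<subseteq> carrier R"
proof -
 have "set (horner_quotient a c p) \<subseteq> carrier R \<and>
  eval (c # p) x \<ominus> eval (c # p) a = (x \<ominus> a) \<otimes> eval (horner_quotient a c p) x"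
  using assms(3)
 proof (induction p arbitrary: c)
  case Nil
  then show ?case using assms by (simp add: a_minus_def r_neg)
 next
  case (Cons d p)
  have cd: "c \<in> carrier R" "d \<in> carrier R" "set p \<subseteq> carrier R" using Cons.prems by auto
  have "set ((c \<otimes> a \<oplus> d) # p) \<subseteq> carrier R" using cd assms by simp
  note IH = Cons.IH[OF this]
  have e: "eval p x \<in> carrier R" "eval p a \<in> carrier R" using eval_in_carrier cd assms by auto
  have q: "eval (horner_quotient a (c \<otimes> a \<oplus> d) p) x \<in> carrier R"
   using IH eval_in_carrier assms by blast
  define u where "u = x [^] length p"
  define w where "w = a [^] length p"
  define Q where "Q = eval (horner_quotient a (c \<otimes> a \<oplus> d) p) x"
  have uw: "u \<in> carrier R" "w \<in> carrier R" "Q \<in> carrier R" unfolding u_def w_def Q_def using assms q by auto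
  have IH': "((c \<otimes> a \<oplus> d) \<otimes> u \<oplus> eval p x) \<ominus> ((c \<otimes> a \<oplus> d) \<otimes> w \<oplus> eval p a) = (x \<ominus> a) \<otimes> Q"
   using IH unfolding u_def w_def Q_def by simp
  have "eval (c # d # p) x \<ominus> eval (c # d # p) a =
    (c \<otimes> (u \<otimes> x) \<oplus> (d \<otimes> u \<oplus> eval p x)) \<ominus> (c \<otimes> (w \<otimes> a) \<oplus> (d \<otimes> w \<oplus> eval p a))"
   unfolding u_def w_def by simp
  also have "\<dots> = (x \<ominus> a) \<otimes> (c \<otimes> u) \<oplus> (((c \<otimes> a \<oplus> d) \<otimes> u \<oplus> eval p x) \<ominus> ((c \<otimes> a \<oplus> d) \<otimes> w \<oplus> eval p a))"
   using uw cd e assms(1,2) by algebra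
  also have "\<dots> = (x \<ominus> a) \<otimes> (c \<otimes> u \<oplus> Q)" unfolding IH' using uw cd assms(1,2) by algebra
  also have "c \<otimes> u \<oplus> Q = eval (horner_quotient a c (d # p)) x" unfolding u_def Q_def by simp
  finally show ?case using IH cd by simp
 qed
 then show "eval (c # p) x \<ominus> eval (c # p) a = (x \<ominus> a) \<otimes> eval (horner_quotient a c p) x"
  "set (horner_quotient a c p) \<subseteq> carrier R" by auto
qed

lemma horner_quotient_integral_coeffs:
 assumes B: "subring B R" and a: "a \<in> B" and d: "d \<in> B" and c: "set (c # p) \<subseteq> carrier R"
  and q: "\<forall>z \<in> set (horner_quotient a c p). d \<otimes> z \<in> B" and e: "d \<otimes> eval (c # p) a \<in> B"
 shows "\<forall>z \<in> set (c # p). d \<otimes> z \<in> B"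
 using c q e
proof (induction p arbitrary: c)
 case Nil
 then show ?case using subringE(1)[OF B] a by auto
next
 case (Cons b p)
 note Op = subringE[OF B]
 have ac: "a \<in> carrier R" "d \<in> carrier R" "c \<in> carrier R" "b \<in> carrier R" using a d Op(1) Cons.prems by auto
 have dc: "d \<otimes> c \<in> B" using Cons.prems(2) by simp
 have "eval (c # b # p) a = eval ((c \<otimes> a \<oplus> b) # p) a"
 proof -
  have "c \<otimes> (y \<otimes> a) \<oplus> (b \<otimes> y \<oplus> z) = (c \<otimes> a \<oplus> b) \<otimes> y \<oplus> z" if "y \<in> carrier R" "z \<in> carrier R" for y z
   using ac that by algebra
  then show ?thesis using eval_in_carrier[of p a] ac Cons.prems(1) by simp
 qed
 then have IH: "\<forall>z \<in> set ((c \<otimes> a \<oplus> b) # p). d \<otimes> z \<in> B"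
  by (intro Cons.IH) (use Cons.prems ac in auto)
 have "d \<otimes> b = d \<otimes> (c \<otimes> a \<oplus> b) \<oplus> \<ominus> ((d \<otimes> c) \<otimes> a)" using ac by algebra
 moreover have "\<dots> \<in> B" using IH dc a Op(5,6,7) by auto
 ultimately show ?case using IH dc by auto
qed

text \<open>The coefficients of \<open>h\<close> are recovered from its values at the points \<open>bs\<close> by successive division by \<open>X - b\<close>;
 the denominators that occur are differences of points, so one \<open>d\<close> serves all \<open>h\<close>.\<close>

lemma lagrange_denominator:
 assumes D: "subring D R" and B: "subring B R" "D \<subseteq> B"
  and den: "\<And>x. x \<in> B ==> x \<noteq> \<zero> ==> \<exists>d \<in> D - {\<zero>}. d \<otimes> inv x \<in> B"
  and bs: "distinct bs" "set bs \<subseteq> B"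
 shows "\<exists>d \<in> D - {\<zero>}. \<forall>h. set h \<subseteq> carrier R \<and> length h = length bs \<and> (\<forall>b \<in> set bs. eval h b \<in> B)
  \<longrightarrow> (\<forall>c \<in> set h. d \<otimes> c \<in> B)"
 using bs
proof (induction bs)
 case Nil
 then show ?case using subringE(3)[OF D] by (intro bexI[of _ \<one>]) auto
next
 case (Cons a bs)
 note Op = subringE[OF B(1)] and Dp = subringE[OF D]
 obtain d where d: "d \<in> D - {\<zero>}" "\<And>h c. set h \<subseteq> carrier R ==> length h = length bs ==>
   (\<forall>b \<in> set bs. eval h b \<in> B) ==> c \<in> set h ==> d \<otimes> c \<in> B"
  using Cons by force
 have ac: "a \<in> carrier R" "a \<in> B" using Cons.prems Op(1) by auto
 have "\<exists>e \<in> D - {\<zero>}. \<forall>b \<in> set cs. e \<otimes> inv (b \<ominus> a) \<in> B" if "a \<notin> set cs" "set cs \<subseteq> B" for cs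
  using that
 proof (induction cs)
  case Nil
  then show ?case using Dp(3) by (intro bexI[of _ \<one>]) auto
 next
  case (Cons b cs)
  then obtain e where e: "e \<in> D - {\<zero>}" "\<forall>b \<in> set cs. e \<otimes> inv (b \<ominus> a) \<in> B" by auto
  have bc: "b \<in> carrier R" "b \<in> B" using Cons.prems Op(1) by auto
  have nz: "y \<ominus> a \<noteq> \<zero>" "inv (y \<ominus> a) \<in> carrier R" if "y \<in> set (b # cs)" for y
  proof -
   show "y \<ominus> a \<noteq> \<zero>" using that Cons.prems Op(1) ac by auto
   then show "inv (y \<ominus> a) \<in> carrier R" using that Cons.prems Op(1) ac field_Units by auto
  qed
  have "b \<ominus> a \<in> B" using bc ac Op(5,7) by (simp add: a_minus_def)
  then obtain f where f: "f \<in> D - {\<zero>}" "f \<otimes> inv (b \<ominus> a) \<in> B" using den[of "b \<ominus> a"] nz(1)[of b] by auto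
  have c: "e \<in> carrier R" "f \<in> carrier R" "e \<in> B" "f \<in> B" using e f Dp(1) B(2) by auto
  have "(e \<otimes> f) \<otimes> inv (y \<ominus> a) \<in> B" if y: "y \<in> set (b # cs)" for y
  proof (cases "y = b")
   case True
   then have "(e \<otimes> f) \<otimes> inv (y \<ominus> a) = e \<otimes> (f \<otimes> inv (b \<ominus> a))" using c nz(2)[OF y] by (simp add: m_assoc)
   then show ?thesis using Op(6)[OF c(3) f(2)] by simp
  next
   case False
   then have "e \<otimes> inv (y \<ominus> a) \<in> B" using e y by simp
   moreover have "(e \<otimes> f) \<otimes> inv (y \<ominus> a) = f \<otimes> (e \<otimes> inv (y \<ominus> a))" using c nz(2)[OF y] by (simp add: m_ac)
   ultimately show ?thesis using Op(6)[OF c(4)] by simp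
  qed
  then have "\<forall>y \<in> set (b # cs). (e \<otimes> f) \<otimes> inv (y \<ominus> a) \<in> B" by blast
  moreover have "e \<otimes> f \<in> D - {\<zero>}" using e f Dp(6) c integral_iff by auto
  ultimately show ?case by blast
 qed
 from this[of bs] Cons.prems obtain e where e: "e \<in> D - {\<zero>}" "\<And>b. b \<in> set bs ==> e \<otimes> inv (b \<ominus> a) \<in> B"
  by auto
 have dec: "d \<in> carrier R" "e \<in> carrier R" "d \<in> B" "e \<in> B" using d e Dp(1) B(2) by auto
 show ?case
 proof (intro bexI[of _ "d \<otimes> e"] allI impI)
  show "d \<otimes> e \<in> D - {\<zero>}" using d e Dp(6) dec integral_iff by auto
  fix h assume h: "set h \<subseteq> carrier R \<and> length h = length (a # bs) \<and> (\<forall>b \<in> set (a # bs). eval h b \<in> B)"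
  then obtain c p where cp: "h = c # p" "length p = length bs" by (cases h) auto
  have cpc: "set (c # p) \<subseteq> carrier R" using h cp by simp
  let ?q = "horner_quotient a c p"
  note hq = eval_horner_quotient[OF ac(1) _ cpc]
  have qc: "set ?q \<subseteq> carrier R" using hq(2)[OF ac(1)] .
  have "eval (map ((\<otimes>) e) ?q) b \<in> B" if b: "b \<in> set bs" for b
  proof -
   have bc: "b \<in> carrier R" "b \<in> B" "b \<noteq> a" using b Cons.prems Op(1) by auto
   have nz: "b \<ominus> a \<noteq> \<zero>" using bc ac by auto
   have ic: "b \<ominus> a \<in> carrier R" "inv (b \<ominus> a) \<in> carrier R" "(b \<ominus> a) \<otimes> inv (b \<ominus> a) = \<one>"
    using nz bc ac field_Units by auto
   have ev: "eval ?q b \<in> carrier R" using eval_in_carrier[OF qc bc(1)] .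
   have "eval h b \<ominus> eval h a = (b \<ominus> a) \<otimes> eval ?q b" using hq(1)[OF bc(1)] cp by simp
   then have "(e \<otimes> inv (b \<ominus> a)) \<otimes> (eval h b \<ominus> eval h a) = ((b \<ominus> a) \<otimes> inv (b \<ominus> a)) \<otimes> (e \<otimes> eval ?q b)"
    using ic(1,2) ev dec by (simp add: m_ac)
   then have eq: "e \<otimes> eval ?q b = (e \<otimes> inv (b \<ominus> a)) \<otimes> (eval h b \<ominus> eval h a)"
    using ic ev dec by simp
   have "eval h b \<ominus> eval h a \<in> B" using h b Op(5,7) by (simp add: a_minus_def)
   then have "e \<otimes> eval ?q b \<in> B" unfolding eq using e(2)[OF b] Op(6) by blast
   then show ?thesis using eval_map_mult[OF dec(2) qc bc(1)] by simp
  qed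
  then have ev: "\<forall>b \<in> set bs. eval (map ((\<otimes>) e) ?q) b \<in> B" by blast
  have "set (map ((\<otimes>) e) ?q) \<subseteq> carrier R" using qc dec by auto
  then have de: "d \<otimes> z \<in> B" if "z \<in> set (map ((\<otimes>) e) ?q)" for z
   using d(2)[OF _ _ ev that] cp(2) by simp
  have "(d \<otimes> e) \<otimes> z \<in> B" if z: "z \<in> set ?q" for z
  proof -
   have "d \<otimes> (e \<otimes> z) \<in> B" using de z by simp
   moreover have "z \<in> carrier R" using z qc by auto
   ultimately show ?thesis using dec by (simp add: m_assoc)
  qed
  then have "\<forall>z \<in> set ?q. (d \<otimes> e) \<otimes> z \<in> B" by blast
  moreover have "eval (c # p) a \<in> B"
   using h unfolding cp(1) by (metis list.set_intros(1))
  then have "(d \<otimes> e) \<otimes> eval (c # p) a \<in> B" by (rule Op(6)[OF Op(6)[OF dec(3,4)]])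
  ultimately show "\<forall>c \<in> set h. d \<otimes> e \<otimes> c \<in> B"
   unfolding cp(1) by (rule horner_quotient_integral_coeffs[OF B(1) ac(2) Op(6)[OF dec(3,4)] cpc])
 qed
qed

end

section \<open>Finite integral extensions of Dedekind domains\<close>

context field begin

lemma dedekind_domainD:
 assumes "dedekind_domain D"
 shows "subring D R" "noetherian_subring D"
  "\<And>x. x \<in> quotient_field D ==> integral D x ==> x \<in> D"
  "\<And>P. prime_in D P ==> P \<noteq> {\<zero>} ==> maximalideal P (sub_ring D)"
 using assms noetherian_subring_iff primeideal_sub_ring_iff unfolding dedekind_domain_def by auto

text \<open>Both parts look at a shortest monic polynomial over \<open>D\<close> whose value at \<open>x\<close> is zero, or lies in \<open>P\<close>:
 its constant term is a multiple of \<open>x\<close>, modulo \<open>P\<close> in the second case. The first part shows that nonzero primes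
 contract to nonzero primes, the second that a prime over a maximal ideal is maximal.\<close>

lemma prime_contains_const_term:
 assumes D: "subring D R" and E: "subring E R" "D \<subseteq> E" and P: "prime_in E P"
  and x: "x \<in> E" "integral D x"
 shows "x \<in> P ==> x \<noteq> \<zero> ==> \<exists>c \<in> P \<inter> D. c \<noteq> \<zero>"
  "x \<notin> P ==> \<exists>c \<in> D - P. \<exists>p \<in> P. \<exists>y \<in> E. c = p \<oplus> y \<otimes> x"
proof -
 note Dp = subringE[OF D] and Ep = subringE[OF E(1)]
 have Pm: "module_over E P" "P \<subseteq> E" "\<one> \<notin> P" and Pp: "\<And>a b. a \<in> E ==> b \<in> E ==> a \<otimes> b \<in> P ==> a \<in> P \<or> b \<in> P"
  using P unfolding prime_in_def by auto
 note Pq = module_overD[OF Pm(1)]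
 have xc: "x \<in> carrier R" using x Ep(1) by auto
 have evE: "eval (\<one> # q) x \<in> E" if "set q \<subseteq> D" for q
 proof -
  have "x [^] n \<in> E" for n :: nat using x(1) Ep by (induction n) auto
  moreover have "eval q x \<in> E" using that
  proof (induction q)
   case (Cons c q)
   then show ?case using \<open>\<And>n. x [^] n \<in> E\<close> Ep E(2) by auto
  qed (use Ep in simp)
  ultimately show ?thesis using Ep xc by simp
 qed
 have split: "eval (\<one> # (q @ [c])) x = eval (\<one> # q) x \<otimes> x \<oplus> c" if "set q \<subseteq> D" "c \<in> D" for q c
  using eval_append_aux[of "\<one> # q" c x] that Dp(1) xc by auto
 have minimal: "\<exists>q. Q q \<and> (\<forall>q'. Q q' \<longrightarrow> length q \<le> length q')" if "\<exists>q. Q q" for Q :: "'a list \<Rightarrow> bool"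
  using that ex_has_least_nat[of Q _ length] by blast
 {
  assume xP: "x \<in> P" and x0: "x \<noteq> \<zero>"
  let ?Q = "\<lambda>q. set q \<subseteq> D \<and> eval (\<one> # q) x = \<zero>"
  obtain q where q: "?Q q" "\<And>q'. ?Q q' ==> length q \<le> length q'"
   using minimal[of ?Q] x(2) integral_iff_list[OF D] by blast
  have "q \<noteq> []" using monic_root_nonconst[OF xc, of q] q(1) by auto
  then obtain r c where r: "q = r @ [c]" by (metis append_butlast_last_id)
  have rc: "set r \<subseteq> D" "c \<in> D" using q(1) r by auto
  have e: "eval (\<one> # r) x \<in> E" "eval (\<one> # r) x \<in> carrier R" using evE[OF rc(1)] Ep(1) by auto
  have eq: "eval (\<one> # r) x \<otimes> x \<oplus> c = \<zero>" using q(1) split[OF rc] unfolding r by metis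
  have cc: "c \<in> carrier R" using rc Dp(1) by auto
  have "c \<noteq> \<zero>"
  proof
   assume "c = \<zero>"
   then have "eval (\<one> # r) x = \<zero>" using eq e xc x0 integral_iff by simp
   then show False using q(2)[of r] rc(1) r by auto
  qed
  moreover have "c \<in> P"
  proof -
   have "c = \<ominus> (eval (\<one> # r) x \<otimes> x)" using eq e cc xc by (metis m_closed minus_equality a_comm)
   then show ?thesis using Pq(4)[OF e(1) xP] module_over_minus[OF E(1) Pm(1)] by simp
  qed
  ultimately show "\<exists>c \<in> P \<inter> D. c \<noteq> \<zero>" using rc(2) by blast
 }
 {
  assume xP: "x \<notin> P"
  let ?Q = "\<lambda>q. set q \<subseteq> D \<and> eval (\<one> # q) x \<in> P"
  have "\<exists>q. ?Q q" using x(2) integral_iff_list[OF D] Pq(2) by metis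
  then obtain q where q: "?Q q" "\<And>q'. ?Q q' ==> length q \<le> length q'"
   using minimal[of ?Q] by blast
  have "q \<noteq> []" using q(1) Pm(3) xc by auto
  then obtain r c where r: "q = r @ [c]" by (metis append_butlast_last_id)
  have rc: "set r \<subseteq> D" "c \<in> D" using q(1) r by auto
  have e: "eval (\<one> # r) x \<in> E" "eval (\<one> # r) x \<in> carrier R" using evE[OF rc(1)] Ep(1) by auto
  have eq: "eval (\<one> # q) x = eval (\<one> # r) x \<otimes> x \<oplus> c" using split[OF rc] unfolding r .
  have cc: "c \<in> carrier R" using rc Dp(1) by auto
  have "c \<notin> P"
  proof
   assume "c \<in> P"
   then have "eval (\<one> # q) x \<oplus> \<ominus> c \<in> P" using q(1) Pq(3) module_over_minus[OF E(1) Pm(1)] by blast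
   moreover have "eval (\<one> # q) x \<oplus> \<ominus> c = eval (\<one> # r) x \<otimes> x" unfolding eq using e cc xc by algebra
   ultimately have "eval (\<one> # r) x \<otimes> x \<in> P" by simp
   then have "eval (\<one> # r) x \<in> P" using Pp[OF e(1) x(1)] xP by blast
   then show False using q(2)[of r] rc(1) r by auto
  qed
  moreover have "c = eval (\<one> # q) x \<oplus> (\<ominus> eval (\<one> # r) x) \<otimes> x" unfolding eq using e cc xc by algebra
  ultimately show "\<exists>c \<in> D - P. \<exists>p \<in> P. \<exists>y \<in> E. c = p \<oplus> y \<otimes> x" using q(1) rc(2) Ep(5)[OF e(1)] by blast
 }
qed

lemma prime_contraction:
 assumes D: "subring D R" and E: "subring E R" "D \<subseteq> E" and P: "prime_in E P"
 shows "prime_in D (P \<inter> D)"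
proof -
 note Dp = subringE[OF D]
 have Pm: "module_over E P" "P \<subseteq> E" "\<one> \<notin> P" and Pp: "\<And>a b. a \<in> E ==> b \<in> E ==> a \<otimes> b \<in> P ==> a \<in> P \<or> b \<in> P"
  using P unfolding prime_in_def by auto
 note Pq = module_overD[OF Pm(1)]
 show ?thesis unfolding prime_in_def module_over_def
  using Pq Dp Pm E(2) Pp by (auto simp: subset_iff)
qed

lemma dedekind_domain_finite_extension:
 assumes D: "dedekind_domain D" and E: "subring E R" "D \<subseteq> E" and fg: "fg_module D E"
  and closed: "\<And>x. x \<in> quotient_field E ==> integral D x ==> x \<in> E"
 shows "dedekind_domain E"
proof -
 note Dd = dedekind_domainD[OF D]
 note Dp = subringE[OF Dd(1)]
 have noethE: "noetherian_subring E" unfolding noetherian_subring_def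
 proof (intro conjI allI impI E(1))
  fix I assume I: "module_over E I \<and> I \<subseteq> E"
  then have ID: "module_over D I" using E(2) unfolding module_over_def by auto
  then obtain Us where Us: "set Us \<subseteq> carrier R" "I = Span D Us"
   using fg_submodule[OF Dd(2) ID fg] I unfolding fg_module_def by auto
  have "set Us \<subseteq> I" using module_over_Span(2)[OF Dd(1) Us(1)] Us(2) by simp
  then have "Span E Us \<subseteq> I" using Span_least I by blast
  moreover have "module_over D (Span E Us)"
   using module_over_Span(1)[OF E(1) Us(1)] E(2) unfolding module_over_def by auto
  then have "I \<subseteq> Span E Us" unfolding Us(2) using Span_least module_over_Span(2)[OF E(1) Us(1)] by blast
  ultimately show "fg_module E I" unfolding fg_module_def using Us(1) by blast
 qed
 have max: "maximalideal P (sub_ring E)" if P: "prime_in E P" and P0: "P \<noteq> {\<zero>}" for P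
 proof -
  have Pm: "module_over E P" "P \<subseteq> E" "\<one> \<notin> P" using P unfolding prime_in_def by auto
  note Pq = module_overD[OF Pm(1)]
  have int: "integral D x" if "x \<in> E" for x using integral_if_mem_fg[OF Dd(2) E(1) fg that] .
  obtain y where y: "y \<in> P" "y \<noteq> \<zero>" using P0 Pq(2) by auto
  obtain c where c: "c \<in> P \<inter> D" "c \<noteq> \<zero>"
   using prime_contains_const_term(1)[OF Dd(1) E P _ int y] y Pm(2) by blast
  then have "P \<inter> D \<noteq> {\<zero>}" by auto
  then have mD: "maximalideal (P \<inter> D) (sub_ring D)"
   using Dd(4) prime_contraction[OF Dd(1) E P] by blast
  show ?thesis unfolding maximalideal_sub_ring_iff[OF E(1)]
  proof (intro conjI allI impI Pm)
   fix J assume J: "module_over E J \<and> J \<subseteq> E \<and> P \<subseteq> J"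
   note Jq = module_overD[OF conjunct1[OF J]]
   show "J = P \<or> \<one> \<in> J"
   proof (rule disjCI)
    assume "\<one> \<notin> J"
    show "J = P"
    proof (rule ccontr)
     assume "J \<noteq> P"
     then obtain x where x: "x \<in> J" "x \<notin> P" using J by auto
     have xE: "x \<in> E" using x J by auto
     obtain c p y where c: "c \<in> D - P" "p \<in> P" "y \<in> E" "c = p \<oplus> y \<otimes> x"
      using prime_contains_const_term(2)[OF Dd(1) E P xE int[OF xE] x(2)] by auto
     have cJ: "c \<in> J" using c J Jq(3,4) x(1) by auto
     have "module_over D (J \<inter> D)" using Jq Dp E(2) unfolding module_over_def by auto
     then have "J \<inter> D = P \<inter> D"
      using prime_in_maximal_eq[OF Dd(1) mD] J \<open>\<one> \<notin> J\<close> by blast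
     then show False using c(1) cJ by auto
    qed
   qed
  qed
 qed
 have ic: "x \<in> E" if "x \<in> quotient_field E" "integral E x" for x
 proof -
  have "x \<in> carrier R" using that(1) subfieldE(3)[OF quotient_field_subfield(1)[OF E(1)]] by auto
  then show ?thesis using closed[OF that(1)] integral_trans[OF Dd(2) E(1) fg _ that(2)] by simp
 qed
 show ?thesis unfolding dedekind_domain_def
  using E(1) noethE noetherian_subring_iff[OF E(1)] ic max primeideal_sub_ring_iff[OF E(1)] by auto
qed

lemma few_roots:
 assumes h: "set h \<subseteq> carrier R" and S: "S \<subseteq> carrier R" "length h \<le> card S" "\<And>b. b \<in> S ==> eval h b = \<zero>"
 shows "set h \<subseteq> {\<zero>}"
proof (rule ccontr)
 assume neg: "\<not> set h \<subseteq> {\<zero>}"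
 define p where "p = normalize h"
 have p: "p \<in> carrier (poly_ring R)" using normalize_gives_polynomial[OF h] univ_poly_carrier unfolding p_def by blast
 have ne: "p \<noteq> []" using neg h unfolding p_def by (induction h) (auto split: if_splits)
 have len: "length p \<le> length h" unfolding p_def by (rule normalize_length_le)
 have "S \<subseteq> set_mset (roots p)"
 proof
  fix b assume b: "b \<in> S"
  then have "eval p b = \<zero>" using eval_normalize[OF h, of b] S unfolding p_def by auto
  then show "b \<in># roots p" using roots_mem_iff_is_root[OF p] ne b S(1) unfolding is_root_def by auto
 qed
 then have "card S \<le> card (set_mset (roots p))" by (simp add: card_mono)
 also have "\<dots> \<le> size (roots p)" 
  unfolding size_multiset_overloaded_eq card_eq_sum by (intro sum_mono) (simp add: Suc_leI)
 also have "\<dots> \<le> degree p" by (rule size_roots_le_degree[OF p])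
 finally show False using len S(2) ne by (cases p) auto
qed

end

text \<open>One step of the tower: \<open>X\<^sup>n + g\<close> is irreducible over the quotient field of \<open>D\<close>, has \<open>n\<close> distinct roots, and
 \<open>t\<close> is one of them.\<close>

locale monogenic_dedekind = field R for R (structure) +
 fixes D g t
 assumes ded: "dedekind_domain D" and g: "set g \<subseteq> D" and t: "t \<in> carrier R" "eval (\<one> # g) t = \<zero>"
  and ind: "powers_independent (quotient_field D) (length g) t"
  and sep: "card {b \<in> carrier R. eval (\<one> # g) b = \<zero>} = length g"
begin

definition L :: "'a set" where "L = simple_extension (quotient_field D) t"
definition E :: "'a set" where "E = {x \<in> L. integral D x}"

lemmas Dd = dedekind_domainD[OF ded]
lemmas Dp = subringE[OF Dd(1)]
lemmas F = quotient_field_subfield[OF Dd(1)]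
lemmas Fp = subringE[OF subfieldE(1)[OF F(1)]]

lemma gF: "set g \<subseteq> quotient_field D" using g F(2) by auto

lemmas Irr_t = monic_list_eq_Irr[OF F(1) t(1) gF t(2) ind]

lemma length_pos: "length g > 0" by (rule monic_root_nonconst[OF t])

lemma L_subfield: "subfield L R"
 unfolding L_def using simple_extension_is_subfield[OF F(1) t(1)] Irr_t(1) by (simp add: over_def)

lemma F_incl_L: "quotient_field D \<subseteq> L" "t \<in> L"
 unfolding L_def using simple_extension_incl[OF Fp(1) t(1)] simple_extension_mem[OF subfieldE(1)[OF F(1)] t(1)]
  Fp(3) by auto

lemma L_dimension: "dimension (length g) (quotient_field D) L"
 using dimension_simple_extension[OF F(1) t(1) Irr_t(1)] Irr_t(2) unfolding L_def by simp

lemma E_subring: "subring E R"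
 unfolding E_def by (rule integral_closure_subring[OF Dd(2) subfieldE(1)[OF L_subfield]])

lemma D_incl_E: "D \<subseteq> E" and t_in_E: "t \<in> E"
 unfolding E_def using integral_mem[OF Dd(1)] F(2) F_incl_L integral_iff_list[OF Dd(1)] g t(2) by auto

lemmas Ep = subringE[OF E_subring]

lemma conj_lift:
 assumes "b \<in> carrier R" "eval (\<one> # g) b = \<zero>"
 shows "hom_lift R R (quotient_field D) g t id b"
proof (intro hom_lift.intro hom_eval.intro hom_eval_axioms.intro hom_lift_axioms.intro domain_axioms)
 show "subring (quotient_field D) R" by (rule subfieldE(1)[OF F(1)])
 show "id \<in> ring_hom (sub_ring (quotient_field D)) R"
  by (rule ring_hom_memI) (use Fp(1) in auto)
qed (use gF t ind assms in \<open>simp_all only: list.map_id\<close>)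

lemma mem_L: "x \<in> L \<longleftrightarrow> (\<exists>h. set h \<subseteq> quotient_field D \<and> length h = length g \<and> x = eval h t)"
 unfolding L_def by (rule hom_lift.mem_simple_extension[OF conj_lift[OF t]])

lemma L_denominator:
 assumes "x \<in> L"
 shows "\<exists>d \<in> D - {\<zero>}. d \<otimes> x \<in> E"
proof -
 obtain h where h: "set h \<subseteq> quotient_field D" "x = eval h t" using assms mem_L by auto
 obtain d where d: "d \<in> D - {\<zero>}" "\<forall>c \<in> set h. d \<otimes> c \<in> D"
  using common_denominator[OF Dd(1) prime_in_zero[OF Dd(1)]] h(1) quotient_field_eq by metis
 have dc: "d \<in> carrier R" using d Dp(1) by auto
 have hc: "set h \<subseteq> carrier R" using h Fp(1) by auto
 have "d \<otimes> x = eval (map ((\<otimes>) d) h) t" unfolding h(2) by (rule eval_map_mult[OF dc hc t(1), symmetric])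
 moreover have "eval (map ((\<otimes>) d) h) t \<in> E"
 proof (rule eval_closed_module[OF _ E_subring _ t_in_E])
  show "module_over E E" unfolding module_over_def using Ep by auto
  show "set (map ((\<otimes>) d) h) \<subseteq> E" using d(2) D_incl_E by auto
 qed (use Ep in auto)
 ultimately show ?thesis using d(1) by metis
qed

lemma quotient_field_E: "quotient_field E = L"
proof
 note mem = localization_mem_iff[OF E_subring prime_in_zero[OF E_subring], folded quotient_field_eq]
 have EL: "E \<subseteq> L" unfolding E_def by auto
 show "quotient_field E \<subseteq> L"
 proof
  fix x assume "x \<in> quotient_field E"
  then obtain a b where "a \<in> E" "b \<in> E - {\<zero>}" "x = a \<otimes> inv b" unfolding quotient_field_def by auto
  then show "x \<in> L" using EL subfield_m_inv(1)[OF L_subfield, of b] subringE(6)[OF subfieldE(1)[OF L_subfield]] by auto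
 qed
 show "L \<subseteq> quotient_field E"
 proof
  fix x assume x: "x \<in> L"
  then obtain d where "d \<in> D - {\<zero>}" "d \<otimes> x \<in> E" using L_denominator by blast
  then show "x \<in> quotient_field E" using mem[of x] x D_incl_E subfieldE(3)[OF L_subfield] by blast
 qed
qed

lemma conj_integral:
 assumes h: "set h \<subseteq> quotient_field D" and int: "integral D (eval h t)" and b: "b \<in> carrier R" "eval (\<one> # g) b = \<zero>"
 shows "integral D (eval h b)"
proof -
 interpret H: hom_lift R R "quotient_field D" g t id b by (rule conj_lift[OF b])
 have hc: "set h \<subseteq> carrier R" using h Fp(1) by auto
 obtain q where q: "set q \<subseteq> D" "eval (\<one> # q) (eval h t) = \<zero>" using int integral_iff_list[OF Dd(1)] by auto
 have Lr: "subring L R" by (rule subfieldE(1)[OF L_subfield])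
 note Lp = subringE[OF Lr]
 have xL: "eval h t \<in> L" unfolding L_def using mem_simple_extension_iff_eval[OF Fp(1) t(1)] h by blast
 have qL: "set (\<one> # q) \<subseteq> L" using q(1) F(2) F_incl_L(1) Lp(3) by auto
 have "map H.lift (\<one> # q) = \<one> # q" using H.lift_extends q(1) F(2) Fp(3) by (auto intro!: map_idI)
 then have "eval (\<one> # q) (eval h b) = \<zero>"
  using H.lift_eval_in_extension(1)[OF qL[unfolded L_def] xL[unfolded L_def]] q(2) H.lift_zero_one(1) H.lift_eval[OF h]
  by (metis list.map_id)
 then show ?thesis using q(1) integral_iff_list[OF Dd(1)] by blast
qed

text \<open>For \<open>x = h(t)\<close> integral over \<open>D\<close> all conjugates \<open>h(b)\<close> are integral, so Lagrange interpolation bounds the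
 denominators of the coefficients of \<open>h\<close>. Thus a multiple of \<open>E\<close> lies in the finite \<open>D\<close>-module \<open>D[t]\<close>.\<close>

lemma E_fg: "fg_module D E"
proof -
 define B where "B = {x \<in> carrier R. integral D x}"
 have B: "subring B R" unfolding B_def by (rule integral_closure_subring[OF Dd(2) carrier_is_subring])
 have DB: "D \<subseteq> B" unfolding B_def using integral_mem[OF Dd(1)] Dp(1) by auto
 have "finite {b \<in> carrier R. eval (\<one> # g) b = \<zero>}" using sep length_pos by (metis card_ge_0_finite)
 then obtain bs where bs: "set bs = {b \<in> carrier R. eval (\<one> # g) b = \<zero>}" "distinct bs"
  using finite_distinct_list by blast
 have len: "length bs = length g" using distinct_card[OF bs(2)] bs(1) sep by simp
 have bsB: "set bs \<subseteq> B" unfolding bs(1) B_def using integral_iff_list[OF Dd(1)] g by auto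
 have den: "\<exists>d \<in> D - {\<zero>}. d \<otimes> inv x \<in> B" if x: "x \<in> B" "x \<noteq> \<zero>" for x
 proof -
  have xc: "x \<in> carrier R" using x unfolding B_def by auto
  obtain q where q: "set q \<subseteq> D" "eval (\<one> # q) x = \<zero>"
   using x integral_iff_list[OF Dd(1)] unfolding B_def by auto
  have "\<one> # q \<in> carrier ((quotient_field D)[X])"
   unfolding sym[OF univ_poly_carrier] polynomial_def using q(1) F(2) Fp(3) by auto
  then have "(algebraic over (quotient_field D)) x" using algebraicI[of "\<one> # q"] q(2) by (simp add: over_def)
  then have xa: "x \<in> {x \<in> carrier R. (algebraic over (quotient_field D)) x}" using xc by simp
  have "inv x \<in> {x \<in> carrier R. (algebraic over (quotient_field D)) x} - {\<zero>}"
   by (rule subfield_m_inv(1)[OF subfield_of_algebraics[OF F(1)]]) (use xa x in blast)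
  then have "inv x \<in> carrier R" "(algebraic over (quotient_field D)) (inv x)" by auto
  then obtain e where "e \<in> D - {\<zero>}" "integral D (e \<otimes> inv x)"
   using algebraic_denominator[OF Dd(1)] by blast
  then show ?thesis using Dp(1) \<open>inv x \<in> carrier R\<close> unfolding B_def by blast
 qed
 obtain d where d: "d \<in> D - {\<zero>}" "\<And>h c. set h \<subseteq> carrier R ==> length h = length bs ==>
   (\<forall>b \<in> set bs. eval h b \<in> B) ==> c \<in> set h ==> d \<otimes> c \<in> B"
  using lagrange_denominator[OF Dd(1) B DB den bs(2) bsB] by metis
 have dc: "d \<in> carrier R" "d \<noteq> \<zero>" using d Dp(1) by auto
 have "(\<otimes>) d ` E \<subseteq> adjoin_module D t (length g)"
 proof
  fix y assume "y \<in> (\<otimes>) d ` E"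
  then obtain x where x: "x \<in> L" "integral D x" "y = d \<otimes> x" unfolding E_def by auto
  then obtain h where h: "set h \<subseteq> quotient_field D" "length h = length g" "x = eval h t" using mem_L by auto
  have hc: "set h \<subseteq> carrier R" using h Fp(1) by auto
  have "\<forall>b \<in> set bs. eval h b \<in> B"
   using conj_integral[OF h(1)] x(2) h(3) bs(1) eval_in_carrier[OF hc] unfolding B_def by auto
  then have "d \<otimes> c \<in> B" if "c \<in> set h" for c using d(2)[OF hc] h(2) len that by simp
  moreover have "d \<otimes> c \<in> quotient_field D" if "c \<in> set h" for c
   using that h(1) d(1) F(2) Fp(6) by auto
  ultimately have "set (map ((\<otimes>) d) h) \<subseteq> D" using Dd(3) unfolding B_def by auto
  moreover have "y = eval (map ((\<otimes>) d) h) t" using eval_map_mult[OF dc(1) hc t(1)] x(3) h(3) by simp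
  ultimately show "y \<in> adjoin_module D t (length g)" using adjoin_moduleI[of "map ((\<otimes>) d) h"] h(2) by simp
 qed
 moreover have "module_over D ((\<otimes>) d ` E)"
 proof -
  have *: "d \<otimes> x \<oplus> d \<otimes> y = d \<otimes> (x \<oplus> y)" "a \<otimes> (d \<otimes> x) = d \<otimes> (a \<otimes> x)" "d \<otimes> \<zero> = \<zero>"
   if "x \<in> E" "y \<in> E" "a \<in> D" for x y a
   using that dc Ep(1) Dp(1) by (auto simp: r_distr m_lcomm subset_iff)
  show ?thesis unfolding module_over_def
  proof (intro conjI ballI)
   show "(\<otimes>) d ` E \<subseteq> carrier R" using dc Ep(1) by auto
   show "\<zero> \<in> (\<otimes>) d ` E" using *(3) Ep(2) Dp(2) by (metis imageI)
   fix u assume "u \<in> (\<otimes>) d ` E"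
   then obtain x where x: "x \<in> E" "u = d \<otimes> x" by auto
   { fix w assume "w \<in> (\<otimes>) d ` E"
    then obtain y where y: "y \<in> E" "w = d \<otimes> y" by auto
    show "u \<oplus> w \<in> (\<otimes>) d ` E" using x y *(1)[OF x(1) y(1) Dp(2)] Ep(7)[OF x(1) y(1)] by simp }
   fix a assume a: "a \<in> D"
   show "a \<otimes> u \<in> (\<otimes>) d ` E" using x a *(2)[OF x(1) x(1) a] Ep(6)[of a x] D_incl_E by auto
  qed
 qed
 ultimately have "fg_module D ((\<otimes>) d ` E)"
  using fg_submodule[OF Dd(2) _ adjoin_module_fg[OF Dd(1) fg_module_self[OF Dd(1)] t(1)]] by blast
 moreover have di: "inv d \<in> carrier R" "inv d \<otimes> d = \<one>" using dc field_Units by auto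
 ultimately have "fg_module D ((\<otimes>) (inv d) ` ((\<otimes>) d ` E))" using fg_module_mult[OF Dd(1)] by blast
 moreover have "(\<otimes>) (inv d) ` ((\<otimes>) d ` E) = E"
 proof -
  have "inv d \<otimes> (d \<otimes> x) = x" if "x \<in> E" for x
   using that di dc Ep(1) by (metis m_assoc l_one subsetD)
  then show ?thesis by (auto simp: image_image)
 qed
 ultimately show ?thesis by simp
qed

lemma E_dedekind: "dedekind_domain E"
 by (rule dedekind_domain_finite_extension[OF ded E_subring D_incl_E E_fg])
   (simp add: quotient_field_E, simp add: E_def)

end

section \<open>Places\<close>

definition (in ring) place_kernel :: "'a set \<Rightarrow> 'c ring \<Rightarrow> ('a \<Rightarrow> 'c) \<Rightarrow> 'a set"
 where "place_kernel E C \<phi> = {x \<in> E. \<phi> x = \<zero>\<^bsub>C\<^esub>}"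

text \<open>Maximal ideals with finite residue field are handled as kernels of homomorphisms into a fixed field. The
 target stays the same for all places over a given maximal ideal, so that degrees need no quotient rings.\<close>

definition (in ring) is_place :: "'a set \<Rightarrow> 'c ring \<Rightarrow> ('a \<Rightarrow> 'c) \<Rightarrow> bool"
 where "is_place E C \<phi> \<longleftrightarrow> subring E R \<and> field C \<and> \<phi> \<in> ring_hom (sub_ring E) C \<and> finite (\<phi> ` E)"

text \<open>The set \<open>\<Psi>\<close> contains exactly one extension of \<open>\<phi>\<close> to \<open>E\<close> for each maximal ideal of \<open>E\<close> over the kernel of
 \<open>\<phi>\<close>, and each of these is unramified: locally the kernel of \<open>\<psi>\<close> is generated by the kernel of \<open>\<phi>\<close>.\<close>

definition (in ring) complete_lifts ::
  "'a set \<Rightarrow> 'a set \<Rightarrow> 'c ring \<Rightarrow> ('a \<Rightarrow> 'c) \<Rightarrow> ('a \<Rightarrow> 'c) set \<Rightarrow> bool"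
 where "complete_lifts D E C \<phi> \<Psi> \<longleftrightarrow> finite \<Psi> \<and> inj_on (place_kernel E C) \<Psi> \<and>
  (\<forall>\<psi> \<in> \<Psi>. is_place E C \<psi> \<and> (\<forall>a \<in> D. \<psi> a = \<phi> a) \<and>
   (\<forall>x \<in> place_kernel E C \<psi>. \<exists>s \<in> E. \<psi> s \<noteq> \<zero>\<^bsub>C\<^esub> \<and>
    s \<otimes> x \<in> Idl\<^bsub>sub_ring E\<^esub> (place_kernel D C \<phi>))) \<and>
  (\<forall>N. maximalideal N (sub_ring E) \<and> N \<inter> D = place_kernel D C \<phi> \<longrightarrow> N \<in> place_kernel E C ` \<Psi>)"

context field begin

lemma place_hom:
 assumes "is_place E C \<phi>"
 shows "ring_hom_ring (sub_ring E) C \<phi>"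
 using assms ring_hom_ringI2[OF subring_is_ring] field.is_ring
 unfolding is_place_def by (metis domain.axioms(1) field.axioms(1) cring.axioms(1))

lemma place_simps:
 assumes "is_place E C \<phi>"
 shows "\<phi> \<zero> = \<zero>\<^bsub>C\<^esub>" "\<phi> \<one> = \<one>\<^bsub>C\<^esub>" "\<one>\<^bsub>C\<^esub> \<noteq> \<zero>\<^bsub>C\<^esub>"
  "\<And>x. x \<in> E ==> \<phi> x \<in> carrier C"
  "\<And>x y. x \<in> E ==> y \<in> E ==> \<phi> (x \<oplus> y) = \<phi> x \<oplus>\<^bsub>C\<^esub> \<phi> y"
  "\<And>x y. x \<in> E ==> y \<in> E ==> \<phi> (x \<otimes> y) = \<phi> x \<otimes>\<^bsub>C\<^esub> \<phi> y"
  "\<And>x. x \<in> E ==> \<phi> (\<ominus> x) = \<ominus>\<^bsub>C\<^esub> \<phi> x"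
proof -
 interpret C: field C using assms unfolding is_place_def by simp
 interpret H: ring_hom_ring "sub_ring E" C \<phi> by (rule place_hom[OF assms])
 have E: "subring E R" using assms unfolding is_place_def by simp
 note Ep = subringE[OF E]
 show "\<phi> \<zero> = \<zero>\<^bsub>C\<^esub>" "\<phi> \<one> = \<one>\<^bsub>C\<^esub>" using H.hom_zero H.hom_one by auto
 show "\<one>\<^bsub>C\<^esub> \<noteq> \<zero>\<^bsub>C\<^esub>" by simp
 show cl: "\<And>x. x \<in> E ==> \<phi> x \<in> carrier C" using H.hom_closed by simp
 show add: "\<And>x y. x \<in> E ==> y \<in> E ==> \<phi> (x \<oplus> y) = \<phi> x \<oplus>\<^bsub>C\<^esub> \<phi> y" using H.hom_add by simp
 show "\<And>x y. x \<in> E ==> y \<in> E ==> \<phi> (x \<otimes> y) = \<phi> x \<otimes>\<^bsub>C\<^esub> \<phi> y" using H.hom_mult by simp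
 fix x assume x: "x \<in> E"
 have "\<phi> (\<ominus> x) \<oplus>\<^bsub>C\<^esub> \<phi> x = \<phi> (\<ominus> x \<oplus> x)" using add[of "\<ominus> x" x] x Ep(5) by simp
 also have "\<dots> = \<zero>\<^bsub>C\<^esub>" using x Ep(1) H.hom_zero by (auto simp: l_neg subset_iff)
 finally show "\<phi> (\<ominus> x) = \<ominus>\<^bsub>C\<^esub> \<phi> x"
  using C.minus_equality[of "\<phi> (\<ominus> x)" "\<phi> x"] cl x Ep(5) by simp
qed

lemma place_image_subfield:
 assumes "is_place E C \<phi>"
 shows "subfield (\<phi> ` E) C"
proof -
 interpret C: field C using assms unfolding is_place_def by simp
 interpret H: ring_hom_ring "sub_ring E" C \<phi> by (rule place_hom[OF assms])
 have "subring (\<phi> ` E) C" using H.img_is_subring[OF H.R.carrier_is_subring] by simp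
 then show ?thesis using C.finite_subring_is_subfield assms unfolding is_place_def by simp
qed

lemma place_inverse:
 assumes p: "is_place E C \<phi>" and x: "x \<in> E" "\<phi> x \<noteq> \<zero>\<^bsub>C\<^esub>"
 shows "\<exists>y \<in> E. \<phi> x \<otimes>\<^bsub>C\<^esub> \<phi> y = \<one>\<^bsub>C\<^esub>"
proof -
 interpret C: field C using p unfolding is_place_def by simp
 have "inv\<^bsub>C\<^esub> \<phi> x \<in> \<phi> ` E" "\<phi> x \<otimes>\<^bsub>C\<^esub> inv\<^bsub>C\<^esub> \<phi> x = \<one>\<^bsub>C\<^esub>"
  using C.subfield_m_inv[OF place_image_subfield[OF p], of "\<phi> x"] x by auto
 then show ?thesis by auto
qed

lemma place_kernel_maximal:
 assumes p: "is_place E C \<phi>"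
 shows "maximalideal (place_kernel E C \<phi>) (sub_ring E)" "prime_in E (place_kernel E C \<phi>)"
proof -
 interpret C: field C using p unfolding is_place_def by simp
 have E: "subring E R" using p unfolding is_place_def by simp
 note Ep = subringE[OF E] and ps = place_simps[OF p]
 have mod: "module_over E (place_kernel E C \<phi>)"
  unfolding module_over_def place_kernel_def using Ep ps by auto
 show "maximalideal (place_kernel E C \<phi>) (sub_ring E)"
  unfolding maximalideal_sub_ring_iff[OF E]
 proof (intro conjI allI impI mod)
  show "place_kernel E C \<phi> \<subseteq> E" "\<one> \<notin> place_kernel E C \<phi>" unfolding place_kernel_def using ps by auto
  fix J assume J: "module_over E J \<and> J \<subseteq> E \<and> place_kernel E C \<phi> \<subseteq> J"
  note Jp = module_overD[OF conjunct1[OF J]]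
  have "\<one> \<in> J" if "J \<noteq> place_kernel E C \<phi>"
  proof -
   from that
   obtain x where x: "x \<in> J" "x \<in> E" "\<phi> x \<noteq> \<zero>\<^bsub>C\<^esub>" using J unfolding place_kernel_def by auto
   obtain y where y: "y \<in> E" "\<phi> x \<otimes>\<^bsub>C\<^esub> \<phi> y = \<one>\<^bsub>C\<^esub>" using place_inverse[OF p x(2,3)] by auto
   have c: "x \<in> carrier R" "y \<in> carrier R" using x y Ep(1) by auto
   have "\<phi> (\<one> \<oplus> \<ominus> (y \<otimes> x)) = \<one>\<^bsub>C\<^esub> \<oplus>\<^bsub>C\<^esub> \<ominus>\<^bsub>C\<^esub> (\<phi> y \<otimes>\<^bsub>C\<^esub> \<phi> x)"
    using ps x y Ep by simp
   also have "\<dots> = \<zero>\<^bsub>C\<^esub>" using y(2) ps(4) x(2) y(1) C.m_comm[of "\<phi> x" "\<phi> y"] by (simp add: C.r_neg)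
   finally have "\<one> \<oplus> \<ominus> (y \<otimes> x) \<in> place_kernel E C \<phi>" unfolding place_kernel_def using x y Ep by auto
   then have "(\<one> \<oplus> \<ominus> (y \<otimes> x)) \<oplus> y \<otimes> x \<in> J" using J Jp(3) Jp(4)[OF y(1) x(1)] by blast
   moreover have "(\<one> \<oplus> \<ominus> (y \<otimes> x)) \<oplus> y \<otimes> x = \<one>" using c by algebra
   ultimately show "\<one> \<in> J" by simp
  qed
  then show "J = place_kernel E C \<phi> \<or> \<one> \<in> J" by blast
 qed
 then show "prime_in E (place_kernel E C \<phi>)" by (rule maximalideal_prime_in[OF E])
qed

text \<open>The value at \<open>x\<close> is \<open>f(s x) / f(s)\<close> for any admissible denominator \<open>s\<close>.\<close>

lemma extend_hom_to_fractions:
 assumes B: "subring B R" and C: "field C" and f: "f \<in> ring_hom (sub_ring B) C"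
  and E: "subring E R" "B \<subseteq> E"
  and frac: "\<And>x. x \<in> E ==> \<exists>s \<in> B. f s \<noteq> \<zero>\<^bsub>C\<^esub> \<and> s \<otimes> x \<in> B"
 shows "\<exists>f'. f' \<in> ring_hom (sub_ring E) C \<and> (\<forall>x \<in> B. f' x = f x)"
proof -
 interpret C: field C by (rule C)
 interpret H: ring_hom_ring "sub_ring B" C f
  by (rule ring_hom_ringI2[OF subring_is_ring[OF B] C.ring_axioms f])
 note Bp = subringE[OF B] and Ep = subringE[OF E(1)]
 have fc: "f x \<in> carrier C" if "x \<in> B" for x using H.hom_closed that by simp
 have fm: "f (x \<otimes> y) = f x \<otimes>\<^bsub>C\<^esub> f y" if "x \<in> B" "y \<in> B" for x y using H.hom_mult that by simp
 have fa: "f (x \<oplus> y) = f x \<oplus>\<^bsub>C\<^esub> f y" if "x \<in> B" "y \<in> B" for x y using H.hom_add that by simp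
 have f1: "f \<one> = \<one>\<^bsub>C\<^esub>" using H.hom_one by simp
 define sel where "sel x = (SOME s. s \<in> B \<and> f s \<noteq> \<zero>\<^bsub>C\<^esub> \<and> s \<otimes> x \<in> B)" for x
 have sel: "sel x \<in> B" "f (sel x) \<noteq> \<zero>\<^bsub>C\<^esub>" "sel x \<otimes> x \<in> B" if "x \<in> E" for x
  using someI_ex[of "\<lambda>s. s \<in> B \<and> f s \<noteq> \<zero>\<^bsub>C\<^esub> \<and> s \<otimes> x \<in> B"] frac[OF that] unfolding sel_def by blast+
 define f' where "f' x = inv\<^bsub>C\<^esub> f (sel x) \<otimes>\<^bsub>C\<^esub> f (sel x \<otimes> x)" for x
 have cancel: "y = z" if "a \<in> carrier C" "a \<noteq> \<zero>\<^bsub>C\<^esub>" "y \<in> carrier C" "z \<in> carrier C" "a \<otimes>\<^bsub>C\<^esub> y = a \<otimes>\<^bsub>C\<^esub> z" for a y z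
  using C.m_lcancel[OF that(2,1,3,4)] that(5) by simp
 have f'c: "f' x \<in> carrier C" if "x \<in> E" for x
  unfolding f'_def using sel[OF that] fc C.field_Units by auto
 have sf': "f (sel x) \<otimes>\<^bsub>C\<^esub> f' x = f (sel x \<otimes> x)" if "x \<in> E" for x
 proof -
  have "f (sel x) \<in> carrier C" "inv\<^bsub>C\<^esub> f (sel x) \<in> carrier C" "f (sel x) \<otimes>\<^bsub>C\<^esub> inv\<^bsub>C\<^esub> f (sel x) = \<one>\<^bsub>C\<^esub>"
   using sel[OF that] fc C.field_Units by auto
  moreover have "f (sel x \<otimes> x) \<in> carrier C" using sel[OF that] fc by auto
  ultimately show ?thesis unfolding f'_def by (simp add: C.m_assoc[symmetric])
 qed
 have char: "f s \<otimes>\<^bsub>C\<^esub> f' x = f (s \<otimes> x)" if x: "x \<in> E" and s: "s \<in> B" "s \<otimes> x \<in> B" for s x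
 proof (rule cancel[of "f (sel x)"])
  have c: "x \<in> carrier R" "s \<in> carrier R" "sel x \<in> carrier R" using x s sel[OF x] Bp(1) Ep(1) by auto
  have "f (sel x) \<otimes>\<^bsub>C\<^esub> (f s \<otimes>\<^bsub>C\<^esub> f' x) = f s \<otimes>\<^bsub>C\<^esub> f (sel x \<otimes> x)"
   using sf'[OF x] fc s(1) sel(1)[OF x] f'c[OF x] by (metis C.m_lcomm)
  also have "\<dots> = f (s \<otimes> (sel x \<otimes> x))" using fm[OF s(1) sel(3)[OF x]] by simp
  also have "s \<otimes> (sel x \<otimes> x) = sel x \<otimes> (s \<otimes> x)" using c by (simp add: m_lcomm)
  also have "f \<dots> = f (sel x) \<otimes>\<^bsub>C\<^esub> f (s \<otimes> x)" using fm[OF sel(1)[OF x] s(2)] by simp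
  finally show "f (sel x) \<otimes>\<^bsub>C\<^esub> (f s \<otimes>\<^bsub>C\<^esub> f' x) = f (sel x) \<otimes>\<^bsub>C\<^esub> f (s \<otimes> x)" .
 qed (use fc f'c x s sel[OF x] in auto)
 have eqI: "f' x = y" if x: "x \<in> E" and s: "s \<in> B" "f s \<noteq> \<zero>\<^bsub>C\<^esub>" "s \<otimes> x \<in> B" and y: "y \<in> carrier C" "f s \<otimes>\<^bsub>C\<^esub> y = f (s \<otimes> x)" for x s y
  by (rule cancel[of "f s"]) (use char[OF x s(1,3)] fc f'c s x y in auto)
 have ext: "f' x = f x" if x: "x \<in> B" for x
  by (rule eqI[of x \<one>]) (use x E(2) Bp f1 fc in \<open>auto simp: subset_iff\<close>)
 have "f' \<in> ring_hom (sub_ring E) C"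
 proof (rule ring_hom_memI)
  fix x assume "x \<in> carrier (sub_ring E)"
  then have x: "x \<in> E" by simp
  then show "f' x \<in> carrier C" by (rule f'c)
  fix y assume "y \<in> carrier (sub_ring E)"
  then have y: "y \<in> E" by simp
  let ?s = "sel x" and ?r = "sel y"
  note sx = sel[OF x] and sy = sel[OF y]
  have c: "x \<in> carrier R" "y \<in> carrier R" "?s \<in> carrier R" "?r \<in> carrier R" using x y sx sy Bp(1) Ep(1) by auto
  have cc: "f ?s \<in> carrier C" "f ?r \<in> carrier C" "f' x \<in> carrier C" "f' y \<in> carrier C" using sx sy x y fc f'c by auto
  have srB: "?s \<otimes> ?r \<in> B" "f (?s \<otimes> ?r) \<noteq> \<zero>\<^bsub>C\<^esub>" "f (?s \<otimes> ?r) = f ?s \<otimes>\<^bsub>C\<^esub> f ?r"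
   using sx sy Bp(6) fm cc C.integral_iff by auto
  have e1: "(?s \<otimes> ?r) \<otimes> (x \<otimes> y) = (?s \<otimes> x) \<otimes> (?r \<otimes> y)" using c by (simp add: m_ac)
  have e2: "(?s \<otimes> ?r) \<otimes> (x \<oplus> y) = ?r \<otimes> (?s \<otimes> x) \<oplus> ?s \<otimes> (?r \<otimes> y)" using c by algebra
  have "f' (x \<otimes> y) = f' x \<otimes>\<^bsub>C\<^esub> f' y"
  proof (rule eqI[of _ "?s \<otimes> ?r"])
   show "x \<otimes> y \<in> E" using x y Ep(6) by simp
   show "?s \<otimes> ?r \<otimes> (x \<otimes> y) \<in> B" unfolding e1 using sx sy Bp(6) by simp
   have "f (?s \<otimes> ?r) \<otimes>\<^bsub>C\<^esub> (f' x \<otimes>\<^bsub>C\<^esub> f' y) = (f ?s \<otimes>\<^bsub>C\<^esub> f' x) \<otimes>\<^bsub>C\<^esub> (f ?r \<otimes>\<^bsub>C\<^esub> f' y)"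
    unfolding srB(3) using cc by (simp add: C.m_ac)
   also have "\<dots> = f ((?s \<otimes> x) \<otimes> (?r \<otimes> y))" using sf'[OF x] sf'[OF y] fm sx sy by simp
   finally show "f (?s \<otimes> ?r) \<otimes>\<^bsub>C\<^esub> (f' x \<otimes>\<^bsub>C\<^esub> f' y) = f (?s \<otimes> ?r \<otimes> (x \<otimes> y))" unfolding e1 .
  qed (use srB cc in auto)
  then show "f' (x \<otimes>\<^bsub>sub_ring E\<^esub> y) = f' x \<otimes>\<^bsub>C\<^esub> f' y" by simp
  have "f' (x \<oplus> y) = f' x \<oplus>\<^bsub>C\<^esub> f' y"
  proof (rule eqI[of _ "?s \<otimes> ?r"])
   show "x \<oplus> y \<in> E" using x y Ep(7) by simp
   show "?s \<otimes> ?r \<otimes> (x \<oplus> y) \<in> B" unfolding e2 using sx sy Bp(6,7) by simp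
   have "f (?s \<otimes> ?r) \<otimes>\<^bsub>C\<^esub> (f' x \<oplus>\<^bsub>C\<^esub> f' y) = f ?r \<otimes>\<^bsub>C\<^esub> (f ?s \<otimes>\<^bsub>C\<^esub> f' x) \<oplus>\<^bsub>C\<^esub> f ?s \<otimes>\<^bsub>C\<^esub> (f ?r \<otimes>\<^bsub>C\<^esub> f' y)"
    unfolding srB(3) using cc by (simp add: C.r_distr C.m_ac)
   also have "\<dots> = f (?r \<otimes> (?s \<otimes> x) \<oplus> ?s \<otimes> (?r \<otimes> y))" using sf'[OF x] sf'[OF y] fm fa sx sy Bp(6) by simp
   finally show "f (?s \<otimes> ?r) \<otimes>\<^bsub>C\<^esub> (f' x \<oplus>\<^bsub>C\<^esub> f' y) = f (?s \<otimes> ?r \<otimes> (x \<oplus> y))" unfolding e2 .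
  qed (use srB cc in auto)
  then show "f' (x \<oplus>\<^bsub>sub_ring E\<^esub> y) = f' x \<oplus>\<^bsub>C\<^esub> f' y" by simp
 next
  show "f' \<one>\<^bsub>sub_ring E\<^esub> = \<one>\<^bsub>C\<^esub>" using ext[OF Bp(3)] f1 by simp
 qed
 then show ?thesis using ext by blast
qed

lemma prime_avoidance_product:
 assumes E: "subring E R" and N: "prime_in E N" and T: "finite T"
  and Z: "\<And>b. b \<in> T ==> \<exists>x \<in> E - N. x \<in> Z b" "\<And>b x y. b \<in> T ==> x \<in> E ==> y \<in> Z b ==> x \<otimes> y \<in> Z b"
  and ZE: "\<And>b. b \<in> T ==> Z b \<subseteq> E"
 shows "\<exists>y \<in> E - N. \<forall>b \<in> T. y \<in> Z b"
 using T Z ZE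
proof (induction T rule: finite_induct)
 case empty
 then show ?case using subringE(3)[OF E] N unfolding prime_in_def by auto
next
 case (insert b T)
 have "\<exists>y \<in> E - N. \<forall>b \<in> T. y \<in> Z b" using insert.IH insert.prems by blast
 then obtain y where y: "y \<in> E - N" "\<forall>b \<in> T. y \<in> Z b" by auto
 obtain x where x: "x \<in> E - N" "x \<in> Z b" using insert.prems(1) by auto
 have "x \<otimes> y \<in> E - N" using x y N subringE(6)[OF E] unfolding prime_in_def by auto
 moreover have "x \<otimes> y \<in> Z c" if "c \<in> T" for c using insert.prems(2)[of c x y] x y that by auto
 moreover have "x \<otimes> y \<in> Z b"
 proof -
  have "x \<otimes> y = y \<otimes> x" using x y subringE(1)[OF E] by (intro m_comm) auto
  then show ?thesis using insert.prems(2)[of b y x] x y by auto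
 qed
 ultimately show ?case by (intro bexI[of _ "x \<otimes> y"]) auto
qed

text \<open>A valuation ring orders the coefficients by divisibility; take one of least value.\<close>

lemma valuation_pivot:
 assumes F: "subfield F R" and V: "subring V R" and val: "\<And>x. x \<in> F ==> x \<in> V \<or> (x \<noteq> \<zero> \<and> inv x \<in> V)"
  and h: "set h \<subseteq> F" "\<not> set h \<subseteq> {\<zero>}"
 shows "\<exists>c \<in> set h. c \<noteq> \<zero> \<and> (\<forall>b \<in> set h. inv c \<otimes> b \<in> V)"
 using h
proof (induction h)
 case (Cons a h)
 note Fp = subringE[OF subfieldE(1)[OF F]] and Vp = subringE[OF V]
 have aF: "a \<in> F" "a \<in> carrier R" using Cons.prems Fp(1) by auto
 show ?case
 proof (cases "set h \<subseteq> {\<zero>}")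
  case True
  then have "a \<noteq> \<zero>" using Cons.prems by auto
  then have "inv a \<in> carrier R" "inv a \<otimes> a = \<one>" using aF field_Units by auto
  then show ?thesis using True \<open>a \<noteq> \<zero>\<close> Vp by (intro bexI[of _ a]) auto
 next
  case False
  then obtain c where c: "c \<in> set h" "c \<noteq> \<zero>" "\<forall>b \<in> set h. inv c \<otimes> b \<in> V" using Cons by auto
  have cF: "c \<in> carrier R" "c \<in> F" "inv c \<in> carrier R" "inv c \<in> F" "c \<otimes> inv c = \<one>"
   using c Cons.prems Fp(1) field_Units subfield_m_inv(1)[OF F, of c] by auto
  show ?thesis
  proof (cases "inv c \<otimes> a \<in> V")
   case True
   then show ?thesis using c by (intro bexI[of _ c]) auto
  next
   case False
   define z where "z = inv c \<otimes> a"
   have zF: "z \<in> F" "z \<in> carrier R" unfolding z_def using cF aF Fp(6) by auto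
   have z: "z \<noteq> \<zero>" "inv z \<in> V" using val[OF zF(1)] False unfolding z_def by auto
   then have a0: "a \<noteq> \<zero>" unfolding z_def using cF by auto
   have ia: "inv a \<in> carrier R" "a \<otimes> inv a = \<one>" using a0 aF field_Units by auto
   have iz: "inv z = inv a \<otimes> c"
   proof (rule comm_inv_char)
    have "z \<otimes> (inv a \<otimes> c) = (a \<otimes> inv a) \<otimes> (c \<otimes> inv c)" unfolding z_def using aF cF(1,3) ia(1) by (simp add: m_ac)
    then show "z \<otimes> (inv a \<otimes> c) = \<one>" using ia cF by simp
   qed (use zF ia cF in auto)
   have "inv a \<otimes> b \<in> V" if b: "b \<in> set (a # h)" for b
   proof (cases "b = a")
    case True
    then show ?thesis using ia aF Vp(3) m_comm by simp
   next
    case False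
    then have bh: "b \<in> set h" "b \<in> carrier R" using b Cons.prems Fp(1) by auto
    have "(inv a \<otimes> c) \<otimes> (inv c \<otimes> b) = inv a \<otimes> ((c \<otimes> inv c) \<otimes> b)" using ia(1) cF(1,3) bh(2) by (simp add: m_assoc)
    then have "inv a \<otimes> b = inv z \<otimes> (inv c \<otimes> b)" using iz cF ia bh by simp
    then show ?thesis using Vp(6) z(2) c(3) bh(1) by simp
   qed
   then show ?thesis using a0 by (intro bexI[of _ a]) auto
  qed
 qed
qed simp

end

section \<open>Places of a monogenic extension\<close>

text \<open>The reduction of \<open>X\<^sup>n + g\<close> at the place \<open>\<phi>\<close> has \<open>n\<close> distinct roots. Then the places of \<open>E\<close> over \<open>\<phi>\<close> are
 \<open>t \<mapsto> b\<close> for these roots \<open>b\<close>, and two roots give the same maximal ideal iff they are conjugate over \<open>\<phi> ` D\<close>.\<close>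

locale monogenic_place = monogenic_dedekind R D g t for R (structure) and D g t +
 fixes C :: "'c ring" and \<phi> :: "'a \<Rightarrow> 'c"
 assumes place: "is_place D C \<phi>" and kernel_nonzero: "place_kernel D C \<phi> \<noteq> {\<zero>}"
  and roots: "card {b \<in> carrier C. ring.eval C (map \<phi> (\<one> # g)) b = \<zero>\<^bsub>C\<^esub>} = length g"
begin

sublocale C: field C using place unfolding is_place_def by simp

definition "M = place_kernel D C \<phi>"
definition "B = {b \<in> carrier C. C.eval (map \<phi> (\<one> # g)) b = \<zero>\<^bsub>C\<^esub>}"

lemmas ps = place_simps[OF place]
lemmas Mm = place_kernel_maximal[OF place, folded M_def]

lemma finB: "finite B" using roots length_pos unfolding B_def by (metis card_ge_0_finite)

lemma hom_lift_place: "b \<in> B ==> hom_lift R C D g t \<phi> b"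
proof (intro hom_lift.intro hom_eval.intro hom_eval_axioms.intro hom_lift_axioms.intro domain_axioms C.domain_axioms)
 show "\<phi> \<in> ring_hom (sub_ring D) C" using place unfolding is_place_def by simp
 show "powers_independent D (length g) t" using ind F(2) unfolding powers_independent_def by blast
qed (use Dd(1) g t in \<open>auto simp: B_def\<close>)

lemma mem_M: "x \<in> M \<longleftrightarrow> x \<in> D \<and> \<phi> x = \<zero>\<^bsub>C\<^esub>" unfolding M_def place_kernel_def by auto

lemma valuation: "x \<in> quotient_field D ==> x \<in> localization D M \<or> (x \<noteq> \<zero> \<and> inv x \<in> localization D M)"
 using dvr_valuation[OF dedekind_localization_dvr[OF ded Mm(1)]] kernel_nonzero unfolding M_def by blast

lemma all_roots_zero:
 assumes h: "set h \<subseteq> D" "length h \<le> length g" and z: "\<And>b. b \<in> B ==> C.eval (map \<phi> h) b = \<zero>\<^bsub>C\<^esub>"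
 shows "set h \<subseteq> M"
proof -
 have "set (map \<phi> h) \<subseteq> carrier C" using h(1) ps(4) by auto
 then have "set (map \<phi> h) \<subseteq> {\<zero>\<^bsub>C\<^esub>}"
  by (rule C.few_roots[of _ B]) (use z h(2) roots in \<open>auto simp: B_def\<close>)
 then show ?thesis using h(1) mem_M by auto
qed

lemma eval_zeros: "set p \<subseteq> {\<zero>\<^bsub>C\<^esub>} ==> b \<in> carrier C ==> C.eval p b = \<zero>\<^bsub>C\<^esub>"
 by (induction p) auto

text \<open>Locally at the kernel \<open>M\<close> of \<open>\<phi>\<close>, the integral closure is just \<open>D[t]\<close>. Otherwise some \<open>x\<close> in \<open>E\<close> has a
 coefficient \<open>c\<close> of least value outside the localization. Scaling by a suitable \<open>e \<in> M\<close> gives \<open>e x = h(t)\<close> with \<open>h\<close> over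
 \<open>D\<close> and one coefficient outside \<open>M\<close>. The monic equation of \<open>e x\<close> has its lower coefficients in \<open>M\<close>, so every
 \<open>t \<mapsto> b\<close> maps \<open>e x\<close> to zero. Hence the reduction of \<open>h\<close> has more roots than its degree allows.\<close>

lemma E_local:
 assumes x: "x \<in> E"
 shows "\<exists>s \<in> D. \<phi> s \<noteq> \<zero>\<^bsub>C\<^esub> \<and> (\<exists>h. set h \<subseteq> D \<and> length h = length g \<and> s \<otimes> x = eval h t)"
proof -
 note P = Mm(2)
 note Vs = localization_subring[OF Dd(1) P]
 note Vp = subringE[OF Vs(1)]
 have Mmod: "module_over D M" "M \<subseteq> D" using P unfolding prime_in_def by auto
 have xL: "x \<in> L" "integral D x" using x unfolding E_def by auto
 have xc: "x \<in> carrier R" using x Ep(1) by auto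
 obtain h where h: "set h \<subseteq> quotient_field D" "length h = length g" "x = eval h t" using xL(1) mem_L by auto
 have hc: "set h \<subseteq> carrier R" using h(1) Fp(1) by auto
 have inV: "set h \<subseteq> localization D M"
 proof (cases "set h \<subseteq> {\<zero>}")
  case True
  then show ?thesis using Vp(2) by auto
 next
  case False
  then obtain c where c: "c \<in> set h" "c \<noteq> \<zero>" "\<forall>b \<in> set h. inv c \<otimes> b \<in> localization D M"
   using valuation_pivot[OF F(1) Vs(1) valuation h(1)] by blast
  have cF: "c \<in> carrier R" "c \<in> quotient_field D" "inv c \<in> carrier R" "inv c \<in> quotient_field D" "c \<otimes> inv c = \<one>" "inv c \<otimes> c = \<one>"
   using c h(1) Fp(1) field_Units subfield_m_inv(1)[OF F(1), of c] by auto
  have "c \<in> localization D M"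
  proof (rule ccontr)
   assume cn: "c \<notin> localization D M"
   then have ci: "inv c \<in> localization D M" using valuation[OF cF(2)] by auto
   have cii: "inv (inv c) = c" using cF by (intro comm_inv_char) auto
   let ?h = "inv c # map ((\<otimes>) (inv c)) h"
   have hV: "set ?h \<subseteq> localization D M" using ci c(3) by auto
   obtain s where s: "s \<in> D - M" "\<forall>b \<in> set ?h. s \<otimes> b \<in> D"
    using common_denominator[OF Dd(1) P hV] by blast
   have sc: "s \<in> carrier R" using s(1) Dp(1) by auto
   define e where "e = s \<otimes> inv c"
   have eD: "e \<in> D" "e \<in> carrier R" using s(2) sc cF unfolding e_def by auto
   have eM: "e \<in> M"
   proof (rule ccontr)
    assume "e \<notin> M"
    then have "inv (inv c) \<in> localization D M"
     using localization_units[OF Dd(1) P ci] s(1) eD unfolding e_def by blast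
    then show False using cn cii by simp
   qed
   have ehD: "set (map ((\<otimes>) e) h) \<subseteq> D"
   proof -
    have "e \<otimes> b = s \<otimes> (inv c \<otimes> b)" if "b \<in> set h" for b
     using that hc sc cF unfolding e_def by (simp add: m_assoc subset_iff)
    then show ?thesis using s(2) by auto
   qed
   have ec: "e \<otimes> c = s" unfolding e_def using sc cF by (simp add: m_assoc)
   define z where "z = eval (map ((\<otimes>) e) h) t"
   have ze: "z = e \<otimes> x" unfolding z_def h(3) by (rule eval_map_mult[OF eD(2) hc t(1)])
   obtain q where q: "set q \<subseteq> D" "eval (\<one> # q) x = \<zero>" using xL(2) integral_iff_list[OF Dd(1)] by auto
   have qc: "set (\<one> # q) \<subseteq> carrier R" using q Dp(1) by auto
   have root: "eval (\<one> # scale_coeffs e 1 q) z = \<zero>"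
    using eval_scale_coeffs[OF eD(2) xc qc, of 0] q(2) eD(2) unfolding ze by simp
   have qM: "set (scale_coeffs e (Suc k) q) \<subseteq> M" for k using q(1)
   proof (induction q arbitrary: k)
    case (Cons a q)
    have "e [^] k \<in> D" using eD Dp(3,6) by (induction k) auto
    then have "e [^] k \<otimes> a \<in> D" using Cons.prems Dp(6) by simp
    moreover have "e [^] Suc k \<otimes> a = (e [^] k \<otimes> a) \<otimes> e"
     using eD(2) Cons.prems Dp(1) by (simp add: m_ac subset_iff)
    ultimately have "e [^] Suc k \<otimes> a \<in> M" using module_overD(4)[OF Mmod(1) _ eM] by simp
    then show ?case using Cons by simp
   qed simp
   have "set (map ((\<otimes>) e) h) \<subseteq> M"
   proof (rule all_roots_zero[OF ehD])
    fix b assume b: "b \<in> B"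
    interpret H: hom_lift R C D g t \<phi> b by (rule hom_lift_place[OF b])
    let ?S = "simple_extension D t" and ?q = "scale_coeffs e 1 q"
    have DS: "D \<subseteq> ?S" by (rule simple_extension_incl[OF Dp(1) t(1)])
    have zS: "z \<in> ?S" unfolding z_def H.mem_simple_extension using ehD h(2)
     by (intro exI[of _ "map ((\<otimes>) e) h"]) simp
    have qS: "set (\<one> # ?q) \<subseteq> ?S" using qM[of 0] Mmod(2) DS Dp(3) by auto
    note lift = H.lift_eval_in_extension[OF qS zS]
    have zc: "H.lift z \<in> carrier C" by (rule lift(2))
    have "H.lift a = \<zero>\<^bsub>C\<^esub>" if "a \<in> set ?q" for a
     using that qM[of 0] H.lift_extends[of a] mem_M by auto
    then have e0: "C.eval (map H.lift ?q) (H.lift z) = \<zero>\<^bsub>C\<^esub>" by (intro eval_zeros[OF _ zc]) auto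
    have "\<zero>\<^bsub>C\<^esub> = H.lift z [^]\<^bsub>C\<^esub> length ?q \<oplus>\<^bsub>C\<^esub> C.eval (map H.lift ?q) (H.lift z)"
     using lift(1) zc unfolding root H.lift_zero_one list.map C.eval.simps by simp
    then have "H.lift z [^]\<^bsub>C\<^esub> length ?q = \<zero>\<^bsub>C\<^esub>" unfolding e0 using zc by simp
    moreover have "H.lift z [^]\<^bsub>C\<^esub> (k::nat) = \<zero>\<^bsub>C\<^esub> ==> H.lift z = \<zero>\<^bsub>C\<^esub>" for k
     by (induction k) (use zc C.integral_iff in auto)
    ultimately have "H.lift z = \<zero>\<^bsub>C\<^esub>" by blast
    then show "C.eval (map \<phi> (map ((\<otimes>) e) h)) b = \<zero>\<^bsub>C\<^esub>"
     using H.lift_eval[OF ehD] unfolding z_def by simp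
   qed (use h(2) in simp)
   moreover have "s \<in> set (map ((\<otimes>) e) h)" using c(1) ec by (metis image_eqI list.set_map)
   ultimately show False using s(1) by auto
  qed
  then show ?thesis
  proof (intro subsetI)
   fix b assume b: "b \<in> set h"
   have "c \<otimes> (inv c \<otimes> b) = b" using cF b hc by (metis m_assoc l_one subsetD)
   then show "b \<in> localization D M" using Vp(6)[OF \<open>c \<in> localization D M\<close>] c(3) b by metis
  qed
 qed
 obtain s where s: "s \<in> D - M" "\<forall>b \<in> set h. s \<otimes> b \<in> D" using common_denominator[OF Dd(1) P inV] by blast
 have sc: "s \<in> carrier R" using s(1) Dp(1) by auto
 have "s \<otimes> x = eval (map ((\<otimes>) s) h) t" unfolding h(3) by (rule eval_map_mult[OF sc hc t(1), symmetric])
 moreover have "set (map ((\<otimes>) s) h) \<subseteq> D" using s(2) by auto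
 moreover have "\<phi> s \<noteq> \<zero>\<^bsub>C\<^esub>" using s(1) mem_M by auto
 ultimately show ?thesis using s(1) h(2) by (intro bexI[of _ s] conjI exI[of _ "map ((\<otimes>) s) h"]) auto
qed

lemma exists_place_at_root:
 assumes b: "b \<in> B"
 shows "\<exists>\<psi>. is_place E C \<psi> \<and> (\<forall>a \<in> D. \<psi> a = \<phi> a) \<and> (\<forall>h. set h \<subseteq> D \<longrightarrow> \<psi> (eval h t) = C.eval (map \<phi> h) b) \<and>
  \<psi> ` E \<subseteq> C.simple_extension (\<phi> ` D) b"
proof -
 interpret H: hom_lift R C D g t \<phi> b by (rule hom_lift_place[OF b])
 let ?S = "simple_extension D t"
 have S: "subring ?S R" by (rule simple_extension_is_subring[OF Dd(1) t(1)])
 have DS: "D \<subseteq> ?S" by (rule simple_extension_incl[OF Dp(1) t(1)])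
 have SE: "?S \<subseteq> E" by (rule simple_extension_subring_incl[OF E_subring D_incl_E t_in_E])
 have frac: "\<exists>s \<in> ?S. H.lift s \<noteq> \<zero>\<^bsub>C\<^esub> \<and> s \<otimes> x \<in> ?S" if x: "x \<in> E" for x
 proof -
  obtain s h where s: "s \<in> D" "\<phi> s \<noteq> \<zero>\<^bsub>C\<^esub>" "set h \<subseteq> D" "length h = length g" "s \<otimes> x = eval h t"
   using E_local[OF x] by auto
  then show ?thesis using H.lift_extends[OF s(1)] DS H.mem_simple_extension[of "s \<otimes> x"] by (intro bexI[of _ s]) auto
 qed
 obtain \<psi> where psi: "\<psi> \<in> ring_hom (sub_ring E) C" "\<And>x. x \<in> ?S ==> \<psi> x = H.lift x"
  using extend_hom_to_fractions[OF S C.field_axioms H.lift_hom E_subring SE frac] by blast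
 have extD: "\<psi> a = \<phi> a" if "a \<in> D" for a using psi(2) DS H.lift_extends that by auto
 have bc: "b \<in> carrier C" using b unfolding B_def by auto
 have k: "subfield (\<phi> ` D) C" by (rule place_image_subfield[OF place])
 have evalS: "eval h t \<in> ?S" if "set h \<subseteq> D" for h
  using mem_simple_extension_iff_eval[OF Dp(1) t(1)] that by blast
 have ev: "\<psi> (eval h t) = C.eval (map \<phi> h) b" if "set h \<subseteq> D" for h
  using psi(2)[OF evalS[OF that]] H.lift_eval[OF that] by simp
 have kf: "finite (\<phi> ` D)" using place unfolding is_place_def by simp
 let ?T = "\<phi> ` D \<times> {h. set h \<subseteq> \<phi> ` D \<and> length h = length g}"
 have img: "\<psi> ` E \<subseteq> (\<lambda>(r, h). r \<otimes>\<^bsub>C\<^esub> C.eval h b) ` ?T"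
 proof
  fix y assume "y \<in> \<psi> ` E"
  then obtain x where x: "x \<in> E" "y = \<psi> x" by auto
  obtain s h where s: "s \<in> D" "\<phi> s \<noteq> \<zero>\<^bsub>C\<^esub>" "set h \<subseteq> D" "length h = length g" "s \<otimes> x = eval h t"
   using E_local[OF x(1)] by auto
  interpret G: ring_hom_ring "sub_ring E" C \<psi>
   by (rule ring_hom_ringI2[OF subring_is_ring[OF E_subring] C.ring_axioms psi(1)])
  have yc: "y \<in> carrier C" using x G.hom_closed by simp
  have sE: "s \<in> E" using s D_incl_E by auto
  have "\<phi> s \<otimes>\<^bsub>C\<^esub> y = C.eval (map \<phi> h) b"
   using G.hom_mult[of s x] sE x ev[OF s(3)] s(5) extD[OF s(1)] by simp
  moreover obtain r where r: "r \<in> D" "\<phi> s \<otimes>\<^bsub>C\<^esub> \<phi> r = \<one>\<^bsub>C\<^esub>" using place_inverse[OF place s(1,2)] by auto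
  ultimately have "y = \<phi> r \<otimes>\<^bsub>C\<^esub> C.eval (map \<phi> h) b"
   using yc ps(4)[OF s(1)] ps(4)[OF r(1)] by (metis C.m_assoc C.m_comm C.l_one)
  then show "y \<in> (\<lambda>(r, h). r \<otimes>\<^bsub>C\<^esub> C.eval h b) ` ?T"
   using r(1) s(3,4) by (intro image_eqI[of _ _ "(\<phi> r, map \<phi> h)"]) auto
 qed
 have sub: "\<psi> ` E \<subseteq> C.simple_extension (\<phi> ` D) b"
 proof
  fix y assume "y \<in> \<psi> ` E"
  then have "y \<in> (\<lambda>(r, h). r \<otimes>\<^bsub>C\<^esub> C.eval h b) ` ?T" by (rule subsetD[OF img])
  then obtain r h where y: "r \<in> \<phi> ` D" "set h \<subseteq> \<phi> ` D" "y = r \<otimes>\<^bsub>C\<^esub> C.eval h b" by auto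
  have "C.eval h b \<in> C.simple_extension (\<phi> ` D) b"
   using C.mem_simple_extension_iff_eval[OF subfieldE(3)[OF k] bc] y(2) by blast
  moreover have "r \<in> C.simple_extension (\<phi> ` D) b"
   using C.simple_extension_incl[OF subfieldE(3)[OF k] bc] subringE(3)[OF subfieldE(1)[OF k]] y(1) by auto
  ultimately show "y \<in> C.simple_extension (\<phi> ` D) b"
   using subringE(6)[OF C.simple_extension_is_subring[OF subfieldE(1)[OF k] bc]] y(3) by simp
 qed
 have "finite {h. set h \<subseteq> \<phi> ` D \<and> length h = length g}" by (rule finite_lists_length_eq[OF kf])
 then have "finite ?T" using kf by simp
 then have "finite (\<psi> ` E)" by (rule finite_subset[OF img finite_imageI])
 then have "is_place E C \<psi>" unfolding is_place_def using E_subring C.field_axioms psi(1) by simp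
 then show ?thesis using extD ev sub by blast
qed

definition place_at :: "'c \<Rightarrow> 'a \<Rightarrow> 'c"
 where "place_at b = (SOME \<psi>. is_place E C \<psi> \<and> (\<forall>a \<in> D. \<psi> a = \<phi> a) \<and>
  (\<forall>h. set h \<subseteq> D \<longrightarrow> \<psi> (eval h t) = C.eval (map \<phi> h) b) \<and> \<psi> ` E \<subseteq> C.simple_extension (\<phi> ` D) b)"

lemma place_at:
 assumes "b \<in> B"
 shows "is_place E C (place_at b)" "\<And>a. a \<in> D ==> place_at b a = \<phi> a"
  "\<And>h. set h \<subseteq> D ==> place_at b (eval h t) = C.eval (map \<phi> h) b"
  "place_at b ` E \<subseteq> C.simple_extension (\<phi> ` D) b"
 using someI_ex[OF exists_place_at_root[OF assms]] unfolding place_at_def by blast+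

lemma place_at_image:
 assumes b: "b \<in> B"
 shows "place_at b ` E = C.simple_extension (\<phi> ` D) b"
proof
 show "place_at b ` E \<subseteq> C.simple_extension (\<phi> ` D) b" by (rule place_at(4)[OF b])
 have bc: "b \<in> carrier C" using b unfolding B_def by auto
 have sf: "subfield (place_at b ` E) C" by (rule place_image_subfield[OF place_at(1)[OF b]])
 have "place_at b (eval [\<one>, \<zero>] t) = C.eval (map \<phi> [\<one>, \<zero>]) b" by (rule place_at(3)[OF b]) (use Dp in auto)
 then have "place_at b t = b" using t(1) bc ps by simp
 then have "b \<in> place_at b ` E" using t_in_E by (metis imageI)
 moreover have "\<phi> ` D \<subseteq> place_at b ` E" using place_at(2)[OF b] D_incl_E by (metis image_mono image_cong)
 ultimately show "C.simple_extension (\<phi> ` D) b \<subseteq> place_at b ` E"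
  using C.simple_extension_subring_incl[OF subfieldE(1)[OF sf]] by blast
qed

abbreviation "ker b \<equiv> place_kernel E C (place_at b)"

text \<open>An element of all kernels over \<open>M\<close> reduces to a polynomial that vanishes at all \<open>n\<close> roots; so its coefficients lie in \<open>M\<close>.\<close>

lemma common_kernel:
 assumes x: "x \<in> E" "\<And>b. b \<in> B ==> place_at b x = \<zero>\<^bsub>C\<^esub>"
 shows "\<exists>s \<in> D. \<phi> s \<noteq> \<zero>\<^bsub>C\<^esub> \<and> s \<otimes> x \<in> Idl\<^bsub>sub_ring E\<^esub> M"
proof -
 obtain s h where s: "s \<in> D" "\<phi> s \<noteq> \<zero>\<^bsub>C\<^esub>" "set h \<subseteq> D" "length h = length g" "s \<otimes> x = eval h t"
  using E_local[OF x(1)] by auto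
 have sE: "s \<in> E" using s D_incl_E by auto
 have "set h \<subseteq> M"
 proof (rule all_roots_zero[OF s(3)])
  fix b assume b: "b \<in> B"
  note pb = place_simps[OF place_at(1)[OF b]]
  have "place_at b (s \<otimes> x) = \<zero>\<^bsub>C\<^esub>" using pb(6)[OF sE x(1)] x(2)[OF b] pb(4)[OF sE] by simp
  then show "C.eval (map \<phi> h) b = \<zero>\<^bsub>C\<^esub>" using place_at(3)[OF b s(3)] s(5) by simp
 qed (use s(4) in simp)
 interpret S: cring "sub_ring E" by (rule sub_ring_cring[OF E_subring])
 have ME: "M \<subseteq> E" using mem_M D_incl_E by auto
 have idl: "ideal (Idl\<^bsub>sub_ring E\<^esub> M) (sub_ring E)" using S.genideal_ideal ME by simp
 then have mod: "module_over E (Idl\<^bsub>sub_ring E\<^esub> M)" "Idl\<^bsub>sub_ring E\<^esub> M \<subseteq> E"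
  using ideal_sub_ring_iff[OF E_subring] by auto
 have "M \<subseteq> Idl\<^bsub>sub_ring E\<^esub> M" using S.genideal_self ME by simp
 then have "eval h t \<in> Idl\<^bsub>sub_ring E\<^esub> M"
 proof (intro eval_closed_module[OF mod(1) E_subring _ t_in_E])
  show "set h \<subseteq> Idl\<^bsub>sub_ring E\<^esub> M" using \<open>set h \<subseteq> M\<close> \<open>M \<subseteq> Idl\<^bsub>sub_ring E\<^esub> M\<close> by auto
  fix p b assume pb: "p \<in> E" "b \<in> Idl\<^bsub>sub_ring E\<^esub> M"
  then have "b \<otimes> p = p \<otimes> b" using mod(2) Ep(1) by (intro m_comm) auto
  then show "b \<otimes> p \<in> Idl\<^bsub>sub_ring E\<^esub> M" using module_overD(4)[OF mod(1) pb] by simp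
 qed
 then show ?thesis using s by auto
qed

lemma kernel_ideal: "b \<in> B ==> x \<in> E ==> y \<in> ker b ==> x \<otimes> y \<in> ker b"
 using place_kernel_maximal(2)[OF place_at(1)] module_overD(4) unfolding prime_in_def by blast

text \<open>Otherwise some element outside \<open>N\<close> lies in all kernels, and then a multiple of it lies in \<open>M E \<subseteq> N\<close>.\<close>

lemma maximal_over:
 assumes N: "maximalideal N (sub_ring E)" "N \<inter> D = M"
 shows "\<exists>b \<in> B. N = ker b"
proof -
 have Np: "prime_in E N" by (rule maximalideal_prime_in[OF E_subring N(1)])
 have Nm: "module_over E N" "N \<subseteq> E" "\<one> \<notin> N" using Np unfolding prime_in_def by auto
 have "\<exists>b \<in> B. ker b \<subseteq> N"
 proof (rule ccontr)
  assume neg: "\<not> ?thesis"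
  have "\<exists>y \<in> E - N. \<forall>b \<in> B. y \<in> ker b"
  proof (rule prime_avoidance_product[OF E_subring Np finB])
   fix b assume b: "b \<in> B"
   then show "\<exists>x \<in> E - N. x \<in> ker b" using neg unfolding place_kernel_def by auto
   show "ker b \<subseteq> E" unfolding place_kernel_def by auto
   show "x \<otimes> y \<in> ker b" if "x \<in> E" "y \<in> ker b" for x y by (rule kernel_ideal[OF b that])
  qed
  then obtain y where y: "y \<in> E" "y \<notin> N" "\<forall>b \<in> B. y \<in> ker b" by auto
  then obtain s where s: "s \<in> D" "\<phi> s \<noteq> \<zero>\<^bsub>C\<^esub>" "s \<otimes> y \<in> Idl\<^bsub>sub_ring E\<^esub> M"
   using common_kernel[OF y(1)] unfolding place_kernel_def by auto
  interpret S: cring "sub_ring E" by (rule sub_ring_cring[OF E_subring])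
  have "Idl\<^bsub>sub_ring E\<^esub> M \<subseteq> N" using S.genideal_minimal[of N M] N maximalideal.axioms(1) by blast
  then have "s \<otimes> y \<in> N" using s by auto
  then have "s \<in> N" using Np y s D_incl_E unfolding prime_in_def by auto
  then have "s \<in> M" using N(2) s(1) by auto
  then show False using s(2) mem_M by simp
 qed
 then obtain b where b: "b \<in> B" "ker b \<subseteq> N" by auto
 then have "N = ker b"
  using prime_in_maximal_eq[OF E_subring place_kernel_maximal(1)[OF place_at(1)[OF b(1)]] Nm(1,2) b(2) Nm(3)] by simp
 then show ?thesis using b by blast
qed

text \<open>Multiply by an element that lies in all other kernels but not in this one, and use the previous description
 of the common kernel.\<close>

lemma unramified:
 assumes b: "b \<in> B" and x: "x \<in> ker b"
 shows "\<exists>s \<in> E. place_at b s \<noteq> \<zero>\<^bsub>C\<^esub> \<and> s \<otimes> x \<in> Idl\<^bsub>sub_ring E\<^esub> M"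
proof -
 define T where "T = {c \<in> B. ker c \<noteq> ker b}"
 have finT: "finite T" unfolding T_def using finB by auto
 note kb = place_kernel_maximal[OF place_at(1)[OF b]]
 have "\<exists>y \<in> E - ker b. \<forall>c \<in> T. y \<in> ker c"
 proof (rule prime_avoidance_product[OF E_subring kb(2) finT])
  fix c assume c: "c \<in> T"
  then have cB: "c \<in> B" "ker c \<noteq> ker b" unfolding T_def by auto
  note kc = place_kernel_maximal[OF place_at(1)[OF cB(1)]]
  have "\<not> ker c \<subseteq> ker b"
   using prime_in_maximal_eq[OF E_subring kc(1)] kb(2) cB(2) unfolding prime_in_def by blast
  then show "\<exists>x \<in> E - ker b. x \<in> ker c" unfolding place_kernel_def by auto
  show "ker c \<subseteq> E" unfolding place_kernel_def by auto
  show "x \<otimes> y \<in> ker c" if "x \<in> E" "y \<in> ker c" for x y by (rule kernel_ideal[OF cB(1) that])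
 qed
 then obtain y where y: "y \<in> E" "y \<notin> ker b" "\<forall>c \<in> T. y \<in> ker c" by auto
 have xE: "x \<in> E" using x unfolding place_kernel_def by auto
 have c: "x \<in> carrier R" "y \<in> carrier R" using xE y Ep(1) by auto
 have "y \<otimes> x \<in> ker c" if cB: "c \<in> B" for c
 proof (cases "c \<in> T")
  case True
  have "x \<otimes> y \<in> ker c" by (rule kernel_ideal[OF cB xE]) (use y True in auto)
  then show ?thesis using c m_comm by simp
 next
  case False
  then have "x \<in> ker c" using x cB unfolding T_def by auto
  then show ?thesis using kernel_ideal[OF cB y(1)] by simp
 qed
 then have "\<forall>c \<in> B. place_at c (y \<otimes> x) = \<zero>\<^bsub>C\<^esub>" unfolding place_kernel_def by auto
 then obtain s where s: "s \<in> D" "\<phi> s \<noteq> \<zero>\<^bsub>C\<^esub>" "s \<otimes> (y \<otimes> x) \<in> Idl\<^bsub>sub_ring E\<^esub> M"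
  using common_kernel[of "y \<otimes> x"] y(1) xE Ep(6) by auto
 have sE: "s \<in> E" "s \<in> carrier R" using s D_incl_E Dp(1) by auto
 note pb = place_simps[OF place_at(1)[OF b]]
 have "place_at b (s \<otimes> y) = \<phi> s \<otimes>\<^bsub>C\<^esub> place_at b y" using pb(6) sE y(1) place_at(2)[OF b s(1)] by simp
 moreover have "place_at b y \<noteq> \<zero>\<^bsub>C\<^esub>" using y(1,2) unfolding place_kernel_def by auto
 ultimately have "place_at b (s \<otimes> y) \<noteq> \<zero>\<^bsub>C\<^esub>" using s(2) ps(4)[OF s(1)] pb(4)[OF y(1)] C.integral_iff by simp
 moreover have "(s \<otimes> y) \<otimes> x \<in> Idl\<^bsub>sub_ring E\<^esub> M" using s(3) sE c by (simp add: m_assoc)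
 ultimately show ?thesis using Ep(6)[OF sE(1) y(1)] by blast
qed

lemma kernel_eqI:
 assumes b: "b \<in> B" "c \<in> B"
  and eq: "\<And>h. set h \<subseteq> \<phi> ` D ==> C.eval h b = \<zero>\<^bsub>C\<^esub> \<longleftrightarrow> C.eval h c = \<zero>\<^bsub>C\<^esub>"
 shows "ker b = ker c"
proof -
 have "x \<in> ker b \<longleftrightarrow> x \<in> ker c" if x: "x \<in> E" for x
 proof -
  obtain s h where s: "s \<in> D" "\<phi> s \<noteq> \<zero>\<^bsub>C\<^esub>" "set h \<subseteq> D" "length h = length g" "s \<otimes> x = eval h t"
   using E_local[OF x] by auto
  have sE: "s \<in> E" using s D_incl_E by auto
  have "place_at d x = \<zero>\<^bsub>C\<^esub> \<longleftrightarrow> C.eval (map \<phi> h) d = \<zero>\<^bsub>C\<^esub>" if d: "d \<in> B" for d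
  proof -
   note pd = place_simps[OF place_at(1)[OF d]]
   have "C.eval (map \<phi> h) d = \<phi> s \<otimes>\<^bsub>C\<^esub> place_at d x"
    using place_at(3)[OF d s(3)] s(5) pd(6)[OF sE x] place_at(2)[OF d s(1)] by simp
   then show ?thesis using s(2) ps(4)[OF s(1)] pd(4)[OF x] C.integral_iff by simp
  qed
  moreover have "set (map \<phi> h) \<subseteq> \<phi> ` D" using s(3) by auto
  ultimately show ?thesis using b eq[of "map \<phi> h"] x unfolding place_kernel_def by auto
 qed
 then show ?thesis unfolding place_kernel_def by auto
qed

lemma complete_lifts_place_at:
 assumes S: "S \<subseteq> B" and rep: "\<And>b. b \<in> B ==> \<exists>c \<in> S. ker b = ker c" and inj: "inj_on ker S"
 shows "complete_lifts D E C \<phi> (place_at ` S)" "card (place_at ` S) = card S"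
proof -
 have "inj_on place_at S" using inj unfolding inj_on_def by metis
 then show "card (place_at ` S) = card S" by (rule card_image)
 show "complete_lifts D E C \<phi> (place_at ` S)" unfolding complete_lifts_def
 proof (intro conjI ballI allI impI)
  show "finite (place_at ` S)" using finB S finite_subset by blast
  show "inj_on (place_kernel E C) (place_at ` S)" using inj unfolding inj_on_def by auto
  fix \<psi> assume "\<psi> \<in> place_at ` S"
  then obtain b where b: "b \<in> B" "\<psi> = place_at b" using S by auto
  show "is_place E C \<psi>" unfolding b by (rule place_at(1)[OF b(1)])
  show "\<psi> a = \<phi> a" if "a \<in> D" for a unfolding b by (rule place_at(2)[OF b(1) that])
  show "\<exists>s \<in> E. \<psi> s \<noteq> \<zero>\<^bsub>C\<^esub> \<and> s \<otimes> x \<in> Idl\<^bsub>sub_ring E\<^esub> (place_kernel D C \<phi>)" if "x \<in> place_kernel E C \<psi>" for x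
   using unramified[OF b(1)] that unfolding b M_def by blast
 next
  fix N assume "maximalideal N (sub_ring E) \<and> N \<inter> D = place_kernel D C \<phi>"
  then obtain b where "b \<in> B" "N = ker b" using maximal_over unfolding M_def by blast
  then obtain c where "c \<in> S" "N = ker c" using rep by blast
  then show "N \<in> place_kernel E C ` place_at ` S" by blast
 qed
qed

end

section \<open>Separability\<close>

primrec (in ring) deriv_coeffs :: "'a list \<Rightarrow> 'a list"
 where "deriv_coeffs [] = []"
 | "deriv_coeffs (c # p) = (if p = [] then [] else ([length p] \<cdot> c) # deriv_coeffs p)"

context cring begin

lemma length_deriv_coeffs: "length (deriv_coeffs p) = length p - 1"
 by (induction p) auto

lemma eval_deriv_coeffs:
 assumes "set p \<subseteq> carrier R" "a \<in> carrier R"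
 shows "eval (deriv_coeffs p) a = deriv_at p a"
 using assms(1)
proof (induction p)
 case (Cons c p)
 show ?case
 proof (cases "p = []")
  case True
  then show ?thesis using Cons assms by simp
 next
  case False
  then show ?thesis using Cons assms length_deriv_coeffs[of p] by (simp add: add_pow_ldistr)
 qed
qed simp

lemma deriv_coeffs_in_subring:
 assumes "subring K R" "set p \<subseteq> K"
 shows "set (deriv_coeffs p) \<subseteq> K"
proof -
 have "[n] \<cdot> c \<in> K" if "c \<in> K" for n :: nat and c
  using that subringE[OF assms(1)] by (induction n) auto
 then show ?thesis using assms(2) by (induction p) auto
qed

lemma deriv_coeffs_zero_imp:
 assumes "set (deriv_coeffs p) \<subseteq> {\<zero>}" "i < length p"
 shows "[(length p - 1 - i)] \<cdot> (p ! i) = \<zero>"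
 using assms
proof (induction p arbitrary: i)
 case (Cons c p)
 show ?case
 proof (cases i)
  case 0
  then show ?thesis using Cons.prems by (cases "p = []") auto
 next
  case (Suc j)
  then show ?thesis using Cons.prems Cons.IH[of j] by (cases "p = []") (auto simp: diff_right_commute)
 qed
qed simp

lemma deriv_at_zero_if_coeffs:
 assumes "set p \<subseteq> carrier R" "a \<in> carrier R" "\<And>i. i < length p ==> [(length p - 1 - i)] \<cdot> (p ! i) = \<zero>"
 shows "deriv_at p a = \<zero>"
 using assms(1,3)
proof (induction p)
 case (Cons c p)
 have "[length p] \<cdot> c = \<zero>" using Cons.prems(2)[of 0] by simp
 then have "[length p] \<cdot> (c \<otimes> a [^] (length p - 1)) = \<zero>"
  using add_pow_ldistr[of c "a [^] (length p - 1)" "length p"] Cons.prems(1) assms(2) by simp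
 moreover have "deriv_at p a = \<zero>"
 proof (rule Cons.IH)
  fix i assume "i < length p"
  then show "[(length p - 1 - i)] \<cdot> (p ! i) = \<zero>" using Cons.prems(2)[of "Suc i"] by simp
 qed (use Cons.prems in simp)
 ultimately show ?case by simp
qed simp

end

context field begin

text \<open>A multiple root of the minimal polynomial is a root of its derivative, which has smaller degree and
 hence vanishes identically.\<close>

lemma Irr_root_deriv_zero:
 assumes K: "subfield K R" and x: "x \<in> carrier R" "(algebraic over K) x"
  and a: "a \<in> carrier R" "alg_mult (Irr K x) a \<ge> 2" and i: "i < length (Irr K x)"
 shows "[(length (Irr K x) - 1 - i)] \<cdot> (Irr K x ! i) = \<zero>"
proof -
 note I = IrrE[OF K x]
 have Ine: "Irr K x \<noteq> []" using I pirreducible_degree[OF K I(1,2)] by auto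
 have IR: "Irr K x \<in> carrier (poly_ring R)" using carrier_polynomial_shell[OF subfieldE(1)[OF K] I(1)] .
 have IK: "set (Irr K x) \<subseteq> K" using I(1) polynomial_incl univ_poly_carrier by blast
 have IC: "set (Irr K x) \<subseteq> carrier R" using IK subfieldE(3)[OF K] by auto
 have ev: "eval (Irr K x) a = \<zero>" "deriv_at (Irr K x) a = \<zero>"
  using alg_mult_ge_2_iff[OF IR Ine a(1)] a(2) by auto
 have alg: "(algebraic over K) a" "Irr K a = Irr K x" using Irr_eq_of_root[OF K x a(1) ev(1)] by auto
 have "powers_independent K (degree (Irr K x)) a" using powers_independent_Irr[OF K a(1) alg(1)] alg(2) by simp
 moreover have "eval (deriv_coeffs (Irr K x)) a = \<zero>" using eval_deriv_coeffs[OF IC a(1)] ev(2) by simp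
 ultimately have "set (deriv_coeffs (Irr K x)) \<subseteq> {\<zero>}"
  using deriv_coeffs_in_subring[OF subfieldE(1)[OF K] IK] length_deriv_coeffs[of "Irr K x"]
  unfolding powers_independent_def by simp
 then show ?thesis by (rule deriv_coeffs_zero_imp[OF _ i])
qed

text \<open>MacLane's criterion \<open>L = F L\<^sup>p\<close> for separability of a finite extension. Unlike the condition on minimal
 polynomials it is visibly transitive.\<close>

definition pth_power_spanned :: "'a set \<Rightarrow> 'a set \<Rightarrow> bool"
 where "pth_power_spanned F L \<longleftrightarrow> (\<forall>p::nat. Factorial_Ring.prime p \<and> [p] \<cdot> \<one> = \<zero> \<longrightarrow>
  (\<forall>x \<in> L. \<exists>Us. set Us \<subseteq> L \<and> x \<in> Span F (map (\<lambda>u. u [^] p) Us)))"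

text \<open>\<open>F L\<^sup>p\<close> is a ring, so it contains \<open>K L\<^sup>p\<close> as soon as it contains \<open>K\<close>; this gives transitivity.\<close>

lemma pth_power_span_subring:
 fixes p :: nat
 assumes p: "Factorial_Ring.prime p" "[p] \<cdot> \<one> = \<zero>" and F: "subfield F R" and L: "subring L R"
 defines "S \<equiv> {x \<in> carrier R. \<exists>Us. set Us \<subseteq> L \<and> x \<in> Span F (map (\<lambda>u. u [^] p) Us)}"
 shows "module_over F S" "\<And>x y. x \<in> S ==> y \<in> S ==> x \<otimes> y \<in> S" "\<And>u. u \<in> L ==> u [^] p \<in> S"
proof -
 note Fr = subfieldE(1)[OF F]
 note Fp = subringE[OF Fr] and Lp = subringE[OF L]
 let ?P = "\<lambda>u. u [^] p"
 have Pc: "set (map ?P Us) \<subseteq> carrier R" if "set Us \<subseteq> L" for Us using that Lp(1) by auto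
 show mod: "module_over F S" unfolding module_over_def
 proof (intro conjI ballI)
  show "S \<subseteq> carrier R" unfolding S_def by auto
  show "\<zero> \<in> S" unfolding S_def by (auto intro: exI[of _ "[]"])
  fix x assume "x \<in> S"
  then obtain Us where Us: "x \<in> carrier R" "set Us \<subseteq> L" "x \<in> Span F (map ?P Us)" unfolding S_def by auto
  {
   fix y assume "y \<in> S"
   then obtain Ws where Ws: "y \<in> carrier R" "set Ws \<subseteq> L" "y \<in> Span F (map ?P Ws)" unfolding S_def by auto
   have "x \<oplus> y \<in> Span F (map ?P (Us @ Ws))"
    unfolding map_append Span_append_sum[OF Fr Pc[OF Us(2)] Pc[OF Ws(2)]] using Us Ws by auto
   moreover have "set (Us @ Ws) \<subseteq> L" using Us Ws by simp
   ultimately show "x \<oplus> y \<in> S" unfolding S_def using Us Ws by blast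
  }
  fix k assume k: "k \<in> F"
  then have "k \<otimes> x \<in> Span F (map ?P Us)" using module_overD(4)[OF module_over_Span(1)[OF Fr Pc[OF Us(2)]]] Us by blast
  then show "k \<otimes> x \<in> S" unfolding S_def using Us k Fp(1) by auto
 qed
 show pw: "u [^] p \<in> S" if u: "u \<in> L" for u
 proof -
  have uc: "u \<in> carrier R" using u Lp(1) by auto
  then have "u [^] p \<in> Span F (map ?P [u])" using module_over_Span(2)[OF Fr, of "map ?P [u]"] by simp
  then show ?thesis unfolding S_def using uc u by (intro CollectI conjI exI[of _ "[u]"]) auto
 qed
 have mulP: "x \<otimes> u [^] p \<in> S" if x: "x \<in> S" and u: "u \<in> L" for x u
 proof -
  obtain Us where Us: "x \<in> carrier R" "set Us \<subseteq> L" "x \<in> Span F (map ?P Us)" using x unfolding S_def by auto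
  have uc: "u \<in> carrier R" "u [^] p \<in> carrier R" using u Lp(1) by auto
  have "u [^] p \<otimes> x \<in> Span F (map ((\<otimes>) (u [^] p)) (map ?P Us))"
   unfolding Span_map_mult[OF Fr Pc[OF Us(2)] uc(2)] using Us(3) by auto
  moreover have "map ((\<otimes>) (u [^] p)) (map ?P Us) = map ?P (map ((\<otimes>) u) Us)"
   using uc Us(2) Lp(1) by (auto simp: nat_pow_distrib subset_iff)
  moreover have "set (map ((\<otimes>) u) Us) \<subseteq> L" using u Us(2) Lp(6) by auto
  ultimately have "\<exists>Us. set Us \<subseteq> L \<and> u [^] p \<otimes> x \<in> Span F (map ?P Us)" by metis
  then show ?thesis unfolding S_def using uc Us(1) m_comm[of x "u [^] p"] by simp
 qed
 show "x \<otimes> y \<in> S" if x: "x \<in> S" and y: "y \<in> S" for x y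
 proof -
  note Sp = module_overD[OF mod]
  have xc: "x \<in> carrier R" using x Sp(1) by auto
  obtain Ws where Ws: "y \<in> carrier R" "set Ws \<subseteq> L" "y \<in> Span F (map ?P Ws)" using y unfolding S_def by auto
  have "module_over F {z \<in> carrier R. x \<otimes> z \<in> S}" unfolding module_over_def
  proof (intro conjI ballI)
   fix k z assume kz: "k \<in> F" "z \<in> {z \<in> carrier R. x \<otimes> z \<in> S}"
   then have "x \<otimes> (k \<otimes> z) = k \<otimes> (x \<otimes> z)" using xc Fp(1) by (auto simp: m_lcomm subset_iff)
   then show "k \<otimes> z \<in> {z \<in> carrier R. x \<otimes> z \<in> S}" using kz Sp(4) Fp(1) by auto
  qed (use Sp xc in \<open>auto simp: r_distr\<close>)
  moreover have "set (map ?P Ws) \<subseteq> {z \<in> carrier R. x \<otimes> z \<in> S}" using mulP[OF x] Ws(2) Lp(1) by auto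
  ultimately have "Span F (map ?P Ws) \<subseteq> {z \<in> carrier R. x \<otimes> z \<in> S}" by (rule Span_least)
  then show ?thesis using Ws(3) by auto
 qed
qed

lemma pth_power_spanned_trans:
 assumes F: "subfield F R" and K: "subfield K R" and L: "subfield L R" "K \<subseteq> L"
  and FK: "pth_power_spanned F K" and KL: "pth_power_spanned K L"
 shows "pth_power_spanned F L"
 unfolding pth_power_spanned_def
proof (intro allI impI ballI)
 fix p :: nat and x assume p: "Factorial_Ring.prime p \<and> [p] \<cdot> \<one> = \<zero>" and x: "x \<in> L"
 let ?S = "{x \<in> carrier R. \<exists>Us. set Us \<subseteq> L \<and> x \<in> Span F (map (\<lambda>u. u [^] p) Us)}"
 note S = pth_power_span_subring[OF conjunct1[OF p] conjunct2[OF p] F subfieldE(1)[OF L(1)]]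
 have KS: "K \<subseteq> ?S"
  using FK p L(2) subfieldE(3)[OF K] unfolding pth_power_spanned_def by (auto; meson order_trans subsetD)
 have "module_over K ?S" using S(1,2) KS unfolding module_over_def by blast
 moreover obtain Us where Us: "set Us \<subseteq> L" "x \<in> Span K (map (\<lambda>u. u [^] p) Us)"
  using KL p x unfolding pth_power_spanned_def by blast
 moreover have "set (map (\<lambda>u. u [^] p) Us) \<subseteq> ?S" using S(3) Us(1) by auto
 ultimately have "x \<in> ?S" using Span_least by blast
 then show "\<exists>Us. set Us \<subseteq> L \<and> x \<in> Span F (map (\<lambda>u. u [^] p) Us)" by blast
qed

lemma spanning_list_dimension:
 assumes K: "subfield K R" and Us: "set Us \<subseteq> carrier R"
 shows "\<exists>d \<le> length Us. dimension d K (Span K Us) \<and> (d = length Us \<longrightarrow> independent K Us)"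
 using Us
proof (induction Us)
 case (Cons u Us)
 then obtain d where d: "d \<le> length Us" "dimension d K (Span K Us)" "d = length Us \<longrightarrow> independent K Us" by auto
 have eq: "Span K (u # Us) = line_extension K u (Span K Us)" by (simp add: Span.simps)
 show ?case
 proof (cases "u \<in> Span K Us")
  case True
  have sub: "set Us \<subseteq> carrier R" using Cons.prems by simp
  note mo = module_over_Span[OF subfieldE(1)[OF K] sub]
  have "Span K (u # Us) \<subseteq> Span K Us" by (rule Span_least[OF mo(1)]) (use True mo(2) in auto)
  moreover have "Span K Us \<subseteq> Span K (u # Us)" using mono_Span[OF K sub] Cons.prems by simp
  ultimately show ?thesis using d by (intro exI[of _ d]) auto
 next
  case False
  then have "dimension (Suc d) K (Span K (u # Us))" unfolding eq using Suc_dim d(2) Cons.prems by auto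
  moreover have "independent K (u # Us)" if "Suc d = length (u # Us)" using that d(3) False Cons.prems li_Cons by auto
  ultimately show ?thesis using d(1) by (intro exI[of _ "Suc d"]) auto
 qed
qed (auto intro: exI[of _ 0])

text \<open>Extend to a basis. The \<open>p\<close>-th powers of a basis span \<open>F L\<^sup>p = L\<close>, hence are a basis by counting.\<close>

lemma pth_powers_independent:
 fixes p :: nat
 assumes p: "Factorial_Ring.prime p" "[p] \<cdot> \<one> = \<zero>" and F: "subfield F R" and L: "subring L R" "F \<subseteq> L"
  and dim: "dimension m F L" and spanned: "pth_power_spanned F L"
  and Us: "independent F Us" "set Us \<subseteq> L"
 shows "independent F (map (\<lambda>u. u [^] p) Us)"
proof -
 let ?P = "\<lambda>u. u [^] p"
 note Fr = subfieldE(1)[OF F]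
 note Fp = subringE[OF Fr] and Lp = subringE[OF L(1)]
 obtain Vs where Vs: "length (Vs @ Us) = m" "independent F (Vs @ Us)" "Span F (Vs @ Us) = L"
  using complete_base[OF F dim Us] by auto
 let ?B = "Vs @ Us"
 have Bc: "set ?B \<subseteq> carrier R" using independent_in_carrier[OF Vs(2)] .
 have BL: "set ?B \<subseteq> L" using module_over_Span(2)[OF Fr Bc] Vs(3) by simp
 have PBc: "set (map ?P ?B) \<subseteq> carrier R" using Bc by auto
 note PBm = module_over_Span[OF Fr PBc]
 note PBp = module_overD[OF PBm(1)]
 have kp: "k [^] (n::nat) \<in> F" if "k \<in> F" for k n using that Fp by (induction n) auto
 have pow: "?P x \<in> Span F (map ?P ?B)" if "x \<in> Span F Ws" "set Ws \<subseteq> set ?B" for x Ws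
  using that
 proof (induction Ws arbitrary: x)
  case Nil
  then have "?P x = \<zero>" using p(1) prime_gt_0_nat by (simp add: nat_pow_zero)
  then show ?case using PBp(2) by simp
 next
  case (Cons w Ws)
  obtain k v where kv: "k \<in> F" "v \<in> Span F Ws" "x = k \<otimes> w \<oplus> v" using Cons.prems(1) unfolding Span_Cons by auto
  have c: "w \<in> carrier R" "k \<in> carrier R" "v \<in> carrier R"
   using Cons.prems(2) Bc kv Fp(1) module_overD(1)[OF module_over_Span(1)[OF Fr, of Ws]] by auto
  have "?P x = ?P k \<otimes> ?P w \<oplus> ?P v" unfolding kv(3) using frobenius_add[OF p] c by (simp add: nat_pow_distrib)
  moreover have "?P w \<in> Span F (map ?P ?B)" using PBm(2) Cons.prems(2) by auto
  ultimately show ?case using PBp(3,4) kp[OF kv(1)] Cons kv(2) by simp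
 qed
 have "Span F (map ?P ?B) = L"
 proof
  have "module_over F L" unfolding module_over_def using Lp L(2) by auto
  moreover have "set (map ?P ?B) \<subseteq> L"
  proof -
   have "u [^] (n::nat) \<in> L" if "u \<in> L" for u n using that Lp by (induction n) auto
   then show ?thesis using BL by auto
  qed
  ultimately show "Span F (map ?P ?B) \<subseteq> L" by (rule Span_least)
  show "L \<subseteq> Span F (map ?P ?B)"
  proof
   fix x assume "x \<in> L"
   then obtain Ws where Ws: "set Ws \<subseteq> L" "x \<in> Span F (map ?P Ws)"
    using spanned p unfolding pth_power_spanned_def by blast
   have "set (map ?P Ws) \<subseteq> Span F (map ?P ?B)" using pow[of _ ?B] Ws(1) Vs(3) by auto
   then show "x \<in> Span F (map ?P ?B)" using Span_least[OF PBm(1)] Ws(2) by blast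
  qed
 qed
 then obtain d where "d \<le> length (map ?P ?B)" "dimension d F L" "d = length (map ?P ?B) \<longrightarrow> independent F (map ?P ?B)"
  using spanning_list_dimension[OF F PBc] by metis
 moreover have "d = m" using dimension_is_inj[OF F calculation(2) dim] .
 ultimately have "independent F (map ?P Vs @ map ?P Us)" using Vs(1) by simp
 then show ?thesis using independent_split(1)[OF F] by blast
qed

lemma eval_as_finsum:
 assumes "set h \<subseteq> carrier R" "x \<in> carrier R"
 shows "eval h x = (\<Oplus>i\<in>{..<length h}. coeff h i \<otimes> x [^] i)"
 using assms(1)
proof (induction h)
 case (Cons c h)
 have cc: "c \<in> carrier R" "set h \<subseteq> carrier R" using Cons.prems by auto
 have "(\<Oplus>i\<in>{..<length (c # h)}. coeff (c # h) i \<otimes> x [^] i)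
   = (\<Oplus>i\<in>insert (length h) {..<length h}. coeff (c # h) i \<otimes> x [^] i)"
  by (simp add: lessThan_Suc)
 also have "\<dots> = coeff (c # h) (length h) \<otimes> x [^] length h \<oplus> (\<Oplus>i\<in>{..<length h}. coeff (c # h) i \<otimes> x [^] i)"
  by (rule finsum_insert) (use cc assms(2) in auto)
 also have "(\<Oplus>i\<in>{..<length h}. coeff (c # h) i \<otimes> x [^] i) = (\<Oplus>i\<in>{..<length h}. coeff h i \<otimes> x [^] i)"
  by (rule finsum_cong') (use cc assms(2) in auto)
 finally show ?case using Cons.IH[OF cc(2)] by simp
qed simp

lemma eval_contract:
 assumes p: "p > 0" and h: "set h \<subseteq> carrier R" and x: "x \<in> carrier R" and len: "length h = Suc (p * n)"
  and z: "\<And>i. i < length h ==> \<not> p dvd i ==> coeff h i = \<zero>"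
 shows "eval (map (\<lambda>j. coeff h (p * j)) (rev [0..<Suc n])) (x [^] p) = eval h x"
proof -
 let ?h = "map (\<lambda>j. coeff h (p * j)) (rev [0..<Suc n])"
 have hc: "set ?h \<subseteq> carrier R" using h by auto
 have co: "coeff ?h j = coeff h (p * j)" if "j < Suc n" for j
  using that coeff_nth[of j ?h] by (simp add: rev_nth del: upt_Suc)
 have "eval h x = (\<Oplus>i\<in>{..<length h}. coeff h i \<otimes> x [^] i)" by (rule eval_as_finsum[OF h x])
 also have "\<dots> = (\<Oplus>i\<in>(\<lambda>j. p * j) ` {..<Suc n}. coeff h i \<otimes> x [^] i)"
 proof (rule add.finprod_mono_neutral_cong_right)
  show "(\<lambda>j. p * j) ` {..<Suc n} \<subseteq> {..<length h}" using p len by (auto simp: less_Suc_eq_le)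
  show "coeff h i \<otimes> x [^] i = \<zero>" if "i \<in> {..<length h} - (\<lambda>j. p * j) ` {..<Suc n}" for i
  proof -
   have "\<not> p dvd i"
   proof
    assume "p dvd i"
    then obtain j where "i = p * j" by (elim dvdE)
    moreover from this have "p * j < Suc (p * n)" using that len by simp
    then have "j \<le> n" using p by (simp add: less_Suc_eq_le)
    ultimately show False using that by auto
   qed
   then show ?thesis using z[of i] that x by simp
  qed
 qed (use h x in auto)
 also have "\<dots> = (\<Oplus>j\<in>{..<Suc n}. coeff h (p * j) \<otimes> x [^] (p * j))"
  by (rule add.finprod_reindex) (use h x p in \<open>auto simp: inj_on_def\<close>)
 also have "\<dots> = (\<Oplus>j\<in>{..<length ?h}. coeff ?h j \<otimes> (x [^] p) [^] j)"
  by (rule finsum_cong') (use h x co hc in \<open>auto simp: nat_pow_pow simp del: upt_Suc\<close>)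
 also have "\<dots> = eval ?h (x [^] p)" by (rule eval_as_finsum[OF hc, symmetric]) (use x in simp)
 finally show ?thesis by simp
qed

text \<open>An inseparable minimal polynomial is a polynomial in \<open>X\<^sup>p\<close>. It then gives a dependence between \<open>p\<close>-th powers
 of the independent elements \<open>1, x, \<dots>, x\<^sup>n\<close>.\<close>

lemma separable_if_pth_power_spanned:
 assumes F: "subfield F R" and L: "subfield L R" "F \<subseteq> L" and dim: "dimension m F L"
  and spanned: "pth_power_spanned F L"
 shows "separable_extension F L"
 unfolding separable_extension_def
proof (intro conjI ballI F L)
 fix x assume xL: "x \<in> L"
 have x: "x \<in> carrier R" using xL subfieldE(3)[OF L(1)] by auto
 show alg: "(algebraic over F) x"
  using finite_dimension_imp_algebraic[OF F subfieldE(1)[OF L(1)] _ xL] dim unfolding finite_dimension_def by blast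
 fix a assume a: "a \<in> carrier R"
 show "alg_mult (Irr F x) a \<le> 1"
 proof (rule ccontr)
  assume "\<not> alg_mult (Irr F x) a \<le> 1"
  then have ge: "alg_mult (Irr F x) a \<ge> 2" by simp
  let ?f = "Irr F x"
  note I = IrrE[OF F x alg]
  have deg: "degree ?f > 0" using pirreducible_degree[OF F I(1,2)] by simp
  have fF: "set ?f \<subseteq> F" using I(1) polynomial_incl univ_poly_carrier by blast
  have fc: "set ?f \<subseteq> carrier R" using fF subfieldE(3)[OF F] by auto
  have der: "[i] \<cdot> (coeff ?f i) = \<zero>" if "i < length ?f" for i
   using Irr_root_deriv_zero[OF F x alg a ge, of "length ?f - 1 - i"] that coeff_nth[OF that] by simp
  have lead: "coeff ?f (degree ?f) = \<one>" using I(3) deg by (subst lead_coeff_simp) auto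
  then have "[degree ?f] \<cdot> \<one> = \<zero>" using der[of "degree ?f"] deg by simp
  then have "\<exists>n::nat. n > 0 \<and> [n] \<cdot> \<one> = \<zero>" using deg by blast
  then obtain p where p: "Factorial_Ring.prime (p::nat)" "[p] \<cdot> \<one> = \<zero>"
   "\<And>n::nat. 0 < n ==> n < p ==> [n] \<cdot> \<one> \<noteq> \<zero>"
   using prime_characteristic by metis
  have p0: "p > 0" "p \<ge> 2" using p(1) prime_gt_0_nat prime_ge_2_nat by auto
  have dvd: "p dvd i" if "[i] \<cdot> c = \<zero>" "c \<in> carrier R" "c \<noteq> \<zero>" for i :: nat and c
  proof -
   have "[i] \<cdot> \<one> \<otimes> c = \<zero>" using that add_pow_ldistr[of \<one> c i] by simp
   then have i1: "[i] \<cdot> \<one> = \<zero>" using that(2,3) integral_iff[of "[i] \<cdot> \<one>" c] by simp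
   have "[i] \<cdot> \<one> = [(p * (i div p))] \<cdot> \<one> \<oplus> [(i mod p)] \<cdot> \<one>" by (simp add: add.nat_pow_mult)
   moreover have "[(p * (i div p))] \<cdot> \<one> = \<zero>"
    using add.nat_pow_pow[of \<one> "i div p" p] p(2) by simp
   ultimately have "[(i mod p)] \<cdot> \<one> = \<zero>" using i1 by simp
   then have "i mod p = 0" using p(3)[of "i mod p"] p0 by (metis gr0I mod_less_divisor)
   then show ?thesis by auto
  qed
  have "p dvd degree ?f" using dvd[of "degree ?f" \<one>] der[of "degree ?f"] lead deg by simp
  then obtain n where n: "degree ?f = p * n" by (elim dvdE)
  then have n0: "n > 0" using deg by (cases n) auto
  have len: "length ?f = Suc (p * n)" using n deg by linarith
  let ?h = "map (\<lambda>j. coeff ?f (p * j)) (rev [0..<Suc n])"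
  have z: "coeff ?f i = \<zero>" if "i < length ?f" "\<not> p dvd i" for i
   using dvd[of i "coeff ?f i"] der[OF that(1)] that(2) coeff_in_carrier[OF fc] by blast
  have "eval ?h (x [^] p) = \<zero>" using eval_contract[OF p0(1) fc x len z] I(4) by simp
  have hF: "set ?h \<subseteq> F"
  proof -
   have "coeff ?f (p * j) \<in> F" if "j < Suc n" for j
   proof -
    have "p * j \<le> p * n" using that by (intro mult_le_mono2) simp
    then have "p * j < length ?f" by (simp only: len less_Suc_eq_le)
    then show ?thesis using fF coeff_nth[of "p * j" ?f] by (metis coeff_img_restrict imageI lessThan_iff subsetD)
   qed
   then show ?thesis by auto
  qed
  have small: "Suc n \<le> degree ?f"
  proof -
   have "2 * n \<le> p * n" using p0(2) by (rule mult_le_mono1)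
   then show ?thesis using n n0 by linarith
  qed
  have ind: "independent F (exp_base x (Suc n))"
  proof -
   have "exp_base x (degree ?f) = map (\<lambda>i. x [^] i) (rev [Suc n..<degree ?f]) @ exp_base x (Suc n)"
    using exp_base_append[of x "Suc n" "degree ?f - Suc n"] small by (metis le_add_diff_inverse)
   then show ?thesis using exp_base_independent[OF F x alg] independent_split(1)[OF F] by metis
  qed
  have ebL: "set (exp_base x (Suc n)) \<subseteq> L"
  proof -
   have "x [^] (i::nat) \<in> L" for i using xL subringE[OF subfieldE(1)[OF L(1)]] by (induction i) auto
   then show ?thesis unfolding exp_base_def by auto
  qed
  have "independent F (map (\<lambda>u. u [^] p) (exp_base x (Suc n)))"
   by (rule pth_powers_independent[OF p(1,2) F subfieldE(1)[OF L(1)] L(2) dim spanned ind ebL])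
  moreover have "map (\<lambda>u. u [^] p) (exp_base x (Suc n)) = exp_base (x [^] p) (Suc n)"
   unfolding exp_base_def using x by (simp add: nat_pow_pow mult.commute del: upt_Suc)
  ultimately have "independent F (exp_base (x [^] p) (Suc n))" by simp
  moreover have "combine ?h (exp_base (x [^] p) (Suc n)) = \<zero>"
   using combine_eq_eval[of ?h "x [^] p"] \<open>eval ?h (x [^] p) = \<zero>\<close> by (simp del: upt_Suc)
  ultimately have "set (take (length (exp_base (x [^] p) (Suc n))) ?h) \<subseteq> {\<zero>}"
   using independent_imp_trivial_combine[OF F _ hF] by blast
  then have "set ?h \<subseteq> {\<zero>}" by (simp add: exp_base_def del: upt_Suc)
  moreover have "coeff ?f (p * n) \<in> set ?h" by auto
  ultimately show False using lead n by auto
 qed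
qed

end

context monogenic_dedekind begin

text \<open>As \<open>x \<mapsto> x\<^sup>p\<close> is injective, \<open>t\<^sup>p\<close> has as many conjugates as \<open>t\<close>. So its powers form a basis of \<open>L\<close> as well.\<close>

lemma L_pth_power_spanned: "pth_power_spanned (quotient_field D) L"
 unfolding pth_power_spanned_def
proof (intro allI impI ballI)
 fix p :: nat and x assume p: "Factorial_Ring.prime p \<and> [p] \<cdot> \<one> = \<zero>" and x: "x \<in> L"
 let ?F = "quotient_field D"
 have Lr: "subring L R" by (rule subfieldE(1)[OF L_subfield])
 have tL: "t [^] (i::nat) \<in> L" for i using F_incl_L(2) subringE[OF Lr] by (induction i) auto
 have frob_inj: "inj_on (\<lambda>b. b [^] p) (carrier R)"
 proof (rule inj_onI)
  fix a b assume ab: "a \<in> carrier R" "b \<in> carrier R" "a [^] p = b [^] p"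
  have "((a \<ominus> b) \<oplus> b) [^] p = (a \<ominus> b) [^] p \<oplus> b [^] p" using frobenius_add[of p "a \<ominus> b" b] p ab by simp
  moreover have "(a \<ominus> b) \<oplus> b = a" using ab by algebra
  ultimately have "(a \<ominus> b) [^] p \<oplus> b [^] p = b [^] p" using ab by simp
  then have "(a \<ominus> b) [^] p = \<zero>" using ab by (metis add.r_cancel_one' minus_closed nat_pow_closed)
  moreover have "c [^] (n::nat) = \<zero> ==> c = \<zero>" if "c \<in> carrier R" for c n
   using that by (induction n) (auto simp: integral_iff)
  ultimately have "a \<ominus> b = \<zero>" using ab by blast
  then show "a = b" using ab by simp
 qed
 have "powers_independent ?F (length g) (t [^] p)" unfolding powers_independent_def
 proof (intro allI impI)
  fix h assume h: "set h \<subseteq> ?F \<and> length h \<le> length g \<and> eval h (t [^] p) = \<zero>"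
  have hc: "set h \<subseteq> carrier R" using h Fp(1) by auto
  show "set h \<subseteq> {\<zero>}"
  proof (rule few_roots[OF hc, of "(\<lambda>b. b [^] p) ` {b \<in> carrier R. eval (\<one> # g) b = \<zero>}"])
   show "length h \<le> card ((\<lambda>b. b [^] p) ` {b \<in> carrier R. eval (\<one> # g) b = \<zero>})"
    using h sep card_image[OF inj_on_subset[OF frob_inj]] by (metis (no_types, lifting) mem_Collect_eq subsetI)
   fix c assume "c \<in> (\<lambda>b. b [^] p) ` {b \<in> carrier R. eval (\<one> # g) b = \<zero>}"
   then obtain b where b: "b \<in> carrier R" "eval (\<one> # g) b = \<zero>" "c = b [^] p" by auto
   interpret H: hom_lift R R ?F g t id b by (rule conj_lift[OF b(1,2)])
   have hL: "set h \<subseteq> L" using h F_incl_L(1) by auto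
   have "set (monom \<one> p) \<subseteq> ?F" unfolding monom_def using Fp(2,3) by auto
   then have "H.lift (eval (monom \<one> p) t) = eval (map id (monom \<one> p)) b" by (rule H.lift_eval)
   then have "H.lift (t [^] p) = b [^] p" using eval_monom t(1) b(1) by (simp only: list.map_id one_closed l_one nat_pow_closed)
   moreover have "map H.lift h = h" using H.lift_extends h by (auto intro!: map_idI)
   ultimately show "eval h c = \<zero>"
    using H.lift_eval_in_extension(1)[OF hL[unfolded L_def] tL[unfolded L_def]] h b(3) H.lift_zero_one(1) by metis
  qed auto
 qed
 then have indp: "independent ?F (exp_base (t [^] p) (length g))"
 proof (intro trivial_combine_imp_independent[OF F(1)] exp_base_closed)
  fix Ks assume pi: "powers_independent ?F (length g) (t [^] p)"
   and Ks: "set Ks \<subseteq> ?F" "combine Ks (exp_base (t [^] p) (length g)) = \<zero>"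
  let ?B = "exp_base (t [^] p) (length g)"
  have KsC: "set Ks \<subseteq> carrier R" "set ?B \<subseteq> carrier R" using Ks(1) Fp(1) exp_base_closed t(1) by auto
  obtain Ks' where K': "set (take (length ?B) Ks) \<subseteq> set Ks'" "set Ks' \<subseteq> set (take (length ?B) Ks) \<union> {\<zero>}"
   "length Ks' = length ?B" "combine Ks' ?B = \<zero>"
   by (rule combine_normalize[OF KsC Ks(2)], rule that)
  have len: "length Ks' = length g" using K'(3) by (simp add: exp_base_def)
  then have "eval Ks' (t [^] p) = \<zero>" using K'(4) combine_eq_eval[of Ks' "t [^] p"] by simp
  moreover have "set Ks' \<subseteq> ?F" using K'(2) Ks(1) Fp(2) set_take_subset[of "length ?B" Ks] by auto
  ultimately have "set Ks' \<subseteq> {\<zero>}" using pi len unfolding powers_independent_def by auto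
  then show "set (take (length ?B) Ks) \<subseteq> {\<zero>}" using K'(1) by auto
 qed (use t in auto)
 have sub: "set (exp_base (t [^] p) (length g)) \<subseteq> L"
  using tL t(1) unfolding exp_base_def by (auto simp: nat_pow_pow)
 have "length (exp_base (t [^] p) (length g)) = length g" by (simp add: exp_base_def)
 then have "Span ?F (exp_base (t [^] p) (length g)) = L"
  using independent_length_eq_dimension[OF F(1) L_dimension indp sub] by blast
 moreover have "exp_base (t [^] p) (length g) = map (\<lambda>u. u [^] p) (exp_base t (length g))"
  unfolding exp_base_def using t(1) by (simp add: nat_pow_pow mult.commute)
 moreover have "set (exp_base t (length g)) \<subseteq> L" using tL unfolding exp_base_def by auto
 ultimately show "\<exists>Us. set Us \<subseteq> L \<and> x \<in> Span ?F (map (\<lambda>u. u [^] p) Us)" using x by metis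
qed

end

section \<open>Prescribing the decomposition of finitely many places\<close>

context field begin

lemma exists_monic_with_roots:
 assumes K: "subring K R" and S: "finite S" "S \<subseteq> K"
 shows "\<exists>g. set g \<subseteq> K \<and> length g = card S \<and> {x \<in> carrier R. eval (\<one> # g) x = \<zero>} = S"
 using S
proof (induction S rule: finite_induct)
 case empty
 then show ?case by (intro exI[of _ "[]"]) auto
next
 case (insert s S)
 note Kp = subringE[OF K]
 have "S \<subseteq> K" using insert.prems by simp
 then obtain g where g: "set g \<subseteq> K" "length g = card S" "{x \<in> carrier R. eval (\<one> # g) x = \<zero>} = S"
  using insert.IH by blast
 let ?l = "[\<one>, \<ominus> s]"
 have s: "s \<in> K" "s \<in> carrier R" using insert.prems Kp(1) by auto
 have l: "polynomial K ?l" "polynomial K (\<one> # g)" unfolding polynomial_def using s Kp(3,5) g(1) by auto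
 have lc: "set ?l \<subseteq> carrier R" "set (\<one> # g) \<subseteq> carrier R" using l polynomial_incl Kp(1) by blast+
 have p: "polynomial K (poly_mult ?l (\<one> # g))" using poly_mult_closed[OF K l] .
 have deg: "degree (poly_mult ?l (\<one> # g)) = Suc (length g)" using poly_mult_degree_eq[OF K l] by simp
 have lead: "lead_coeff (poly_mult ?l (\<one> # g)) = \<one>" using poly_mult_lead_coeff[OF K l] by simp
 obtain c h where h: "poly_mult ?l (\<one> # g) = c # h" using deg by (cases "poly_mult ?l (\<one> # g)") auto
 have c: "c = \<one>" "length h = Suc (length g)" "set h \<subseteq> K"
  using lead deg p polynomial_incl[OF p] unfolding h by auto
 have "eval (\<one> # h) x = \<zero> \<longleftrightarrow> x \<in> insert s S" if x: "x \<in> carrier R" for x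
 proof -
  have "eval (\<one> # h) x = eval ?l x \<otimes> eval (\<one> # g) x"
   using eval_poly_mult[OF lc x] unfolding h c(1) .
  moreover have "eval ?l x = x \<ominus> s" using x s by (simp add: minus_eq)
  moreover have "eval (\<one> # g) x \<in> carrier R" by (rule eval_in_carrier[OF lc(2) x])
  ultimately have "eval (\<one> # h) x = \<zero> \<longleftrightarrow> x = s \<or> eval (\<one> # g) x = \<zero>"
   using integral_iff[of "x \<ominus> s" "eval (\<one> # g) x"] x s by simp
  then show ?thesis using g(3) x by auto
 qed
 then have "{x \<in> carrier R. eval (\<one> # h) x = \<zero>} = insert s S" using s insert.prems Kp(1) by auto
 then show ?case using c g(2) insert.hyps by (intro exI[of _ h]) simp
qed

text \<open>The Chinese remainder theorem for places.\<close>

lemma exists_simultaneous_preimage: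
 assumes D: "subring D R" and J: "finite J" and pl: "\<And>j. j \<in> J ==> is_place D (C j) (\<phi> j)"
  and inj: "inj_on (\<lambda>j. place_kernel D (C j) (\<phi> j)) J" and c: "\<And>j. j \<in> J ==> c j \<in> \<phi> j ` D"
 shows "\<exists>a \<in> D. \<forall>j \<in> J. \<phi> j a = c j"
proof -
 note Dp = subringE[OF D]
 let ?K = "\<lambda>j. place_kernel D (C j) (\<phi> j)"
 have e: "\<exists>e \<in> D. \<phi> i e = \<one>\<^bsub>C i\<^esub> \<and> (\<forall>j \<in> J - {i}. \<phi> j e = \<zero>\<^bsub>C j\<^esub>)" if i: "i \<in> J" for i
 proof -
  note ki = place_kernel_maximal[OF pl[OF i]] and pi = place_simps[OF pl[OF i]]
  have "\<exists>y \<in> D - ?K i. \<forall>j \<in> J - {i}. y \<in> ?K j"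
  proof (rule prime_avoidance_product[OF D ki(2)])
   fix j assume j: "j \<in> J - {i}"
   then have jJ: "j \<in> J" "?K j \<noteq> ?K i" using inj i unfolding inj_on_def by auto
   note kj = place_kernel_maximal[OF pl[OF jJ(1)]]
   have "\<not> ?K j \<subseteq> ?K i"
    using prime_in_maximal_eq[OF D kj(1)] ki(2) jJ(2) unfolding prime_in_def by blast
   then show "\<exists>x \<in> D - ?K i. x \<in> ?K j" unfolding place_kernel_def by auto
   show "?K j \<subseteq> D" unfolding place_kernel_def by auto
   show "x \<otimes> y \<in> ?K j" if "x \<in> D" "y \<in> ?K j" for x y
    using kj(2) module_overD(4) that unfolding prime_in_def by blast
  qed (use J in simp)
  then obtain y where y: "y \<in> D" "y \<notin> ?K i" "\<forall>j \<in> J - {i}. y \<in> ?K j" by auto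
  then have "\<phi> i y \<noteq> \<zero>\<^bsub>C i\<^esub>" unfolding place_kernel_def by auto
  then obtain r where r: "r \<in> D" "\<phi> i y \<otimes>\<^bsub>C i\<^esub> \<phi> i r = \<one>\<^bsub>C i\<^esub>" using place_inverse[OF pl[OF i] y(1)] by auto
  have "\<phi> j (y \<otimes> r) = \<zero>\<^bsub>C j\<^esub>" if j: "j \<in> J - {i}" for j
  proof -
   have plj: "is_place D (C j) (\<phi> j)" using pl j by auto
   interpret Cj: field "C j" using plj unfolding is_place_def by simp
   note pj = place_simps[OF plj]
   have "\<phi> j y = \<zero>\<^bsub>C j\<^esub>" using y(3) j unfolding place_kernel_def by auto
   then show ?thesis using pj(6)[OF y(1) r(1)] pj(4)[OF r(1)] by simp
  qed
  moreover have "\<phi> i (y \<otimes> r) = \<one>\<^bsub>C i\<^esub>" using pi(6)[OF y(1) r(1)] r(2) by simp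
  ultimately show ?thesis using Dp(6)[OF y(1) r(1)] by blast
 qed
 have "\<exists>a \<in> D. (\<forall>j \<in> T. \<phi> j a = c j) \<and> (\<forall>j \<in> J - T. \<phi> j a = \<zero>\<^bsub>C j\<^esub>)" if "finite T" "T \<subseteq> J" for T
  using that
 proof (induction T rule: finite_induct)
  case empty
  then show ?case using Dp(2) place_simps(1)[OF pl] by auto
 next
  case (insert i T)
  have i: "i \<in> J" using insert.prems by auto
  obtain a where a: "a \<in> D" "\<forall>j \<in> T. \<phi> j a = c j" "\<forall>j \<in> J - T. \<phi> j a = \<zero>\<^bsub>C j\<^esub>" using insert by auto
  obtain u where u: "u \<in> D" "\<phi> i u = \<one>\<^bsub>C i\<^esub>" "\<forall>j \<in> J - {i}. \<phi> j u = \<zero>\<^bsub>C j\<^esub>" using e[OF i] by auto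
  obtain d where d: "d \<in> D" "\<phi> i d = c i" using c[OF i] by auto
  have "\<phi> j (a \<oplus> u \<otimes> d) = (if j = i then c j else \<phi> j a)" if j: "j \<in> J" for j
  proof -
   interpret Cj: field "C j" using pl[OF j] unfolding is_place_def by simp
   note pj = place_simps[OF pl[OF j]]
   have eq: "\<phi> j (a \<oplus> u \<otimes> d) = \<phi> j a \<oplus>\<^bsub>C j\<^esub> \<phi> j u \<otimes>\<^bsub>C j\<^esub> \<phi> j d"
    using pj(5)[OF a(1) Dp(6)[OF u(1) d(1)]] pj(6)[OF u(1) d(1)] by simp
   have cc: "\<phi> j a \<in> carrier (C j)" "\<phi> j d \<in> carrier (C j)" using pj(4) a(1) d(1) by auto
   show ?thesis
   proof (cases "j = i")
    case True
    have "\<phi> j a = \<zero>\<^bsub>C j\<^esub>" using a(3) True i insert.hyps by auto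
    moreover have "\<phi> j u = \<one>\<^bsub>C j\<^esub>" "\<phi> j d = c j" using u(2) d(2) True by auto
    ultimately have "\<phi> j (a \<oplus> u \<otimes> d) = c j" using eq cc by simp
    then show ?thesis using True by simp
   next
    case False
    then have "\<phi> j u = \<zero>\<^bsub>C j\<^esub>" using u(3) j by auto
    then show ?thesis using eq False cc by simp
   qed
  qed
  then show ?case using a Dp(6,7) u(1) d(1) insert.prems insert.hyps by (intro bexI[of _ "a \<oplus> u \<otimes> d"]) auto
 qed
 from this[OF J] show ?thesis by auto
qed

lemma exists_simultaneous_list_preimage:
 assumes D: "subring D R" and J: "finite J" and pl: "\<And>j. j \<in> J ==> is_place D (C j) (\<phi> j)"
  and inj: "inj_on (\<lambda>j. place_kernel D (C j) (\<phi> j)) J"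
  and G: "\<And>j. j \<in> J ==> set (G j) \<subseteq> \<phi> j ` D \<and> length (G j) = l"
 shows "\<exists>g. set g \<subseteq> D \<and> length g = l \<and> (\<forall>j \<in> J. map (\<phi> j) g = G j)"
 using G
proof (induction l arbitrary: G)
 case 0
 then show ?case by (intro exI[of _ "[]"]) auto
next
 case (Suc l)
 have cons: "G j = hd (G j) # tl (G j)" if "j \<in> J" for j using Suc.prems[OF that] by (cases "G j") auto
 have "\<exists>a \<in> D. \<forall>j \<in> J. \<phi> j a = hd (G j)"
 proof (rule exists_simultaneous_preimage[OF D J pl inj])
  fix j assume "j \<in> J"
  then show "hd (G j) \<in> \<phi> j ` D" using Suc.prems[of j] cons[of j] by (metis list.set_intros(1) subsetD)
 qed
 then obtain a where a: "a \<in> D" "\<And>j. j \<in> J ==> \<phi> j a = hd (G j)" by auto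
 have "\<exists>g. set g \<subseteq> D \<and> length g = l \<and> (\<forall>j \<in> J. map (\<phi> j) g = tl (G j))"
 proof (rule Suc.IH)
  fix j assume j: "j \<in> J"
  have "set (tl (G j)) \<subseteq> set (G j)" by (cases "G j") auto
  then show "set (tl (G j)) \<subseteq> \<phi> j ` D \<and> length (tl (G j)) = l" using Suc.prems[OF j] by auto
 qed
 then obtain g where g: "set g \<subseteq> D" "length g = l" "\<And>j. j \<in> J ==> map (\<phi> j) g = tl (G j)" by auto
 show ?case using a g cons by (intro exI[of _ "a # g"]) auto
qed

text \<open>Irreducibility is inherited from the reduction at one place. A dependence of smaller degree scales to
 \<open>k(t) = 0\<close> with \<open>k\<close> over \<open>D\<close> and nonzero modulo \<open>M\<close>. The value \<open>k(b)\<close> is invertible in the residue field of \<open>b\<close>; lifting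
 its inverse and reducing modulo \<open>X\<^sup>n + g\<close> gives \<open>r(t) = -1\<close> with all coefficients of \<open>r\<close> in \<open>M\<close>. Dividing by a
 coefficient \<open>c \<in> M\<close> of least value shows that \<open>s / c\<close> is integral over \<open>D\<close> for some \<open>s \<notin> M\<close>. Thus \<open>s / c \<in> D\<close> and
 \<open>s \<in> M\<close>, a contradiction.\<close>

lemma powers_independent_lift:
 assumes ded: "dedekind_domain D" and pl: "is_place D C \<phi>" "place_kernel D C \<phi> \<noteq> {\<zero>}" and g: "set g \<subseteq> D"
  and b: "b \<in> carrier C" "ring.eval C (map \<phi> (\<one> # g)) b = \<zero>\<^bsub>C\<^esub>"
   "domain.powers_independent C (\<phi> ` D) (length g) b"
  and t: "t \<in> carrier R" "eval (\<one> # g) t = \<zero>"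
 shows "powers_independent (quotient_field D) (length g) t"
 unfolding powers_independent_def
proof (intro allI impI)
 fix h assume h: "set h \<subseteq> quotient_field D \<and> length h \<le> length g \<and> eval h t = \<zero>"
 interpret C: field C using pl unfolding is_place_def by simp
 note Dd = dedekind_domainD[OF ded]
 note Dp = subringE[OF Dd(1)]
 note F = quotient_field_subfield[OF Dd(1)]
 note Fp = subringE[OF subfieldE(1)[OF F(1)]]
 define M where "M = place_kernel D C \<phi>"
 note ps = place_simps[OF pl(1)]
 note Mm = place_kernel_maximal[OF pl(1), folded M_def]
 have mem_M: "x \<in> M \<longleftrightarrow> x \<in> D \<and> \<phi> x = \<zero>\<^bsub>C\<^esub>" for x unfolding M_def place_kernel_def by auto
 have Mmod: "module_over D M" "M \<subseteq> D" using Mm(2) unfolding prime_in_def by auto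
 note Vs = localization_subring[OF Dd(1) Mm(2)]
 have val: "x \<in> localization D M \<or> (x \<noteq> \<zero> \<and> inv x \<in> localization D M)" if "x \<in> quotient_field D" for x
  using dvr_valuation[OF dedekind_localization_dvr[OF ded Mm(1)] that] pl(2) unfolding M_def by blast
 have pivot: "\<exists>c \<in> set h. \<exists>s \<in> D - M. c \<noteq> \<zero> \<and> (\<forall>a \<in> set h. s \<otimes> (inv c \<otimes> a) \<in> D)"
  if hF: "set h \<subseteq> quotient_field D" and h0: "\<not> set h \<subseteq> {\<zero>}" for h
 proof -
  obtain c where c: "c \<in> set h" "c \<noteq> \<zero>" "\<forall>a \<in> set h. inv c \<otimes> a \<in> localization D M"
   using valuation_pivot[OF F(1) Vs(1) val hF h0] by blast
  have "set (map ((\<otimes>) (inv c)) h) \<subseteq> localization D M" using c(3) by auto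
  then obtain s where "s \<in> D - M" "\<forall>a \<in> set (map ((\<otimes>) (inv c)) h). s \<otimes> a \<in> D"
   using common_denominator[OF Dd(1) Mm(2)] by blast
  then show ?thesis using c(1,2) by (intro bexI[of _ c] bexI[of _ s]) auto
 qed
 have invF: "inv c \<in> quotient_field D" "inv c \<in> carrier R" "inv c \<otimes> c = \<one>" "c \<otimes> inv c = \<one>" "c \<in> carrier R"
  if "c \<in> quotient_field D" "c \<noteq> \<zero>" for c
  using that Fp(1) field_Units subfield_m_inv(1)[OF F(1), of c] by auto
 interpret H: hom_eval R C D \<phi> b
  by (intro hom_eval.intro hom_eval_axioms.intro domain_axioms C.domain_axioms Dd(1) b(1))
   (use pl in \<open>simp add: is_place_def\<close>)
 show "set h \<subseteq> {\<zero>}"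
 proof (rule ccontr)
  assume h0: "\<not> set h \<subseteq> {\<zero>}"
  have hF: "set h \<subseteq> quotient_field D" "length h \<le> length g" "eval h t = \<zero>" using h by auto
  have hc: "set h \<subseteq> carrier R" using hF(1) Fp(1) by auto
  obtain c s where c: "c \<in> set h" "c \<noteq> \<zero>" and s: "s \<in> D - M" "\<forall>a \<in> set h. s \<otimes> (inv c \<otimes> a) \<in> D"
   using pivot[OF hF(1) h0] by auto
  note ci = invF[OF subsetD[OF hF(1) c(1)] c(2)]
  have sc: "s \<in> carrier R" using s Dp(1) by auto
  define k where "k = map ((\<otimes>) s) (map ((\<otimes>) (inv c)) h)"
  have kD: "set k \<subseteq> D" "length k \<le> length g" using s(2) hF(2) unfolding k_def by auto
  have ch: "set (map ((\<otimes>) (inv c)) h) \<subseteq> carrier R" using hc ci(2) by auto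
  have "eval k t = s \<otimes> (inv c \<otimes> eval h t)"
   unfolding k_def eval_map_mult[OF sc ch t(1)] eval_map_mult[OF ci(2) hc t(1)] ..
  then have kt: "eval k t = \<zero>" using hF(3) sc ci(2) by simp
  have "s \<in> set k"
  proof -
   have "s \<otimes> (inv c \<otimes> c) \<in> set k" unfolding k_def using c(1) by auto
   then show ?thesis using ci sc by simp
  qed
  moreover have "\<phi> s \<noteq> \<zero>\<^bsub>C\<^esub>" using s(1) mem_M by auto
  ultimately have "\<not> set (map \<phi> k) \<subseteq> {\<zero>\<^bsub>C\<^esub>}" by auto
  moreover have "set (map \<phi> k) \<subseteq> \<phi> ` D" using kD(1) by auto
  ultimately have y0: "H.img_eval k \<noteq> \<zero>\<^bsub>C\<^esub>"
   using b(3) kD(2) unfolding C.powers_independent_def by (metis length_map)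
  note sub = place_image_subfield[OF pl(1)]
  have gk: "set (map \<phi> g) \<subseteq> \<phi> ` D" using g by auto
  have "ring.eval C (\<one>\<^bsub>C\<^esub> # map \<phi> g) b = \<zero>\<^bsub>C\<^esub>" using b(2) ps(2) by simp
  then have alg: "(C.algebraic over (\<phi> ` D)) b"
   using C.monic_list_eq_Irr(1)[OF sub b(1) gk] b(3) by simp
  have ext: "subfield (C.simple_extension (\<phi> ` D) b) C"
   using C.simple_extension_is_subfield[OF sub b(1)] alg by (simp add: over_def)
  have ext_eval: "x \<in> C.simple_extension (\<phi> ` D) b \<longleftrightarrow> (\<exists>u. set u \<subseteq> D \<and> x = H.img_eval u)" for x
  proof -
   have "v \<in> lists (\<phi> ` D) \<longleftrightarrow> v \<in> map \<phi> ` lists D" for v by (simp only: lists_image)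
   then have "set v \<subseteq> \<phi> ` D \<longleftrightarrow> (\<exists>u. set u \<subseteq> D \<and> v = map \<phi> u)" for v
    unfolding lists_eq_set image_iff by blast
   then show ?thesis unfolding C.mem_simple_extension_iff_eval[OF subfieldE(3)[OF sub] b(1)] by (simp only:) blast
  qed
  have "H.img_eval k \<in> C.simple_extension (\<phi> ` D) b - {\<zero>\<^bsub>C\<^esub>}" using ext_eval kD(1) y0 by blast
  note iv = C.subfield_m_inv[OF ext this]
  obtain u where u: "set u \<subseteq> D" "inv\<^bsub>C\<^esub> (H.img_eval k) = H.img_eval u" using iv(1) ext_eval by blast
  have uk: "H.img_eval u \<otimes>\<^bsub>C\<^esub> H.img_eval k = \<one>\<^bsub>C\<^esub>" using iv(3) u(2) by simp
  define p where "p = poly_add (poly_mult u k) [\<ominus> \<one>]"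
  have m1: "set [\<ominus> \<one>] \<subseteq> D" using Dp(3,5) by simp
  note ukD = H.poly_closed(1)[OF u(1) kD(1)]
  have pD: "set p \<subseteq> D" unfolding p_def by (rule H.poly_closed(2)[OF ukD m1])
  have "H.img_eval [\<ominus> \<one>] = \<ominus>\<^bsub>C\<^esub> \<one>\<^bsub>C\<^esub>" using ps(2) ps(7)[OF Dp(3)] b(1) by simp
  then have pb: "H.img_eval p = \<zero>\<^bsub>C\<^esub>"
   unfolding p_def H.img_eval_add[OF ukD m1] H.img_eval_mult[OF u(1) kD(1)] uk by (simp add: C.r_neg)
  have pt: "eval p t = \<ominus> \<one>"
  proof -
   have "eval p t = eval u t \<otimes> eval k t \<oplus> eval [\<ominus> \<one>] t"
    unfolding p_def eval_poly_add[OF H.in_carrier[OF ukD] H.in_carrier[OF m1] t(1)]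
     eval_poly_mult[OF H.in_carrier[OF u(1)] H.in_carrier[OF kD(1)] t(1)] ..
   then show ?thesis using kt eval_in_carrier[OF H.in_carrier[OF u(1)] t(1)] t(1) by simp
  qed
  obtain q r where r: "set q \<subseteq> D" "set r \<subseteq> D" "length r = length g"
   "\<And>x. x \<in> carrier R ==> eval p x = eval (\<one> # g) x \<otimes> eval q x \<oplus> eval r x"
   "normalize p = poly_add (poly_mult (\<one> # g) q) (normalize r)"
   by (rule exists_reduced_list[OF Dd(1) g t(1) pD], rule that)
  have rt: "eval r t = \<ominus> \<one>"
   using r(4)[OF t(1)] pt t eval_in_carrier[OF H.in_carrier[OF r(1)] t(1)] eval_in_carrier[OF H.in_carrier[OF r(2)] t(1)]
   by simp
  have rb: "H.img_eval r = \<zero>\<^bsub>C\<^esub>"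
  proof -
   have g1: "set (\<one> # g) \<subseteq> D" using g Dp(3) by simp
   have gq: "set (poly_mult (\<one> # g) q) \<subseteq> D" by (rule H.poly_closed(1)[OF g1 r(1)])
   have nr: "set (normalize r) \<subseteq> D" using normalize_gives_polynomial[OF r(2)] polynomial_incl by blast
   have "H.img_eval p = H.img_eval (normalize p)" using H.img_eval_normalize[OF pD] by simp
   also have "\<dots> = H.img_eval (\<one> # g) \<otimes>\<^bsub>C\<^esub> H.img_eval q \<oplus>\<^bsub>C\<^esub> H.img_eval r"
    unfolding r(5) H.img_eval_add[OF gq nr] H.img_eval_mult[OF g1 r(1)] H.img_eval_normalize[OF r(2)] ..
   finally have "\<zero>\<^bsub>C\<^esub> = \<zero>\<^bsub>C\<^esub> \<otimes>\<^bsub>C\<^esub> H.img_eval q \<oplus>\<^bsub>C\<^esub> H.img_eval r" unfolding pb b(2) .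
   then show ?thesis
    unfolding C.l_null[OF H.img_eval_in_carrier[OF r(1)]] C.l_zero[OF H.img_eval_in_carrier[OF r(2)]] by (rule sym)
  qed
  have "set (map \<phi> r) \<subseteq> \<phi> ` D" using r(2) by auto
  then have "set (map \<phi> r) \<subseteq> {\<zero>\<^bsub>C\<^esub>}" using b(3) rb r(3) unfolding C.powers_independent_def by (metis length_map order_refl)
  then have rM: "set r \<subseteq> M" using r(2) mem_M by auto
  have rF: "set r \<subseteq> quotient_field D" using r(2) F(2) by auto
  have "\<not> set r \<subseteq> {\<zero>}"
  proof
   assume "set r \<subseteq> {\<zero>}"
   then have "eval r t = \<zero>" using t(1) by (induction r) auto
   then have "\<ominus> \<one> = \<zero>" using rt by simp
   then show False using add.inv_eq_1_iff[of \<one>] one_not_zero by simp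
  qed
  then obtain c' s' where c': "c' \<in> set r" "c' \<noteq> \<zero>" and s': "s' \<in> D - M" "\<forall>a \<in> set r. s' \<otimes> (inv c' \<otimes> a) \<in> D"
   using pivot[OF rF] by auto
  note ci' = invF[OF subsetD[OF rF c'(1)] c'(2)]
  have sc': "s' \<in> carrier R" using s' Dp(1) by auto
  define z where "z = s' \<otimes> inv c'"
  have zF: "z \<in> quotient_field D" "z \<in> carrier R" unfolding z_def using Fp(6) s' F(2) ci' sc' by auto
  let ?I = "{x \<in> carrier R. integral D x}"
  have I: "subring ?I R" by (rule integral_closure_subring[OF Dd(2) carrier_is_subring])
  note Ip = subringE[OF I]
  have DI: "D \<subseteq> ?I" using integral_mem[OF Dd(1)] Dp(1) by auto
  have tI: "t \<in> ?I" using t g integral_iff_list[OF Dd(1)] by auto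
  let ?r = "map ((\<otimes>) s') (map ((\<otimes>) (inv c')) r)"
  have rc: "set r \<subseteq> carrier R" using r(2) Dp(1) by auto
  have cr: "set (map ((\<otimes>) (inv c')) r) \<subseteq> carrier R" using rc ci'(2) by auto
  have "eval ?r t = s' \<otimes> (inv c' \<otimes> eval r t)"
   unfolding eval_map_mult[OF sc' cr t(1)] eval_map_mult[OF ci'(2) rc t(1)] ..
  also have "\<dots> = \<ominus> z" unfolding rt z_def using sc' ci'(2) by (simp add: r_minus)
  finally have ez: "eval ?r t = \<ominus> z" .
  have "eval ?r t \<in> ?I"
  proof (rule eval_closed_module[OF _ I _ tI])
   have "module_over I I" if "subring I R" for I unfolding module_over_def using subringE[OF that] by auto
   then show "module_over ?I ?I" using I .
   show "set ?r \<subseteq> ?I" using s'(2) DI by auto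
  qed (use Ip(6) in blast)
  then have "z \<in> ?I" using Ip(5)[of "\<ominus> z"] ez zF(2) by simp
  then have "z \<in> D" using Dd(3)[OF zF(1)] by simp
  then have "z \<otimes> c' \<in> M" using module_overD(4)[OF Mmod(1)] rM c'(1) by blast
  moreover have "z \<otimes> c' = s'" unfolding z_def using ci' sc' by (simp add: m_assoc)
  ultimately show False using s'(1) by simp
 qed
qed

text \<open>If \<open>X\<^sup>n + g\<close>, which is irreducible, has a multiple root, its derivative is zero. Then the derivative of
 the reduction is zero too, and all roots of the reduction are multiple.\<close>

lemma card_roots_lift:
 assumes ac: "algebraically_closed R" and F: "subfield F R" "D \<subseteq> F" and pl: "is_place D C \<phi>"
  and g: "set g \<subseteq> D" "g \<noteq> []"
  and roots: "card {b \<in> carrier C. ring.eval C (map \<phi> (\<one> # g)) b = \<zero>\<^bsub>C\<^esub>} = length g"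
  and t: "t \<in> carrier R" "eval (\<one> # g) t = \<zero>" and ind: "powers_independent F (length g) t"
 shows "card {b \<in> carrier R. eval (\<one> # g) b = \<zero>} = length g"
proof -
 interpret A: algebraically_closed R by (rule ac)
 interpret C: field C using pl unfolding is_place_def by simp
 have D: "subring D R" using pl unfolding is_place_def by simp
 note Dp = subringE[OF D] and ps = place_simps[OF pl]
 have gF: "set g \<subseteq> F" using g(1) F(2) by auto
 note I = monic_list_eq_Irr[OF F(1) t(1) gF t(2) ind]
 have gc: "set (\<one> # g) \<subseteq> carrier R" using g(1) Dp(1) by auto
 have p: "\<one> # g \<in> carrier (poly_ring R)" using gc unfolding sym[OF univ_poly_carrier] polynomial_def by simp
 have "alg_mult (\<one> # g) a \<le> 1" if a: "a \<in> carrier R" for a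
 proof (rule ccontr)
  assume "\<not> alg_mult (\<one> # g) a \<le> 1"
  then have "alg_mult (Irr F t) a \<ge> 2" unfolding I(2) by simp
  note der = Irr_root_deriv_zero[OF F(1) t(1) I(1) a this, unfolded I(2)]
  let ?p = "map \<phi> (\<one> # g)"
  have g1D: "set (\<one> # g) \<subseteq> D" using g(1) Dp(3) by simp
  have pc: "set ?p \<subseteq> carrier C" using g1D ps(4) by auto
  have add_pow: "\<phi> ([k] \<cdot> c) = [k] \<cdot>\<^bsub>C\<^esub> \<phi> c \<and> [k] \<cdot> c \<in> D" if "c \<in> D" for k :: nat and c
   using that ps(1,5) Dp(2,7) by (induction k) auto
  have derC: "[(length ?p - 1 - i)] \<cdot>\<^bsub>C\<^esub> (?p ! i) = \<zero>\<^bsub>C\<^esub>" if i: "i < length ?p" for i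
  proof -
   have i': "i < length (\<one> # g)" using i by simp
   have "(\<one> # g) ! i \<in> D" using g1D nth_mem[OF i'] by blast
   then have "[(length ?p - 1 - i)] \<cdot>\<^bsub>C\<^esub> (?p ! i) = \<phi> ([(length (\<one> # g) - 1 - i)] \<cdot> ((\<one> # g) ! i))"
    using add_pow nth_map[OF i', of \<phi>] by simp
   then show ?thesis using der[OF i'] ps(1) by simp
  qed
  have pp: "?p \<in> carrier (poly_ring C)" using pc ps(2,3) unfolding sym[OF univ_poly_carrier] polynomial_def by simp
  let ?B = "{b \<in> carrier C. C.eval ?p b = \<zero>\<^bsub>C\<^esub>}"
  have cnt: "2 \<le> count (C.roots ?p) b" if "b \<in> ?B" for b
  proof -
   have b: "b \<in> carrier C" "C.eval ?p b = \<zero>\<^bsub>C\<^esub>" using that by auto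
   have "C.deriv_at ?p b = \<zero>\<^bsub>C\<^esub>" by (rule C.deriv_at_zero_if_coeffs[OF pc b(1) derC])
   then have "2 \<le> C.alg_mult ?p b" using C.alg_mult_ge_2_iff[OF pp _ b(1)] b(2) by simp
   then show ?thesis using C.alg_mult_eq_count_roots[OF pp] by simp
  qed
  have sub: "?B \<subseteq> set_mset (C.roots ?p)"
  proof
   fix b assume "b \<in> ?B"
   then have "0 < count (C.roots ?p) b" using cnt[of b] by linarith
   then show "b \<in># C.roots ?p" by (simp only: count_greater_zero_iff)
  qed
  have "2 * card ?B = (\<Sum>b\<in>?B. 2)" by simp
  also have "\<dots> \<le> (\<Sum>b\<in>?B. count (C.roots ?p) b)" by (rule sum_mono[OF cnt])
  also have "\<dots> \<le> (\<Sum>b\<in>set_mset (C.roots ?p). count (C.roots ?p) b)" by (rule sum_mono2[OF _ sub]) auto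
  also have "\<dots> = size (C.roots ?p)" by (simp add: size_multiset_overloaded_eq)
  also have "\<dots> \<le> degree ?p" by (rule C.size_roots_le_degree[OF pp])
  finally show False using roots g(2) by (cases g) auto
 qed
 then show ?thesis using A.card_roots_eq_degree(1)[OF p] by simp
qed

end

context monogenic_place begin

lemma place_at_t: "b \<in> B ==> a \<in> D ==> t \<ominus> a \<in> ker b \<longleftrightarrow> b = \<phi> a"
proof -
 assume b: "b \<in> B" and a: "a \<in> D"
 have bc: "b \<in> carrier C" using b unfolding B_def by auto
 have ac: "a \<in> carrier R" using a Dp(1) by auto
 have "eval [\<one>, \<ominus> a] t = t \<ominus> a" using t(1) ac by (simp add: minus_eq)
 moreover have "place_at b (eval [\<one>, \<ominus> a] t) = C.eval (map \<phi> [\<one>, \<ominus> a]) b"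
  by (rule place_at(3)[OF b]) (use a Dp in auto)
 moreover have "C.eval (map \<phi> [\<one>, \<ominus> a]) b = b \<ominus>\<^bsub>C\<^esub> \<phi> a"
  using bc ps(2,4,7) a by (simp add: C.minus_eq)
 moreover have "t \<ominus> a \<in> E" using t_in_E a D_incl_E Ep(5,7) unfolding minus_eq by blast
 ultimately show ?thesis using bc ps(4)[OF a] unfolding place_kernel_def by simp
qed

lemma split_lifts:
 assumes split: "B \<subseteq> \<phi> ` D"
 shows "\<exists>\<Psi>. complete_lifts D E C \<phi> \<Psi> \<and> card \<Psi> = length g \<and> (\<forall>\<psi> \<in> \<Psi>. card (\<psi> ` E) = card (\<phi> ` D))"
proof (intro exI conjI ballI)
 have inj: "inj_on ker B"
 proof (rule inj_onI)
  fix b c assume bc: "b \<in> B" "c \<in> B" "ker b = ker c"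
  then obtain a where a: "a \<in> D" "b = \<phi> a" using split by auto
  then have "t \<ominus> a \<in> ker c" using place_at_t[OF bc(1) a(1)] bc(3) by simp
  then show "b = c" using place_at_t[OF bc(2) a(1)] a(2) by simp
 qed
 have rep: "\<exists>c \<in> B. ker b = ker c" if "b \<in> B" for b using that by blast
 note cl = complete_lifts_place_at[OF subset_refl rep inj]
 show "complete_lifts D E C \<phi> (place_at ` B)" by (rule cl(1))
 show "card (place_at ` B) = length g" using cl(2) roots unfolding B_def by simp
 fix \<psi> assume "\<psi> \<in> place_at ` B"
 then obtain b where b: "b \<in> B" "\<psi> = place_at b" by auto
 note sub = place_image_subfield[OF place]
 have bc: "b \<in> carrier C" using b(1) unfolding B_def by auto
 have "C.simple_extension (\<phi> ` D) b = \<phi> ` D"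
  using C.simple_extension_subring_incl[OF subfieldE(1)[OF sub], of "\<phi> ` D" b] split b(1)
   C.simple_extension_incl[OF subfieldE(3)[OF sub] bc] subringE(3)[OF subfieldE(1)[OF sub]] by auto
 then show "card (\<psi> ` E) = card (\<phi> ` D)" using place_at_image[OF b(1)] b(2) by simp
qed

lemma inert_lifts:
 assumes b: "b \<in> B" and conj: "\<And>c h. c \<in> B ==> set h \<subseteq> \<phi> ` D ==> C.eval h c = \<zero>\<^bsub>C\<^esub> \<longleftrightarrow> C.eval h b = \<zero>\<^bsub>C\<^esub>"
  and card: "card (C.simple_extension (\<phi> ` D) b) = q"
 shows "\<exists>\<Psi>. complete_lifts D E C \<phi> \<Psi> \<and> card \<Psi> = 1 \<and> (\<forall>\<psi> \<in> \<Psi>. card (\<psi> ` E) = q)"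
proof (intro exI conjI ballI)
 have "ker c = ker b" if "c \<in> B" for c by (rule kernel_eqI[OF that b conj[OF that]])
 then have rep: "\<exists>d \<in> {b}. ker c = ker d" if "c \<in> B" for c using that by blast
 have sub: "{b} \<subseteq> B" using b by simp
 note cl = complete_lifts_place_at[OF sub rep]
 show "complete_lifts D E C \<phi> (place_at ` {b})" "card (place_at ` {b}) = 1" using cl by auto
 show "card (\<psi> ` E) = q" if "\<psi> \<in> place_at ` {b}" for \<psi> using that place_at_image[OF b] card by simp
qed

end

context field begin

text \<open>Choose a polynomial over each residue field, a product of \<open>l\<close> distinct linear factors for the places in
 \<open>A\<close> and an irreducible one for the others, and lift all of them to a single \<open>X\<^sup>l + g\<close> over \<open>D\<close>. As \<open>A\<close> is a proper subset of
 \<open>J\<close>, some reduction is irreducible, which makes the lifted polynomial irreducible and separable.\<close>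

lemma exists_extension_with_places:
 fixes J :: "'j set" and C :: "'j \<Rightarrow> 'c ring" and l :: nat
 assumes ac: "algebraically_closed R" and ded: "dedekind_domain D"
  and J: "finite J" and pl: "\<And>j. j \<in> J ==> is_place D (C j) (\<phi> j)"
  and nz: "\<And>j. j \<in> J ==> place_kernel D (C j) (\<phi> j) \<noteq> {\<zero>}"
  and acC: "\<And>j. j \<in> J ==> algebraically_closed (C j)"
  and inj: "inj_on (\<lambda>j. place_kernel D (C j) (\<phi> j)) J"
  and l: "l > 0" and A: "A \<subset> J" and big: "\<And>j. j \<in> A ==> l \<le> card (\<phi> j ` D)"
 shows "\<exists>E. dedekind_domain E \<and> D \<subseteq> E \<and> fg_module D E \<and>
  dimension l (quotient_field D) (quotient_field E) \<and>
  pth_power_spanned (quotient_field D) (quotient_field E) \<and>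
  (\<forall>j \<in> J. \<exists>\<Psi>. complete_lifts D E (C j) (\<phi> j) \<Psi> \<and> card \<Psi> = (if j \<in> A then l else 1) \<and>
   (\<forall>\<psi> \<in> \<Psi>. card (\<psi> ` E) = card (\<phi> j ` D) ^ (if j \<in> A then 1 else l)))"
proof -
 interpret A: algebraically_closed R by (rule ac)
 note Dd = dedekind_domainD[OF ded]
 note Dp = subringE[OF Dd(1)]
 note F = quotient_field_subfield[OF Dd(1)]
 define ev where "ev j = ring.eval (C j)" for j
 define rts where "rts j p = {x \<in> carrier (C j). ev j p x = \<zero>\<^bsub>C j\<^esub>}" for j p
 \<comment> \<open>\<open>p\<close> has pairwise conjugate roots, and \<open>b\<close> is one of them\<close>
 define inert where "inert j p b \<longleftrightarrow> b \<in> rts j p \<and> domain.powers_independent (C j) (\<phi> j ` D) l b \<and>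
  (\<forall>x h. x \<in> rts j p \<longrightarrow> set h \<subseteq> \<phi> j ` D \<longrightarrow> ev j h x = \<zero>\<^bsub>C j\<^esub> \<longleftrightarrow> ev j h b = \<zero>\<^bsub>C j\<^esub>) \<and>
  card (ring.simple_extension (C j) (\<phi> j ` D) b) = card (\<phi> j ` D) ^ l" for j p b
 define good where "good j G \<longleftrightarrow> set G \<subseteq> \<phi> j ` D \<and> length G = l \<and> card (rts j (\<one>\<^bsub>C j\<^esub> # G)) = l \<and>
  (if j \<in> A then rts j (\<one>\<^bsub>C j\<^esub> # G) \<subseteq> \<phi> j ` D else \<exists>b. inert j (\<one>\<^bsub>C j\<^esub> # G) b)" for j G
 have "\<exists>G. good j G" if j: "j \<in> J" for j
 proof -
  interpret Cj: algebraically_closed "C j" by (rule acC[OF j])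
  note sub = place_image_subfield[OF pl[OF j]]
  have fin: "finite (\<phi> j ` D)" using pl[OF j] unfolding is_place_def by simp
  show ?thesis
  proof (cases "j \<in> A")
   case True
   obtain S where S: "S \<subseteq> \<phi> j ` D" "card S = l" using big[OF True] by (meson obtain_subset_with_card_n)
   have "finite S" using S(1) fin finite_subset by blast
   then obtain G where G: "set G \<subseteq> \<phi> j ` D" "length G = card S" "{x \<in> carrier (C j). Cj.eval (\<one>\<^bsub>C j\<^esub> # G) x = \<zero>\<^bsub>C j\<^esub>} = S"
    using Cj.exists_monic_with_roots[OF subfieldE(1)[OF sub] _ S(1)] by blast
   then show ?thesis using S True unfolding good_def rts_def ev_def by (intro exI[of _ G]) simp
  next
   case False
   obtain b G where bG: "b \<in> carrier (C j)" "set G \<subseteq> \<phi> j ` D" "length G = l" "Cj.eval (\<one>\<^bsub>C j\<^esub> # G) b = \<zero>\<^bsub>C j\<^esub>"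
    "Cj.powers_independent (\<phi> j ` D) l b" "card {x \<in> carrier (C j). Cj.eval (\<one>\<^bsub>C j\<^esub> # G) x = \<zero>\<^bsub>C j\<^esub>} = l"
    "\<And>x h. x \<in> carrier (C j) ==> Cj.eval (\<one>\<^bsub>C j\<^esub> # G) x = \<zero>\<^bsub>C j\<^esub> ==> set h \<subseteq> \<phi> j ` D ==>
     Cj.eval h x = \<zero>\<^bsub>C j\<^esub> \<longleftrightarrow> Cj.eval h b = \<zero>\<^bsub>C j\<^esub>"
    "card (Cj.simple_extension (\<phi> j ` D) b) = card (\<phi> j ` D) ^ l"
    by (rule Cj.exists_irreducible_over_finite_subfield[OF sub fin l], rule that)
   have "inert j (\<one>\<^bsub>C j\<^esub> # G) b" unfolding inert_def rts_def ev_def using bG(1,4,5,7,8) by blast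
   then show ?thesis using bG(2,3,6) False unfolding good_def rts_def ev_def by (intro exI[of _ G]) auto
  qed
 qed
 then obtain G where G: "\<And>j. j \<in> J ==> good j (G j)" by metis
 have Gl: "set (G j) \<subseteq> \<phi> j ` D \<and> length (G j) = l" if "j \<in> J" for j using G[OF that] unfolding good_def by blast
 obtain g where g: "set g \<subseteq> D" "length g = l" "\<And>j. j \<in> J ==> map (\<phi> j) g = G j"
  using exists_simultaneous_list_preimage[OF Dd(1) J pl inj Gl] by blast
 have img: "map (\<phi> j) (\<one> # g) = \<one>\<^bsub>C j\<^esub> # G j" if "j \<in> J" for j using g(3)[OF that] place_simps(2)[OF pl[OF that]] by simp
 have gne: "g \<noteq> []" using g(2) l by auto
 have gc: "set (\<one> # g) \<subseteq> carrier R" using g(1) Dp(1) by auto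
 have gp: "\<one> # g \<in> carrier (poly_ring R)" using gc unfolding sym[OF univ_poly_carrier] polynomial_def by simp
 obtain t where t: "t \<in> carrier R" "eval (\<one> # g) t = \<zero>"
 proof -
  have "size (roots (\<one> # g)) = l" using A.roots_over_carrier[OF gp] g(2) unfolding splitted_def by simp
  then obtain t where "t \<in># roots (\<one> # g)" using l by (metis multiset_nonemptyE neq0_conv size_empty)
  then have "is_root (\<one> # g) t" using roots_mem_iff_is_root[OF gp] by simp
  then show ?thesis using that unfolding is_root_def by blast
 qed
 obtain j0 where j0: "j0 \<in> J" "j0 \<notin> A" using A by auto
 obtain b0 where b0: "inert j0 (\<one>\<^bsub>C j0\<^esub> # G j0) b0" using G[OF j0(1)] j0(2) unfolding good_def by auto
 have ind: "powers_independent (quotient_field D) (length g) t"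
 proof (rule powers_independent_lift[OF ded pl[OF j0(1)] nz[OF j0(1)] g(1) _ _ _ t])
  show "b0 \<in> carrier (C j0)" "ring.eval (C j0) (map (\<phi> j0) (\<one> # g)) b0 = \<zero>\<^bsub>C j0\<^esub>"
   "domain.powers_independent (C j0) (\<phi> j0 ` D) (length g) b0"
   using b0 unfolding img[OF j0(1)] g(2) inert_def rts_def ev_def by auto
 qed
 have roots: "card {b \<in> carrier (C j). ring.eval (C j) (map (\<phi> j) (\<one> # g)) b = \<zero>\<^bsub>C j\<^esub>} = length g" if "j \<in> J" for j
  using G[OF that] unfolding img[OF that] g(2) good_def rts_def ev_def by blast
 have sep: "card {b \<in> carrier R. eval (\<one> # g) b = \<zero>} = length g"
  by (rule card_roots_lift[OF ac F pl[OF j0(1)] g(1) gne roots[OF j0(1)] t ind])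
 interpret N: monogenic_dedekind R D g t
  by (intro monogenic_dedekind.intro monogenic_dedekind_axioms.intro field_axioms ded g(1) t ind sep)
 have "\<exists>\<Psi>. complete_lifts D N.E (C j) (\<phi> j) \<Psi> \<and> card \<Psi> = (if j \<in> A then l else 1) \<and>
   (\<forall>\<psi> \<in> \<Psi>. card (\<psi> ` N.E) = card (\<phi> j ` D) ^ (if j \<in> A then 1 else l))" if j: "j \<in> J" for j
 proof -
  interpret P: monogenic_place R D g t "C j" "\<phi> j"
   by (intro monogenic_place.intro monogenic_place_axioms.intro N.monogenic_dedekind_axioms pl[OF j] nz[OF j] roots[OF j])
  have B: "P.B = rts j (\<one>\<^bsub>C j\<^esub> # G j)" unfolding P.B_def img[OF j] rts_def ev_def ..
  show ?thesis
  proof (cases "j \<in> A")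
   case True
   then have "P.B \<subseteq> \<phi> j ` D" using G[OF j] unfolding B good_def by simp
   then show ?thesis using P.split_lifts True g(2) by simp
  next
   case False
   then obtain b where b: "inert j (\<one>\<^bsub>C j\<^esub> # G j) b" using G[OF j] unfolding good_def by auto
   have "\<exists>\<Psi>. complete_lifts D N.E (C j) (\<phi> j) \<Psi> \<and> card \<Psi> = 1 \<and> (\<forall>\<psi> \<in> \<Psi>. card (\<psi> ` N.E) = card (\<phi> j ` D) ^ l)"
   proof (rule P.inert_lifts)
    show "b \<in> P.B" using b unfolding inert_def B by blast
    show "P.C.eval h c = \<zero>\<^bsub>C j\<^esub> \<longleftrightarrow> P.C.eval h b = \<zero>\<^bsub>C j\<^esub>" if "c \<in> P.B" "set h \<subseteq> \<phi> j ` D" for c h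
     using b that unfolding inert_def B ev_def by blast
    show "card (P.C.simple_extension (\<phi> j ` D) b) = card (\<phi> j ` D) ^ l" using b unfolding inert_def by blast
   qed
   then show ?thesis using False by simp
  qed
 qed
 moreover have "dimension l (quotient_field D) (quotient_field N.E)"
  "pth_power_spanned (quotient_field D) (quotient_field N.E)"
  using N.L_dimension N.L_pth_power_spanned g(2) unfolding N.quotient_field_E by auto
 ultimately show ?thesis using N.E_dedekind N.D_incl_E N.E_fg by (intro exI[of _ N.E]) blast
qed

end

section \<open>Towers of extensions\<close>

context field begin

lemma genideal_sub_ring:
 assumes E: "subring E R" and S: "S \<subseteq> E"
 shows "module_over E (Idl\<^bsub>sub_ring E\<^esub> S)" "Idl\<^bsub>sub_ring E\<^esub> S \<subseteq> E" "S \<subseteq> Idl\<^bsub>sub_ring E\<^esub> S"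
  "\<And>I. module_over E I ==> I \<subseteq> E ==> S \<subseteq> I ==> Idl\<^bsub>sub_ring E\<^esub> S \<subseteq> I"
proof -
 interpret S: cring "sub_ring E" by (rule sub_ring_cring[OF E])
 have "ideal (Idl\<^bsub>sub_ring E\<^esub> S) (sub_ring E)" using S.genideal_ideal S by simp
 then show "module_over E (Idl\<^bsub>sub_ring E\<^esub> S)" "Idl\<^bsub>sub_ring E\<^esub> S \<subseteq> E"
  using ideal_sub_ring_iff[OF E] by auto
 show "S \<subseteq> Idl\<^bsub>sub_ring E\<^esub> S" using S.genideal_self S by simp
 show "Idl\<^bsub>sub_ring E\<^esub> S \<subseteq> I" if "module_over E I" "I \<subseteq> E" "S \<subseteq> I" for I
  using S.genideal_minimal[of I S] ideal_sub_ring_iff[OF E] that by blast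
qed

lemma complete_liftsD:
 assumes "complete_lifts D E C \<phi> \<Psi>"
 shows "finite \<Psi>" "inj_on (place_kernel E C) \<Psi>" "\<And>\<psi>. \<psi> \<in> \<Psi> ==> is_place E C \<psi>"
  "\<And>\<psi> a. \<psi> \<in> \<Psi> ==> a \<in> D ==> \<psi> a = \<phi> a"
  "\<And>\<psi> x. \<psi> \<in> \<Psi> ==> x \<in> place_kernel E C \<psi> ==>
   \<exists>s \<in> E. \<psi> s \<noteq> \<zero>\<^bsub>C\<^esub> \<and> s \<otimes> x \<in> Idl\<^bsub>sub_ring E\<^esub> (place_kernel D C \<phi>)"
  "\<And>N. maximalideal N (sub_ring E) ==> N \<inter> D = place_kernel D C \<phi> ==> N \<in> place_kernel E C ` \<Psi>"
 using assms unfolding complete_lifts_def by blast+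

lemma lift_kernel_contraction:
 assumes "D \<subseteq> E" "\<And>a. a \<in> D ==> \<psi> a = \<phi> a"
 shows "place_kernel E C \<psi> \<inter> D = place_kernel D C \<phi>"
 using assms unfolding place_kernel_def by auto

lemma complete_lifts_refl:
 assumes "is_place D C \<phi>"
 shows "complete_lifts D D C \<phi> {\<phi>}"
proof -
 have D: "subring D R" using assms unfolding is_place_def by simp
 note ps = place_simps[OF assms]
 have k: "place_kernel D C \<phi> \<subseteq> D" unfolding place_kernel_def by auto
 have "\<exists>s \<in> D. \<phi> s \<noteq> \<zero>\<^bsub>C\<^esub> \<and> s \<otimes> x \<in> Idl\<^bsub>sub_ring D\<^esub> (place_kernel D C \<phi>)" if "x \<in> place_kernel D C \<phi>" for x
 proof -
  have "x \<in> carrier R" using that k subringE(1)[OF D] by auto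
  then show ?thesis using ps(2,3) genideal_sub_ring(3)[OF D k] that subringE(3)[OF D] by (intro bexI[of _ \<one>]) auto
 qed
 moreover have "N = place_kernel D C \<phi>" if "maximalideal N (sub_ring D)" "N \<inter> D = place_kernel D C \<phi>" for N
  using that maximalideal_sub_ring_iff[OF D] by auto
 ultimately show ?thesis unfolding complete_lifts_def using assms by simp
qed

text \<open>For unramifiedness, the elements with a multiple outside \<open>ker \<theta>\<close> that lies in the ideal generated by
 \<open>ker \<phi>\<close> form an ideal. It contains \<open>ker \<psi>\<close>, hence \<open>ker \<theta>\<close> by unramifiedness of the upper step.\<close>

lemma complete_lifts_compose:
 assumes ded: "dedekind_domain E" and DE: "D \<subseteq> E" and E': "subring E' R" "E \<subseteq> E'"
  and nz: "place_kernel D C \<phi> \<noteq> {\<zero>}" and pl: "is_place D C \<phi>"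
  and \<Phi>: "complete_lifts D E C \<phi> \<Phi>" and \<Psi>: "\<And>\<psi>. \<psi> \<in> \<Phi> ==> complete_lifts E E' C \<psi> (\<Psi> \<psi>)"
 shows "complete_lifts D E' C \<phi> (\<Union>\<psi>\<in>\<Phi>. \<Psi> \<psi>)" "card (\<Union>\<psi>\<in>\<Phi>. \<Psi> \<psi>) = (\<Sum>\<psi>\<in>\<Phi>. card (\<Psi> \<psi>))"
proof -
 interpret C: field C using pl unfolding is_place_def by simp
 note E = dedekind_domainD[OF ded]
 have D: "subring D R" using pl unfolding is_place_def by simp
 note Dp = subringE[OF D] and Ep = subringE[OF E(1)] and Ep' = subringE[OF E'(1)]
 note P = complete_liftsD[OF \<Phi>]
 note Q = complete_liftsD[OF \<Psi>]
 have kc: "place_kernel E' C \<theta> \<inter> E = place_kernel E C \<psi>" if "\<psi> \<in> \<Phi>" "\<theta> \<in> \<Psi> \<psi>" for \<psi> \<theta>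
  by (rule lift_kernel_contraction[OF E'(2) Q(4)[OF that]])
 have same: "\<psi> = \<psi>'" if "\<psi> \<in> \<Phi>" "\<theta> \<in> \<Psi> \<psi>" "\<psi>' \<in> \<Phi>" "\<theta>' \<in> \<Psi> \<psi>'" "place_kernel E' C \<theta> = place_kernel E' C \<theta>'" for \<psi> \<psi>' \<theta> \<theta>'
  using kc[OF that(1,2)] kc[OF that(3,4)] that(5) inj_onD[OF P(2) _ that(1,3)] by simp
 show "card (\<Union>\<psi>\<in>\<Phi>. \<Psi> \<psi>) = (\<Sum>\<psi>\<in>\<Phi>. card (\<Psi> \<psi>))"
 proof (rule card_UN_disjoint[OF P(1)])
  show "\<forall>\<psi>\<in>\<Phi>. finite (\<Psi> \<psi>)" using Q(1) by blast
  show "\<forall>\<psi>\<in>\<Phi>. \<forall>\<psi>'\<in>\<Phi>. \<psi> \<noteq> \<psi>' \<longrightarrow> \<Psi> \<psi> \<inter> \<Psi> \<psi>' = {}" using same by blast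
 qed
 let ?I = "Idl\<^bsub>sub_ring E'\<^esub> (place_kernel D C \<phi>)"
 have kD: "place_kernel D C \<phi> \<subseteq> D" unfolding place_kernel_def by auto
 have kE: "place_kernel D C \<phi> \<subseteq> E" "place_kernel D C \<phi> \<subseteq> E'" using kD DE E'(2) by auto
 note I = genideal_sub_ring[OF E'(1) kE(2)]
 note Im = module_overD[OF I(1)]
 have unram: "\<exists>s \<in> E'. \<theta> s \<noteq> \<zero>\<^bsub>C\<^esub> \<and> s \<otimes> x \<in> ?I"
  if psi: "\<psi> \<in> \<Phi>" and th: "\<theta> \<in> \<Psi> \<psi>" and x: "x \<in> place_kernel E' C \<theta>" for \<psi> \<theta> x
 proof -
  note ps = place_simps[OF Q(3)[OF psi th]]
  have prod0: "\<theta> (s \<otimes> r) \<noteq> \<zero>\<^bsub>C\<^esub>" if "s \<in> E'" "r \<in> E'" "\<theta> s \<noteq> \<zero>\<^bsub>C\<^esub>" "\<theta> r \<noteq> \<zero>\<^bsub>C\<^esub>" for s r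
   using ps(6)[OF that(1,2)] ps(4)[OF that(1)] ps(4)[OF that(2)] that(3,4) C.integral_iff by simp
  \<comment> \<open>the elements that are locally in the ideal\<close>
  define Y where "Y = {y \<in> E'. \<exists>s \<in> E'. \<theta> s \<noteq> \<zero>\<^bsub>C\<^esub> \<and> s \<otimes> y \<in> ?I}"
  have YE: "Y \<subseteq> E'" unfolding Y_def by auto
  have Ymod: "module_over E' Y" unfolding module_over_def
  proof (intro conjI ballI)
   show "Y \<subseteq> carrier R" using YE Ep'(1) by auto
   show "\<zero> \<in> Y" unfolding Y_def using Ep'(2,3) Im(2) ps(2,3) by (auto intro!: bexI[of _ \<one>])
   fix y assume "y \<in> Y"
   then obtain s where s: "y \<in> E'" "s \<in> E'" "\<theta> s \<noteq> \<zero>\<^bsub>C\<^esub>" "s \<otimes> y \<in> ?I" unfolding Y_def by auto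
   have c: "y \<in> carrier R" "s \<in> carrier R" using s Ep'(1) by auto
   {
    fix z assume "z \<in> Y"
    then obtain r where r: "z \<in> E'" "r \<in> E'" "\<theta> r \<noteq> \<zero>\<^bsub>C\<^esub>" "r \<otimes> z \<in> ?I" unfolding Y_def by auto
    have cr: "z \<in> carrier R" "r \<in> carrier R" using r Ep'(1) by auto
    have "(s \<otimes> r) \<otimes> (y \<oplus> z) = r \<otimes> (s \<otimes> y) \<oplus> s \<otimes> (r \<otimes> z)" using c cr by algebra
    then have "(s \<otimes> r) \<otimes> (y \<oplus> z) \<in> ?I" using Im(3) Im(4)[OF r(2) s(4)] Im(4)[OF s(2) r(4)] by simp
    then show "y \<oplus> z \<in> Y"
     unfolding Y_def using prod0[OF s(2) r(2) s(3) r(3)] Ep'(6)[OF s(2) r(2)] Ep'(7)[OF s(1) r(1)] by blast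
   }
   fix k assume k: "k \<in> E'"
   then have "s \<otimes> (k \<otimes> y) = k \<otimes> (s \<otimes> y)" using c Ep'(1) by (auto simp: m_lcomm subset_iff)
   then have "s \<otimes> (k \<otimes> y) \<in> ?I" using Im(4)[OF k s(4)] by simp
   then show "k \<otimes> y \<in> Y" unfolding Y_def using s(2,3) Ep'(6)[OF k s(1)] by blast
  qed
  have "place_kernel E C \<psi> \<subseteq> Y"
  proof
   fix y assume y: "y \<in> place_kernel E C \<psi>"
   then obtain s where s: "s \<in> E" "\<psi> s \<noteq> \<zero>\<^bsub>C\<^esub>" "s \<otimes> y \<in> Idl\<^bsub>sub_ring E\<^esub> (place_kernel D C \<phi>)"
    using P(5)[OF psi] by blast
   have "module_over E (?I \<inter> E)" using Im Ep E'(2) unfolding module_over_def by auto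
   then have "Idl\<^bsub>sub_ring E\<^esub> (place_kernel D C \<phi>) \<subseteq> ?I \<inter> E"
    using genideal_sub_ring(4)[OF E(1) kE(1)] I(3) kE(1) by blast
   then have "s \<otimes> y \<in> ?I" using s(3) by auto
   moreover have "\<theta> s \<noteq> \<zero>\<^bsub>C\<^esub>" using Q(4)[OF psi th s(1)] s(2) by simp
   moreover have "y \<in> E'" "s \<in> E'" using y s(1) E'(2) unfolding place_kernel_def by auto
   ultimately show "y \<in> Y" unfolding Y_def by blast
  qed
  moreover have "place_kernel E C \<psi> \<subseteq> E'" using E'(2) unfolding place_kernel_def by auto
  ultimately have sub: "Idl\<^bsub>sub_ring E'\<^esub> (place_kernel E C \<psi>) \<subseteq> Y"
   using genideal_sub_ring(4)[OF E'(1) _ Ymod YE] by blast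
  obtain s where s: "s \<in> E'" "\<theta> s \<noteq> \<zero>\<^bsub>C\<^esub>" "s \<otimes> x \<in> Idl\<^bsub>sub_ring E'\<^esub> (place_kernel E C \<psi>)"
   using Q(5)[OF psi th x] by blast
  then obtain r where r: "r \<in> E'" "\<theta> r \<noteq> \<zero>\<^bsub>C\<^esub>" "r \<otimes> (s \<otimes> x) \<in> ?I" using sub unfolding Y_def by auto
  have "x \<in> carrier R" "r \<in> carrier R" "s \<in> carrier R" using x r(1) s(1) Ep'(1) unfolding place_kernel_def by auto
  then have "(r \<otimes> s) \<otimes> x \<in> ?I" using r(3) by (simp add: m_assoc)
  then show ?thesis using prod0[OF r(1) s(1) r(2) s(2)] Ep'(6)[OF r(1) s(1)] by blast
 qed
 show "complete_lifts D E' C \<phi> (\<Union>\<psi>\<in>\<Phi>. \<Psi> \<psi>)" unfolding complete_lifts_def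
 proof (intro conjI ballI allI impI)
  show "finite (\<Union>\<psi>\<in>\<Phi>. \<Psi> \<psi>)" using P(1) Q(1) by blast
  show "inj_on (place_kernel E' C) (\<Union>\<psi>\<in>\<Phi>. \<Psi> \<psi>)"
  proof (rule inj_onI)
   fix \<theta> \<theta>' assume "\<theta> \<in> (\<Union>\<psi>\<in>\<Phi>. \<Psi> \<psi>)" "\<theta>' \<in> (\<Union>\<psi>\<in>\<Phi>. \<Psi> \<psi>)" and eq: "place_kernel E' C \<theta> = place_kernel E' C \<theta>'"
   then obtain \<psi> \<psi>' where p: "\<psi> \<in> \<Phi>" "\<theta> \<in> \<Psi> \<psi>" "\<psi>' \<in> \<Phi>" "\<theta>' \<in> \<Psi> \<psi>'" by auto
   then show "\<theta> = \<theta>'" using same[OF p eq] inj_onD[OF Q(2)[OF p(1)], OF eq] by simp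
  qed
 next
  fix \<theta> assume "\<theta> \<in> (\<Union>\<psi>\<in>\<Phi>. \<Psi> \<psi>)"
  then obtain \<psi> where p: "\<psi> \<in> \<Phi>" "\<theta> \<in> \<Psi> \<psi>" by auto
  show "is_place E' C \<theta>" by (rule Q(3)[OF p])
  show "\<theta> a = \<phi> a" if "a \<in> D" for a using Q(4)[OF p] P(4)[OF p(1) that] that DE by auto
  show "\<exists>s \<in> E'. \<theta> s \<noteq> \<zero>\<^bsub>C\<^esub> \<and> s \<otimes> x \<in> ?I" if "x \<in> place_kernel E' C \<theta>" for x by (rule unram[OF p that])
 next
  fix N assume N: "maximalideal N (sub_ring E') \<and> N \<inter> D = place_kernel D C \<phi>"
  have Np: "prime_in E' N" using maximalideal_prime_in[OF E'(1)] N by blast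
  have NE: "N \<inter> E \<inter> D = place_kernel D C \<phi>" using N DE by auto
  have "N \<inter> E \<noteq> {\<zero>}"
  proof
   assume "N \<inter> E = {\<zero>}"
   then have "place_kernel D C \<phi> \<subseteq> {\<zero>}" using NE by auto
   moreover have "\<zero> \<in> place_kernel D C \<phi>" unfolding place_kernel_def using Dp(2) place_simps(1)[OF pl] by simp
   ultimately show False using nz by auto
  qed
  then have "maximalideal (N \<inter> E) (sub_ring E)" using E(4) prime_contraction[OF E(1) E' Np] by blast
  then obtain \<psi> where psi: "\<psi> \<in> \<Phi>" "N \<inter> E = place_kernel E C \<psi>" using P(6)[OF _ NE] by auto
  then obtain \<theta> where "\<theta> \<in> \<Psi> \<psi>" "N = place_kernel E' C \<theta>" using Q(6)[OF psi(1), of N] N by blast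
  then show "N \<in> place_kernel E' C ` (\<Union>\<psi>\<in>\<Phi>. \<Psi> \<psi>)" using psi(1) by blast
 qed
qed

lemma pth_power_spanned_refl:
 assumes F: "subfield F R"
 shows "pth_power_spanned F F"
 unfolding pth_power_spanned_def
proof (intro allI impI ballI)
 fix p :: nat and x assume x: "x \<in> F"
 have "set [\<one>] \<subseteq> carrier R" by simp
 note Sp = module_over_Span[OF subfieldE(1)[OF F] this]
 have "x \<otimes> \<one> \<in> Span F [\<one>]" using module_overD(4)[OF Sp(1) x] Sp(2) by simp
 then have "x \<in> Span F (map (\<lambda>u. u [^] p) [\<one>])" using x subfieldE(3)[OF F] by (auto simp: subset_iff)
 then show "\<exists>Us. set Us \<subseteq> F \<and> x \<in> Span F (map (\<lambda>u. u [^] p) Us)"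
  using subringE(3)[OF subfieldE(1)[OF F]] by (intro exI[of _ "[\<one>]"]) simp
qed

text \<open>The tower. In step \<open>k + 1\<close> the places over \<open>\<phi>\<^sub>k\<^sub>+\<^sub>1\<close> split and all others are inert; until then there is just one place over
 \<open>\<phi>\<^sub>k\<^sub>+\<^sub>1\<close>. As \<open>n > 1\<close>, some place is inert in each step. The residue field of the splitting place is at least as large as that
 of \<open>\<phi>\<^sub>k\<^sub>+\<^sub>1\<close>, so it has enough elements for \<open>f\<^sub>k\<^sub>+\<^sub>1\<close> linear factors.\<close>

lemma exists_extension_with_split_lifts:
 fixes n k :: nat and f :: "nat \<Rightarrow> nat" and C :: "nat \<Rightarrow> 'c ring"
 assumes ac: "algebraically_closed R" and ded: "dedekind_domain D"
  and pl: "\<And>i. i \<in> {1..n} ==> is_place D (C i) (\<phi> i)"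
  and nz: "\<And>i. i \<in> {1..n} ==> place_kernel D (C i) (\<phi> i) \<noteq> {\<zero>}"
  and acC: "\<And>i. i \<in> {1..n} ==> algebraically_closed (C i)"
  and inj: "inj_on (\<lambda>i. place_kernel D (C i) (\<phi> i)) {1..n}"
  and f: "\<And>i. i \<in> {1..n} ==> 0 < f i" "\<And>i. i \<in> {1..n} ==> f i \<le> card (\<phi> i ` D)"
  and n: "1 < n" and k: "k \<le> n"
 shows "\<exists>E. dedekind_domain E \<and> D \<subseteq> E \<and> fg_module D E \<and>
  dimension (\<Prod>i\<in>{1..k}. f i) (quotient_field D) (quotient_field E) \<and>
  pth_power_spanned (quotient_field D) (quotient_field E) \<and>
  (\<forall>i \<in> {1..n}. \<exists>\<Phi>. complete_lifts D E (C i) (\<phi> i) \<Phi> \<and> card \<Phi> = (if i \<le> k then f i else 1) \<and>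
   (\<forall>\<psi> \<in> \<Phi>. card (\<psi> ` E) = card (\<phi> i ` D) ^ (\<Prod>j\<in>{1..k} - {i}. f j)))"
 using k
proof (induction k)
 case 0
 have D: "subring D R" by (rule dedekind_domainD(1)[OF ded])
 note F = quotient_field_subfield(1)[OF D]
 have "\<exists>\<Phi>. complete_lifts D D (C i) (\<phi> i) \<Phi> \<and> card \<Phi> = (if i \<le> 0 then f i else 1) \<and>
   (\<forall>\<psi> \<in> \<Phi>. card (\<psi> ` D) = card (\<phi> i ` D) ^ (\<Prod>j\<in>{1..0} - {i}. f j))" if i: "i \<in> {1..n}" for i
  by (rule exI[of _ "{\<phi> i}"]) (use i complete_lifts_refl[OF pl[OF i]] in auto)
 then show ?case
  using ded fg_module_self[OF D] dimension_one[OF F] pth_power_spanned_refl[OF F] by (intro exI[of _ D]) auto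
next
 case (Suc k)
 then obtain E where E: "dedekind_domain E" "D \<subseteq> E" "fg_module D E"
   "dimension (\<Prod>i\<in>{1..k}. f i) (quotient_field D) (quotient_field E)"
   "pth_power_spanned (quotient_field D) (quotient_field E)"
   "\<forall>i \<in> {1..n}. \<exists>\<Phi>. complete_lifts D E (C i) (\<phi> i) \<Phi> \<and> card \<Phi> = (if i \<le> k then f i else 1) \<and>
    (\<forall>\<psi> \<in> \<Phi>. card (\<psi> ` E) = card (\<phi> i ` D) ^ (\<Prod>j\<in>{1..k} - {i}. f j))"
  by auto
 from bchoice[OF E(6)] obtain \<Phi> where \<Phi>: "\<And>i. i \<in> {1..n} ==> complete_lifts D E (C i) (\<phi> i) (\<Phi> i)"
  "\<And>i. i \<in> {1..n} ==> card (\<Phi> i) = (if i \<le> k then f i else 1)"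
  "\<And>i \<psi>. i \<in> {1..n} ==> \<psi> \<in> \<Phi> i ==> card (\<psi> ` E) = card (\<phi> i ` D) ^ (\<Prod>j\<in>{1..k} - {i}. f j)"
  by blast
 note P = complete_liftsD[OF \<Phi>(1)]
 have kc: "place_kernel E (C i) \<psi> \<inter> D = place_kernel D (C i) (\<phi> i)" if "i \<in> {1..n}" "\<psi> \<in> \<Phi> i" for i \<psi>
  by (rule lift_kernel_contraction[OF E(2) P(4)[OF that]])
 have Sk: "Suc k \<in> {1..n}" using Suc.prems by simp
 have ne: "\<Phi> i \<noteq> {}" if "i \<in> {1..n}" for i using \<Phi>(2)[OF that] f(1)[OF that] by (cases "\<Phi> i = {}") (auto split: if_splits)
 define J where "J = Sigma {1..n} \<Phi>"
 define A where "A = {Suc k} \<times> \<Phi> (Suc k)"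
 have inA: "(i, \<psi>) \<in> A \<longleftrightarrow> i = Suc k" if "(i, \<psi>) \<in> J" for i \<psi> using that unfolding A_def J_def by auto
 have "\<exists>E'. dedekind_domain E' \<and> E \<subseteq> E' \<and> fg_module E E' \<and>
  dimension (f (Suc k)) (quotient_field E) (quotient_field E') \<and>
  pth_power_spanned (quotient_field E) (quotient_field E') \<and>
  (\<forall>j \<in> J. \<exists>\<Psi>. complete_lifts E E' (C (fst j)) (snd j) \<Psi> \<and> card \<Psi> = (if j \<in> A then f (Suc k) else 1) \<and>
   (\<forall>\<psi> \<in> \<Psi>. card (\<psi> ` E') = card (snd j ` E) ^ (if j \<in> A then 1 else f (Suc k))))"
 proof (rule exists_extension_with_places[OF ac E(1)])
  show "finite J" unfolding J_def using P(1) by auto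
  show "is_place E (C (fst j)) (snd j)" if "j \<in> J" for j using that P(3) unfolding J_def by auto
  show "algebraically_closed (C (fst j))" if "j \<in> J" for j using that acC unfolding J_def by auto
  show "place_kernel E (C (fst j)) (snd j) \<noteq> {\<zero>}" if "j \<in> J" for j
  proof
   assume z: "place_kernel E (C (fst j)) (snd j) = {\<zero>}"
   have j: "fst j \<in> {1..n}" "snd j \<in> \<Phi> (fst j)" using that unfolding J_def by auto
   have "\<zero> \<in> D" using subringE(2)[OF dedekind_domainD(1)[OF ded]] .
   then have "place_kernel D (C (fst j)) (\<phi> (fst j)) = {\<zero>}" using kc[OF j] z by auto
   then show False using nz[OF j(1)] by simp
  qed
  show "inj_on (\<lambda>j. place_kernel E (C (fst j)) (snd j)) J"
  proof (rule inj_onI)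
   fix a b assume ab: "a \<in> J" "b \<in> J" and eq: "place_kernel E (C (fst a)) (snd a) = place_kernel E (C (fst b)) (snd b)"
   have a: "fst a \<in> {1..n}" "snd a \<in> \<Phi> (fst a)" using ab unfolding J_def by auto
   have b: "fst b \<in> {1..n}" "snd b \<in> \<Phi> (fst b)" using ab unfolding J_def by auto
   have fe: "fst a = fst b" using kc[OF a] kc[OF b] eq inj_onD[OF inj _ a(1) b(1)] by simp
   have "snd a = snd b" by (rule inj_onD[OF P(2)[OF a(1)]]) (use eq a b fe in auto)
   then show "a = b" using fe by (simp add: prod_eq_iff)
  qed
  show "f (Suc k) > 0" by (rule f(1)[OF Sk])
  obtain i where i: "i \<in> {1..n}" "i \<noteq> Suc k"
  proof (cases "Suc k = 1")
   case True
   then show ?thesis using that[of 2] n by simp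
  next
   case False
   then show ?thesis using that[of 1] n by simp
  qed
  obtain \<psi> where "\<psi> \<in> \<Phi> i" using ne[OF i(1)] by auto
  then have "(i, \<psi>) \<in> J" "(i, \<psi>) \<notin> A" using i unfolding J_def A_def by auto
  moreover have "A \<subseteq> J" unfolding A_def J_def using Sk by auto
  ultimately show "A \<subset> J" by blast
  show "f (Suc k) \<le> card (snd j ` E)" if "j \<in> A" for j
  proof -
   have j: "snd j \<in> \<Phi> (Suc k)" using that unfolding A_def by auto
   have e: "0 < (\<Prod>j\<in>{1..k} - {Suc k}. f j)" by (rule prod_pos) (use f(1) Suc.prems in auto)
   have q: "0 < card (\<phi> (Suc k) ` D)" using f[OF Sk] by linarith
   have "f (Suc k) \<le> card (\<phi> (Suc k) ` D)" by (rule f(2)[OF Sk])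
   also have "\<dots> \<le> card (\<phi> (Suc k) ` D) ^ (\<Prod>j\<in>{1..k} - {Suc k}. f j)" using e q by (intro self_le_power) auto
   finally show ?thesis using \<Phi>(3)[OF Sk j] by simp
  qed
 qed
 then obtain E' where E': "dedekind_domain E'" "E \<subseteq> E'" "fg_module E E'"
   "dimension (f (Suc k)) (quotient_field E) (quotient_field E')"
   "pth_power_spanned (quotient_field E) (quotient_field E')"
   "\<forall>j \<in> J. \<exists>\<Psi>. complete_lifts E E' (C (fst j)) (snd j) \<Psi> \<and> card \<Psi> = (if j \<in> A then f (Suc k) else 1) \<and>
    (\<forall>\<psi> \<in> \<Psi>. card (\<psi> ` E') = card (snd j ` E) ^ (if j \<in> A then 1 else f (Suc k)))"
  by auto
 from bchoice[OF E'(6)] obtain \<Psi> where \<Psi>: "\<And>j. j \<in> J ==> complete_lifts E E' (C (fst j)) (snd j) (\<Psi> j)"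
  "\<And>j. j \<in> J ==> card (\<Psi> j) = (if j \<in> A then f (Suc k) else 1)"
  "\<And>j \<psi>. j \<in> J ==> \<psi> \<in> \<Psi> j ==> card (\<psi> ` E') = card (snd j ` E) ^ (if j \<in> A then 1 else f (Suc k))"
  by blast
 have Dr: "subring D R" "subring E R" "subring E' R" using dedekind_domainD(1) ded E(1) E'(1) by auto
 note Q = quotient_field_subfield[OF Dr(1)] quotient_field_subfield[OF Dr(2)] quotient_field_subfield[OF Dr(3)]
 have qsub: "quotient_field E \<subseteq> quotient_field E'" using E'(2) unfolding quotient_field_def by blast
 have lifts: "\<exists>\<Theta>. complete_lifts D E' (C i) (\<phi> i) \<Theta> \<and> card \<Theta> = (if i \<le> Suc k then f i else 1) \<and>
   (\<forall>\<psi> \<in> \<Theta>. card (\<psi> ` E') = card (\<phi> i ` D) ^ (\<Prod>j\<in>{1..Suc k} - {i}. f j))" if i: "i \<in> {1..n}" for i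
 proof -
  have iJ: "(i, \<psi>) \<in> J" if "\<psi> \<in> \<Phi> i" for \<psi> using i that unfolding J_def by auto
  have cl: "complete_lifts E E' (C i) \<psi> (\<Psi> (i, \<psi>))" if "\<psi> \<in> \<Phi> i" for \<psi> using \<Psi>(1)[OF iJ[OF that]] by simp
  note comp = complete_lifts_compose[OF E(1,2) Dr(3) E'(2) nz[OF i] pl[OF i] \<Phi>(1)[OF i] cl]
  let ?\<Theta> = "\<Union>\<psi>\<in>\<Phi> i. \<Psi> (i, \<psi>)"
  have "card ?\<Theta> = (\<Sum>\<psi>\<in>\<Phi> i. card (\<Psi> (i, \<psi>)))" by (rule comp(2))
  also have "\<dots> = (\<Sum>\<psi>\<in>\<Phi> i. if i = Suc k then f (Suc k) else 1)"
   by (rule sum.cong[OF refl]) (use \<Psi>(2)[OF iJ] inA[OF iJ] in auto)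
  also have "\<dots> = card (\<Phi> i) * (if i = Suc k then f (Suc k) else 1)" by simp
  also have "\<dots> = (if i \<le> Suc k then f i else 1)" using \<Phi>(2)[OF i] by auto
  finally have card: "card ?\<Theta> = (if i \<le> Suc k then f i else 1)" .
  have "card (\<theta> ` E') = card (\<phi> i ` D) ^ (\<Prod>j\<in>{1..Suc k} - {i}. f j)" if "\<theta> \<in> ?\<Theta>" for \<theta>
  proof -
   obtain \<psi> where p: "\<psi> \<in> \<Phi> i" "\<theta> \<in> \<Psi> (i, \<psi>)" using \<open>\<theta> \<in> ?\<Theta>\<close> by auto
   have "card (\<theta> ` E') = card (\<psi> ` E) ^ (if i = Suc k then 1 else f (Suc k))"
    using \<Psi>(3)[OF iJ[OF p(1)] p(2)] inA[OF iJ[OF p(1)]] by simp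
   also have "\<dots> = card (\<phi> i ` D) ^ ((\<Prod>j\<in>{1..k} - {i}. f j) * (if i = Suc k then 1 else f (Suc k)))"
    unfolding \<Phi>(3)[OF i p(1)] power_mult ..
   also have "(\<Prod>j\<in>{1..k} - {i}. f j) * (if i = Suc k then 1 else f (Suc k)) = (\<Prod>j\<in>{1..Suc k} - {i}. f j)"
   proof (cases "i = Suc k")
    case True
    then have "{1..Suc k} - {i} = {1..k} - {i}" by auto
    then show ?thesis using True by simp
   next
    case False
    then have "{1..Suc k} - {i} = insert (Suc k) ({1..k} - {i})" by auto
    then show ?thesis using False by simp
   qed
   finally show ?thesis .
  qed
  then show ?thesis using comp(1) card by (intro exI[of _ ?\<Theta>]) blast
 qed
 have "fg_module D E'" by (rule fg_module_trans[OF Dr(1,2) E(3) E'(3)])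
 moreover have "dimension (\<Prod>i\<in>{1..Suc k}. f i) (quotient_field D) (quotient_field E')"
  using telescopic_base[OF Q(1,3) E(4) E'(4)] by (simp add: mult.commute)
 moreover have "pth_power_spanned (quotient_field D) (quotient_field E')"
  by (rule pth_power_spanned_trans[OF Q(1,3,5) qsub E(5) E'(5)])
 ultimately show ?case using E'(1) E(2) E'(2) lifts by (intro exI[of _ E']) blast
qed

end

section \<open>Residue fields\<close>

context field begin

lemma place_of_residue_embedding:
 assumes D: "subring D R" and M: "maximalideal M (sub_ring D)" and C: "field C"
  and \<iota>: "\<iota> \<in> ring_hom (sub_ring D Quot M) C" and fin: "finite (carrier (sub_ring D Quot M))"
 shows "is_place D C (\<lambda>x. \<iota> (M +>\<^bsub>sub_ring D\<^esub> x))" "place_kernel D C (\<lambda>x. \<iota> (M +>\<^bsub>sub_ring D\<^esub> x)) = M"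
  "(\<lambda>x. \<iota> (M +>\<^bsub>sub_ring D\<^esub> x)) ` D = \<iota> ` carrier (sub_ring D Quot M)"
proof -
 interpret C: field C by (rule C)
 interpret S: cring "sub_ring D" by (rule sub_ring_cring[OF D])
 interpret M: maximalideal M "sub_ring D" by (rule M)
 define \<phi> where "\<phi> = (\<lambda>x. \<iota> (M +>\<^bsub>sub_ring D\<^esub> x))"
 have cr: "carrier (sub_ring D Quot M) = (\<lambda>x. M +>\<^bsub>sub_ring D\<^esub> x) ` D"
  unfolding FactRing_def A_RCOSETS_defs a_r_coset_defs by auto
 have hom: "\<phi> \<in> ring_hom (sub_ring D) C"
  using ring_hom_trans[OF M.rcos_ring_hom \<iota>] unfolding \<phi>_def comp_def by simp
 show img: "(\<lambda>x. \<iota> (M +>\<^bsub>sub_ring D\<^esub> x)) ` D = \<iota> ` carrier (sub_ring D Quot M)" unfolding cr by auto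
 show pl: "is_place D C (\<lambda>x. \<iota> (M +>\<^bsub>sub_ring D\<^esub> x))"
  unfolding is_place_def using D C hom img fin unfolding \<phi>_def by simp
 have "M \<subseteq> place_kernel D C \<phi>"
 proof
  fix x assume x: "x \<in> M"
  then have xD: "x \<in> D" using M.a_subset by auto
  have "\<zero> \<in> M" using maximalideal_prime_in[OF D M] unfolding prime_in_def module_over_def by simp
  then have "M = M +>\<^bsub>sub_ring D\<^esub> \<zero>" using M.a_rcos_const by simp
  then have "\<phi> x = \<phi> \<zero>" unfolding \<phi>_def using M.a_rcos_const[OF x] by simp
  then show "x \<in> place_kernel D C \<phi>" unfolding place_kernel_def using xD place_simps(1)[OF pl] unfolding \<phi>_def by simp
 qed
 then show "place_kernel D C (\<lambda>x. \<iota> (M +>\<^bsub>sub_ring D\<^esub> x)) = M"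
  using prime_in_maximal_eq[rule_format, OF D M, of "place_kernel D C \<phi>"] place_kernel_maximal(2)[OF pl]
  unfolding \<phi>_def prime_in_def by blast
qed

text \<open>Cosets of the kernel are the fibres of the place.\<close>

lemma place_quotient:
 fixes C :: "'c ring"
 assumes pl: "is_place E C \<theta>"
 defines "Q \<equiv> sub_ring E Quot place_kernel E C \<theta>"
 shows "field Q" "(\<lambda>x. place_kernel E C \<theta> +>\<^bsub>sub_ring E\<^esub> x) \<in> ring_hom (sub_ring E) Q"
  "carrier Q = (\<lambda>x. place_kernel E C \<theta> +>\<^bsub>sub_ring E\<^esub> x) ` E"
  "\<And>x. x \<in> E ==> place_kernel E C \<theta> +>\<^bsub>sub_ring E\<^esub> x = {y \<in> E. \<theta> y = \<theta> x}"
  "(\<lambda>A. the_elem (\<theta> ` A)) \<in> ring_iso Q (C \<lparr> carrier := \<theta> ` E \<rparr>)"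
  "\<And>x. x \<in> E ==> the_elem (\<theta> ` (place_kernel E C \<theta> +>\<^bsub>sub_ring E\<^esub> x)) = \<theta> x"
  "card (carrier Q) = card (\<theta> ` E)" "finite (carrier Q)"
proof -
 interpret C: field C using pl unfolding is_place_def by simp
 have E: "subring E R" using pl unfolding is_place_def by simp
 note Ep = subringE[OF E] and ps = place_simps[OF pl]
 interpret S: cring "sub_ring E" by (rule sub_ring_cring[OF E])
 interpret N: maximalideal "place_kernel E C \<theta>" "sub_ring E" by (rule place_kernel_maximal(1)[OF pl])
 interpret H: ring_hom_ring "sub_ring E" C \<theta> by (rule place_hom[OF pl])
 have ker: "a_kernel (sub_ring E) C \<theta> = place_kernel E C \<theta>" unfolding a_kernel_def' place_kernel_def by simp
 show "field Q" unfolding Q_def by (rule N.quotient_is_field[OF S.cring_axioms])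
 show "(\<lambda>x. place_kernel E C \<theta> +>\<^bsub>sub_ring E\<^esub> x) \<in> ring_hom (sub_ring E) Q" unfolding Q_def by (rule N.rcos_ring_hom)
 show cr: "carrier Q = (\<lambda>x. place_kernel E C \<theta> +>\<^bsub>sub_ring E\<^esub> x) ` E"
  unfolding Q_def FactRing_def A_RCOSETS_defs a_r_coset_defs by auto
 show fib: "place_kernel E C \<theta> +>\<^bsub>sub_ring E\<^esub> x = {y \<in> E. \<theta> y = \<theta> x}" if x: "x \<in> E" for x
 proof
  have xc: "\<theta> x \<in> carrier C" using ps(4)[OF x] .
  show "place_kernel E C \<theta> +>\<^bsub>sub_ring E\<^esub> x \<subseteq> {y \<in> E. \<theta> y = \<theta> x}"
   unfolding a_r_coset_def' place_kernel_def using x Ep(7) ps(5) xc by auto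
  show "{y \<in> E. \<theta> y = \<theta> x} \<subseteq> place_kernel E C \<theta> +>\<^bsub>sub_ring E\<^esub> x"
  proof
   fix y assume "y \<in> {y \<in> E. \<theta> y = \<theta> x}"
   then have y: "y \<in> E" "\<theta> y = \<theta> x" by auto
   have d: "y \<oplus> \<ominus> x \<in> E" using y(1) x Ep(5,7) by simp
   have "\<theta> (y \<oplus> \<ominus> x) = \<zero>\<^bsub>C\<^esub>" using ps(5)[OF y(1) Ep(5)[OF x]] ps(7)[OF x] y(2) xc by (simp add: C.r_neg)
   then have "y \<oplus> \<ominus> x \<in> place_kernel E C \<theta>" unfolding place_kernel_def using d by simp
   moreover have "x \<in> carrier R" "y \<in> carrier R" using x y(1) Ep(1) by auto
   then have "y = (y \<oplus> \<ominus> x) \<oplus> x" by algebra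
   ultimately show "y \<in> place_kernel E C \<theta> +>\<^bsub>sub_ring E\<^esub> x" unfolding a_r_coset_def' by auto
  qed
 qed
 show iso: "(\<lambda>A. the_elem (\<theta> ` A)) \<in> ring_iso Q (C \<lparr> carrier := \<theta> ` E \<rparr>)"
  using H.FactRing_iso_set_aux unfolding ker Q_def by simp
 show "the_elem (\<theta> ` (place_kernel E C \<theta> +>\<^bsub>sub_ring E\<^esub> x)) = \<theta> x" if x: "x \<in> E" for x
 proof -
  have "\<theta> ` {y \<in> E. \<theta> y = \<theta> x} = {\<theta> x}" using x by auto
  then show ?thesis unfolding fib[OF x] by simp
 qed
 have bij: "bij_betw (\<lambda>A. the_elem (\<theta> ` A)) (carrier Q) (\<theta> ` E)" using iso unfolding ring_iso_def by simp
 show "card (carrier Q) = card (\<theta> ` E)" by (rule bij_betw_same_card[OF bij])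
 show "finite (carrier Q)" using bij_betw_finite[OF bij] pl unfolding is_place_def by simp
qed

lemma coset_map_place:
 assumes \<phi>: "is_place D C \<phi>" and \<psi>: "is_place E C \<psi>" and DE: "D \<subseteq> E" and eq: "\<forall>x \<in> D. \<psi> x = \<phi> x" and x: "x \<in> D"
 shows "coset_map (place_kernel E C \<psi>) (place_kernel D C \<phi> +>\<^bsub>sub_ring D\<^esub> x) = place_kernel E C \<psi> +>\<^bsub>sub_ring E\<^esub> x"
proof -
 interpret C: field C using \<phi> unfolding is_place_def by simp
 have E: "subring E R" using \<psi> unfolding is_place_def by simp
 note Ep = subringE[OF E] and ps = place_simps[OF \<psi>]
 have xE: "x \<in> E" using x DE by auto
 show ?thesis unfolding place_quotient(4)[OF \<phi> x] place_quotient(4)[OF \<psi> xE] coset_map_def set_add_def'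
 proof
  show "(\<Union>h\<in>{y \<in> D. \<phi> y = \<phi> x}. \<Union>k\<in>place_kernel E C \<psi>. {h \<oplus> k}) \<subseteq> {y \<in> E. \<psi> y = \<psi> x}"
  proof
   fix y assume "y \<in> (\<Union>h\<in>{y \<in> D. \<phi> y = \<phi> x}. \<Union>k\<in>place_kernel E C \<psi>. {h \<oplus> k})"
   then obtain h k where h: "h \<in> D" "\<phi> h = \<phi> x" "k \<in> E" "\<psi> k = \<zero>\<^bsub>C\<^esub>" "y = h \<oplus> k" unfolding place_kernel_def by auto
   have hE: "h \<in> E" using h(1) DE by auto
   have "\<psi> y = \<psi> x" using ps(5)[OF hE h(3)] ps(4)[OF hE] h eq[rule_format, OF h(1)] eq[rule_format, OF x] by simp
   then show "y \<in> {y \<in> E. \<psi> y = \<psi> x}" using Ep(7)[OF hE h(3)] h(5) by simp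
  qed
  show "{y \<in> E. \<psi> y = \<psi> x} \<subseteq> (\<Union>h\<in>{y \<in> D. \<phi> y = \<phi> x}. \<Union>k\<in>place_kernel E C \<psi>. {h \<oplus> k})"
  proof
   fix y assume "y \<in> {y \<in> E. \<psi> y = \<psi> x}"
   then have y: "y \<in> E" "\<psi> y = \<psi> x" by auto
   have d: "y \<oplus> \<ominus> x \<in> E" using y(1) xE Ep(5,7) by simp
   have "\<psi> (y \<oplus> \<ominus> x) = \<zero>\<^bsub>C\<^esub>"
    using ps(5)[OF y(1) Ep(5)[OF xE]] ps(7)[OF xE] y(2) ps(4)[OF xE] by (simp add: C.r_neg)
   then have k: "y \<oplus> \<ominus> x \<in> place_kernel E C \<psi>" unfolding place_kernel_def using d by simp
   have "x \<in> carrier R" "y \<in> carrier R" using xE y(1) Ep(1) by auto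
   then have "y = x \<oplus> (y \<oplus> \<ominus> x)" by algebra
   then show "y \<in> (\<Union>h\<in>{y \<in> D. \<phi> y = \<phi> x}. \<Union>k\<in>place_kernel E C \<psi>. {h \<oplus> k})" using k x by blast
  qed
 qed
qed

lemma ring_hom_codomain_mono:
 "h \<in> ring_hom Q (C \<lparr> carrier := A \<rparr>) ==> A \<subseteq> B ==> h \<in> ring_hom Q (C \<lparr> carrier := B \<rparr>)"
 unfolding ring_hom_def Pi_def by auto

text \<open>Under the identification of both quotients with subfields of \<open>C\<close>, the canonical map is the inclusion.\<close>

lemma coset_map_hom:
 assumes \<phi>: "is_place D C \<phi>" and \<psi>: "is_place E C \<psi>" and DE: "D \<subseteq> E" and eq: "\<forall>x \<in> D. \<psi> x = \<phi> x"
 shows "coset_map (place_kernel E C \<psi>) \<in>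
  ring_hom (sub_ring D Quot place_kernel D C \<phi>) (sub_ring E Quot place_kernel E C \<psi>)"
proof -
 let ?Q = "sub_ring D Quot place_kernel D C \<phi>" and ?P = "sub_ring E Quot place_kernel E C \<psi>"
 let ?h = "\<lambda>A. the_elem (\<psi> ` A)"
 note q = place_quotient[OF \<phi>] and p = place_quotient[OF \<psi>]
 interpret Q: field ?Q by (rule q(1))
 interpret P: field ?P by (rule p(1))
 have "\<phi> ` D \<subseteq> \<psi> ` E" using eq DE by (metis image_cong image_mono)
 moreover have "(\<lambda>A. the_elem (\<phi> ` A)) \<in> ring_hom ?Q (C \<lparr> carrier := \<phi> ` D \<rparr>)" using q(5) unfolding ring_iso_def by simp
 ultimately have "(\<lambda>A. the_elem (\<phi> ` A)) \<in> ring_hom ?Q (C \<lparr> carrier := \<psi> ` E \<rparr>)" by (rule ring_hom_codomain_mono[rotated])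
 moreover have "inv_into (carrier ?P) ?h \<in> ring_hom (C \<lparr> carrier := \<psi> ` E \<rparr>) ?P"
  using ring_iso_set_sym[OF P.ring_axioms p(5)] unfolding ring_iso_def by simp
 ultimately have "inv_into (carrier ?P) ?h \<circ> (\<lambda>A. the_elem (\<phi> ` A)) \<in> ring_hom ?Q ?P" by (rule ring_hom_trans)
 then show ?thesis
 proof (rule Q.ring_hom_restrict)
  fix A assume "A \<in> carrier ?Q"
  then obtain x where x: "x \<in> D" "A = place_kernel D C \<phi> +>\<^bsub>sub_ring D\<^esub> x" unfolding q(3) by auto
  have xE: "x \<in> E" using x(1) DE by auto
  have inj: "inj_on ?h (carrier ?P)" using p(5) unfolding ring_iso_def bij_betw_def by simp
  let ?y = "place_kernel E C \<psi> +>\<^bsub>sub_ring E\<^esub> x"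
  have "?y \<in> carrier ?P" unfolding p(3) using xE by blast
  then have "inv_into (carrier ?P) ?h (the_elem (\<psi> ` ?y)) = ?y" by (rule inv_into_f_f[OF inj])
  then have "inv_into (carrier ?P) ?h (\<phi> x) = ?y" unfolding p(6)[OF xE] bspec[OF eq x(1)] .
  then show "(inv_into (carrier ?P) ?h \<circ> (\<lambda>A. the_elem (\<phi> ` A))) A = coset_map (place_kernel E C \<psi>) A"
   unfolding x(2) comp_def q(6)[OF x(1)] coset_map_place[OF \<phi> \<psi> DE eq x(1)] .
 qed
qed

lemma dimension_residue_field:
 assumes \<phi>: "is_place D C \<phi>" and \<psi>: "is_place E C \<psi>" and DE: "D \<subseteq> E" and eq: "\<forall>x \<in> D. \<psi> x = \<phi> x"
  and k: "subfield k (sub_ring D Quot place_kernel D C \<phi>)" and card: "card (\<psi> ` E) = card k ^ d"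
 shows "ring.dimension (sub_ring E Quot place_kernel E C \<psi>) d (coset_map (place_kernel E C \<psi>) ` k)
  (carrier (sub_ring E Quot place_kernel E C \<psi>))"
proof -
 define Q where "Q = sub_ring E Quot place_kernel E C \<psi>"
 define K where "K = sub_ring D Quot place_kernel D C \<phi>"
 define h where "h = coset_map (place_kernel E C \<psi>)"
 note q = place_quotient[OF \<psi>, folded Q_def]
 interpret K: field K unfolding K_def by (rule place_quotient(1)[OF \<phi>])
 interpret Q: field Q by (rule q(1))
 have h: "h \<in> ring_hom K Q" unfolding h_def K_def Q_def by (rule coset_map_hom[OF \<phi> \<psi> DE eq])
 interpret H: ring_hom_ring K Q h by (rule ring_hom_ringI2[OF K.ring_axioms Q.ring_axioms h])
 note im = H.img_is_subfield[OF k[folded K_def] Q.one_not_zero]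
 have "Q.dimension d (h ` k) (carrier Q)"
 proof (rule Q.dimension_eq_card[OF im(2) q(8) Q.one_not_zero subset_refl Q.carrier_is_subring subfieldE(3)[OF im(2)]])
  show "card (carrier Q) = card (h ` k) ^ d" using q(7) card card_image[OF im(1)] by simp
 qed
 then show ?thesis unfolding Q_def h_def .
qed

lemma residue_simple_algebraic_extension:
 assumes pl: "is_place V C \<phi>" and ac: "algebraically_closed C"
  and K': "subfield K' C" "\<phi> ` V \<subseteq> K'" "finite K'" "card K' = card (\<phi> ` V) ^ d"
  and \<kappa>: "\<And>v. v \<in> V ==> \<kappa> (place_kernel V C \<phi> +>\<^bsub>sub_ring V\<^esub> v) = \<phi> v"
 shows "simple_algebraic_extension (sub_ring V Quot place_kernel V C \<phi>) (C \<lparr> carrier := K' \<rparr>) \<kappa>"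
  "ring.dimension (C \<lparr> carrier := K' \<rparr>) d (\<kappa> ` carrier (sub_ring V Quot place_kernel V C \<phi>)) K'"
proof -
 define Q where "Q = sub_ring V Quot place_kernel V C \<phi>"
 note q = place_quotient[OF pl, folded Q_def]
 interpret Q: field Q by (rule q(1))
 interpret C: algebraically_closed C by (rule ac)
 interpret S: field "C \<lparr> carrier := K' \<rparr>" by (rule C.subfield_iff(2)[OF K'(1)])
 note sub = place_image_subfield[OF pl]
 have sr: "subring K' C" by (rule subfieldE(1)[OF K'(1)])
 have fin: "finite (\<phi> ` V)" using K'(2,3) finite_subset by blast
 have img: "\<kappa> ` carrier Q = \<phi> ` V" unfolding q(3) image_image using \<kappa> by simp
 have subS: "subfield (\<phi> ` V) (C \<lparr> carrier := K' \<rparr>)"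
  using S.subfield_iff(1)[of "\<phi> ` V"] C.subfield_iff(2)[OF sub] K'(2) by simp
 have "S.dimension d (\<phi> ` V) K'"
  by (rule S.dimension_eq_card[OF subS K'(3) S.one_not_zero]) (use K' S.carrier_is_subring in auto)
 then show "ring.dimension (C \<lparr> carrier := K' \<rparr>) d (\<kappa> ` carrier (sub_ring V Quot place_kernel V C \<phi>)) K'"
  using img unfolding Q_def by simp
 obtain a where a: "a \<in> K'" "C.simple_extension (\<phi> ` V) a = K'" "(C.algebraic over (\<phi> ` V)) a"
  by (rule C.finite_field_generator[OF sub fin K'(1,3,2)], rule that)
 have ac': "a \<in> carrier C" using a(1) subfieldE(3)[OF K'(1)] by auto
 obtain p where p: "p \<in> carrier ((\<phi> ` V)[X]\<^bsub>C\<^esub>)" "p \<noteq> []" "C.eval p a = \<zero>\<^bsub>C\<^esub>"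
  by (rule C.algebraicE[OF subfieldE(1)[OF sub] ac' a(3)], rule that)
 have "p \<in> carrier ((\<phi> ` V)[X]\<^bsub>C \<lparr> carrier := K' \<rparr>\<^esub>)"
  using p(1) unfolding sym[OF univ_poly_carrier] polynomial_def by simp
 then have "(S.algebraic over (\<phi> ` V)) a"
  by (rule S.algebraicI[OF _ p(2)]) (use p(3) C.eval_consistent[OF sr] in simp)
 moreover have "S.simple_extension (\<phi> ` V) a = K'" using a(2) C.simple_extension_consistent[OF sr] by simp
 moreover have "\<kappa> \<in> ring_hom Q (C \<lparr> carrier := K' \<rparr>)"
 proof (rule Q.ring_hom_restrict)
  show "(\<lambda>A. the_elem (\<phi> ` A)) \<in> ring_hom Q (C \<lparr> carrier := K' \<rparr>)"
   by (rule ring_hom_codomain_mono[OF _ K'(2)]) (use q(5) in \<open>simp add: ring_iso_def\<close>)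
  show "the_elem (\<phi> ` A) = \<kappa> A" if "A \<in> carrier Q" for A using that q(6) \<kappa> unfolding q(3) by auto
 qed
 ultimately show "simple_algebraic_extension (sub_ring V Quot place_kernel V C \<phi>) (C \<lparr> carrier := K' \<rparr>) \<kappa>"
  using Q.field_axioms S.field_axioms a(1) img unfolding simple_algebraic_extension_def Q_def by auto
qed

lemma residue_isomorphic_over:
 assumes \<phi>: "is_place V C \<phi>" and \<psi>: "is_place W C \<psi>" and VW: "V \<subseteq> W" and eq: "\<forall>x \<in> V. \<psi> x = \<phi> x"
  and \<kappa>: "\<And>v. v \<in> V ==> \<kappa> (place_kernel V C \<phi> +>\<^bsub>sub_ring V\<^esub> v) = \<phi> v"
 shows "isomorphic_over (sub_ring V Quot place_kernel V C \<phi>) (sub_ring W Quot place_kernel W C \<psi>)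
  (coset_map (place_kernel W C \<psi>)) (C \<lparr> carrier := \<psi> ` W \<rparr>) \<kappa>"
 unfolding isomorphic_over_def
proof (intro bexI ballI)
 show "(\<lambda>A. the_elem (\<psi> ` A)) \<in> ring_iso (sub_ring W Quot place_kernel W C \<psi>) (C \<lparr> carrier := \<psi> ` W \<rparr>)"
  by (rule place_quotient(5)[OF \<psi>])
 fix c assume "c \<in> carrier (sub_ring V Quot place_kernel V C \<phi>)"
 then obtain v where v: "v \<in> V" "c = place_kernel V C \<phi> +>\<^bsub>sub_ring V\<^esub> v" unfolding place_quotient(3)[OF \<phi>] by auto
 have "v \<in> W" using v VW by auto
 then show "the_elem (\<psi> ` coset_map (place_kernel W C \<psi>) c) = \<kappa> c"
  unfolding v(2) coset_map_place[OF \<phi> \<psi> VW eq v(1)] \<kappa>[OF v(1)] using place_quotient(6)[OF \<psi>] eq[rule_format, OF v(1)] by simp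
qed

section \<open>Localizations at places\<close>

text \<open>The extension of the place \<open>\<theta>\<close> to the localization at its kernel.\<close>

definition local_place :: "'a set \<Rightarrow> 'c ring \<Rightarrow> ('a \<Rightarrow> 'c) \<Rightarrow> 'a \<Rightarrow> 'c"
 where "local_place E C \<theta> = (SOME \<theta>'.
  \<theta>' \<in> ring_hom (sub_ring (localization E (place_kernel E C \<theta>))) C \<and> (\<forall>x \<in> E. \<theta>' x = \<theta> x))"

lemma local_place:
 assumes pl: "is_place E C \<theta>"
 defines "W \<equiv> localization E (place_kernel E C \<theta>)" and "\<theta>' \<equiv> local_place E C \<theta>"
 shows "is_place W C \<theta>'" "\<And>x. x \<in> E ==> \<theta>' x = \<theta> x" "\<theta>' ` W = \<theta> ` E" "place_kernel W C \<theta>' = nonunits W"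
  "E \<subseteq> W" "subring W R"
  "\<And>x. x \<in> W ==> \<exists>s \<in> E. \<theta> s \<noteq> \<zero>\<^bsub>C\<^esub> \<and> s \<otimes> x \<in> E \<and> \<theta> (s \<otimes> x) = \<theta> s \<otimes>\<^bsub>C\<^esub> \<theta>' x"
  "\<And>x. x \<in> W ==> x \<notin> nonunits W ==> x \<noteq> \<zero> \<and> inv x \<in> W"
proof -
 interpret C: field C using pl unfolding is_place_def by simp
 have E: "subring E R" and fin: "finite (\<theta> ` E)" and hom: "\<theta> \<in> ring_hom (sub_ring E) C"
  using pl unfolding is_place_def by auto
 note Ep = subringE[OF E] and ps = place_simps[OF pl]
 define P where "P = place_kernel E C \<theta>"
 have P: "prime_in E P" unfolding P_def by (rule place_kernel_maximal(2)[OF pl])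
 have W_eq: "W = localization E P" unfolding W_def P_def ..
 have mem_P: "x \<in> P \<longleftrightarrow> x \<in> E \<and> \<theta> x = \<zero>\<^bsub>C\<^esub>" for x unfolding P_def place_kernel_def by auto
 show W: "subring W R" and EW: "E \<subseteq> W" unfolding W_eq using localization_subring[OF E P] by auto
 note Wp = subringE[OF W]
 have frac: "\<exists>s \<in> E. \<theta> s \<noteq> \<zero>\<^bsub>C\<^esub> \<and> s \<otimes> x \<in> E" if "x \<in> W" for x
  using that mem_P unfolding W_eq localization_mem_iff[OF E P] by blast
 have "\<exists>f'. f' \<in> ring_hom (sub_ring W) C \<and> (\<forall>x \<in> E. f' x = \<theta> x)"
  by (rule extend_hom_to_fractions[OF E C.field_axioms hom W EW frac])
 from someI_ex[OF this] have h: "\<theta>' \<in> ring_hom (sub_ring W) C" "\<And>x. x \<in> E ==> \<theta>' x = \<theta> x"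
  unfolding \<theta>'_def local_place_def W_def by blast+
 show ext: "\<And>x. x \<in> E ==> \<theta>' x = \<theta> x" by (rule h(2))
 have hm: "\<theta>' (x \<otimes> y) = \<theta>' x \<otimes>\<^bsub>C\<^esub> \<theta>' y" if "x \<in> W" "y \<in> W" for x y
  using ring_hom_mult[OF h(1), of x y] that by simp
 have hc: "\<theta>' x \<in> carrier C" if "x \<in> W" for x using ring_hom_closed[OF h(1), of x] that by simp
 show den: "\<exists>s \<in> E. \<theta> s \<noteq> \<zero>\<^bsub>C\<^esub> \<and> s \<otimes> x \<in> E \<and> \<theta> (s \<otimes> x) = \<theta> s \<otimes>\<^bsub>C\<^esub> \<theta>' x" if x: "x \<in> W" for x
 proof -
  obtain s where s: "s \<in> E" "\<theta> s \<noteq> \<zero>\<^bsub>C\<^esub>" "s \<otimes> x \<in> E" using frac[OF x] by auto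
  have "s \<in> W" using s(1) EW by auto
  then have "\<theta> (s \<otimes> x) = \<theta> s \<otimes>\<^bsub>C\<^esub> \<theta>' x" using hm[of s x] x ext[OF s(1)] ext[OF s(3)] by simp
  then show ?thesis using s by blast
 qed
 show img: "\<theta>' ` W = \<theta> ` E"
 proof
  show "\<theta> ` E \<subseteq> \<theta>' ` W" using ext EW by (metis image_cong image_mono)
  show "\<theta>' ` W \<subseteq> \<theta> ` E"
  proof
   fix y assume "y \<in> \<theta>' ` W"
   then obtain x where x: "x \<in> W" "y = \<theta>' x" by auto
   obtain s where s: "s \<in> E" "\<theta> s \<noteq> \<zero>\<^bsub>C\<^esub>" "s \<otimes> x \<in> E" "\<theta> (s \<otimes> x) = \<theta> s \<otimes>\<^bsub>C\<^esub> \<theta>' x" using den[OF x(1)] by auto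
   obtain r where r: "r \<in> E" "\<theta> s \<otimes>\<^bsub>C\<^esub> \<theta> r = \<one>\<^bsub>C\<^esub>" using place_inverse[OF pl s(1,2)] by auto
   have cc: "\<theta> s \<in> carrier C" "\<theta> r \<in> carrier C" "y \<in> carrier C" using s(1) r(1) ps(4) hc[OF x(1)] x(2) by auto
   have "\<theta> (r \<otimes> (s \<otimes> x)) = \<theta> r \<otimes>\<^bsub>C\<^esub> (\<theta> s \<otimes>\<^bsub>C\<^esub> y)" using ps(6)[OF r(1) s(3)] s(4) x(2) by simp
   also have "\<dots> = (\<theta> s \<otimes>\<^bsub>C\<^esub> \<theta> r) \<otimes>\<^bsub>C\<^esub> y" using cc by (simp add: C.m_ac)
   also have "\<dots> = y" using r(2) cc by simp
   finally show "y \<in> \<theta> ` E" using Ep(6)[OF r(1) s(3)] by (metis imageI)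
  qed
 qed
 show "is_place W C \<theta>'" unfolding is_place_def using W C.field_axioms h(1) img fin by simp
 have inv: "x \<noteq> \<zero> \<and> inv x \<in> W" if x: "x \<in> W" "\<theta>' x \<noteq> \<zero>\<^bsub>C\<^esub>" for x
 proof -
  obtain s where s: "s \<in> E" "\<theta> s \<noteq> \<zero>\<^bsub>C\<^esub>" "s \<otimes> x \<in> E" "\<theta> (s \<otimes> x) = \<theta> s \<otimes>\<^bsub>C\<^esub> \<theta>' x" using den[OF x(1)] by auto
  have "\<theta> (s \<otimes> x) \<noteq> \<zero>\<^bsub>C\<^esub>" using s(2,4) x(2) ps(4)[OF s(1)] hc[OF x(1)] C.integral_iff by simp
  then show ?thesis using localization_units[OF E P, of x] x(1) s(1-3) mem_P unfolding W_eq by blast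
 qed
 have unit: "x \<in> Units (sub_ring W) \<longleftrightarrow> x \<in> W \<and> \<theta>' x \<noteq> \<zero>\<^bsub>C\<^esub>" for x
 proof
  assume "x \<in> Units (sub_ring W)"
  then obtain y where y: "x \<in> W" "y \<in> W" "x \<otimes> y = \<one>" unfolding Units_def by auto
  have "\<theta>' x \<otimes>\<^bsub>C\<^esub> \<theta>' y = \<one>\<^bsub>C\<^esub>" using hm[OF y(1,2)] y(3) ext[OF Ep(3)] ps(2) by simp
  then show "x \<in> W \<and> \<theta>' x \<noteq> \<zero>\<^bsub>C\<^esub>" using y(1) hc[OF y(2)] ps(3) by auto
 next
  assume x: "x \<in> W \<and> \<theta>' x \<noteq> \<zero>\<^bsub>C\<^esub>"
  then have "x \<noteq> \<zero>" "inv x \<in> W" "x \<in> carrier R" using inv Wp(1) by auto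
  moreover from this have "inv x \<otimes> x = \<one>" "x \<otimes> inv x = \<one>" using field_Units by auto
  ultimately show "x \<in> Units (sub_ring W)" unfolding Units_def using x by auto
 qed
 show "place_kernel W C \<theta>' = nonunits W" unfolding place_kernel_def nonunits_def using unit by blast
 show "x \<noteq> \<zero> \<and> inv x \<in> W" if "x \<in> W" "x \<notin> nonunits W" for x
  using inv[OF that(1)] that unit unfolding nonunits_def by blast
qed

lemma local_place_extends:
 assumes \<phi>: "is_place D C \<phi>" and \<psi>: "is_place E C \<psi>" and DE: "D \<subseteq> E" and eq: "\<forall>x \<in> D. \<psi> x = \<phi> x"
 shows "localization D (place_kernel D C \<phi>) \<subseteq> localization E (place_kernel E C \<psi>)"
  "\<And>x. x \<in> localization D (place_kernel D C \<phi>) ==> local_place E C \<psi> x = local_place D C \<phi> x"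
proof -
 interpret C: field C using \<phi> unfolding is_place_def by simp
 let ?V = "localization D (place_kernel D C \<phi>)" and ?W = "localization E (place_kernel E C \<psi>)"
 note l = local_place[OF \<phi>] and w = local_place[OF \<psi>]
 have D: "subring D R" and E: "subring E R" using \<phi> \<psi> unfolding is_place_def by auto
 show sub: "?V \<subseteq> ?W"
 proof
  fix x assume x: "x \<in> ?V"
  obtain s where s: "s \<in> D" "\<phi> s \<noteq> \<zero>\<^bsub>C\<^esub>" "s \<otimes> x \<in> D" using l(7)[OF x] by auto
  have "s \<in> E - place_kernel E C \<psi>" using s(1,2) eq[rule_format, OF s(1)] DE unfolding place_kernel_def by auto
  then show "x \<in> ?W"
   using localization_memI[OF E place_kernel_maximal(2)[OF \<psi>], of x s] x subringE(1)[OF l(6)] s(3) DE by blast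
 qed
 show "local_place E C \<psi> x = local_place D C \<phi> x" if x: "x \<in> ?V" for x
 proof -
  obtain s where s: "s \<in> D" "\<phi> s \<noteq> \<zero>\<^bsub>C\<^esub>" "s \<otimes> x \<in> D" "\<phi> (s \<otimes> x) = \<phi> s \<otimes>\<^bsub>C\<^esub> local_place D C \<phi> x" using l(7)[OF x] by auto
  have sW: "s \<in> ?W" "x \<in> ?W" using s(1) DE w(5) x sub by auto
  have "local_place E C \<psi> (s \<otimes> x) = \<phi> (s \<otimes> x)" using w(2)[of "s \<otimes> x"] s(3) DE eq[rule_format, OF s(3)] by auto
  moreover have "local_place E C \<psi> s = \<phi> s" using w(2)[of s] s(1) DE eq[rule_format, OF s(1)] by auto
  ultimately have e: "\<phi> s \<otimes>\<^bsub>C\<^esub> local_place E C \<psi> x = \<phi> s \<otimes>\<^bsub>C\<^esub> local_place D C \<phi> x"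
   using place_simps(6)[OF w(1) sW] s(4) by simp
  show ?thesis
   using C.m_lcancel[OF s(2) place_simps(4)[OF \<phi> s(1)] place_simps(4)[OF w(1) sW(2)] place_simps(4)[OF l(1) x]] e by simp
 qed
qed

text \<open>This is unramifiedness in terms of the local ring: any set between the kernel of \<open>\<phi>\<close> and the maximal ideal
 generates the maximal ideal, since the denominators that occur are units.\<close>

lemma genideal_localization:
 assumes \<phi>: "is_place D C \<phi>" and \<Phi>: "complete_lifts D E C \<phi> \<Phi>" and psi: "\<psi> \<in> \<Phi>" and DE: "D \<subseteq> E"
  and S: "place_kernel D C \<phi> \<subseteq> S" "S \<subseteq> nonunits (localization E (place_kernel E C \<psi>))"
 shows "Idl\<^bsub>sub_ring (localization E (place_kernel E C \<psi>))\<^esub> S = nonunits (localization E (place_kernel E C \<psi>))"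
proof -
 note P = complete_liftsD[OF \<Phi>]
 note pl = P(3)[OF psi]
 interpret C: field C using pl unfolding is_place_def by simp
 define W where "W = localization E (place_kernel E C \<psi>)"
 note w = local_place[OF pl, folded W_def]
 have E: "subring E R" using pl unfolding is_place_def by simp
 note Ep = subringE[OF E] and Wp = subringE[OF w(6)]
 have SW: "S \<subseteq> W" using S(2) unfolding W_def nonunits_def by auto
 note I = genideal_sub_ring[OF w(6) SW]
 note Im = module_overD[OF I(1)]
 have nm: "module_over W (nonunits W)" "nonunits W \<subseteq> W"
  using place_kernel_maximal(2)[OF w(1)] unfolding w(4) prime_in_def by auto
 have kE: "place_kernel D C \<phi> \<subseteq> E" using DE unfolding place_kernel_def by auto
 have "module_over E (Idl\<^bsub>sub_ring W\<^esub> S \<inter> E)" using Im Ep w(5) unfolding module_over_def by auto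
 then have JI: "Idl\<^bsub>sub_ring E\<^esub> (place_kernel D C \<phi>) \<subseteq> Idl\<^bsub>sub_ring W\<^esub> S"
  using genideal_sub_ring(4)[OF E kE, of "Idl\<^bsub>sub_ring W\<^esub> S \<inter> E"] I(3) S(1) kE by blast
 have cancel: "x \<in> Idl\<^bsub>sub_ring W\<^esub> S" if s: "s \<in> E" "\<psi> s \<noteq> \<zero>\<^bsub>C\<^esub>" and x: "x \<in> W" "s \<otimes> x \<in> Idl\<^bsub>sub_ring W\<^esub> S" for s x
 proof -
  have sW: "s \<in> W" using s(1) w(5) by auto
  have "s \<notin> nonunits W" using w(2)[OF s(1)] s(2) unfolding w(4)[symmetric] place_kernel_def by simp
  then have "s \<noteq> \<zero>" "inv s \<in> W" using w(8)[OF sW] by auto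
  moreover have c: "s \<in> carrier R" "x \<in> carrier R" "inv s \<in> carrier R" using sW x(1) \<open>inv s \<in> W\<close> Wp(1) by auto
  moreover have "inv s \<otimes> (s \<otimes> x) = (inv s \<otimes> s) \<otimes> x" using c by (simp add: m_assoc)
  ultimately have "inv s \<otimes> (s \<otimes> x) = x" using field_Units by simp
  then show ?thesis using Im(4)[OF \<open>inv s \<in> W\<close> x(2)] by simp
 qed
 have "nonunits W \<subseteq> Idl\<^bsub>sub_ring W\<^esub> S"
 proof
  fix x assume x: "x \<in> nonunits W"
  then have xW: "x \<in> W" "local_place E C \<psi> x = \<zero>\<^bsub>C\<^esub>" using w(4) unfolding place_kernel_def by auto
  obtain s where s: "s \<in> E" "\<psi> s \<noteq> \<zero>\<^bsub>C\<^esub>" "s \<otimes> x \<in> E" "\<psi> (s \<otimes> x) = \<psi> s \<otimes>\<^bsub>C\<^esub> local_place E C \<psi> x"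
   using w(7)[OF xW(1)] by auto
  have "s \<otimes> x \<in> place_kernel E C \<psi>" unfolding place_kernel_def using s xW(2) place_simps(4)[OF pl s(1)] by simp
  then obtain r where r: "r \<in> E" "\<psi> r \<noteq> \<zero>\<^bsub>C\<^esub>" "r \<otimes> (s \<otimes> x) \<in> Idl\<^bsub>sub_ring E\<^esub> (place_kernel D C \<phi>)"
   using P(5)[OF psi] by blast
  have "s \<otimes> x \<in> W" using s(3) w(5) by auto
  then have "s \<otimes> x \<in> Idl\<^bsub>sub_ring W\<^esub> S" using cancel[OF r(1,2)] r(3) JI by blast
  then show "x \<in> Idl\<^bsub>sub_ring W\<^esub> S" using cancel[OF s(1,2) xW(1)] by simp
 qed
 moreover have "Idl\<^bsub>sub_ring W\<^esub> S \<subseteq> nonunits W" using I(4)[OF nm] S(2) unfolding W_def by blast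
 ultimately show ?thesis unfolding W_def by blast
qed

text \<open>Divide the equation \<open>x\<^sup>n\<^sup>+\<^sup>1 + \<dots> = 0\<close> by \<open>x\<^sup>n\<close> to get \<open>x\<close> as a polynomial in \<open>1/x\<close>.\<close>

lemma integral_in_valuation_ring:
 assumes W: "subring W R" "D \<subseteq> W" and D: "subring D R" and x: "x \<in> carrier R" "integral D x"
  and val: "x \<noteq> \<zero>" "inv x \<in> W"
 shows "x \<in> W"
proof -
 note Wp = subringE[OF W(1)]
 have c: "inv x \<in> carrier R" "x \<otimes> inv x = \<one>" using x(1) val(1) field_Units by auto
 have key: "inv x [^] (length q - 1) \<otimes> eval q x \<in> W" if "set q \<subseteq> D" for q
  using that
 proof (induction q)
  case (Cons a q)
  have aW: "a \<in> W" "a \<in> carrier R" using Cons.prems W(2) Wp(1) by auto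
  have qc: "set q \<subseteq> carrier R" using Cons.prems W(2) Wp(1) by auto
  have e: "eval q x \<in> carrier R" by (rule eval_in_carrier[OF qc x(1)])
  have IH: "inv x [^] (length q - 1) \<otimes> eval q x \<in> W" using Cons by simp
  have one: "inv x [^] n \<otimes> x [^] n = \<one>" for n :: nat
   using nat_pow_distrib[of "inv x" x n] c x(1) m_comm[of x "inv x"] by simp
  have "inv x [^] length q \<otimes> (a \<otimes> x [^] length q) = a"
   using one[of "length q"] aW(2) c(1) x(1) by (simp add: m_lcomm)
  moreover have "inv x [^] length q \<otimes> eval q x \<in> W"
  proof (cases q)
   case Nil
   then show ?thesis using Wp(2) by simp
  next
   case (Cons b r)
   have "inv x [^] length q \<otimes> eval q x = inv x \<otimes> (inv x [^] (length q - 1) \<otimes> eval q x)"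
    using Cons e c(1) by (simp add: m_ac)
   then show ?thesis using IH Wp(6)[OF val(2)] by simp
  qed
  ultimately show ?case using aW c(1) x(1) e Wp(7) by (simp add: r_distr)
 qed (use Wp in simp)
 obtain q where q: "set q \<subseteq> D" "eval (\<one> # q) x = \<zero>" using x(2) integral_iff_list[OF D] by auto
 have qc: "set q \<subseteq> carrier R" using q(1) W(2) Wp(1) by auto
 have e: "eval q x \<in> carrier R" by (rule eval_in_carrier[OF qc x(1)])
 obtain n where n: "length q = Suc n" using monic_root_nonconst[OF x(1) q(2)] by (cases "length q") auto
 have one: "inv x [^] n \<otimes> x [^] n = \<one>"
  using nat_pow_distrib[of "inv x" x n] c x(1) m_comm[of x "inv x"] by simp
 have "x [^] n \<otimes> x \<oplus> eval q x = \<zero>" using q(2) n x(1) by simp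
 then have "inv x [^] n \<otimes> (x [^] n \<otimes> x \<oplus> eval q x) = \<zero>" using c(1) by simp
 moreover have "inv x [^] n \<otimes> (x [^] n \<otimes> x \<oplus> eval q x) = (inv x [^] n \<otimes> x [^] n) \<otimes> x \<oplus> inv x [^] n \<otimes> eval q x"
  using c(1) x(1) e by (simp add: r_distr m_assoc)
 ultimately have "x \<oplus> inv x [^] n \<otimes> eval q x = \<zero>" using one x(1) by simp
 then have "x = \<ominus> (inv x [^] n \<otimes> eval q x)" using x(1) c(1) e by (metis m_closed minus_equality nat_pow_closed)
 moreover have "inv x [^] n \<otimes> eval q x \<in> W" using key[OF q(1)] n by simp
 ultimately show ?thesis using Wp(5) by metis
qed

end

section \<open>Extensions of valuations\<close>

context field begin

lemma nonunits_subring: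
 assumes "subring U R"
 shows "nonunits U = {x \<in> U. x = \<zero> \<or> inv x \<notin> U}"
proof -
 note Up = subringE[OF assms]
 have "x \<in> Units (sub_ring U) \<longleftrightarrow> x \<in> U \<and> x \<noteq> \<zero> \<and> inv x \<in> U" for x
 proof
  assume "x \<in> Units (sub_ring U)"
  then obtain y where y: "x \<in> U" "y \<in> U" "x \<otimes> y = \<one>" unfolding Units_def by auto
  have c: "x \<in> carrier R" "y \<in> carrier R" using y Up(1) by auto
  then have "x \<noteq> \<zero>" using y(3) by auto
  moreover have "inv x = y" using comm_inv_char[OF c y(3)] .
  ultimately show "x \<in> U \<and> x \<noteq> \<zero> \<and> inv x \<in> U" using y by simp
 next
  assume x: "x \<in> U \<and> x \<noteq> \<zero> \<and> inv x \<in> U"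
  then have "inv x \<otimes> x = \<one>" "x \<otimes> inv x = \<one>" using Up(1) field_Units by auto
  then show "x \<in> Units (sub_ring U)" unfolding Units_def using x by auto
 qed
 then show ?thesis unfolding nonunits_def by auto
qed

lemma valuation_ring_nonunits:
 assumes U: "valuation_ring L U" and L: "subfield L R"
 shows "module_over U (nonunits U)"
proof -
 have Ur: "subring U R" and UL: "U \<subseteq> L" and val: "\<And>x. x \<in> L ==> x \<noteq> \<zero> ==> x \<in> U \<or> inv x \<in> U"
  using U unfolding valuation_ring_def by auto
 note Up = subringE[OF Ur] and Lp = subringE[OF subfieldE(1)[OF L]]
 note nu = nonunits_subring[OF Ur]
 have inv: "inv x \<in> carrier R" "inv x \<otimes> x = \<one>" "x \<otimes> inv x = \<one>" if "x \<in> carrier R" "x \<noteq> \<zero>" for x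
  using that field_Units by auto
 have scale: "a \<otimes> x \<in> nonunits U" if a: "a \<in> U" and x: "x \<in> nonunits U" for a x
 proof -
  have xU: "x \<in> U" "x = \<zero> \<or> inv x \<notin> U" using x unfolding nu by auto
  have c: "a \<in> carrier R" "x \<in> carrier R" using a xU(1) Up(1) by auto
  have "inv (a \<otimes> x) \<notin> U" if nz: "a \<otimes> x \<noteq> \<zero>"
  proof
   assume i: "inv (a \<otimes> x) \<in> U"
   have ic: "inv (a \<otimes> x) \<in> carrier R" "a \<otimes> x \<otimes> inv (a \<otimes> x) = \<one>" using inv[of "a \<otimes> x"] c nz by auto
   have "x \<otimes> (a \<otimes> inv (a \<otimes> x)) = \<one>" using ic c by (simp add: m_ac)
   then have "inv x = a \<otimes> inv (a \<otimes> x)" using comm_inv_char[of x] c ic(1) by simp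
   moreover have "x \<noteq> \<zero>" using nz c by auto
   ultimately show False using xU(2) Up(6)[OF a i] by simp
  qed
  then show ?thesis unfolding nu using Up(6)[OF a xU(1)] by auto
 qed
 show ?thesis unfolding module_over_def
 proof (intro conjI ballI scale)
  show "nonunits U \<subseteq> carrier R" "\<zero> \<in> nonunits U" unfolding nu using Up(1,2) by auto
  fix x y assume xy: "x \<in> nonunits U" "y \<in> nonunits U"
  then have xyU: "x \<in> U" "y \<in> U" unfolding nu by auto
  have c: "x \<in> carrier R" "y \<in> carrier R" using xyU Up(1) by auto
  show "x \<oplus> y \<in> nonunits U"
  proof (cases "x = \<zero> \<or> y = \<zero>")
   case True
   then show ?thesis using xy c by auto
  next
   case False
   note ix = inv[OF c(1)] and iy = inv[OF c(2)]
   define z where "z = x \<otimes> inv y"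
   have "inv y \<in> L" using subfield_m_inv(1)[OF L, of y] xyU(2) UL False by auto
   then have zL: "z \<in> L" "z \<in> carrier R" unfolding z_def using xyU(1) UL Lp(6) iy(1) c False by auto
   have zy: "z \<otimes> y = x" unfolding z_def using iy False c by (simp add: m_assoc)
   have "z \<noteq> \<zero>" using zy c False by auto
   then consider "z \<in> U" | "inv z \<in> U" using val[OF zL(1)] by auto
   then show ?thesis
   proof cases
    case 1
    have "x \<oplus> y = (z \<oplus> \<one>) \<otimes> y" using zy zL(2) c by (simp add: l_distr)
    then show ?thesis using scale[OF Up(7)[OF 1 Up(3)] xy(2)] by simp
   next
    case 2
    note iz = inv[OF zL(2) \<open>z \<noteq> \<zero>\<close>]
    have "inv z \<otimes> x = (inv z \<otimes> z) \<otimes> y" unfolding zy[symmetric] using iz(1) zL(2) c by (simp add: m_assoc)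
    then have "inv z \<otimes> x = y" using iz c by simp
    then have "x \<oplus> y = (\<one> \<oplus> inv z) \<otimes> x" using iz(1) c by (simp add: l_distr)
    then show ?thesis using scale[OF Up(7)[OF Up(3) 2] xy(1)] by simp
   qed
  qed
 qed
qed

text \<open>A valuation ring \<open>U\<close> of the upper field over \<open>V\<close> contains \<open>E\<close>, and its nonunits meet \<open>E\<close> in a prime over the
 kernel of \<open>\<phi>\<close>, that is in some \<open>ker \<psi>\<close>. So \<open>U\<close> contains the localization at \<open>ker \<psi>\<close>, and two valuation rings one of
 which dominates the other are equal.\<close>

lemma valuation_extensions_places:
 assumes dedD: "dedekind_domain D" and dedE: "dedekind_domain E" and DE: "D \<subseteq> E" and int: "\<And>x. x \<in> E ==> integral D x"
  and \<phi>: "is_place D C \<phi>" and nz: "place_kernel D C \<phi> \<noteq> {\<zero>}" and \<Phi>: "complete_lifts D E C \<phi> \<Phi>"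
 shows "bij_betw (\<lambda>\<psi>. localization E (place_kernel E C \<psi>)) \<Phi>
  (valuation_extensions (quotient_field D) (quotient_field E) (localization D (place_kernel D C \<phi>)))"
proof -
 interpret C: field C using \<phi> unfolding is_place_def by simp
 note D = dedekind_domainD[OF dedD] and E = dedekind_domainD[OF dedE]
 note Dp = subringE[OF D(1)] and Ep = subringE[OF E(1)]
 note F = quotient_field_subfield[OF D(1)] and L = quotient_field_subfield[OF E(1)]
 note P = complete_liftsD[OF \<Phi>]
 define V where "V = localization D (place_kernel D C \<phi>)"
 define W where "W \<psi> = localization E (place_kernel E C \<psi>)" for \<psi>
 note v = local_place[OF \<phi>, folded V_def]
 note w = local_place[OF P(3), folded W_def]
 have wv: "V \<subseteq> W \<psi>" "\<And>x. x \<in> V ==> local_place E C \<psi> x = local_place D C \<phi> x" if "\<psi> \<in> \<Phi>" for \<psi>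
  using local_place_extends[OF \<phi> P(3)[OF that] DE] P(4)[OF that] unfolding V_def W_def by auto
 have inv: "inv x \<in> carrier R" "inv x \<otimes> x = \<one>" "x \<otimes> inv x = \<one>" "inv (inv x) = x" "inv x \<noteq> \<zero>"
  if "x \<in> carrier R" "x \<noteq> \<zero>" for x
 proof -
  show i: "inv x \<in> carrier R" "inv x \<otimes> x = \<one>" "x \<otimes> inv x = \<one>" using that field_Units by auto
  show "inv (inv x) = x" by (rule comm_inv_char[OF i(1) that(1) i(2)])
  show "inv x \<noteq> \<zero>" using i(2) that(1) by auto
 qed
 have kc: "place_kernel E C \<psi> \<inter> D = place_kernel D C \<phi>" if "\<psi> \<in> \<Phi>" for \<psi>
  by (rule lift_kernel_contraction[OF DE P(4)[OF that]])
 have valD: "x \<in> V \<or> (x \<noteq> \<zero> \<and> inv x \<in> V)" if "x \<in> quotient_field D" for x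
  using dvr_valuation[OF dedekind_localization_dvr[OF dedD place_kernel_maximal(1)[OF \<phi>] nz] that] unfolding V_def .
 have valE: "x \<in> W \<psi> \<or> (x \<noteq> \<zero> \<and> inv x \<in> W \<psi>)" if psi: "\<psi> \<in> \<Phi>" and x: "x \<in> quotient_field E" for \<psi> x
 proof -
  have "place_kernel E C \<psi> \<noteq> {\<zero>}" using kc[OF psi] nz Dp(2) by auto
  then show ?thesis
   using dvr_valuation[OF dedekind_localization_dvr[OF dedE place_kernel_maximal(1)[OF P(3)[OF psi]]] x] unfolding W_def by blast
 qed
 have kW: "nonunits (W \<psi>) \<inter> E = place_kernel E C \<psi>" if "\<psi> \<in> \<Phi>" for \<psi>
  unfolding w(4)[OF that, symmetric] by (rule lift_kernel_contraction[OF w(5)[OF that] w(2)[OF that]])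
 have "inj_on W \<Phi>"
 proof (rule inj_onI)
  fix \<psi> \<psi>' assume p: "\<psi> \<in> \<Phi>" "\<psi>' \<in> \<Phi>" "W \<psi> = W \<psi>'"
  then have "place_kernel E C \<psi> = place_kernel E C \<psi>'" using kW[OF p(1)] kW[OF p(2)] by simp
  then show "\<psi> = \<psi>'" using inj_onD[OF P(2) _ p(1,2)] by simp
 qed
 moreover have "W \<psi> \<in> valuation_extensions (quotient_field D) (quotient_field E) V" if psi: "\<psi> \<in> \<Phi>" for \<psi>
 proof -
  have "W \<psi> \<subseteq> quotient_field E"
   unfolding W_def by (rule localization_subring(3)[OF E(1) place_kernel_maximal(2)[OF P(3)[OF psi]]])
  then have vr: "valuation_ring (quotient_field E) (W \<psi>)"
   unfolding valuation_ring_def using w(6)[OF psi] valE[OF psi] by blast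
  have VF: "V \<subseteq> quotient_field D" unfolding V_def by (rule localization_subring(3)[OF D(1) place_kernel_maximal(2)[OF \<phi>]])
  have "x \<in> V" if x: "x \<in> W \<psi>" "x \<in> quotient_field D" for x
  proof (rule ccontr)
   assume xV: "x \<notin> V"
   then have i: "x \<noteq> \<zero>" "inv x \<in> V" using valD[OF x(2)] by auto
   have xc: "x \<in> carrier R" using x(2) subfieldE(3)[OF F(1)] by auto
   note ix = inv[OF xc i(1)]
   have "inv x \<in> nonunits V" using v(8)[OF i(2)] ix(4) xV by auto
   then have "local_place D C \<phi> (inv x) = \<zero>\<^bsub>C\<^esub>" using v(4) unfolding place_kernel_def by auto
   then have z: "local_place E C \<psi> (inv x) = \<zero>\<^bsub>C\<^esub>" using wv(2)[OF psi i(2)] by simp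
   have iW: "inv x \<in> W \<psi>" using wv(1)[OF psi] i(2) by auto
   note ws = place_simps[OF w(1)[OF psi]]
   have "local_place E C \<psi> (x \<otimes> inv x) = \<zero>\<^bsub>C\<^esub>" using ws(6)[OF x(1) iW] z ws(4)[OF x(1)] by simp
   then show False using ix(3) ws(2,3) by simp
  qed
  then have "W \<psi> \<inter> quotient_field D = V" using wv(1)[OF psi] VF by auto
  then show ?thesis unfolding valuation_extensions_def using vr by simp
 qed
 moreover have "U \<in> W ` \<Phi>" if "U \<in> valuation_extensions (quotient_field D) (quotient_field E) V" for U
 proof -
  have U: "subring U R" "U \<subseteq> quotient_field E" "\<And>x. x \<in> quotient_field E ==> x \<noteq> \<zero> ==> x \<in> U \<or> inv x \<in> U"
   and vr: "valuation_ring (quotient_field E) U" and UF: "U \<inter> quotient_field D = V"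
   using that unfolding valuation_extensions_def valuation_ring_def by auto
  note Up = subringE[OF U(1)]
  have DU: "D \<subseteq> U" using v(5) UF by auto
  have EU: "E \<subseteq> U"
  proof
   fix x assume x: "x \<in> E"
   show "x \<in> U"
   proof (cases "x = \<zero> \<or> x \<in> U")
    case False
    have xL: "x \<in> quotient_field E" "x \<in> carrier R" using x L(2) Ep(1) by auto
    then have "inv x \<in> U" using U(3) False by auto
    then show ?thesis using integral_in_valuation_ring[OF U(1) DU D(1) xL(2) int[OF x]] False by simp
   qed (use Up in auto)
  qed
  note nu = nonunits_subring[OF U(1)] and nuV = nonunits_subring[OF v(6)]
  note nm = module_overD[OF valuation_ring_nonunits[OF vr L(1)]]
  define N where "N = nonunits U \<inter> E"
  have N: "prime_in E N" unfolding prime_in_def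
  proof (intro conjI ballI impI)
   show "module_over E N" unfolding N_def module_over_def using nm Ep EU by auto
   show "N \<subseteq> E" unfolding N_def by auto
   have "inv \<one> = \<one>" by simp
   then show "\<one> \<notin> N" unfolding N_def nu using Up(3) one_not_zero by simp
   fix a b assume ab: "a \<in> E" "b \<in> E" "a \<otimes> b \<in> N"
   show "a \<in> N \<or> b \<in> N"
   proof (rule ccontr)
    assume "\<not> ?thesis"
    then have u: "a \<noteq> \<zero>" "inv a \<in> U" "b \<noteq> \<zero>" "inv b \<in> U" using ab(1,2) EU unfolding N_def nu by auto
    have c: "a \<in> carrier R" "b \<in> carrier R" using ab Ep(1) by auto
    have "(a \<otimes> b) \<otimes> (inv a \<otimes> inv b) = (a \<otimes> inv a) \<otimes> (b \<otimes> inv b)"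
     using c inv(1)[OF c(1) u(1)] inv(1)[OF c(2) u(3)] by (simp add: m_ac)
    then have "(a \<otimes> b) \<otimes> (inv a \<otimes> inv b) = \<one>" using inv(3)[OF c(1) u(1)] inv(3)[OF c(2) u(3)] by simp
    then have "inv (a \<otimes> b) = inv a \<otimes> inv b"
     using comm_inv_char[of "a \<otimes> b" "inv a \<otimes> inv b"] c inv(1)[OF c(1) u(1)] inv(1)[OF c(2) u(3)] by simp
    moreover have "a \<otimes> b \<noteq> \<zero>" using c u integral_iff by simp
    ultimately show False using ab(3) Up(6)[OF u(2,4)] unfolding N_def nu by simp
   qed
  qed
  have ND: "N \<inter> D = place_kernel D C \<phi>"
  proof -
   have "x \<in> nonunits U \<longleftrightarrow> x \<in> nonunits V" if x: "x \<in> D" for x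
   proof (cases "x = \<zero>")
    case True
    then show ?thesis unfolding nu nuV using subringE(2)[OF v(6)] Up(2) by simp
   next
    case False
    have "inv x \<in> quotient_field D" using subfield_m_inv(1)[OF F(1), of x] x F(2) False by auto
    then have "inv x \<in> U \<longleftrightarrow> inv x \<in> V" using UF by auto
    then show ?thesis unfolding nu nuV using x DU v(5) by auto
   qed
   then have "N \<inter> D = nonunits V \<inter> D" unfolding N_def using DE by auto
   also have "\<dots> = place_kernel D C \<phi>"
    unfolding v(4)[symmetric] by (rule lift_kernel_contraction[OF v(5) v(2)])
   finally show ?thesis .
  qed
  have "N \<noteq> {\<zero>}" using ND nz Dp(2) by auto
  then have "maximalideal N (sub_ring E)" using E(4)[OF N] by simp
  then obtain \<psi> where psi: "\<psi> \<in> \<Phi>" "N = place_kernel E C \<psi>" using P(6)[OF _ ND] by auto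
  note pl = P(3)[OF psi(1)]
  have unit: "s \<noteq> \<zero> \<and> inv s \<in> U \<and> s \<in> carrier R" if "s \<in> E" "\<psi> s \<noteq> \<zero>\<^bsub>C\<^esub>" for s
  proof -
   have "s \<notin> N" using psi(2) that unfolding place_kernel_def by simp
   then show ?thesis using that(1) EU Ep(1) unfolding N_def nu by auto
  qed
  have WU: "W \<psi> \<subseteq> U"
  proof
   fix x assume x: "x \<in> W \<psi>"
   obtain s where s: "s \<in> E" "\<psi> s \<noteq> \<zero>\<^bsub>C\<^esub>" "s \<otimes> x \<in> E" using w(7)[OF psi(1) x] by auto
   note u = unit[OF s(1,2)]
   have xc: "x \<in> carrier R" using x subringE(1)[OF w(6)[OF psi(1)]] by auto
   have "inv s \<otimes> (s \<otimes> x) = x" using inv[of s] u xc by (simp add: m_assoc[symmetric])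
   then show "x \<in> U" using Up(6)[of "inv s" "s \<otimes> x"] u s(3) EU by auto
  qed
  have "U \<subseteq> W \<psi>"
  proof
   fix x assume x: "x \<in> U"
   show "x \<in> W \<psi>"
   proof (rule ccontr)
    assume xW: "x \<notin> W \<psi>"
    have xL: "x \<in> quotient_field E" "x \<in> carrier R" using x U(2) Up(1) by auto
    have i: "x \<noteq> \<zero>" "inv x \<in> W \<psi>" using valE[OF psi(1) xL(1)] xW by auto
    note ix = inv[OF xL(2) i(1)]
    have "inv x \<in> nonunits (W \<psi>)" using w(8)[OF psi(1) i(2)] ix(4) xW by auto
    then have z: "local_place E C \<psi> (inv x) = \<zero>\<^bsub>C\<^esub>" using w(4)[OF psi(1)] unfolding place_kernel_def by auto
    obtain s where s: "s \<in> E" "\<psi> s \<noteq> \<zero>\<^bsub>C\<^esub>" "s \<otimes> inv x \<in> E" "\<psi> (s \<otimes> inv x) = \<psi> s \<otimes>\<^bsub>C\<^esub> local_place E C \<psi> (inv x)"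
     using w(7)[OF psi(1) i(2)] by auto
    note u = unit[OF s(1,2)] and si = inv[of s]
    have "s \<otimes> inv x \<in> N" unfolding psi(2) place_kernel_def using s z place_simps(4)[OF pl s(1)] by simp
    then have n: "s \<otimes> inv x \<in> nonunits U" unfolding N_def by simp
    have sc: "s \<in> carrier R" "inv s \<in> carrier R" using u si by auto
    have "(s \<otimes> inv x) \<otimes> (inv s \<otimes> x) = (s \<otimes> inv s) \<otimes> (inv x \<otimes> x)" using sc ix(1) xL(2) by (simp add: m_ac)
    then have one: "(s \<otimes> inv x) \<otimes> (inv s \<otimes> x) = \<one>" using si u ix by simp
    then have "inv (s \<otimes> inv x) = inv s \<otimes> x" using comm_inv_char[of "s \<otimes> inv x" "inv s \<otimes> x"] sc ix(1) xL(2) by simp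
    moreover have "s \<otimes> inv x \<noteq> \<zero>" using sc u ix integral_iff by simp
    ultimately show False using n Up(6)[of "inv s" x] u x unfolding nu by simp
   qed
  qed
  then show ?thesis using WU psi(1) by blast
 qed
 ultimately show ?thesis unfolding bij_betw_def V_def W_def by blast
qed

text \<open>Every residue class of the localization meets \<open>D\<close> in a residue class of \<open>D\<close>.\<close>

lemma residue_embedding_local:
 assumes pl: "is_place D C \<phi>" and \<iota>: "\<And>x. x \<in> D ==> \<iota> (place_kernel D C \<phi> +>\<^bsub>sub_ring D\<^esub> x) = \<phi> x"
 defines "V \<equiv> localization D (place_kernel D C \<phi>)"
 assumes v: "v \<in> V"
 shows "\<iota> ((place_kernel V C (local_place D C \<phi>) +>\<^bsub>sub_ring V\<^esub> v) \<inter> D) = local_place D C \<phi> v"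
proof -
 note l = local_place[OF pl, folded V_def]
 have "local_place D C \<phi> v \<in> \<phi> ` D" using l(3) v by auto
 then obtain d where d: "d \<in> D" "\<phi> d = local_place D C \<phi> v" by auto
 have "(place_kernel V C (local_place D C \<phi>) +>\<^bsub>sub_ring V\<^esub> v) \<inter> D = place_kernel D C \<phi> +>\<^bsub>sub_ring D\<^esub> d"
  unfolding place_quotient(4)[OF l(1) v] place_quotient(4)[OF pl d(1)] using l(2,5) d by auto
 then show ?thesis using \<iota>[OF d(1)] d(2) by simp
qed

lemma quotient_field_eq_if_zero_maximal:
 assumes D: "subring D R" and M: "maximalideal {\<zero>} (sub_ring D)"
 shows "quotient_field D = D"
proof -
 interpret S: cring "sub_ring D" by (rule sub_ring_cring[OF D])
 have "field (sub_ring D)" using S.zeromaximalideal_fieldI M by simp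
 then have sub: "subfield D R" using subfield_iff(1) subringE(1)[OF D] by blast
 have "quotient_field D \<subseteq> D"
  unfolding quotient_field_def using subfield_m_inv(1)[OF sub] subringE(6)[OF D] by auto
 then show ?thesis using quotient_field_subfield(2)[OF D] by blast
qed

end

lemma extension_of_degree_finite:
 fixes C :: "'c ring"
 assumes ac: "algebraically_closed C" and k: "subfield k C" "finite k" and d: "d > 0"
 defines "K' \<equiv> extension_of_degree C k d"
 shows "subfield K' C" "k \<subseteq> K'" "finite K'" "card K' = card k ^ d"
  "\<And>E. subfield E C ==> card E = card k ^ d ==> E = K'"
proof -
 interpret C: algebraically_closed C by (rule ac)
 note ff = C.finite_frobenius_fixed[OF k d] and eq = C.finite_subfield_eq_frobenius_fixed[OF k d]
 let ?K = "C.frobenius_fixed (card k ^ d)"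
 have "C.dimension d k ?K"
  by (rule C.dimension_eq_card[OF k(1) ff(4) C.one_not_zero subfieldE(3)[OF ff(1)] subfieldE(1)[OF ff(1)] ff(2,3)])
 then have K': "K' = ?K" unfolding K'_def extension_of_degree_def
  using ff(1,2) eq C.card_dimension[OF k] by (intro the_equality) blast+
 show "subfield K' C" "k \<subseteq> K'" "finite K'" "card K' = card k ^ d" unfolding K' by (rule ff)+
 show "E = K'" if "subfield E C" "card E = card k ^ d" for E unfolding K' by (rule eq[OF that])
qed

section \<open>Realizing the system\<close>

theorem theorem4p1:
  fixes \<Omega> :: "'a ring" and F D :: "'a set" and n m :: nat
    and M :: "nat \<Rightarrow> 'a set" and K :: "nat \<Rightarrow> 'a set ring"
    and f :: "nat \<Rightarrow> nat" and Fs :: "nat \<Rightarrow> 'a set set"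
    and Kbar :: "nat \<Rightarrow> 'k ring" and \<iota> :: "nat \<Rightarrow> 'a set \<Rightarrow> 'k" and K' :: "nat \<Rightarrow> 'k set"
    and V :: "nat \<Rightarrow> 'a set" and T :: "nat \<Rightarrow> ('a set, 'k) ext_triple list"
  assumes ambient: "algebraic_closure \<Omega> F"
    and dedekind: "ring.dedekind_domain \<Omega> D"
    and quotient_field: "F = ring.quotient_field \<Omega> D"
    and not_field: "F \<noteq> D"
    and n: "n > 1"
    and maximal: "\<forall>i \<in> {1..n}. maximalideal (M i) (\<Omega> \<lparr> carrier := D \<rparr>)"
    and distinct: "inj_on M {1..n}"
    and K: "\<forall>i \<in> {1..n}. K i = (\<Omega> \<lparr> carrier := D \<rparr>) Quot M i"
    and finite: "\<forall>i \<in> {1..n}. finite (carrier (K i))"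
    and f: "\<forall>i \<in> {1..n}. f i > 0 \<and> subfield (Fs i) (K i) \<and>
              ring.dimension (K i) (f i) (Fs i) (carrier (K i))"
    and m: "m = (\<Prod>i \<in> {1..n}. f i)"
    and closure: "\<forall>i \<in> {1..n}. \<iota> i \<in> ring_hom (K i) (Kbar i) \<and>
              algebraic_closure (Kbar i) (\<iota> i ` carrier (K i))"
    and K': "\<forall>i \<in> {1..n}. K' i =
              extension_of_degree (Kbar i) (\<iota> i ` carrier (K i)) (m div f i)"
    and V: "\<forall>i \<in> {1..n}. V i = ring.localization \<Omega> D (M i)"
    \<comment> \<open>\<open>C \<mapsto> C \<inter> D\<close> is the canonical isomorphism from the residue field of \<open>V i\<close> to \<open>K i\<close>.\<close>
    and T: "\<forall>i \<in> {1..n}. T i = replicate (f i)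
              \<lparr> ext_field = Kbar i \<lparr> carrier := K' i \<rparr>, ext_emb = (\<lambda>C. \<iota> i (C \<inter> D)),
                ext_deg = m div f i, ext_ram = 1 \<rparr>"
  shows "ring.consistent_system \<Omega> F n V m T \<and>
    ring.realizable \<Omega> F n V m T \<and>
    (\<exists>E. ring.dedekind_domain \<Omega> E \<and>
      ring.finite_separable_integral_extension \<Omega> D E \<and>
      ring.dimension \<Omega> m F (ring.quotient_field \<Omega> E) \<and>
      (\<forall>i \<in> {1..n}.
        card {N. maximalideal N (\<Omega> \<lparr> carrier := E \<rparr>) \<and> N \<inter> D = M i} = f i \<and>
        (\<forall>N. maximalideal N (\<Omega> \<lparr> carrier := E \<rparr>) \<and> N \<inter> D = M i \<longrightarrow>
          Idl\<^bsub>\<Omega> \<lparr> carrier := ring.localization \<Omega> E N \<rparr>\<^esub> (M i) =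
            Idl\<^bsub>\<Omega> \<lparr> carrier := ring.localization \<Omega> E N \<rparr>\<^esub> N \<and>
          ring.dimension ((\<Omega> \<lparr> carrier := E \<rparr>) Quot N) (m div f i)
            (ring.coset_map \<Omega> N ` carrier (K i)) (carrier ((\<Omega> \<lparr> carrier := E \<rparr>) Quot N)) \<and>
          ring.dimension ((\<Omega> \<lparr> carrier := E \<rparr>) Quot N) m
            (ring.coset_map \<Omega> N ` Fs i) (carrier ((\<Omega> \<lparr> carrier := E \<rparr>) Quot N)))))"
proof -
  interpret A: algebraic_closure \<Omega> F by (rule ambient)
  let ?I = "{1..n}"
  note D = A.dedekind_domainD[OF dedekind]
  note F = A.quotient_field_subfield[OF D(1), folded quotient_field]
  define \<phi> where "\<phi> i = (\<lambda>x. \<iota> i (M i +>\<^bsub>A.sub_ring D\<^esub> x))" for i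
  have acK: "algebraically_closed (Kbar i)" if "i \<in> ?I" for i
  proof -
    interpret B: algebraic_closure "Kbar i" "\<iota> i ` carrier (K i)" using closure that by blast
    show ?thesis by (rule B.algebraically_closed_axioms)
  qed
  have Kf: "field (Kbar i)" if "i \<in> ?I" for i using acK[OF that] by (rule algebraically_closed.axioms(1))
  have Mi: "maximalideal (M i) (A.sub_ring D)" if "i \<in> ?I" for i using maximal that by blast
  have Ki: "K i = A.sub_ring D Quot M i" if "i \<in> ?I" for i using K that by blast
  have \<iota>i: "\<iota> i \<in> ring_hom (A.sub_ring D Quot M i) (Kbar i)" if "i \<in> ?I" for i using closure Ki that by metis
  have fini: "finite (carrier (A.sub_ring D Quot M i))" if "i \<in> ?I" for i using finite Ki that by metis
  note place = A.place_of_residue_embedding[OF D(1) Mi Kf \<iota>i fini, folded \<phi>_def]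
  have M0: "M i \<noteq> {\<zero>\<^bsub>\<Omega>\<^esub>}" if "i \<in> ?I" for i
    using A.quotient_field_eq_if_zero_maximal[OF D(1)] Mi[OF that] not_field quotient_field by auto
  have img: "\<phi> i ` D = \<iota> i ` carrier (K i)" if "i \<in> ?I" for i using place(3)[OF that that that that] Ki[OF that] by simp
  have pl: "A.is_place D (Kbar i) (\<phi> i)" if "i \<in> ?I" for i using place(1)[OF that that that that] .
  have ker: "A.place_kernel D (Kbar i) (\<phi> i) = M i" if "i \<in> ?I" for i using place(2)[OF that that that that] .
  have nz: "A.place_kernel D (Kbar i) (\<phi> i) \<noteq> {\<zero>\<^bsub>\<Omega>\<^esub>}" if "i \<in> ?I" for i
    unfolding ker[OF that] by (rule M0[OF that])
  define k where "k i = \<phi> i ` D" for i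
  have ksub: "subfield (k i) (Kbar i)" "finite (k i)" if "i \<in> ?I" for i
    using A.place_image_subfield[OF pl[OF that]] pl[OF that] unfolding k_def A.is_place_def by auto
  have qK: "carrier (K i) = carrier (A.sub_ring D Quot A.place_kernel D (Kbar i) (\<phi> i))" if "i \<in> ?I" for i
    using Ki[OF that] ker[OF that] by simp
  have cardK: "card (carrier (K i)) = card (k i)" if "i \<in> ?I" for i
    using A.place_quotient(7)[OF pl[OF that]] qK[OF that] unfolding k_def by simp
  have fieldK: "field (K i)" if "i \<in> ?I" for i
    using A.place_quotient(1)[OF pl[OF that]] unfolding ker[OF that] Ki[OF that] .
  have fpos: "0 < f i" if "i \<in> ?I" for i using f that by blast
  have Fsub: "subfield (Fs i) (K i)" if "i \<in> ?I" for i using f that by blast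
  have Fscard: "card (carrier (K i)) = card (Fs i) ^ f i" "2 \<le> card (Fs i)" if i: "i \<in> ?I" for i
  proof -
    interpret K: field "K i" by (rule fieldK[OF i])
    have fs: "Fs i \<subseteq> carrier (K i)" using subfieldE(3)[OF Fsub[OF i]] .
    then have fin: "finite (Fs i)" using finite i finite_subset by blast
    show "card (carrier (K i)) = card (Fs i) ^ f i" using K.card_dimension[OF Fsub[OF i] fin] f i by blast
    have "{\<zero>\<^bsub>K i\<^esub>, \<one>\<^bsub>K i\<^esub>} \<subseteq> Fs i" using subringE(2,3)[OF subfieldE(1)[OF Fsub[OF i]]] by auto
    then show "2 \<le> card (Fs i)" using card_mono[OF fin, of "{\<zero>\<^bsub>K i\<^esub>, \<one>\<^bsub>K i\<^esub>}"] by simp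
  qed
  \<comment> \<open>enough elements for complete splitting in step \<open>i\<close>\<close>
  have fle: "f i \<le> card (k i)" if i: "i \<in> ?I" for i
  proof -
    have "f i < 2 ^ f i" by (rule less_exp)
    also have "\<dots> \<le> card (Fs i) ^ f i" by (rule power_mono[OF Fscard(2)[OF i]]) simp
    finally show ?thesis using Fscard(1)[OF i] cardK[OF i] by simp
  qed
  define d where "d i = m div f i" for i
  have md: "m = f i * d i" "d i = (\<Prod>j\<in>?I - {i}. f j)" "0 < d i" if i: "i \<in> ?I" for i
  proof -
    have e: "m = f i * (\<Prod>j\<in>?I - {i}. f j)" unfolding m using prod.remove[OF _ i, of f] by simp
    then show dd: "d i = (\<Prod>j\<in>?I - {i}. f j)" unfolding d_def using fpos[OF i] by simp
    show "m = f i * d i" using e dd by simp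
    show "0 < d i" unfolding dd by (rule prod_pos) (use fpos in auto)
  qed
  have mpos: "0 < m" unfolding m by (rule prod_pos) (use fpos in auto)
  have K'i: "K' i = extension_of_degree (Kbar i) (k i) (d i)" if "i \<in> ?I" for i
    using K' that img[OF that] unfolding k_def d_def by simp
  note deg = extension_of_degree_finite[OF acK ksub md(3)]
  have ext: "subfield (K' i) (Kbar i)" "k i \<subseteq> K' i" "finite (K' i)" "card (K' i) = card (k i) ^ d i"
    if "i \<in> ?I" for i
    using deg(1-4)[OF that that that that] unfolding K'i[OF that] by simp_all
  have uniq: "E = K' i" if "i \<in> ?I" "subfield E (Kbar i)" "card E = card (k i) ^ d i" for i E
    using deg(5)[OF that(1) that(1) that(1) that(1) that(2,3)] unfolding K'i[OF that(1)] .
  obtain E where E: "A.dedekind_domain E" "D \<subseteq> E" "A.fg_module D E"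
      "A.dimension m F (A.quotient_field E)" "A.pth_power_spanned F (A.quotient_field E)"
      "\<forall>i \<in> ?I. \<exists>\<Phi>. A.complete_lifts D E (Kbar i) (\<phi> i) \<Phi> \<and> card \<Phi> = f i \<and>
        (\<forall>\<psi> \<in> \<Phi>. card (\<psi> ` E) = card (k i) ^ d i)"
  proof -
    have inj: "inj_on (\<lambda>i. A.place_kernel D (Kbar i) (\<phi> i)) ?I"
    proof (rule inj_onI)
      fix i j assume ij: "i \<in> ?I" "j \<in> ?I" and eq: "A.place_kernel D (Kbar i) (\<phi> i) = A.place_kernel D (Kbar j) (\<phi> j)"
      then have "M i = M j" unfolding ker[OF ij(1)] ker[OF ij(2)] by simp
      then show "i = j" using inj_onD[OF distinct _ ij] by blast
    qed
    have "\<exists>E. A.dedekind_domain E \<and> D \<subseteq> E \<and> A.fg_module D E \<and>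
      A.dimension (\<Prod>i\<in>{1..n}. f i) (A.quotient_field D) (A.quotient_field E) \<and>
      A.pth_power_spanned (A.quotient_field D) (A.quotient_field E) \<and>
      (\<forall>i \<in> ?I. \<exists>\<Phi>. A.complete_lifts D E (Kbar i) (\<phi> i) \<Phi> \<and> card \<Phi> = (if i \<le> n then f i else 1) \<and>
        (\<forall>\<psi> \<in> \<Phi>. card (\<psi> ` E) = card (\<phi> i ` D) ^ (\<Prod>j\<in>{1..n} - {i}. f j)))"
      by (rule A.exists_extension_with_split_lifts[OF A.algebraically_closed_axioms dedekind pl nz acK inj fpos fle[unfolded k_def] n order_refl])
    then show ?thesis using that md(2) unfolding k_def m[symmetric] quotient_field[symmetric] by force
  qed
  from bchoice[OF E(6)] obtain \<Phi> where \<Phi>: "\<And>i. i \<in> ?I \<Longrightarrow> A.complete_lifts D E (Kbar i) (\<phi> i) (\<Phi> i)"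
    "\<And>i. i \<in> ?I \<Longrightarrow> card (\<Phi> i) = f i" "\<And>i \<psi>. i \<in> ?I \<Longrightarrow> \<psi> \<in> \<Phi> i \<Longrightarrow> card (\<psi> ` E) = card (k i) ^ d i"
    by blast
  note P = A.complete_liftsD[OF \<Phi>(1)]
  note Ed = A.dedekind_domainD[OF E(1)]
  note L = A.quotient_field_subfield[OF Ed(1)]
  have int: "A.integral D x" if "x \<in> E" for x by (rule A.integral_if_mem_fg[OF D(2) Ed(1) E(3) that])
  have sep: "A.separable_extension F (A.quotient_field E)"
  proof (rule A.separable_if_pth_power_spanned[OF F(1) L(1) _ E(4,5)])
    show "F \<subseteq> A.quotient_field E" unfolding quotient_field A.quotient_field_def using E(2) by blast
  qed
  have eqD: "\<forall>x \<in> D. \<psi> x = \<phi> i x" if "i \<in> ?I" "\<psi> \<in> \<Phi> i" for i \<psi> using P(4)[OF that] by blast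
  have kc: "A.place_kernel E (Kbar i) \<psi> \<inter> D = M i" if "i \<in> ?I" "\<psi> \<in> \<Phi> i" for i \<psi>
    unfolding ker[OF that(1), symmetric] by (rule A.lift_kernel_contraction[OF E(2) P(4)[OF that]])
  have imgE: "\<psi> ` E = K' i" if "i \<in> ?I" "\<psi> \<in> \<Phi> i" for i \<psi>
    by (rule uniq[OF that(1) A.place_image_subfield[OF P(3)[OF that]] \<Phi>(3)[OF that]])
  have Vi: "V i = A.localization D (A.place_kernel D (Kbar i) (\<phi> i))" if "i \<in> ?I" for i using V that ker[OF that] by simp
  define \<phi>' where "\<phi>' i = A.local_place D (Kbar i) (\<phi> i)" for i
  have v: "A.is_place (V i) (Kbar i) (\<phi>' i)" "\<phi>' i ` V i = k i"
    "A.place_kernel (V i) (Kbar i) (\<phi>' i) = A.nonunits (V i)" "D \<subseteq> V i" "\<And>x. x \<in> D \<Longrightarrow> \<phi>' i x = \<phi> i x"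
    if "i \<in> ?I" for i
    using A.local_place(1-5)[OF pl[OF that]] unfolding Vi[OF that] \<phi>'_def k_def by auto
  let ?\<kappa> = "\<lambda>i B. \<iota> i (B \<inter> D)"
  have resV: "A.residue_field (V i) = A.sub_ring (V i) Quot A.place_kernel (V i) (Kbar i) (\<phi>' i)" if "i \<in> ?I" for i
    unfolding A.residue_field_def v(3)[OF that] ..
  have \<kappa>: "?\<kappa> i (A.place_kernel (V i) (Kbar i) (\<phi>' i) +>\<^bsub>A.sub_ring (V i)\<^esub> x) = \<phi>' i x" if "i \<in> ?I" "x \<in> V i" for i x
    using A.residue_embedding_local[OF pl[OF that(1)], of "\<iota> i" x] that(2) ker[OF that(1)]
    unfolding Vi[OF that(1)] \<phi>'_def \<phi>_def by simp
  have res_ext: "simple_algebraic_extension (A.residue_field (V i)) (Kbar i \<lparr> carrier := K' i \<rparr>) (?\<kappa> i)"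
    "ring.dimension (Kbar i \<lparr> carrier := K' i \<rparr>) (d i) (?\<kappa> i ` carrier (A.residue_field (V i))) (K' i)"
    if i: "i \<in> ?I" for i
    unfolding resV[OF i]
    by (rule A.residue_simple_algebraic_extension[OF v(1)[OF i] acK[OF i] ext(1)[OF i] _ ext(3)[OF i]];
      use ext(2,4)[OF i] v(2)[OF i] \<kappa>[OF i] in simp)+
  have Ti: "T i = replicate (f i) \<lparr> ext_field = Kbar i \<lparr> carrier := K' i \<rparr>, ext_emb = ?\<kappa> i, ext_deg = d i, ext_ram = 1 \<rparr>"
    if "i \<in> ?I" for i using T that unfolding d_def by simp
  have Vdvr: "A.dvr F (V i)" if "i \<in> ?I" for i
    using A.dedekind_localization_dvr[OF dedekind Mi[OF that] M0[OF that]] V that unfolding quotient_field by simp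
  have Vinj: "inj_on V ?I"
  proof (rule inj_onI)
    fix i j assume ij: "i \<in> ?I" "j \<in> ?I" "V i = V j"
    have "A.nonunits (V i) \<inter> D = M i" if "i \<in> ?I" for i
      unfolding v(3)[OF that, symmetric] ker[OF that, symmetric]
      by (rule A.lift_kernel_contraction[OF v(4)[OF that] v(5)[OF that]])
    then have "M i = M j" using ij by metis
    then show "i = j" using distinct ij unfolding inj_on_def by blast
  qed
  have consistent: "A.consistent_system F n V m T"
    unfolding A.consistent_system_def
  proof (intro conjI ballI mpos Vinj Vdvr)
    fix i assume i: "i \<in> ?I"
    show "T i \<noteq> []" using fpos[OF i] unfolding Ti[OF i] by simp
    show "(\<Sum>t\<leftarrow>T i. ext_ram t * ext_deg t) = m" unfolding Ti[OF i] using md(1)[OF i] by (simp add: sum_list_replicate)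
    fix t assume "t \<in> set (T i)"
    then have t: "t = \<lparr> ext_field = Kbar i \<lparr> carrier := K' i \<rparr>, ext_emb = ?\<kappa> i, ext_deg = d i, ext_ram = 1 \<rparr>"
      unfolding Ti[OF i] by (auto split: if_splits)
    show "simple_algebraic_extension (A.residue_field (V i)) (ext_field t) (ext_emb t)"
      "ring.dimension (ext_field t) (ext_deg t) (ext_emb t ` carrier (A.residue_field (V i))) (carrier (ext_field t))"
      "ext_ram t > 0" unfolding t using res_ext[OF i] by simp_all
  qed
  define W where "W i \<psi> = A.localization E (A.place_kernel E (Kbar i) \<psi>)" for i \<psi>
  have w: "A.is_place (W i \<psi>) (Kbar i) (A.local_place E (Kbar i) \<psi>)" "A.local_place E (Kbar i) \<psi> ` W i \<psi> = K' i"
    "A.place_kernel (W i \<psi>) (Kbar i) (A.local_place E (Kbar i) \<psi>) = A.nonunits (W i \<psi>)" "E \<subseteq> W i \<psi>"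
    "\<And>x. x \<in> E \<Longrightarrow> A.local_place E (Kbar i) \<psi> x = \<psi> x" "subring (W i \<psi>) \<Omega>"
    if "i \<in> ?I" "\<psi> \<in> \<Phi> i" for i \<psi>
    using A.local_place(1-6)[OF P(3)[OF that]] imgE[OF that] unfolding W_def by auto
  have wv: "V i \<subseteq> W i \<psi>" "\<forall>x \<in> V i. A.local_place E (Kbar i) \<psi> x = \<phi>' i x" if "i \<in> ?I" "\<psi> \<in> \<Phi> i" for i \<psi>
    using A.local_place_extends[OF pl[OF that(1)] P(3)[OF that] E(2) eqD[OF that]] unfolding Vi[OF that(1)] W_def \<phi>'_def by auto
  have gen: "Idl\<^bsub>A.sub_ring (W i \<psi>)\<^esub> S = A.nonunits (W i \<psi>)"
    if "i \<in> ?I" "\<psi> \<in> \<Phi> i" "M i \<subseteq> S" "S \<subseteq> A.nonunits (W i \<psi>)" for i \<psi> S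
    using A.genideal_localization[OF pl[OF that(1)] \<Phi>(1)[OF that(1)] that(2) E(2), of S] that(3,4) ker[OF that(1)]
    unfolding W_def by simp
  have kerW: "A.nonunits (W i \<psi>) \<inter> E = A.place_kernel E (Kbar i) \<psi>" if "i \<in> ?I" "\<psi> \<in> \<Phi> i" for i \<psi>
    unfolding w(3)[OF that, symmetric] by (rule A.lift_kernel_contraction[OF w(4)[OF that] w(5)[OF that]])
  have "A.realization F n V m T (A.quotient_field E)"
    unfolding A.realization_def
  proof (intro conjI sep E(4) ballI)
    fix i assume i: "i \<in> ?I"
    have "bij_betw (W i) (\<Phi> i) (A.valuation_extensions F (A.quotient_field E) (V i))"
      unfolding W_def Vi[OF i] quotient_field
      by (rule A.valuation_extensions_places[OF dedekind E(1,2) int pl[OF i] nz[OF i] \<Phi>(1)[OF i]])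
    moreover obtain e where e: "bij_betw e {0..<card (\<Phi> i)} (\<Phi> i)" using ex_bij_betw_nat_finite[OF P(1)[OF i]] by blast
    ultimately have bij: "bij_betw (W i \<circ> e) {..<length (T i)} (A.valuation_extensions F (A.quotient_field E) (V i))"
      using bij_betw_trans[OF e] \<Phi>(2)[OF i] unfolding Ti[OF i] by (simp add: lessThan_atLeast0)
    show "\<exists>W. bij_betw W {..<length (T i)} (A.valuation_extensions F (A.quotient_field E) (V i)) \<and>
      (\<forall>j < length (T i).
        isomorphic_over (A.residue_field (V i)) (A.residue_field (W j)) (A.coset_map (A.nonunits (W j)))
          (ext_field (T i ! j)) (ext_emb (T i ! j)) \<and>
        A.ramification_index (V i) (W j) (ext_ram (T i ! j)))"
    proof (intro exI[of _ "W i \<circ> e"] conjI bij allI impI)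
      fix j assume "j < length (T i)"
      then have j: "j < f i" unfolding Ti[OF i] by simp
      then have psi: "e j \<in> \<Phi> i" using bij_betwE[OF e] \<Phi>(2)[OF i] by simp
      have t: "T i ! j = \<lparr> ext_field = Kbar i \<lparr> carrier := K' i \<rparr>, ext_emb = ?\<kappa> i, ext_deg = d i, ext_ram = 1 \<rparr>"
        unfolding Ti[OF i] using j by simp
      note iw = w[OF i psi]
      have "isomorphic_over (A.sub_ring (V i) Quot A.place_kernel (V i) (Kbar i) (\<phi>' i))
        (A.sub_ring (W i (e j)) Quot A.place_kernel (W i (e j)) (Kbar i) (A.local_place E (Kbar i) (e j)))
        (A.coset_map (A.place_kernel (W i (e j)) (Kbar i) (A.local_place E (Kbar i) (e j))))
        (Kbar i \<lparr> carrier := A.local_place E (Kbar i) (e j) ` W i (e j) \<rparr>) (?\<kappa> i)"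
        by (rule A.residue_isomorphic_over[OF v(1)[OF i] iw(1) wv[OF i psi] \<kappa>[OF i]])
      then show "isomorphic_over (A.residue_field (V i)) (A.residue_field ((W i \<circ> e) j))
        (A.coset_map (A.nonunits ((W i \<circ> e) j))) (ext_field (T i ! j)) (ext_emb (T i ! j))"
        unfolding t A.residue_field_def iw(2,3) v(3)[OF i] by simp
      have ne: "A.nonunits (V i) \<subseteq> A.nonunits (W i (e j))"
        unfolding v(3)[OF i, symmetric] iw(3)[symmetric] A.place_kernel_def using wv[OF i psi] by auto
      have MV: "M i \<subseteq> A.nonunits (V i)"
        unfolding v(3)[OF i, symmetric] ker[OF i, symmetric] A.place_kernel_def using v(4,5)[OF i] by auto
      interpret S: cring "A.sub_ring (W i (e j))" by (rule A.sub_ring_cring[OF iw(6)])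
      interpret S: comm_monoid "ideals_set (A.sub_ring (W i (e j)))" by (rule S.ideals_set_is_comm_monoid)
      have "ideal (A.nonunits (W i (e j))) (A.sub_ring (W i (e j)))"
        using A.place_kernel_maximal(1)[OF iw(1)] unfolding iw(3) by (rule maximalideal.axioms(1))
      then have "A.nonunits (W i (e j)) \<in> carrier (ideals_set (A.sub_ring (W i (e j))))" unfolding ideals_set_def by simp
      then have "A.nonunits (W i (e j)) [^]\<^bsub>ideals_set (A.sub_ring (W i (e j)))\<^esub> (1::nat) = A.nonunits (W i (e j))"
        by (rule S.nat_pow_eone)
      then show "A.ramification_index (V i) ((W i \<circ> e) j) (ext_ram (T i ! j))"
        unfolding t A.ramification_index_def using gen[OF i psi MV ne] by simp
    qed
  qed
  then have realizable: "A.realizable F n V m T" unfolding A.realizable_def by blast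
  have integral_ext: "A.finite_separable_integral_extension D E"
    unfolding A.finite_separable_integral_extension_def
  proof (intro conjI ballI int E(2))
    show "subdomain E \<Omega>" by (rule A.subdomainI'[OF Ed(1)])
    obtain Us where Us: "set Us \<subseteq> carrier \<Omega>" "E = A.Span D Us" using E(3) unfolding A.fg_module_def by blast
    then show "\<exists>Us. set Us \<subseteq> E \<and> E = A.Span D Us" using A.module_over_Span(2)[OF D(1) Us(1)] by blast
    show "A.separable_extension (A.quotient_field D) (A.quotient_field E)" using sep unfolding quotient_field .
    show "A.finite_dimension (A.quotient_field D) (A.quotient_field E)"
      using E(4) unfolding quotient_field A.finite_dimension_def by blast
  qed
  have primes_over: "card {N. maximalideal N (A.sub_ring E) \<and> N \<inter> D = M i} = f i \<and>
        (\<forall>N. maximalideal N (A.sub_ring E) \<and> N \<inter> D = M i \<longrightarrow>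
          Idl\<^bsub>A.sub_ring (A.localization E N)\<^esub> (M i) = Idl\<^bsub>A.sub_ring (A.localization E N)\<^esub> N \<and>
          ring.dimension (A.sub_ring E Quot N) (m div f i)
            (A.coset_map N ` carrier (K i)) (carrier (A.sub_ring E Quot N)) \<and>
          ring.dimension (A.sub_ring E Quot N) m (A.coset_map N ` Fs i) (carrier (A.sub_ring E Quot N)))"
    if i: "i \<in> ?I" for i
  proof -
    have eq: "{N. maximalideal N (A.sub_ring E) \<and> N \<inter> D = M i} = A.place_kernel E (Kbar i) ` \<Phi> i"
    proof
      show "{N. maximalideal N (A.sub_ring E) \<and> N \<inter> D = M i} \<subseteq> A.place_kernel E (Kbar i) ` \<Phi> i"
        using P(6)[OF i] ker[OF i] by auto
      show "A.place_kernel E (Kbar i) ` \<Phi> i \<subseteq> {N. maximalideal N (A.sub_ring E) \<and> N \<inter> D = M i}"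
        using A.place_kernel_maximal(1)[OF P(3)[OF i]] kc[OF i] by auto
    qed
    show ?thesis
    proof (intro conjI allI impI)
      show "card {N. maximalideal N (A.sub_ring E) \<and> N \<inter> D = M i} = f i"
        unfolding eq using card_image[OF P(2)[OF i]] \<Phi>(2)[OF i] by simp
      fix N assume "maximalideal N (A.sub_ring E) \<and> N \<inter> D = M i"
      then have "N \<in> A.place_kernel E (Kbar i) ` \<Phi> i" unfolding eq[symmetric] by (rule CollectI)
      then obtain \<psi> where psi: "\<psi> \<in> \<Phi> i" "N = A.place_kernel E (Kbar i) \<psi>" by (elim imageE)
      have W: "A.localization E N = W i \<psi>" unfolding psi(2) W_def ..
      have MN: "M i \<subseteq> N" using kc[OF i psi(1)] psi(2) by auto
      have NW: "N \<subseteq> A.nonunits (W i \<psi>)" using kerW[OF i psi(1)] psi(2) by auto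
      show "Idl\<^bsub>A.sub_ring (A.localization E N)\<^esub> (M i) = Idl\<^bsub>A.sub_ring (A.localization E N)\<^esub> N"
        unfolding W gen[OF i psi(1) MN NW] by (rule gen[OF i psi(1) subset_refl]) (use MN NW in auto)
      have Kq: "A.sub_ring D Quot A.place_kernel D (Kbar i) (\<phi> i) = K i" unfolding ker[OF i] Ki[OF i] ..
      interpret Ki: field "K i" by (rule fieldK[OF i])
      note dims = A.dimension_residue_field[OF pl[OF i] P(3)[OF i psi(1)] E(2) eqD[OF i psi(1)], unfolded Kq, folded psi(2)]
      show "ring.dimension (A.sub_ring E Quot N) (m div f i)
            (A.coset_map N ` carrier (K i)) (carrier (A.sub_ring E Quot N))"
        by (rule dims[OF Ki.carrier_is_subfield]) (use \<Phi>(3)[OF i psi(1)] cardK[OF i] in \<open>simp add: d_def\<close>)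
      have "card (\<psi> ` E) = card (Fs i) ^ m"
        using \<Phi>(3)[OF i psi(1)] cardK[OF i] Fscard(1)[OF i] md(1)[OF i] by (simp add: power_mult)
      then show "ring.dimension (A.sub_ring E Quot N) m (A.coset_map N ` Fs i) (carrier (A.sub_ring E Quot N))"
        by (rule dims[OF Fsub[OF i]])
    qed
  qed
  show ?thesis
    by (intro conjI exI[of _ E] consistent realizable E(1) integral_ext E(4)) (rule ballI, rule primes_over)
qed

end
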